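(* Let $d>2$, $\beta>0$ and $\rho>\rho_c(\beta)$, and let $\nu_\rho$ be the boson random point field on $\mathbb{R}^d$ with particle density $\rho$. Let $f\ge 0$ be a bounded measurable function with compact support in $\mathbb{R}^d$. Then there exists a convex good rate function $I:\mathbb{R}\to[0,+\infty]$ (that is, $I$ is convex and all sublevel sets $\{s: I(s)\le a\}$, $a\in[0,\infty)$, are compact) such that $$\limsup_{\kappa\to\infty}\frac{1}{\kappa^{d-2}}\log\nu_\rho\Big(\frac{1}{\kappa^d}\langle f(\cdot/\kappa),\xi\rangle\in F\Big)\le-\inf_{s\in F}I(s)\quad\text{for every closed }F\subset\mathbb{R},$$ and $$\liminf_{\kappa\to\infty}\frac{1}{\kappa^{d-2}}\log\nu_\rho\Big(\frac{1}{\kappa^d}\langle f(\cdot/\kappa),\xi\rangle\in G\Big)\ge-\inf_{s\in G}I(s)\quad\text{for every open }G\subset\mathbb{R}.$$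
   Context: $Q(\mathbb{R}^d)$ is the Polish space of locally finite non-negative integer-valued Borel measures (point measures) on $\mathbb{R}^d$; for $\xi=\sum_j\delta_{x_j}\in Q(\mathbb{R}^d)$, $\langle f,\xi\rangle=\sum_j f(x_j)$. $\Delta$ is the self-adjoint Laplacian in $L^2(\mathbb{R}^d)$, and the critical density is $\rho_c=\rho_c(\beta)=\int_{\mathbb{R}^d}\frac{1}{e^{\beta|p|^2}-1}\frac{dp}{(2\pi)^d}$ (finite since $d>2$). For a non-negative bounded measurable compactly supported $f$, put $W_f=(e^{\beta\Delta}(1-e^{\beta\Delta})^{-1})^{1/2}\sqrt{1-e^{-f}}$ (a bounded operator on $L^2(\mathbb{R}^d)$, functions acting by multiplication) and $K_f=W_f^*W_f$ (a trace-class operator). For $\rho>\rho_c$, $\nu_\rho$ is the Borel probability measure on $Q(\mathbb{R}^d)$ characterized by $$\int_{Q(\mathbb{R}^d)}e^{-\langle f,\xi\rangle}\,\nu_\rho(d\xi)=\frac{\exp\big(-(\rho-\rho_c)\langle\sqrt{1-e^{-f}},(1+K_f)^{-1}\sqrt{1-e^{-f}}\rangle\big)}{\mathrm{Det}[1+K_f]}$$ for all non-negative bounded measurable $f$ with compact support, where $\mathrm{Det}$ is the Fredholm determinant and $\langle\cdot,\cdot\rangle$ on the right is the $L^2(\mathbb{R}^d)$ inner product. The existence of $\nu_\rho$ is known and may be assumed. Conventions: $\log 0=-\infty$, $\inf\emptyset=+\infty$. *)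

theory Defs
  imports "HOL-Probability.Probability"
begin

section \<open>Point measures\<close>

text \<open>\<open>Q(\<real>\<^sup>d)\<close>: a locally finite measure takes finite values on compact sets; on other Borel sets
  the value \<open>\<infinity>\<close> is allowed.\<close>

definition point_measures :: "'a::euclidean_space measure set" where
  "point_measures = {\<xi>. sets \<xi> = sets borel
     \<and> (\<forall>C. compact C \<longrightarrow> emeasure \<xi> C < \<infinity>)
     \<and> (\<forall>A\<in>sets borel. emeasure \<xi> A \<in> range ennreal_of_enat)}"

text \<open>The topology of \<open>Q(\<real>\<^sup>d)\<close> is the vague topology, the coarsest one for which
  \<open>\<xi> \<mapsto> \<langle>\<phi>, \<xi>\<rangle>\<close> is continuous for every continuous \<open>\<phi>\<close> with compact support.\<close>

definition vague_topology :: "'a::euclidean_space measure topology" where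
  "vague_topology = topology_generated_by
     {{\<xi> \<in> point_measures. (\<integral>x. \<phi> x \<partial>\<xi>) \<in> U} | (\<phi> :: 'a \<Rightarrow> real) U.
        continuous_on UNIV \<phi> \<and> compact (closure {x. \<phi> x \<noteq> 0}) \<and> open U}"

definition point_measure_borel :: "'a::euclidean_space measure measure" where
  "point_measure_borel = sigma point_measures {V. openin vague_topology V}"

definition test_functions :: "('a::euclidean_space \<Rightarrow> real) set" where
  "test_functions = {f. f \<in> borel_measurable borel \<and> (\<forall>x. 0 \<le> f x) \<and> bounded (range f)
     \<and> compact (closure {x. f x \<noteq> 0})}"

section \<open>The complex Hilbert space \<open>L\<^sup>2(\<real>\<^sup>d)\<close>\<close>

text \<open>Elements are represented by functions, and equality in \<open>L\<^sup>2\<close> is equality almost everywhere.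
  Operators act on representatives. Their values are chosen by \<open>SOME\<close>, and each condition after
  \<open>SOME\<close> determines the value up to null sets whenever it can be satisfied.\<close>

definition L2 :: "('a::euclidean_space \<Rightarrow> complex) set" where
  "L2 = {u \<in> borel_measurable lborel. integrable lborel (\<lambda>x. (cmod (u x))\<^sup>2)}"

definition L2_inner :: "('a::euclidean_space \<Rightarrow> complex) \<Rightarrow> ('a \<Rightarrow> complex) \<Rightarrow> complex" where
  "L2_inner u v = (\<integral>x. cnj (u x) * v x \<partial>lborel)"

definition L2_adjoint ::
    "(('a::euclidean_space \<Rightarrow> complex) \<Rightarrow> ('a \<Rightarrow> complex)) \<Rightarrow> ('a \<Rightarrow> complex) \<Rightarrow> ('a \<Rightarrow> complex)" where
  "L2_adjoint T v = (SOME w. w \<in> L2 \<and> (\<forall>u\<in>L2. L2_inner (T u) v = L2_inner u w))"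

text \<open>\<open>(1 + K)\<^sup>-\<^sup>1 v\<close>\<close>

definition inverse_one_plus ::
    "(('a::euclidean_space \<Rightarrow> complex) \<Rightarrow> ('a \<Rightarrow> complex)) \<Rightarrow> ('a \<Rightarrow> complex) \<Rightarrow> ('a \<Rightarrow> complex)" where
  "inverse_one_plus K v = (SOME u. u \<in> L2 \<and> (AE x in lborel. u x + K u x = v x))"

definition orthonormal_basis :: "('a::euclidean_space \<Rightarrow> complex) set \<Rightarrow> bool" where
  "orthonormal_basis B \<longleftrightarrow> B \<subseteq> L2
     \<and> (\<forall>u\<in>B. \<forall>v\<in>B. L2_inner u v = (if u = v then 1 else 0))
     \<and> (\<forall>v\<in>L2. (\<forall>u\<in>B. L2_inner u v = 0) \<longrightarrow> (AE x in lborel. v x = 0))"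

definition det_on :: "'b set \<Rightarrow> ('b \<Rightarrow> 'b \<Rightarrow> complex) \<Rightarrow> complex" where
  "det_on S A = (\<Sum>\<pi> | \<pi> permutes S. of_int (sign \<pi>) * (\<Prod>i\<in>S. A i (\<pi> i)))"

text \<open>\<open>Det[1 + K] = \<Sum>\<^sub>n Tr (\<Lambda>\<^sup>n K)\<close> for trace-class \<open>K\<close>. If \<open>B\<close> is an orthonormal basis, then
  the wedge products of the \<open>n\<close>-element subsets of \<open>B\<close> form an orthonormal basis of \<open>\<Lambda>\<^sup>n L\<^sup>2\<close>, so
  \<open>Tr (\<Lambda>\<^sup>n K)\<close> is the sum of the \<open>n \<times> n\<close> principal minors of the matrix of \<open>K\<close>. For trace-class
  \<open>K\<close> the sum over all finite \<open>S\<close> converges absolutely and does not depend on \<open>B\<close>.\<close>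

definition fredholm_det :: "(('a::euclidean_space \<Rightarrow> complex) \<Rightarrow> ('a \<Rightarrow> complex)) \<Rightarrow> complex" where
  "fredholm_det K = (let B = (SOME B. orthonormal_basis B) in
     \<Sum>\<^sub>\<infinity>S\<in>{S. finite S \<and> S \<subseteq> B}. det_on S (\<lambda>u v. L2_inner u (K v)))"

section \<open>Functions of the Laplacian\<close>

definition fourier_integral :: "('a::euclidean_space \<Rightarrow> complex) \<Rightarrow> 'a \<Rightarrow> complex" where
  "fourier_integral u p = (\<integral>x. cis (- (p \<bullet> x)) * u x \<partial>lborel)"

text \<open>\<open>v\<close> is the Fourier--Plancherel transform of \<open>u\<close>, the \<open>L\<^sup>2\<close> limit of truncated Fourier
  integrals.\<close>

definition plancherel_transform :: "('a::euclidean_space \<Rightarrow> complex) \<Rightarrow> ('a \<Rightarrow> complex) \<Rightarrow> bool" where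
  "plancherel_transform u v \<longleftrightarrow> u \<in> L2 \<and> v \<in> L2 \<and>
     ((\<lambda>R. \<integral>\<^sup>+p. ennreal ((cmod (v p - fourier_integral (\<lambda>x. indicator (cball 0 R) x * u x) p))\<^sup>2) \<partial>lborel)
        \<longlongrightarrow> 0) at_top"

text \<open>\<open>\<phi>(\<Delta>) u\<close>: the Fourier transform turns the self-adjoint Laplacian into multiplication by
  \<open>-\<bar>p\<bar>\<^sup>2\<close>. The value is meaningful for \<open>u\<close> in the domain of \<open>\<phi>(\<Delta>)\<close>.\<close>

definition fun_laplacian ::
    "(real \<Rightarrow> real) \<Rightarrow> ('a::euclidean_space \<Rightarrow> complex) \<Rightarrow> ('a \<Rightarrow> complex)" where
  "fun_laplacian \<phi> u = (SOME w. \<exists>u' w'. plancherel_transform u u' \<and> plancherel_transform w w'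
     \<and> (AE p in lborel. w' p = complex_of_real (\<phi> (- (norm p)\<^sup>2)) * u' p))"

section \<open>The boson random point field\<close>

definition critical_density :: "'a::euclidean_space itself \<Rightarrow> real \<Rightarrow> real" where
  "critical_density _ \<beta> =
     (\<integral>p. 1 / (exp (\<beta> * (norm (p :: 'a))\<^sup>2) - 1) \<partial>lborel) / (2 * pi) ^ DIM('a)"

definition sqrt_one_minus_exp :: "('a::euclidean_space \<Rightarrow> real) \<Rightarrow> 'a \<Rightarrow> complex" where
  "sqrt_one_minus_exp f x = complex_of_real (sqrt (1 - exp (- f x)))"

definition W_op ::
    "real \<Rightarrow> ('a::euclidean_space \<Rightarrow> real) \<Rightarrow> ('a \<Rightarrow> complex) \<Rightarrow> ('a \<Rightarrow> complex)" where
  "W_op \<beta> f v = fun_laplacian (\<lambda>s. sqrt (exp (\<beta> * s) * inverse (1 - exp (\<beta> * s))))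
     (\<lambda>x. sqrt_one_minus_exp f x * v x)"

definition K_op ::
    "real \<Rightarrow> ('a::euclidean_space \<Rightarrow> real) \<Rightarrow> ('a \<Rightarrow> complex) \<Rightarrow> ('a \<Rightarrow> complex)" where
  "K_op \<beta> f v = L2_adjoint (W_op \<beta> f) (W_op \<beta> f v)"

definition boson_point_field :: "real \<Rightarrow> real \<Rightarrow> 'a::euclidean_space measure measure \<Rightarrow> bool" where
  "boson_point_field \<beta> \<rho> \<nu> \<longleftrightarrow> prob_space \<nu> \<and> sets \<nu> = sets point_measure_borel \<and>
     (\<forall>f\<in>test_functions.
        complex_of_real (\<integral>\<xi>. exp (- (\<integral>x. f x \<partial>\<xi>)) \<partial>\<nu>) =
          exp (- (complex_of_real (\<rho> - critical_density TYPE('a) \<beta>)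
                  * L2_inner (sqrt_one_minus_exp f)
                      (inverse_one_plus (K_op \<beta> f) (sqrt_one_minus_exp f))))
          / fredholm_det (K_op \<beta> f))"

section \<open>Large deviations\<close>

definition ereal_log :: "real \<Rightarrow> ereal" where
  "ereal_log x = (if x = 0 then - \<infinity> else ereal (ln x))"

text \<open>In \<^typ>\<open>ereal\<close>, \<open>0 * \<infinity> = 0\<close>.\<close>

definition convex_ereal :: "(real \<Rightarrow> ereal) \<Rightarrow> bool" where
  "convex_ereal I \<longleftrightarrow> (\<forall>x y. \<forall>t\<in>{0..1}.
     I ((1 - t) * x + t * y) \<le> ereal (1 - t) * I x + ereal t * I y)"

definition good_rate_function :: "(real \<Rightarrow> ereal) \<Rightarrow> bool" where
  "good_rate_function I \<longleftrightarrow> (\<forall>s. 0 \<le> I s) \<and> (\<forall>a::real. 0 \<le> a \<longrightarrow> compact {s. I s \<le> ereal a})"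

end

theory Submission
  imports Defs "HOL-Complex_Analysis.Complex_Analysis" "Jordan_Normal_Form.Schur_Decomposition" "HOL-Real_Asymp.Real_Asymp"
begin

text \<open>
\<open>K\<^sub>f\<close> is almost everywhere the integral operator with kernel
\<open>\<surd>h(x) G(x - y) \<surd>h(y)\<close>, where \<open>h = 1 - e\<^sup>-\<^sup>f\<close> and the Bose kernel \<open>G\<close> is a sum of
heat kernels. Its compressions to finite subsets of an orthonormal basis show that \<open>Det[1 + z K]\<close> is a limit of
products of factors \<open>1 + z a\<^sub>i\<close> with \<open>a\<^sub>i \<ge> 0\<close>. Since \<open>\<xi>\<close> is integer-valued,
\<open>exp(\<integral>ln(1 + (y - c) h) d\<xi>)\<close> is a polynomial in \<open>y\<close> with nonnegative coefficients. The prescribed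
Laplace transforms are the values for \<open>0 \<le> y \<le> c\<close>; nonnegativity lets the identity continue analytically to
all \<open>y\<close> up to the first singularity of the resolvent, which gives exponential moments of positive sign.

Under the dilation by \<open>\<kappa>\<close> the rescaled kernels converge in \<open>L\<^sup>1\<close> on balls to the Riemann integral
\<open>\<integral> heat_kernel (\<beta> s) ds\<close> of their summands. The logarithm of the determinant is its trace up to
\<open>o(\<kappa>\<^sup>d\<^sup>-\<^sup>2)\<close>, because the Hilbert--Schmidt norms are of lower order, and the resolvent term converges.
The exponents are of order \<open>\<kappa>\<^sup>-\<^sup>2\<close>, so that \<open>ln(1 + w h)\<close> may be replaced by \<open>w h\<close>.
The scaled logarithmic moment generating function thus converges on an open half-line (or the line) containing
\<open>0\<close>; the limit is differentiable there, and it tends to infinity at a finite endpoint because the resolvent of the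
limit operator blows up. This steepness is what the one-dimensional Gaertner--Ellis argument needs, and the rate function is the
Legendre transform of the limit.\<close>

text \<open>\<open>boson_point_field\<close> prescribes only the transforms of nonnegative test
  functions, so a positive exponential moment might be infinite below the singularity of the
  resolvent. The power series is therefore centred at some \<open>- c < 0\<close>: the known values
  then fill an interval of nonnegative \<open>y\<close>, and finiteness comes together with the
  identity. The endpoint of the domain is described by the supremum norms of \<open>T^n 1\<close>,
  because the kernel is positive and because a bound on the scalar resolvent can be traced back to
  these norms. A function \<open>\<psi> >= 1\<close> with
  \<open>T \<psi> <= \<Lambda> (\<psi> - 1)\<close> converts them into bounds on quadratic forms,
  and its slack absorbs an L1 error of the kernel, so one \<open>\<Lambda>\<close> serves all large
  dilations. The determinant contributes only a linear term to the limit; curvature and blow-up come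
  from the condensate, whose factor \<open>\<rho> - critical_density\<close> is positive. Operators,
  bases and inverses are chosen by \<open>SOME\<close>, so each value must first be shown to exist,
  and afterwards only properties common to all admissible choices may be used.\<close>

no_notation Matrix.scalar_prod (infix "\<bullet>" 70)

abbreviation (input) cor :: "real => complex" where "cor == complex_of_real"

notation (input) tendsto (infixr "--->" 55)

abbreviation (input) seq_lim :: "(nat => 'a::topological_space) => 'a => bool" (infixr "---->" 60)
 where "X ----> L == X \<longlonglongrightarrow> L"

abbreviation (input) BM :: "('a::topological_space => 'b::topological_space) set" where "BM == borel_measurable borel"

lemmas bochner_integral_cong = Bochner_Integration.integral_cong
 and bochner_integral_cnj = Bochner_Integration.integral_cnj
 and bochner_integral_add = Bochner_Integration.integral_add
 and bochner_integral_diff = Bochner_Integration.integral_diff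
 and bochner_integral_sum = Bochner_Integration.integral_sum
 and bochner_integrable_bound = Bochner_Integration.integrable_bound
 and bochner_integrable_add = Bochner_Integration.integrable_add
 and bochner_integrable_diff = Bochner_Integration.integrable_diff
 and bochner_integrable_sum = Bochner_Integration.integrable_sum

section \<open>Heat kernel and Gaussian integrals\<close>

text \<open>The substitution \<open>y = c x\<close> with \<open>c = sqrt (2 s)\<close> turns the
  integrand into that of the characteristic function of the standard normal law, which is known to
  be \<open>exp (- t^2/2)\<close>.\<close>

lemma cis_gauss_1d:
 fixes s t :: real assumes s: "s > 0"
 shows "integrable lborel (%x. cis (t*x)*cor (exp (- s*x^2)))"
  and "(LBINT x. cis (t*x)*cor (exp (- s*x^2)))
   = cor (sqrt (pi/s)*exp (- t\<^sup>2/(4 * s)))"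
proof -
 define c where "c = sqrt (2 * s)"
 have c: "c > 0" "c^2 = 2 * s" using s by (auto simp: c_def)
 let ?f = "%y. iexp (t/c*y)*cor (std_normal_density y)"
 have int: "integrable lborel ?f"
  by (rule bochner_integrable_bound[where f = "%y. std_normal_density y"])
   (use integrable_std_normal_moment[of 0] in \<open>auto simp: norm_mult\<close>)
 have char: "(LBINT y. ?f y) = cor (exp (- (t/c)\<^sup>2/2))"
 proof -
  have "char std_normal_distribution (t/c) = (LBINT y. ?f y)"
   unfolding char_def
   by (subst integral_density)
    (auto simp: normal_density_nonneg scaleR_conv_of_real mult.commute)
  then show ?thesis by (simp add: char_std_normal_distribution)
 qed
 have eq: "?f (c*x) = cor (1/sqrt (2*pi))*(cis (t*x)*cor (exp (- s*x^2)))" for x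
 proof -
  have "(c*x)^2/2 = s*x^2" using c by (simp add: power_mult_distrib)
  then show ?thesis using c unfolding std_normal_density_def
   by (simp add: cis_conv_exp)
 qed
 have "integrable lborel (%x. ?f (0 + c*x))"
  using lborel_integrable_real_affine[OF int, of c 0] c by simp
 then have int2: "integrable lborel (%x. cor (1/sqrt (2*pi))*(cis (t*x)*cor (exp (- s*x^2))))"
  by (simp only: eq add_0)
 have "(%x. cis (t*x)*cor (exp (- s*x^2)))
  = (%x. cor (sqrt (2*pi))*(cor (1/sqrt (2*pi))*(cis (t*x)*cor (exp (- s*x^2)))))"
  by (simp add: fun_eq_iff)
 then show "integrable lborel (%x. cis (t*x)*cor (exp (- s*x^2)))"
  using integrable_mult_right[OF int2, of "cor (sqrt (2*pi))"] by simp
 have "(LBINT y. ?f y) = \<bar>c\<bar> *\<^sub>R (LBINT x. ?f (0 + c*x))"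
  by (rule lborel_integral_real_affine) (use c in auto)
 also have "... = cor (c/sqrt (2*pi))*(LBINT x. cis (t*x)*cor (exp (- s*x^2)))"
  using c by (simp only: eq add_0) (simp add: scaleR_conv_of_real)
 finally have "cor (c/sqrt (2*pi))*(LBINT x. cis (t*x)*cor (exp (- s*x^2)))
   = cor (exp (- (t/c)\<^sup>2/2))" using char by simp
 then have "(LBINT x. cis (t*x)*cor (exp (- s*x^2)))
  = cor (sqrt (2*pi)/c*exp (- (t/c)\<^sup>2/2))"
  using c by (simp add: field_simps)
 moreover have "sqrt (2*pi)/c = sqrt (pi/s)"
  using s by (simp add: c_def real_sqrt_divide real_sqrt_mult)
 moreover have "(t/c)^2/2 = t^2/(4 * s)" using c by (simp add: power_divide)
 ultimately show "(LBINT x. cis (t*x)*cor (exp (- s*x^2)))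
   = cor (sqrt (pi/s)*exp (- t\<^sup>2/(4 * s)))" by simp
qed

lemma integral_lborel_prod:
 fixes f :: "'a::euclidean_space => real => complex"
 assumes f: "!!b. b : Basis ==> integrable lborel (f b)"
 shows "integrable lborel (%x::'a. \<Prod>b\<in>Basis. f b (x \<bullet> b))"
  and "(LBINT (x::'a). (\<Prod>b\<in>Basis. f b (x \<bullet> b))) = (\<Prod>b\<in>Basis. (LBINT x. f b x))"
proof -
 interpret P: product_sigma_finite "%b::'a. lborel :: real measure"
  by standard
 have [measurable]: "f b : BM" if "b : Basis" for b
  using f[OF that] by auto
 have m: "(%x::'a. \<Prod>b\<in>Basis. f b (x \<bullet> b)) : BM"
  by measurable
 have T: "(%g. \<Sum>b\<in>Basis. g b *\<^sub>R b) : (\<Pi>\<^sub>M b\<in>(Basis::'a set). (lborel::real measure)) \<rightarrow>\<^sub>M borel"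
  by measurable
 have comp: "(\<Prod>b\<in>Basis. f b ((\<Sum>b'\<in>Basis. g b' *\<^sub>R b') \<bullet> b)) = (\<Prod>b\<in>(Basis::'a set). f b (g b))" for g
  by (intro prod.cong refl) simp
 have "integrable (\<Pi>\<^sub>M b\<in>(Basis::'a set). lborel) (%g. \<Prod>b\<in>Basis. f b (g b))"
  by (rule P.product_integrable_prod) (auto intro: f)
 then show "integrable lborel (%x::'a. \<Prod>b\<in>Basis. f b (x \<bullet> b))"
  by (subst lborel_eq, subst integrable_distr_eq[OF T m]) (simp only: comp)
 show "(LBINT (x::'a). (\<Prod>b\<in>Basis. f b (x \<bullet> b))) = (\<Prod>b\<in>Basis. (LBINT x. f b x))"
  by (subst lborel_eq, subst integral_distr[OF T m], simp only: comp)
   (rule P.product_integral_prod, auto intro: f)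
qed

text \<open>The integral kernel of \<open>exp (s \<Delta>)\<close>, that is, the inverse Fourier
  transform of \<open>exp (- s |p|^2)\<close>, as \<open>fourier_gauss\<close> confirms.\<close>

definition heat_kernel :: "real => 'a::euclidean_space => real" where
 "heat_kernel s x = (1/sqrt (4*pi * s))^DIM('a)*exp (- (norm x)\<^sup>2/(4 * s))"

lemma norm_sq_Basis: "(norm (x::'a::euclidean_space))^2 = (\<Sum>b\<in>Basis. (x \<bullet> b)^2)"
 by (subst power2_norm_eq_inner, subst euclidean_inner) (simp add: power2_eq_square)

lemma fourier_gauss:
 fixes x :: "'a::euclidean_space"
 assumes s: "s > 0"
 shows "integrable lborel (%p::'a. cis (x \<bullet> p)*cor (exp (- s*(norm p)^2)))"
  and "(LBINT p. cis (x \<bullet> p)*cor (exp (- s*(norm p)^2)))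
   = cor ((2*pi)^DIM('a)*heat_kernel s x)"
proof -
 let ?f = "%b y. cis ((x \<bullet> b)*y)*cor (exp (- s*y^2))"
 have eq: "(\<Prod>b\<in>Basis. ?f b (p \<bullet> b)) = cis (x \<bullet> p)*cor (exp (- s*(norm p)^2))" for p
 proof -
  have "(\<Prod>b\<in>Basis. ?f b (p \<bullet> b)) = exp (\<Sum>b\<in>Basis. \<i>*cor ((x \<bullet> b)*(p \<bullet> b)) + cor (- s*(p \<bullet> b)^2))"
   by (subst exp_sum) (auto simp: cis_conv_exp exp_of_real[symmetric] mult_exp_exp)
  also have "(\<Sum>b\<in>Basis. \<i>*cor ((x \<bullet> b)*(p \<bullet> b)) + cor (- s*(p \<bullet> b)^2))
   = \<i>*cor (x \<bullet> p) + cor (- s*(norm p)^2)"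
   by (simp add: sum.distrib norm_sq_Basis sum_distrib_left euclidean_inner[of x p] sum_subtractf sum_negf)
  finally show ?thesis
   by (simp only: exp_add cis_conv_exp exp_of_real[symmetric])
 qed
 have i: "integrable lborel (?f b)" for b
  by (rule cis_gauss_1d(1)[OF s])
 show "integrable lborel (%p::'a. cis (x \<bullet> p)*cor (exp (- s*(norm p)^2)))"
  using integral_lborel_prod(1)[where f="?f", OF i] by (simp only: eq)
 have "(LBINT p. cis (x \<bullet> p)*cor (exp (- s*(norm p)^2)))
  = (\<Prod>b\<in>Basis. cor (sqrt (pi/s)*exp (- (x \<bullet> b)\<^sup>2/(4 * s))))"
  using integral_lborel_prod(2)[where f="?f", OF i] by (simp only: eq cis_gauss_1d(2)[OF s])
 also have "... = cor (sqrt (pi/s)^DIM('a)*exp (\<Sum>b\<in>Basis. - (x \<bullet> b)\<^sup>2/(4 * s)))"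
  by (subst exp_sum) (auto simp: prod.distrib)
 also have "(\<Sum>b\<in>Basis. - (x \<bullet> b)\<^sup>2/(4 * s)) = - (norm x)\<^sup>2/(4 * s)"
  by (simp add: norm_sq_Basis sum_divide_distrib sum_negf)
 also have "sqrt (pi/s) = 2*pi*(1/sqrt (4*pi * s))"
  using s by (simp add: real_sqrt_divide real_sqrt_mult field_simps)
 finally show "(LBINT p. cis (x \<bullet> p)*cor (exp (- s*(norm p)^2)))
   = cor ((2*pi)^DIM('a)*heat_kernel s x)"
  by (simp add: heat_kernel_def power_mult_distrib power_divide)
qed

lemma integral_gauss:
 assumes s: "s > 0"
 shows "integrable lborel (%p::'a::euclidean_space. exp (- s*(norm p)^2))"
  and "(LBINT (p::'a). exp (- s*(norm p)^2)) = sqrt (pi/s)^DIM('a)"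
proof -
 have "integrable lborel (%p::'a. cor (exp (- s*(norm p)^2)))"
  using fourier_gauss(1)[OF s, of "0::'a"] by simp
 then show "integrable lborel (%p::'a. exp (- s*(norm p)^2))"
  by (simp only: complex_of_real_integrable_eq)
 have "cor (LBINT (p::'a). exp (- s*(norm p)^2)) = cor ((2*pi)^DIM('a)*heat_kernel s (0::'a))"
  using fourier_gauss(2)[OF s, of "0::'a"] by simp
 moreover have "sqrt (pi/s) = 2*pi*(1/sqrt (4*pi * s))"
  using s by (simp add: real_sqrt_divide real_sqrt_mult field_simps)
 ultimately show "(LBINT (p::'a). exp (- s*(norm p)^2)) = sqrt (pi/s)^DIM('a)"
  by (simp add: heat_kernel_def power_mult_distrib power_divide del: of_real_mult of_real_power of_real_divide)
qed

lemma heat_kernel_nonneg: "s > 0 ==> 0 <= heat_kernel s x"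
 by (simp add: heat_kernel_def)

lemma heat_kernel_minus [simp]: "heat_kernel s (- x) = heat_kernel s x"
 by (simp add: heat_kernel_def)

lemma heat_kernel_le: "s > 0 ==> heat_kernel s (x::'a::euclidean_space) <= heat_kernel s (0::'a)"
 by (simp add: heat_kernel_def mult_left_le)

lemma heat_kernel_measurable [measurable]: "(%x. heat_kernel s x) : BM"
 unfolding heat_kernel_def by measurable

lemma integral_heat_kernel:
 assumes s: "s > 0"
 shows "integrable lborel (heat_kernel s :: 'a::euclidean_space => real)"
  and "(LBINT (x::'a). heat_kernel s x) = 1"
proof -
 have eq: "heat_kernel s = (%x::'a. (1/sqrt (4*pi * s))^DIM('a)*exp (- (1/(4 * s))*(norm x)^2))"
  by (simp add: heat_kernel_def fun_eq_iff)
 have s': "1/(4 * s) > 0" using s by simp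
 show "integrable lborel (heat_kernel s :: 'a => real)"
  unfolding eq by (intro integrable_mult_right integral_gauss(1)[OF s'])
 have "(LBINT (x::'a). heat_kernel s x) = (1/sqrt (4*pi * s))^DIM('a) * sqrt (pi/(1/(4 * s)))^DIM('a)"
  unfolding eq by (simp only: integral_mult_right_zero integral_gauss(2)[OF s'])
 also have "... = (1/sqrt (4*pi * s) * sqrt (pi/(1/(4 * s))))^DIM('a)"
  by (rule power_mult_distrib[symmetric])
 also have "1/sqrt (4*pi * s) * sqrt (pi/(1/(4 * s))) = 1"
  using s by (simp add: mult.commute[of 4] mult.assoc)
 finally show "(LBINT (x::'a). heat_kernel s x) = 1"
  by simp
qed

section \<open>The space of square integrable functions\<close>

lemma cnj_measurable [measurable]: "cnj : BM"
 by (intro borel_measurable_continuous_onI continuous_on_cnj continuous_on_id)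

lemma L2_measurable [measurable_dest, simp]: "u : L2 ==> u : BM"
 unfolding L2_def mem_Collect_eq measurable_lborel2 by blast

lemma L2_integrable [simp]: "u : L2 ==> integrable lborel (%x. (cmod (u x))^2)"
 unfolding L2_def by blast

lemma L2I: "u : BM ==> integrable lborel (%x. (cmod (u x))^2) ==> u : L2"
 unfolding L2_def mem_Collect_eq measurable_lborel2 by blast

lemma L2_bound:
 assumes [measurable]: "u : BM" and g: "integrable lborel g"
  and le: "AE x in lborel. (cmod (u x))^2 <= g x"
 shows "u : L2"
 by (rule L2I[OF assms(1)], rule bochner_integrable_bound[OF g]) (use le in auto)

lemma L2_zero [simp]: "(%x. 0) : L2"
 by (rule L2I) auto

lemma cmod_add_sq: "(cmod (a + b))^2 <= 2*(cmod a)^2 + 2*(cmod b)^2"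
proof -
 have "(cmod (a + b))^2 <= (cmod a + cmod b)^2"
  by (intro power_mono norm_triangle_ineq) auto
 also have "... <= 2*(cmod a)^2 + 2*(cmod b)^2"
  using sum_squares_ge_zero[of "cmod a - cmod b" 0] by (simp add: power2_eq_square algebra_simps)
 finally show ?thesis .
qed

lemma L2_cong_AE:
 assumes "u : L2" "v : BM" "AE x in lborel. u x = v x"
 shows "v : L2"
 by (rule L2_bound[OF assms(2) L2_integrable[OF assms(1)]]) (use assms(3) in auto)

lemma L2_add [simp]: "u : L2 ==> v : L2 ==> (%x. u x + v x) : L2"
 by (rule L2_bound[where g = "%x. 2*(cmod (u x))^2 + 2*(cmod (v x))^2"])
  (measurable, auto simp: cmod_add_sq)

lemma L2_cmult [simp]: "u : L2 ==> (%x. c*u x) : L2"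
 by (rule L2I) (measurable, auto simp: norm_mult power_mult_distrib)

lemma L2_diff [simp]: "u : L2 ==> v : L2 ==> (%x. u x - v x) : L2"
 using L2_add[of u "%x. (- 1) * v x"] L2_cmult[of v "- 1"] by simp

lemma L2_sum [simp]: "(!!i. i : A ==> u i : L2) ==> (%x. \<Sum>i\<in>A. u i x) : L2"
 by (induction A rule: infinite_finite_induct) auto

lemma L2_bounded_mult:
 assumes u: "u : L2" and [measurable]: "b : BM" and b: "!!x. cmod (b x) <= C"
 shows "(%x. b x*u x) : L2"
proof (rule L2_bound[where g = "%x. C^2*(cmod (u x))^2"])
 show "AE x in lborel. (cmod (b x*u x))^2 <= C^2*(cmod (u x))^2"
  using b by (auto simp: norm_mult power_mult_distrib intro!: mult_right_mono power_mono)
qed (use u in \<open>measurable, auto\<close>)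

lemma L2_inner_integrable:
 assumes "u : L2" "v : L2" shows "integrable lborel (%x. cnj (u x) * v x)"
proof (rule bochner_integrable_bound[where f = "%x. (cmod (u x))^2 + (cmod (v x))^2"])
 show "AE x in lborel. norm (cnj (u x) * v x) <= norm ((cmod (u x))^2 + (cmod (v x))^2)"
 proof (rule AE_I2)
  fix x
  have "2*(cmod (u x)*cmod (v x)) <= (cmod (u x))^2 + (cmod (v x))^2"
   using sum_squares_bound[of "cmod (u x)" "cmod (v x)"] by simp
  moreover have "0 <= cmod (u x)*cmod (v x)" by simp
  ultimately show "norm (cnj (u x) * v x) <= norm ((cmod (u x))^2 + (cmod (v x))^2)"
   unfolding norm_mult complex_mod_cnj real_norm_def by linarith
 qed
qed (use assms in \<open>measurable, auto\<close>)

lemma L2_inner_add_right: "u : L2 ==> v : L2 ==> w : L2 ==> L2_inner u (%x. v x + w x) = L2_inner u v + L2_inner u w"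
 unfolding L2_inner_def by (simp add: distrib_left L2_inner_integrable)

lemma L2_inner_diff_right: "u : L2 ==> v : L2 ==> w : L2 ==> L2_inner u (%x. v x - w x) = L2_inner u v - L2_inner u w"
 unfolding L2_inner_def by (simp add: right_diff_distrib L2_inner_integrable)

lemma L2_inner_cmult_right: "L2_inner u (%x. c * v x) = c*L2_inner u v"
 unfolding L2_inner_def by (simp add: mult.left_commute)

lemma L2_inner_cnj: "cnj (L2_inner u v) = L2_inner v u"
 unfolding L2_inner_def by (subst bochner_integral_cnj[symmetric]) (simp add: mult.commute)

lemma L2_inner_zero_right [simp]: "L2_inner u (%x. 0) = 0"
 by (simp add: L2_inner_def)

lemma L2_inner_sum_right: "u : L2 ==> (!!i. i : A ==> v i : L2) ==> L2_inner u (%x. \<Sum>i\<in>A. v i x) = (\<Sum>i\<in>A. L2_inner u (v i))"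
 by (induction A rule: infinite_finite_induct) (simp_all add: L2_inner_add_right)

lemma L2_inner_add_left: "u : L2 ==> v : L2 ==> w : L2 ==> L2_inner (%x. u x + v x) w = L2_inner u w + L2_inner v w"
 by (metis (no_types) L2_inner_add_right L2_inner_cnj complex_cnj_add)

lemma L2_inner_cmult_left: "L2_inner (%x. c*u x) v = cnj c*L2_inner u v"
 by (metis (no_types) L2_inner_cmult_right L2_inner_cnj complex_cnj_mult)

lemma L2_inner_sum_left: "u : L2 ==> (!!i. i : A ==> v i : L2) ==> L2_inner (%x. \<Sum>i\<in>A. v i x) u = (\<Sum>i\<in>A. L2_inner (v i) u)"
 by (induction A rule: infinite_finite_induct)
  (simp_all add: L2_inner_add_left L2_inner_cnj[of u "%x. 0", symmetric])

lemma L2_inner_cong_AE: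
 assumes "u : BM" "v : BM" "u' : BM" "v' : BM"
  and "AE x in lborel. u x = u' x" "AE x in lborel. v x = v' x"
 shows "L2_inner u v = L2_inner u' v'"
 unfolding L2_inner_def by (rule integral_cong_AE) (use assms in \<open>measurable, auto\<close>)

definition L2_norm :: "('a::euclidean_space => complex) => real" where
 "L2_norm u = sqrt (LBINT x. (cmod (u x))^2)"

lemma L2_norm_nonneg [simp]: "0 <= L2_norm u"
 by (simp add: L2_norm_def)

lemma L2_norm_sq: "(L2_norm u)^2 = (LBINT x. (cmod (u x))^2)"
 by (simp add: L2_norm_def)

lemma L2_inner_self: "L2_inner u u = cor ((L2_norm u)^2)"
 unfolding L2_inner_def L2_norm_sq integral_complex_of_real[symmetric]
 by (simp add: complex_norm_square[symmetric] mult.commute del: of_real_power)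

lemma L2_norm_eq_0:
 assumes "u : L2" "L2_norm u = 0" shows "AE x in lborel. u x = 0"
proof -
 have "(LBINT x. (cmod (u x))^2) = 0" using assms(2) by (simp add: L2_norm_def)
 then have "AE x in lborel. (cmod (u x))^2 = 0"
  by (subst (asm) integral_nonneg_eq_0_iff_AE) (use assms in auto)
 then show ?thesis by simp
qed

lemma L2_norm_cong_AE:
 "u : BM ==> v : BM ==> AE x in lborel. u x = v x ==> L2_norm u = L2_norm v"
 unfolding L2_norm_def by (intro arg_cong[where f=sqrt] integral_cong_AE) auto

lemma L2_norm_cmult: "L2_norm (%x. c*u x) = cmod c*L2_norm u"
 by (simp add: L2_norm_def norm_mult power_mult_distrib real_sqrt_mult)

lemma L2_norm_add_sq:
 assumes "u : L2" "v : L2"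
 shows "(L2_norm (%x. u x + v x))^2 = (L2_norm u)^2 + (L2_norm v)^2 + 2*Re (L2_inner u v)"
proof -
 have "cor ((L2_norm (%x. u x + v x))^2) = L2_inner u u + L2_inner v v + (L2_inner u v + cnj (L2_inner u v))"
  using assms by (simp add: L2_inner_self[symmetric] L2_inner_add_left L2_inner_add_right L2_inner_cnj del: of_real_power)
 then show ?thesis
  by (simp add: L2_inner_self complex_add_cnj flip: of_real_power of_real_add of_real_mult)
qed

lemma L2_norm_diff_sq:
 assumes "u : L2" "v : L2"
 shows "(L2_norm (%x. u x - v x))^2 = (L2_norm u)^2 + (L2_norm v)^2 - 2*Re (L2_inner u v)"
 using L2_norm_add_sq[of u "%x. (- 1) * v x"] assms L2_cmult[of v "- 1"]
 by (simp add: L2_norm_cmult[of "- 1", simplified] L2_inner_cmult_right[of _ "- 1", simplified])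

lemma L2_Cauchy_Schwarz:
 assumes u: "u : L2" and v: "v : L2"
 shows "cmod (L2_inner u v) <= L2_norm u*L2_norm v"
proof (cases "L2_norm v = 0")
 case True
 have "L2_inner u v = L2_inner u (%x. 0)"
  by (rule L2_inner_cong_AE) (use u v L2_norm_eq_0[OF v True] in auto)
 then show ?thesis using True by simp
next
 case False
 define n where "n = (L2_norm v)^2"
 have n: "n > 0" using False by (simp add: n_def)
 \<comment> \<open>The multiple \<open>c v\<close> is the orthogonal projection of \<open>u\<close>
   on the line of \<open>v\<close>; the inequality is the nonnegativity of the squared
   defect.\<close>
 define c where "c = L2_inner v u/cor n"
 have "0 <= (L2_norm (%x. u x - c * v x))^2" by simp
 also have "... = (L2_norm u)^2 + (cmod c)^2*n - 2*Re (c*L2_inner u v)"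
  using u v by (simp add: L2_norm_diff_sq L2_norm_cmult L2_inner_cmult_right n_def power_mult_distrib)
 also have "c*L2_inner u v = cor ((cmod (L2_inner u v))^2/n)"
  by (simp add: c_def L2_inner_cnj[of u v, symmetric] complex_norm_square[symmetric] mult.commute[of "cnj _"] flip: of_real_power of_real_divide)
 also have "(cmod c)^2*n = (cmod (L2_inner u v))^2/n"
  using n by (simp add: c_def norm_divide power_divide L2_inner_cnj[of u v, symmetric] power2_eq_square)
 finally have "(cmod (L2_inner u v))^2/n <= (L2_norm u)^2" by simp
 then have "(cmod (L2_inner u v))^2 <= (L2_norm u*L2_norm v)^2"
  using n by (simp add: n_def power_mult_distrib divide_le_eq)
 then show ?thesis by (rule power2_le_imp_le) simp
qed

lemma L2_norm_triangle:
 assumes "u : L2" "v : L2"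
 shows "L2_norm (%x. u x + v x) <= L2_norm u + L2_norm v"
proof (rule power2_le_imp_le)
 have "Re (L2_inner u v) <= L2_norm u*L2_norm v"
  using L2_Cauchy_Schwarz[OF assms] complex_Re_le_cmod order_trans by blast
 then show "(L2_norm (%x. u x + v x))^2 <= (L2_norm u + L2_norm v)^2"
  unfolding L2_norm_add_sq[OF assms] by (simp add: power2_sum)
qed simp

lemma L2_norm_minus_commute: "L2_norm (%x. u x - v x) = L2_norm (%x. v x - u x)"
 by (simp add: L2_norm_def norm_minus_commute)

lemma L2_norm_triangle_diff:
 assumes "u : L2" "v : L2" "w : L2"
 shows "L2_norm (%x. u x - w x) <= L2_norm (%x. u x - v x) + L2_norm (%x. v x - w x)"
 using L2_norm_triangle[of "%x. u x - v x" "%x. v x - w x"] assms by simp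

lemma L2_norm_triangle_rev:
 assumes "u : L2" "v : L2"
 shows "\<bar>L2_norm u - L2_norm v\<bar> <= L2_norm (%x. u x - v x)"
 using L2_norm_triangle[of "%x. u x - v x" v] L2_norm_triangle[of "%x. v x - u x" u] assms
  L2_norm_minus_commute[of u v] by simp

lemma L2_norm_tendsto:
 assumes "!!n. u n : L2" "v : L2" "((%n. L2_norm (%x. u n x - v x)) ---> 0) F"
 shows "((%n. L2_norm (u n)) ---> L2_norm v) F"
proof (rule LIM_zero_cancel, rule tendsto_rabs_zero_cancel, rule tendsto_sandwich[OF _ _ tendsto_const assms(3)])
 show "\<forall>\<^sub>F n in F. \<bar>L2_norm (u n) - L2_norm v\<bar> <= L2_norm (%x. u n x - v x)"
  using L2_norm_triangle_rev assms by (intro always_eventually) auto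
qed auto

lemma L2_inner_tendsto:
 assumes "!!n. u n : L2" "v : L2" "w : L2" "((%n. L2_norm (%x. u n x - v x)) ---> 0) F"
 shows "((%n. L2_inner w (u n)) ---> L2_inner w v) F"
proof (rule LIM_zero_cancel, rule tendsto_norm_zero_cancel, rule tendsto_sandwich[OF _ _ tendsto_const])
 show "\<forall>\<^sub>F n in F. norm (L2_inner w (u n) - L2_inner w v) <= L2_norm w*L2_norm (%x. u n x - v x)"
  using assms by (intro always_eventually) (auto simp flip: L2_inner_diff_right intro!: L2_Cauchy_Schwarz)
 show "((%n. L2_norm w*L2_norm (%x. u n x - v x)) ---> 0) F"
  using tendsto_mult_left[OF assms(4), of "L2_norm w"] by simp
qed auto

lemma nn_integral_L2_norm: "u : L2 ==> (\<integral>\<^sup>+x. ennreal ((cmod (u x))^2) \<partial>lborel) = ennreal ((L2_norm u)^2)"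
 by (simp add: L2_norm_sq nn_integral_eq_integral)

lemma L2_orth_all:
 assumes "w : L2" "!!u. u : L2 ==> L2_inner u w = 0" shows "AE x in lborel. w x = 0"
proof -
 have "cor ((L2_norm w)^2) = 0" using assms(2)[OF assms(1)] by (simp add: L2_inner_self)
 then show ?thesis using L2_norm_eq_0[OF assms(1)] by simp
qed

text \<open>A subsequence with increments below \<open>2^-k\<close> in norm converges almost
  everywhere; Fatou's lemma then bounds the distance of the original sequence from the pointwise
  limit.\<close>

theorem L2_complete:
 fixes u :: "nat => 'a::euclidean_space => complex"
 assumes u: "!!n. u n : L2"
  and Cauchy: "!!e. e > 0 ==> EX N. ALL m>=N. ALL n>=N. L2_norm (%x. u m x - u n x) <= e"
 obtains v where "v : L2" "(%n. L2_norm (%x. u n x - v x)) ----> 0"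
proof -
 have [measurable]: "u n : BM" for n using u by auto
 have "EX N. ALL k. ALL m>=N k. ALL n>=N k. L2_norm (%x. u m x - u n x) <= (1/2)^k"
  by (intro choice allI Cauchy) simp
 then obtain N where N: "!!k m n. m >= N k ==> n >= N k ==> L2_norm (%x. u m x - u n x) <= (1/2)^k" by blast
 define r where "r = rec_nat (N 0) (%k rk. max (Suc rk) (N (Suc k)))"
 have r_Suc: "r (Suc k) = max (Suc (r k)) (N (Suc k))" and r_0: "r 0 = N 0" for k by (simp_all add: r_def)
 have rN: "r k >= N k" for k by (cases k) (simp_all add: r_0 r_Suc)
 have sm: "strict_mono r" by (rule strict_monoI_Suc) (simp add: r_Suc)
 have rmono: "r k <= r l" if "k <= l" for k l using sm that by (simp add: strict_mono_less_eq)
 define g where "g = (%k x. cmod (u (r (Suc k)) x - u (r k) x))"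
 have [measurable]: "g k : BM" for k unfolding g_def by measurable
 have step: "(\<integral>\<^sup>+x. ennreal ((g k x)^2) \<partial>lborel) <= ennreal ((1/4)^k)" for k
 proof -
  have "(\<integral>\<^sup>+x. ennreal ((g k x)^2) \<partial>lborel) = ennreal ((L2_norm (%x. u (r (Suc k)) x - u (r k) x))^2)"
   unfolding g_def by (rule nn_integral_L2_norm) (simp add: u)
  also have "... <= ennreal (((1/2)^k)^2)"
   using N[OF order_trans[OF rN rmono] rN, of k "Suc k"]
   by (intro ennreal_leI power_mono) auto
  also have "((1/2)^k)^2 = ((1/4)^k :: real)"
   by (simp add: power2_eq_square flip: power_mult_distrib)
  finally show ?thesis .
 qed
 have "(\<integral>\<^sup>+x. (\<Sum>k. ennreal (2^k*(g k x)^2)) \<partial>lborel) = (\<Sum>k. \<integral>\<^sup>+x. ennreal (2^k*(g k x)^2) \<partial>lborel)"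
  by (rule nn_integral_suminf) measurable
 also have "... = (\<Sum>k. ennreal (2^k)*(\<integral>\<^sup>+x. ennreal ((g k x)^2) \<partial>lborel))"
  by (intro suminf_cong) (simp add: ennreal_mult nn_integral_cmult)
 also have "... <= (\<Sum>k. ennreal (2^k)*ennreal ((1/4)^k))"
  by (intro suminf_le mult_left_mono step) auto
 also have "... = (\<Sum>k. ennreal ((1/2)^k))"
  by (intro suminf_cong) (simp flip: ennreal_mult' power_mult_distrib)
 also have "... = ennreal (\<Sum>k. (1/2)^k)"
  by (rule suminf_ennreal2) auto
 also have "... < \<infinity>" by simp
 finally have fin: "(\<integral>\<^sup>+x. (\<Sum>k. ennreal (2^k*(g k x)^2)) \<partial>lborel) ~= \<infinity>" by simp
 have "AE x in lborel. (\<Sum>k. ennreal (2^k*(g k x)^2)) ~= \<infinity>"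
  by (rule nn_integral_PInf_AE[OF _ fin]) measurable
 then have conv: "AE x in lborel. convergent (%k. u (r k) x)"
 proof eventually_elim
  case (elim x)
  have g0: "0 <= g k x" for k by (simp add: g_def)
  have "summable (%k. 2^k*(g k x)^2)"
   by (rule summable_suminf_not_top) (use elim in auto)
  then have "summable (%k. (sqrt 2^k*g k x)^2)"
   by (simp add: power_mult_distrib flip: power_mult) (simp add: power_mult mult.commute[of _ 2])
  then have "(%k. (sqrt 2^k*g k x)^2) ----> 0" by (rule summable_LIMSEQ_zero)
  then have "Bseq (%k. (sqrt 2^k*g k x)^2)" by (rule convergent_imp_Bseq[OF convergentI])
  then obtain K where K: "!!k. (sqrt 2^k*g k x)^2 <= K" "K > 0"
   by (auto simp: Bseq_def)
  \<comment> \<open>The weight \<open>2^k\<close> inserted in the sum of squares still leaves a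
    finite integral, and it forces geometric decay of the increments at this point.\<close>
  have gb: "g k x <= sqrt K*(1/sqrt 2)^k" for k
  proof -
   have "sqrt 2^k*g k x <= sqrt K" using K(1)[of k] by (rule real_le_rsqrt)
   then show ?thesis by (simp add: power_divide field_simps)
  qed
  have "summable (%k. sqrt K*(1/sqrt 2)^k)"
   by (intro summable_mult summable_geometric) simp
  then have "summable (%k. u (r (Suc k)) x - u (r k) x)"
   by (rule summable_comparison_test'[where N=0]) (use gb in \<open>auto simp: g_def\<close>)
  then have "convergent (%n. \<Sum>k<n. u (r (Suc k)) x - u (r k) x)"
   by (simp add: summable_iff_convergent)
  then have "convergent (%n. u (r n) x - u (r 0) x)"
   by (subst (asm) sum_lessThan_telescope)
  then show ?case using convergent_add[OF _ convergent_const[of "u (r 0) x"]] by force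
 qed
 define v where "v x = lim (%k. u (r k) x)" for x
 have [measurable]: "v : BM"
  unfolding v_def by (rule borel_measurable_lim_metric) measurable
 have lim: "AE x in lborel. (%k. u (r k) x) ----> v x"
  using conv by eventually_elim (simp add: v_def convergent_LIMSEQ_iff)
 have key: "(\<integral>\<^sup>+x. ennreal ((cmod (u n x - v x))^2) \<partial>lborel) <= ennreal (((1/2)^k)^2)" if n: "n >= N k" for n k
 proof -
  have "(\<integral>\<^sup>+x. ennreal ((cmod (u n x - v x))^2) \<partial>lborel) = (\<integral>\<^sup>+x. liminf (%l. ennreal ((cmod (u n x - u (r l) x))^2)) \<partial>lborel)"
  proof (rule nn_integral_cong_AE)
   show "AE x in lborel. ennreal ((cmod (u n x - v x))^2) = liminf (%l. ennreal ((cmod (u n x - u (r l) x))^2))"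
    using lim
   proof eventually_elim
    case (elim x)
    have "(%l. ennreal ((cmod (u n x - u (r l) x))^2)) ----> ennreal ((cmod (u n x - v x))^2)"
     by (intro tendsto_ennrealI tendsto_intros elim)
    then show ?case by (rule lim_imp_Liminf[OF sequentially_bot, symmetric])
   qed
  qed
  also have "... <= liminf (%l. \<integral>\<^sup>+x. ennreal ((cmod (u n x - u (r l) x))^2) \<partial>lborel)"
   by (rule nn_integral_liminf) measurable
  also have "... <= ennreal (((1/2)^k)^2)"
  proof (rule Liminf_le)
   show "\<forall>\<^sub>F l in sequentially. (\<integral>\<^sup>+x. ennreal ((cmod (u n x - u (r l) x))^2) \<partial>lborel) <= ennreal (((1/2)^k)^2)"
    using eventually_ge_at_top[of k]
   proof eventually_elim
    case (elim l)
    have "L2_norm (%x. u n x - u (r l) x) <= (1/2)^k"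
     by (rule N[OF n]) (use rN[of k] rmono[OF elim] in auto)
    then show ?case by (subst nn_integral_L2_norm) (auto simp: u intro!: ennreal_leI power_mono)
   qed
  qed simp
  finally show ?thesis .
 qed
 have vd: "(%x. u (N 0) x - v x) : L2"
 proof (rule L2I)
  show "integrable lborel (%x. (cmod (u (N 0) x - v x))^2)"
   by (rule integrableI_bounded) (use key[of 0 "N 0"] in \<open>auto simp: less_top[symmetric] top_unique\<close>)
 qed measurable
 have v: "v : L2"
  using L2_diff[OF u[of "N 0"] vd] by simp
 have "(%n. L2_norm (%x. u n x - v x)) ----> 0"
 proof (rule LIMSEQ_I)
  fix e :: real assume e: "e > 0"
  obtain k where k: "(1/2)^k < e" using real_arch_pow_inv[OF e, of "1/2"] by auto
  have "norm (L2_norm (%x. u n x - v x) - 0) < e" if "n >= N k" for n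
  proof -
   have "ennreal ((L2_norm (%x. u n x - v x))^2) <= ennreal (((1/2)^k)^2)"
    using key[OF that] by (subst (asm) nn_integral_L2_norm) (auto simp: u v)
   then have "(L2_norm (%x. u n x - v x))^2 <= ((1/2)^k)^2" by (subst (asm) ennreal_le_iff) auto
   then have "L2_norm (%x. u n x - v x) <= (1/2)^k" by (rule power2_le_imp_le) simp
   then show ?thesis using k by simp
  qed
  then show "EX no. ALL n>=no. norm (L2_norm (%x. u n x - v x) - 0) < e" by blast
 qed
 then show thesis by (rule that[OF v])
qed

section \<open>Plancherel transform\<close>

lemma nn_integral_lborel_affine:
 fixes t :: "'a::euclidean_space"
 assumes c: "c ~= 0" and [measurable]: "f : BM"
 shows "(\<integral>\<^sup>+x. f x \<partial>lborel) = ennreal (\<bar>c\<bar>^DIM('a))*(\<integral>\<^sup>+x. f (t + c *\<^sub>R x) \<partial>lborel)"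
 by (subst lborel_affine[OF c, of t])
  (simp add: nn_integral_density nn_integral_distr nn_integral_cmult ennreal_power)

lemma integrable_lborel_affine:
 fixes t :: "'a::euclidean_space" and f :: "'a => 'b::{banach, second_countable_topology}"
 assumes f: "integrable lborel f" and c: "c ~= 0"
 shows "integrable lborel (%x. f (t + c *\<^sub>R x))"
 using f f[THEN borel_measurable_integrable] c unfolding integrable_iff_bounded
 by (subst (asm) nn_integral_lborel_affine[where c=c and t=t]) (auto simp: ennreal_mult_less_top)

lemma integral_lborel_affine:
 fixes t :: "'a::euclidean_space" and f :: "'a => 'b::{banach, second_countable_topology}"
 assumes c: "c ~= 0" and [measurable]: "f : BM"
 shows "(LBINT x. f x) = (\<bar>c\<bar>^DIM('a)) *\<^sub>R (LBINT x. f (t + c *\<^sub>R x))"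
proof -
 have "(LBINT x. f x) = (\<integral>x. f x \<partial>density (distr lborel borel (%x. t + c *\<^sub>R x)) (%_. ennreal (\<bar>c\<bar>^DIM('a))))"
  by (subst lborel_affine[OF c, of t]) (simp add: ennreal_power)
 also have "... = (\<bar>c\<bar>^DIM('a)) *\<^sub>R (LBINT x. f (t + c *\<^sub>R x))"
  by (subst integral_density) (auto simp: integral_distr)
 finally show ?thesis .
qed

lemma L2_affine:
 fixes t :: "'a::euclidean_space"
 assumes u: "u : L2" and c: "c ~= 0"
 shows "(%x. u (t + c *\<^sub>R x)) : L2" "(L2_norm u)^2 = \<bar>c\<bar>^DIM('a)*(L2_norm (%x. u (t + c *\<^sub>R x)))^2"
proof -
 have [measurable]: "u : BM" using u by simp
 show "(%x. u (t + c *\<^sub>R x)) : L2"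
  by (rule L2I) (measurable, rule integrable_lborel_affine[OF L2_integrable[OF u] c])
 show "(L2_norm u)^2 = \<bar>c\<bar>^DIM('a)*(L2_norm (%x. u (t + c *\<^sub>R x)))^2"
  unfolding L2_norm_sq by (subst integral_lborel_affine[OF c, of _ t]) auto
qed

lemma L2_norm_tendsto_0:
 fixes s :: "nat => 'a::euclidean_space => complex"
 assumes "!!n. s n : BM" "integrable lborel w"
  and "!!n x. (cmod (s n x))^2 <= w x" "AE x in lborel. (%n. s n x) ----> 0"
 shows "(%n. L2_norm (s n)) ----> 0"
proof -
 have [measurable]: "s n : BM" for n by fact
 have "(%n. (LBINT x. (cmod (s n x))^2)) ----> (LBINT (x::'a). 0)"
 proof (rule integral_dominated_convergence[where w = w])
  show "AE x in lborel. (%n. (cmod (s n x))^2) ----> 0"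
   using assms(4) by eventually_elim (metis tendsto_norm_zero tendsto_null_power zero_less_numeral)
 qed (use assms in auto)
 then show ?thesis unfolding L2_norm_def using tendsto_real_sqrt by fastforce
qed

text \<open>After truncation of values and support, \<open>measurable_on\<close> supplies continuous
  functions converging outside a null set. \<open>clip\<close> and \<open>chi\<close> give these
  approximants a common bound and a common bounded support, so that dominated convergence
  applies.\<close>

lemma L2_approx_continuous:
 fixes u :: "'a::euclidean_space => complex"
 assumes u: "u : L2" and e: "e > 0"
 obtains g R B where "continuous_on UNIV g" "!!x. norm x > R ==> g x = 0" "!!x. cmod (g x) <= B" "g : L2"
  "L2_norm (%x. u x - g x) <= e"
proof -
 have [measurable]: "u : BM" using u by simp
 define v where "v = (%n x. if cmod (u x) <= real n & norm x <= real n then u x else 0)"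
 have [measurable]: "v n : BM" for n unfolding v_def by measurable
 have vL: "v n : L2" for n
  by (rule L2_bound[OF _ L2_integrable[OF u]]) (measurable, auto simp: v_def)
 have "(%n. L2_norm (%x. u x - v n x)) ----> 0"
 proof (rule L2_norm_tendsto_0[OF _ L2_integrable[OF u]])
  show "AE x in lborel. (%n. u x - v n x) ----> 0"
  proof (rule AE_I2)
   fix x
   obtain N where N: "max (cmod (u x)) (norm x) <= real N" using real_arch_simple by blast
   have "\<forall>\<^sub>F n in sequentially. u x - v n x = 0"
    using eventually_ge_at_top[of N] by eventually_elim (use N in \<open>auto simp: v_def\<close>)
   then show "(%n. u x - v n x) ----> 0" by (rule tendsto_eventually)
  qed
 qed (measurable, auto simp: v_def)
 then have "\<forall>\<^sub>F n in sequentially. L2_norm (%x. u x - v n x) < e/2"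
  using e by (intro order_tendstoD(2)) auto
 then obtain n where n: "L2_norm (%x. u x - v n x) < e/2"
  by (auto simp: eventually_sequentially)
 have "v n : borel_measurable lebesgue"
  by (rule measurable_completion) measurable
 then have "v n measurable_on UNIV"
  by (rule lebesgue_measurable_imp_measurable_on) simp
 then obtain N g where N: "negligible N" and gc: "!!k. continuous_on UNIV (g k)"
  and glim: "!!x. x \<notin> N ==> (%k. g k x) ----> v n x"
  unfolding measurable_on_def by auto
 define clip where "clip = (%z::complex. (real n/max (real n) (cmod z)) *\<^sub>R z)"
 define chi where "chi = (%x::'a. max 0 (min 1 (real n + 1 - norm x)))"
 define h where "h = (%k x. chi x *\<^sub>R clip (g k x))"
 show thesis
 \<comment> \<open>For \<open>n = 0\<close> the quotient in \<open>clip\<close> degenerates at the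
   origin, but then the truncation \<open>v 0\<close> vanishes identically.\<close>
 proof (cases "n = 0")
  case True
  have "L2_norm (%x. u x - 0) <= e"
  proof -
   have "v n = (%x. 0)" by (auto simp: v_def True)
   then show ?thesis using n e by simp
  qed
  then show ?thesis by (intro that[of "%x. 0" 0 0]) auto
 next
  case False
  have clipc: "continuous_on UNIV clip" unfolding clip_def
   by (intro continuous_intros) (use False in auto)
  have clipb: "cmod (clip z) <= real n" for z
  proof -
   have "cmod (clip z) = real n*(cmod z/max (real n) (cmod z))" by (simp add: clip_def)
   also have "... <= real n*1"
    using False by (intro mult_left_mono) (auto simp: divide_le_eq max_def)
   finally show ?thesis by simp
  qed
  have clip_id: "clip z = z" if "cmod z <= real n" for z
   using that False by (simp add: clip_def max_absorb1)
  have hc: "continuous_on UNIV (h k)" for k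
   unfolding h_def chi_def by (intro continuous_intros continuous_on_compose2[OF clipc gc]) auto
  have [measurable]: "h k : BM" for k
   using hc by (rule borel_measurable_continuous_onI)
  have h0: "h k x = 0" if "norm x > real n + 1" for k x
   using that by (simp add: h_def chi_def)
  have hb: "cmod (h k x) <= real n" for k x
  proof -
   have "cmod (h k x) = chi x*cmod (clip (g k x))" by (simp add: h_def chi_def)
   also have "... <= 1*real n" by (intro mult_mono clipb) (auto simp: chi_def)
   finally show ?thesis by simp
  qed
  have vb: "cmod (v n x) <= real n" for x by (simp add: v_def)
  have v0: "v n x = 0" if "norm x > real n + 1" for x
   using that by (simp add: v_def)
  let ?w = "%x::'a. indicator (cball 0 (real n + 1)) x*(2*real n)^2 :: real"
  have intw: "integrable lborel ?w"
   by (intro integrable_real_mult_indicator integrable_real_indicator emeasure_lborel_cball_finite integrable_mult_left) auto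
  have hL: "h k : L2" for k
  proof (rule L2_bound[OF _ intw], measurable, rule AE_I2)
   fix x :: 'a
   have "cmod (h k x) <= 2*real n" using hb[of k x] by simp
   then show "(cmod (h k x))^2 <= ?w x"
    using power_mono[of "cmod (h k x)" "2*real n" 2] h0[of x k] by (auto split: split_indicator simp del: power_mult_distrib)
  qed
  have "(%k. L2_norm (%x. v n x - h k x)) ----> 0"
  proof (rule L2_norm_tendsto_0[OF _ intw])
   fix k and x :: 'a
   have "cmod (v n x - h k x) <= 2*real n"
    using norm_triangle_ineq4[of "v n x" "h k x"] vb[of x] hb[of k x] by linarith
   then show "(cmod (v n x - h k x))^2 <= ?w x"
    using power_mono[of "cmod (v n x - h k x)" "2*real n" 2] h0[of x k] v0[of x]
    by (auto split: split_indicator simp del: power_mult_distrib)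
  next
   have "AE x in lebesgue. x \<notin> N" using N by (simp add: negligible_iff_null_sets AE_not_in)
   then have "AE x in lborel. x \<notin> N" by (simp add: AE_completion_iff)
   then show "AE x in lborel. (%k. v n x - h k x) ----> 0"
   proof eventually_elim
    case (elim x)
    have "(%k. clip (g k x)) ----> clip (v n x)"
     using continuous_on_tendsto_compose[OF clipc glim[OF elim]] by auto
    then have "(%k. clip (g k x)) ----> v n x" by (simp add: clip_id vb)
    then have "(%k. v n x - h k x) ----> v n x - chi x *\<^sub>R v n x"
     unfolding h_def by (intro tendsto_intros)
    moreover have "chi x *\<^sub>R v n x = v n x" by (auto simp: v_def chi_def)
    ultimately show ?case by simp
   qed
  qed measurable
  then have "\<forall>\<^sub>F k in sequentially. L2_norm (%x. v n x - h k x) < e/2"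
   using e by (intro order_tendstoD(2)) auto
  then obtain k where k: "L2_norm (%x. v n x - h k x) < e/2"
   by (auto simp: eventually_sequentially)
  show thesis
  proof (rule that[OF hc h0 hb hL])
   show "L2_norm (%x. u x - h k x) <= e"
    using L2_norm_triangle_diff[OF u vL[of n] hL[of k]] n k by simp
  qed
 qed
qed

text \<open>The norm is translation invariant, so \<open>u\<close> may be replaced by a continuous
  function of bounded support; its translates by a bounded sequence share one bounded
  support.\<close>

lemma L2_translation_continuous:
 fixes u :: "'a::euclidean_space => complex"
 assumes u: "u : L2" and z: "z ----> 0"
 shows "(%n. L2_norm (%x. u (x + z n) - u x)) ----> 0"
proof (rule LIMSEQ_I)
 fix e :: real assume e: "e > 0"
 have e4: "e/4 > 0" using e by simp
 obtain g R B where g: "continuous_on UNIV g" "!!x. norm x > R ==> g x = 0" "!!x. cmod (g x) <= B" "g : L2"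
  and ug: "L2_norm (%x. u x - g x) <= e/4"
  by (rule L2_approx_continuous[OF u e4], rule that)
 have [measurable]: "g : BM" using g(4) by simp
 have shift: "f : L2 ==> (%x. f (x + y)) : L2 & L2_norm (%x. f (x + y)) = L2_norm f" for f :: "'a => complex" and y
  using L2_affine[of f 1 y] by (simp add: add.commute power2_eq_iff_nonneg)
 obtain C where C: "!!n. norm (z n) <= C"
  using convergent_imp_Bseq[OF convergentI[OF z]] by (auto simp: Bseq_def)
 let ?w = "%x::'a. indicator (cball 0 (R + C)) x*(2*B)^2 :: real"
 have intw: "integrable lborel ?w"
  by (intro integrable_mult_left integrable_real_indicator emeasure_lborel_cball_finite) auto
 have "(%n. L2_norm (%x. g (x + z n) - g x)) ----> 0"
 proof (rule L2_norm_tendsto_0[OF _ intw])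
  fix n and x :: 'a
  have "cmod (g (x + z n) - g x) <= 2*B"
   using norm_triangle_ineq4[of "g (x + z n)" "g x"] g(3)[of x] g(3)[of "x + z n"] by linarith
  moreover have "g (x + z n) - g x = 0" if "norm x > R + C"
  proof -
   have "norm (x + z n) > R" using norm_diff_ineq[of x "z n"] C[of n] that by linarith
   moreover have "norm x > R" using C[of n] norm_ge_zero[of "z n"] that by linarith
   ultimately show ?thesis using g(2) by simp
  qed
  ultimately show "(cmod (g (x + z n) - g x))^2 <= ?w x"
   using power_mono[of "cmod (g (x + z n) - g x)" "2*B" 2]
   by (auto split: split_indicator simp del: power_mult_distrib)
 next
  show "AE x in lborel. (%n. g (x + z n) - g x) ----> 0"
  proof (rule AE_I2)
   fix x
   have "(%n. x + z n) ----> x" using tendsto_add[OF tendsto_const z, of x] by simp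
   then have "(%n. g (x + z n)) ----> g x"
    using continuous_on_tendsto_compose[OF g(1)] by auto
   then show "(%n. g (x + z n) - g x) ----> 0" by (rule LIM_zero)
  qed
 qed measurable
 then have "\<forall>\<^sub>F n in sequentially. L2_norm (%x. g (x + z n) - g x) < e/4"
  using e by (intro order_tendstoD(2)) auto
 then obtain N where N: "!!n. n >= N ==> L2_norm (%x. g (x + z n) - g x) < e/4"
  by (auto simp: eventually_sequentially)
 have "norm (L2_norm (%x. u (x + z n) - u x) - 0) < e" if "n >= N" for n
 proof -
  have "L2_norm (%x. u (x + z n) - u x) <= L2_norm (%x. u (x + z n) - g (x + z n)) + L2_norm (%x. g (x + z n) - u x)"
   by (rule L2_norm_triangle_diff) (use shift u g in auto)
  also have "L2_norm (%x. g (x + z n) - u x) <= L2_norm (%x. g (x + z n) - g x) + L2_norm (%x. g x - u x)"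
   by (rule L2_norm_triangle_diff) (use shift u g in auto)
  also have "L2_norm (%x. u (x + z n) - g (x + z n)) = L2_norm (%x. u x - g x)"
   using shift[of "%x. u x - g x" "z n"] u g by auto
  finally have "L2_norm (%x. u (x + z n) - u x) <= 2*L2_norm (%x. u x - g x) + L2_norm (%x. g (x + z n) - g x)"
   using L2_norm_minus_commute[of g u] by simp
  then show ?thesis using N[OF that] ug e by (simp only: diff_zero real_norm_def abs_of_nonneg[OF L2_norm_nonneg])
 qed
 then show "EX no. ALL n>=no. norm (L2_norm (%x. u (x + z n) - u x) - 0) < e" by blast
qed

section \<open>Fourier integrals and the Plancherel identity for integrable functions\<close>

lemma integrable_prod_bounded:
 fixes f :: "'a::euclidean_space => complex" and g :: "'b::euclidean_space => complex"
 assumes f: "integrable lborel f" and g: "integrable lborel g"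
  and [measurable]: "b : borel_measurable (borel \<Otimes>\<^sub>M borel)" and b: "!!z. cmod (b z) <= C"
 shows "integrable (lborel \<Otimes>\<^sub>M lborel) (%(x, y). f x*g y*b (x, y))"
proof -
 have [measurable]: "f : BM" "g : BM" using f g by auto
 show ?thesis
 proof (rule integrableI_bounded)
  have "(\<integral>\<^sup>+z. ennreal (norm (case z of (x, y) => f x*g y*b (x, y))) \<partial>(lborel \<Otimes>\<^sub>M lborel))
   = (\<integral>\<^sup>+x. \<integral>\<^sup>+y. ennreal (norm (f x*g y*b (x, y))) \<partial>lborel \<partial>lborel)"
   by (subst lborel.nn_integral_fst[symmetric]) auto
  also have "... <= (\<integral>\<^sup>+x. \<integral>\<^sup>+y. ennreal (C*norm (f x))*ennreal (norm (g y)) \<partial>lborel \<partial>lborel)"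
  proof (intro nn_integral_mono)
   fix x y
   have "norm (f x*g y*b (x, y)) <= norm (f x)*norm (g y)*C"
    unfolding norm_mult by (intro mult_left_mono b) auto
   then show "ennreal (norm (f x*g y*b (x, y))) <= ennreal (C*norm (f x))*ennreal (norm (g y))"
    by (subst ennreal_mult''[symmetric]) (auto intro!: ennreal_leI simp: mult_ac)
  qed
  also have "... = (\<integral>\<^sup>+x. ennreal (C*norm (f x)) \<partial>lborel)*(\<integral>\<^sup>+y. ennreal (norm (g y)) \<partial>lborel)"
   by (simp add: nn_integral_cmult nn_integral_multc)
  also have "... < \<infinity>"
  proof -
   have C: "C >= 0" using b norm_ge_zero order_trans by blast
   have "(\<integral>\<^sup>+x. ennreal (C*norm (f x)) \<partial>lborel) = ennreal C*(\<integral>\<^sup>+x. ennreal (norm (f x)) \<partial>lborel)"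
    using C by (simp add: ennreal_mult nn_integral_cmult)
   then show ?thesis using f g by (simp add: integrable_iff_bounded ennreal_mult_less_top)
  qed
  finally show "(\<integral>\<^sup>+z. ennreal (norm (case z of (x, y) => f x*g y*b (x, y))) \<partial>(lborel \<Otimes>\<^sub>M lborel)) < \<infinity>" .
 qed measurable
qed

lemma fubini_prod_bounded:
 fixes f :: "'a::euclidean_space => complex" and g :: "'b::euclidean_space => complex"
 assumes "integrable lborel f" "integrable lborel g"
  and "b : borel_measurable (borel \<Otimes>\<^sub>M borel)" "!!z. cmod (b z) <= C"
 shows "(LBINT x. f x*(LBINT y. g y*b (x, y))) = (LBINT y. g y*(LBINT x. f x*b (x, y)))"
proof -
 have "(LBINT x. f x*(LBINT y. g y*b (x, y))) = (LBINT x. (LBINT y. f x*g y*b (x, y)))"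
  by (simp add: mult.assoc)
 also have "... = (LBINT y. (LBINT x. f x*g y*b (x, y)))"
  using lborel_pair.Fubini_integral[of "%x y. f x*g y*b (x, y)", OF integrable_prod_bounded[OF assms]] by simp
 also have "... = (LBINT y. g y*(LBINT x. f x*b (x, y)))"
  by (subst integral_mult_right_zero[symmetric]) (simp add: mult_ac)
 finally show ?thesis .
qed

lemma cis_inner_measurable [measurable]:
 "(%z::'a::euclidean_space \<times> 'a. cis (fst z \<bullet> snd z)) : borel_measurable (borel \<Otimes>\<^sub>M borel)"
 unfolding borel_prod by (intro borel_measurable_continuous_onI continuous_intros)

lemma cis_measurable [measurable]: "cis : BM"
 by (intro borel_measurable_continuous_onI continuous_intros)

lemma fourier_integral_measurable [measurable]:
 assumes [measurable]: "u : BM"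
 shows "fourier_integral (u :: 'a::euclidean_space => complex) : BM"
 unfolding fourier_integral_def by measurable

lemma integrable_cis_mult:
 fixes u :: "'a::euclidean_space => complex"
 assumes u: "integrable lborel u" and [measurable]: "r : BM"
 shows "integrable lborel (%x. cis (r x)*u x)"
proof (rule bochner_integrable_bound[OF u])
 have [measurable]: "u : BM" using u by auto
 show "(%x. cis (r x)*u x) : borel_measurable lborel" by measurable
qed (auto simp: norm_mult)

lemma fourier_integral_bound:
 assumes u: "integrable lborel u"
 shows "cmod (fourier_integral u p) <= (LBINT x. cmod (u x))"
proof -
 have "cmod (fourier_integral u p) <= (LBINT x. cmod (cis (- (p \<bullet> x))*u x))"
  unfolding fourier_integral_def by (rule integral_norm_bound)
 then show ?thesis by (simp add: norm_mult)
qed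

lemma fourier_integral_add:
 assumes "integrable lborel u" "integrable lborel v"
 shows "fourier_integral (%x. u x + v x) p = fourier_integral u p + fourier_integral v p"
 unfolding fourier_integral_def
 by (simp add: distrib_left bochner_integral_add integrable_cis_mult assms)

lemma fourier_integral_cmult:
 "fourier_integral (%x. c*u x) p = c*fourier_integral u p"
 unfolding fourier_integral_def by (simp add: mult.left_commute)

lemma L2_inner_eq: "L2_inner u v = (LBINT x. v x*cnj (u x))"
 by (simp add: L2_inner_def mult.commute)

text \<open>The Gaussian factor makes the double integrals absolutely convergent, so the order of
  integration can be changed; the integral over \<open>p\<close> then produces the heat kernel at
  the difference \<open>y - x\<close>.\<close>

lemma gauss_autocorrelation:
 fixes u :: "'a::euclidean_space => complex"
 assumes u: "integrable lborel u" and s: "s > 0"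
 shows "(LBINT p. cor ((cmod (fourier_integral u p))^2*exp (- s*(norm p)^2)))
  = cor ((2*pi)^DIM('a)) *
   (LBINT z. cor (heat_kernel s z)*(LBINT x. u x*cnj (u (x + z))))"
proof -
 let ?u = "fourier_integral u"
 let ?g = "%p::'a. cor (exp (- s*(norm p)^2))"
 let ?C = "(LBINT x. cmod (u x))"
 have [measurable]: "u : BM" using u by auto
 have gi: "integrable lborel ?g"
  by (intro integrable_of_real integral_gauss(1) s)
 have ui: "integrable lborel (%y. cnj (u y))" using u by simp
 have ub: "cmod (?u p) <= ?C" for p by (rule fourier_integral_bound[OF u])
 have gui: "integrable lborel (%p. ?g p*cnj (?u p))"
 proof (rule bochner_integrable_bound)
  show "integrable lborel (%p. ?C *\<^sub>R ?g p)" by (intro integrable_scaleR_right gi)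
  show "AE p in lborel. norm (?g p*cnj (?u p)) <= norm (?C *\<^sub>R ?g p)"
   using ub by (auto simp: norm_mult mult.commute intro!: mult_left_mono)
 qed measurable
 have "(LBINT p. cor ((cmod (?u p))^2*exp (- s*(norm p)^2)))
  = (LBINT p. (?g p*cnj (?u p))*(LBINT x. u x*cis (- (p \<bullet> x))))"
 proof (rule bochner_integral_cong[OF refl])
  fix p
  have "(LBINT x. u x*cis (- (p \<bullet> x))) = ?u p"
   unfolding fourier_integral_def by (simp add: mult.commute)
  then show "cor ((cmod (?u p))^2*exp (- s*(norm p)^2))
    = (?g p*cnj (?u p))*(LBINT x. u x*cis (- (p \<bullet> x)))"
   using complex_norm_square[of "?u p"] by (simp add: mult_ac)
 qed
 also have "... = (LBINT x. u x*(LBINT p. (?g p*cnj (?u p))*cis (- (p \<bullet> x))))"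
  using fubini_prod_bounded[OF gui u, of "%z. cis (- (fst z \<bullet> snd z))" 1] by simp
 also have "... = (LBINT x. u x*(cor ((2*pi)^DIM('a))*(LBINT y. cnj (u y)*cor (heat_kernel s (y - x)))))"
 proof (rule bochner_integral_cong[OF refl])
  fix x
  have "integrable lborel (%p. ?g p*cis (- (p \<bullet> x)))"
   using integrable_cis_mult[OF gi, of "%p. - (p \<bullet> x)"] by (simp add: mult.commute)
  note i = this
  have "(LBINT p. (?g p*cnj (?u p))*cis (- (p \<bullet> x)))
   = (LBINT p. (?g p*cis (- (p \<bullet> x)))*(LBINT y. cnj (u y)*cis (p \<bullet> y)))"
  proof (rule bochner_integral_cong[OF refl])
   fix p
   have "cnj (?u p) = (LBINT y. cnj (u y)*cis (p \<bullet> y))"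
    unfolding fourier_integral_def bochner_integral_cnj[symmetric]
    by (simp add: cis_cnj mult.commute)
   then show "(?g p*cnj (?u p))*cis (- (p \<bullet> x)) = (?g p*cis (- (p \<bullet> x)))*(LBINT y. cnj (u y)*cis (p \<bullet> y))"
    by simp
  qed
  also have "... = (LBINT y. cnj (u y)*(LBINT p. (?g p*cis (- (p \<bullet> x)))*cis (p \<bullet> y)))"
   using fubini_prod_bounded[OF i ui, of "%z. cis (fst z \<bullet> snd z)" 1] by simp
  also have "... = (LBINT y. cor ((2*pi)^DIM('a))*(cnj (u y)*cor (heat_kernel s (y - x))))"
  proof (rule bochner_integral_cong[OF refl])
   fix y
   have "(LBINT p. (?g p*cis (- (p \<bullet> x)))*cis (p \<bullet> y)) = (LBINT p. cis ((y - x) \<bullet> p)*?g p)"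
    by (intro bochner_integral_cong refl)
     (simp add: inner_diff_right inner_commute[of _ "_ :: 'a"] mult.assoc mult.commute[of "cor _"] cis_mult)
   also have "... = cor ((2*pi)^DIM('a)*heat_kernel s (y - x))"
    by (rule fourier_gauss(2)[OF s])
   finally show "cnj (u y)*(LBINT p. (?g p*cis (- (p \<bullet> x)))*cis (p \<bullet> y))
    = cor ((2*pi)^DIM('a))*(cnj (u y)*cor (heat_kernel s (y - x)))" by simp
  qed
  also have "... = cor ((2*pi)^DIM('a))*(LBINT y. cnj (u y)*cor (heat_kernel s (y - x)))"
   by (rule integral_mult_right_zero)
  finally show "u x*(LBINT p. (?g p*cnj (?u p))*cis (- (p \<bullet> x)))
   = u x*(cor ((2*pi)^DIM('a))*(LBINT y. cnj (u y)*cor (heat_kernel s (y - x))))" by simp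
 qed
 also have "... = cor ((2*pi)^DIM('a))*(LBINT x. (LBINT z. cor (heat_kernel s z)*(u x*cnj (u (x + z)))))"
 proof -
  have "(LBINT y. cnj (u y)*cor (heat_kernel s (y - x)))
   = (LBINT z. cor (heat_kernel s z)*cnj (u (x + z)))" for x
   using integral_lborel_affine[of 1 "%y. cnj (u y)*cor (heat_kernel s (y - x))" x]
   by (simp add: mult.commute)
  then show ?thesis
   by (subst integral_mult_right_zero[symmetric]) (simp add: mult.left_commute)
 qed
 also have "(LBINT x. (LBINT z. cor (heat_kernel s z)*(u x*cnj (u (x + z)))))
  = (LBINT z. (LBINT x. cor (heat_kernel s z)*(u x*cnj (u (x + z)))))"
 proof (rule lborel_pair.Fubini_integral[symmetric, of "%x z. cor (heat_kernel s z)*(u x*cnj (u (x + z)))"])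
  show "integrable (lborel \<Otimes>\<^sub>M lborel) (%(x, z). cor (heat_kernel s z)*(u x*cnj (u (x + z))))"
  proof (rule integrableI_bounded)
   have "(\<integral>\<^sup>+q. ennreal (norm (case q of (x, z) => cor (heat_kernel s z)*(u x*cnj (u (x + z))))) \<partial>(lborel \<Otimes>\<^sub>M lborel))
    = (\<integral>\<^sup>+x. \<integral>\<^sup>+z. ennreal (norm (cor (heat_kernel s z)*(u x*cnj (u (x + z))))) \<partial>lborel \<partial>lborel)"
    by (subst lborel.nn_integral_fst[symmetric]) auto
   also have "... <= (\<integral>\<^sup>+x. \<integral>\<^sup>+z. ennreal (heat_kernel s (0::'a)*cmod (u x))*ennreal (cmod (u (x + z))) \<partial>lborel \<partial>lborel)"
   proof (intro nn_integral_mono)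
    fix x z :: 'a
    have "norm (cor (heat_kernel s z)*(u x*cnj (u (x + z)))) <= heat_kernel s (0::'a)*(cmod (u x)*cmod (u (x + z)))"
     unfolding norm_mult complex_mod_cnj norm_of_real
     using heat_kernel_nonneg[OF s, of z] heat_kernel_le[OF s, of z] by (intro mult_right_mono) auto
    then show "ennreal (norm (cor (heat_kernel s z)*(u x*cnj (u (x + z)))))
     <= ennreal (heat_kernel s (0::'a)*cmod (u x))*ennreal (cmod (u (x + z)))"
     by (subst ennreal_mult''[symmetric]) (auto intro!: ennreal_leI simp: mult_ac)
   qed
   also have "... = (\<integral>\<^sup>+x. ennreal (heat_kernel s (0::'a)*cmod (u x))*(\<integral>\<^sup>+z. ennreal (cmod (u z)) \<partial>lborel) \<partial>lborel)"
   proof (intro nn_integral_cong)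
    fix x :: 'a
    have "(\<integral>\<^sup>+z. ennreal (cmod (u (x + z))) \<partial>lborel) = (\<integral>\<^sup>+z. ennreal (cmod (u z)) \<partial>lborel)"
     using nn_integral_lborel_affine[of 1 "%z. ennreal (cmod (u z))" x] by simp
    then show "(\<integral>\<^sup>+z. ennreal (heat_kernel s (0::'a)*cmod (u x))*ennreal (cmod (u (x + z))) \<partial>lborel)
     = ennreal (heat_kernel s (0::'a)*cmod (u x))*(\<integral>\<^sup>+z. ennreal (cmod (u z)) \<partial>lborel)"
     by (simp add: nn_integral_cmult)
   qed
   also have "... = ennreal (heat_kernel s (0::'a))*(\<integral>\<^sup>+x. ennreal (cmod (u x)) \<partial>lborel)*(\<integral>\<^sup>+z. ennreal (cmod (u z)) \<partial>lborel)"
    using heat_kernel_nonneg[OF s, of "0::'a"] by (simp add: nn_integral_multc ennreal_mult nn_integral_cmult)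
   also have "... < \<infinity>"
    using u by (simp add: integrable_iff_bounded ennreal_mult_less_top)
   finally show "(\<integral>\<^sup>+q. ennreal (norm (case q of (x, z) => cor (heat_kernel s z)*(u x*cnj (u (x + z))))) \<partial>(lborel \<Otimes>\<^sub>M lborel)) < \<infinity>" .
  qed measurable
 qed
 finally show ?thesis by simp
qed

text \<open>As the damping \<open>e n\<close> tends to 0, the heat kernel concentrates at 0, and the
  autocorrelation \<open>r\<close> tends to the squared norm because translation is continuous in
  L2. Fatou's lemma first shows that the transform is square integrable; dominated convergence then
  identifies its norm.\<close>

theorem plancherel_L1_L2:
 fixes u :: "'a::euclidean_space => complex"
 assumes u: "u : L2" and u1: "integrable lborel u"
 shows "fourier_integral u : L2"
  and "(L2_norm (fourier_integral u))^2 = (2*pi)^DIM('a)*(L2_norm u)^2"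
proof -
 let ?u = "fourier_integral u"
 let ?C = "(LBINT x. cmod (u x))"
 have [measurable]: "u : BM" using u by auto
 have ub: "cmod (?u p) <= ?C" for p by (rule fourier_integral_bound[OF u1])
 define e where "e = (%n. 1/real (Suc n))"
 have e0: "e n > 0" for n by (simp add: e_def)
 have el: "e ----> 0" unfolding e_def by (rule LIMSEQ_Suc) (rule lim_1_over_n)
 define r where "r = (%z. (LBINT x. u x*cnj (u (x + z))))"
 have [measurable]: "r : BM" unfolding r_def by measurable
 have shift: "(%x. u (x + y)) : L2 & L2_norm (%x. u (x + y)) = L2_norm u" for y
  using L2_affine[OF u, of 1 y] by (simp add: add.commute power2_eq_iff_nonneg)
 have r: "r z = L2_inner (%x. u (x + z)) u" for z by (simp add: r_def L2_inner_eq)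
 have rb: "cmod (r z) <= (L2_norm u)^2" for z
  using L2_Cauchy_Schwarz[of "%x. u (x + z)" u] shift[of z] u by (simp add: r power2_eq_square)
 have rlim: "(%n. r (z n)) ----> cor ((L2_norm u)^2)" if "z ----> 0" for z
 proof -
  have "(%n. L2_inner u (%x. u (x + z n))) ----> L2_inner u u"
   by (rule L2_inner_tendsto[OF _ u u L2_translation_continuous[OF u that]]) (use shift in auto)
  then have "(%n. cnj (L2_inner u (%x. u (x + z n)))) ----> cnj (L2_inner u u)"
   by (rule tendsto_cnj)
  then show ?thesis by (simp add: L2_inner_cnj r L2_inner_self del: of_real_power)
 qed
 define A where "A = (%n. (LBINT p. (cmod (?u p))^2*exp (- e n*(norm p)^2)))"
 \<comment> \<open>Replacing \<open>z\<close> by \<open>sqrt (e n)\<close> times \<open>z\<close>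
   fixes the heat kernel at time 1, so that only the bounded factor \<open>r\<close> still depends
   on \<open>n\<close>.\<close>
 have Aeq: "cor (A n) = cor ((2*pi)^DIM('a))*(LBINT z. cor (heat_kernel 1 z)*r (sqrt (e n) *\<^sub>R z))" for n
 proof -
  have "cor (A n) = cor ((2*pi)^DIM('a))*(LBINT z. cor (heat_kernel (e n) z)*r z)"
   unfolding A_def r_def integral_complex_of_real[symmetric] by (rule gauss_autocorrelation[OF u1 e0])
  also have "(LBINT z. cor (heat_kernel (e n) z)*r z)
   = (sqrt (e n)^DIM('a)) *\<^sub>R (LBINT z. cor (heat_kernel (e n) (0 + sqrt (e n) *\<^sub>R z))*r (0 + sqrt (e n) *\<^sub>R z))"
   by (subst integral_lborel_affine[of "sqrt (e n)" _ 0]) (use e0[of n] in auto)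
  also have "... = (LBINT z. cor (sqrt (e n)^DIM('a)*heat_kernel (e n) (sqrt (e n) *\<^sub>R z))*r (sqrt (e n) *\<^sub>R z))"
   by (simp add: scaleR_conv_of_real mult.assoc del: of_real_power flip: integral_mult_right_zero)
  also have "(%z. cor (sqrt (e n)^DIM('a)*heat_kernel (e n) (sqrt (e n) *\<^sub>R z))*r (sqrt (e n) *\<^sub>R z))
   = (%z::'a. cor (heat_kernel 1 z)*r (sqrt (e n) *\<^sub>R z))"
   using e0[of n] by (simp add: heat_kernel_def power_mult_distrib real_sqrt_mult power_divide)
  finally show ?thesis .
 qed
 have hi: "integrable lborel (%z::'a. heat_kernel 1 z)" by (rule integral_heat_kernel) simp
 have "(%n. (LBINT z. cor (heat_kernel 1 z)*r (sqrt (e n) *\<^sub>R z)))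
  ----> (LBINT (z::'a). cor (heat_kernel 1 z)*cor ((L2_norm u)^2))"
 proof (rule integral_dominated_convergence[where w = "%z. heat_kernel 1 z*(L2_norm u)^2"])
  show "AE z in lborel. (%n. cor (heat_kernel 1 z)*r (sqrt (e n) *\<^sub>R z)) ----> cor (heat_kernel 1 z)*cor ((L2_norm u)^2)"
  proof (intro AE_I2 tendsto_mult tendsto_const rlim)
   fix z :: 'a
   have "(%n. sqrt (e n) *\<^sub>R z) ----> sqrt 0 *\<^sub>R z" by (intro tendsto_intros el)
   then show "(%n. sqrt (e n) *\<^sub>R z) ----> 0" by simp
  qed
  show "AE z in lborel. norm (cor (heat_kernel 1 z)*r (sqrt (e n) *\<^sub>R z)) <= heat_kernel 1 z*(L2_norm u)^2" for n
   by (intro AE_I2) (simp add: norm_mult abs_of_nonneg heat_kernel_nonneg mult_left_mono rb)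
 qed (use hi in auto)
 also have "(LBINT (z::'a). cor (heat_kernel 1 z)*cor ((L2_norm u)^2)) = cor ((L2_norm u)^2)"
  using integral_heat_kernel(2)[of 1, where 'a='a] by simp
 finally have "(%n. cor (A n)) ----> cor ((2*pi)^DIM('a))*cor ((L2_norm u)^2)"
  unfolding Aeq by (rule tendsto_mult_left)
 then have Alim: "A ----> (2*pi)^DIM('a)*(L2_norm u)^2"
  unfolding of_real_mult[symmetric] tendsto_of_real_iff .
 have int: "integrable lborel (%p::'a. (cmod (?u p))^2*exp (- e n*(norm p)^2))" for n
 proof (rule bochner_integrable_bound)
  show "integrable lborel (%p::'a. ?C^2*exp (- e n*(norm p)^2))"
   by (intro integrable_mult_right integral_gauss(1) e0)
  show "AE p in lborel. norm ((cmod (?u p))^2*exp (- e n*(norm p)^2)) <= norm (?C^2*exp (- e n*(norm p)^2))"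
   using ub by (auto intro!: mult_right_mono power_mono simp: abs_mult)
 qed measurable
 have plim: "(%n. (cmod (?u p))^2*exp (- e n*(norm p)^2)) ----> (cmod (?u p))\<^sup>2" for p :: 'a
 proof -
  have "(%n. (cmod (?u p))^2*exp (- e n*(norm p)^2)) ----> (cmod (?u p))\<^sup>2*exp (- 0*(norm p)^2)"
   by (intro tendsto_intros el)
  then show ?thesis by simp
 qed
 have "(\<integral>\<^sup>+p. ennreal ((cmod (?u p))^2) \<partial>lborel) = (\<integral>\<^sup>+p. liminf (%n. ennreal ((cmod (?u p))^2*exp (- e n*(norm p)^2))) \<partial>lborel)"
 proof (rule nn_integral_cong)
  fix p :: 'a
  have "(%n. ennreal ((cmod (?u p))^2*exp (- e n*(norm p)^2))) ----> ennreal ((cmod (?u p))^2)"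
   by (rule tendsto_ennrealI[OF plim])
  then show "ennreal ((cmod (?u p))^2) = liminf (%n. ennreal ((cmod (?u p))^2*exp (- e n*(norm p)^2)))"
   by (rule lim_imp_Liminf[OF sequentially_bot, symmetric])
 qed
 also have "... <= liminf (%n. \<integral>\<^sup>+p. ennreal ((cmod (?u p))^2*exp (- e n*(norm p)^2)) \<partial>lborel)"
  by (rule nn_integral_liminf) measurable
 also have "... = liminf (%n. ennreal (A n))"
  unfolding A_def by (subst nn_integral_eq_integral[OF int]) auto
 also have "... = ennreal ((2*pi)^DIM('a)*(L2_norm u)^2)"
  by (rule lim_imp_Liminf[OF sequentially_bot tendsto_ennrealI[OF Alim]])
 finally have fin: "(\<integral>\<^sup>+p. ennreal ((cmod (?u p))^2) \<partial>lborel) < \<infinity>"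
  by (auto simp: less_top[symmetric] top_unique)
 show L: "?u : L2"
  by (rule L2I, measurable, rule integrableI_bounded) (use fin in auto)
 have "A ----> (LBINT p. (cmod (?u p))^2)"
  unfolding A_def
 proof (rule integral_dominated_convergence[where w = "%p. (cmod (?u p))^2"])
  show "AE p in lborel. norm ((cmod (?u p))^2*exp (- e n*(norm p)^2)) <= (cmod (?u p))^2" for n
   using e0[of n] by (intro AE_I2) (simp add: abs_mult mult_left_le)
 qed (use L plim in auto)
 then show "(L2_norm ?u)^2 = (2*pi)^DIM('a)*(L2_norm u)^2"
  using Alim unfolding L2_norm_sq by (rule LIMSEQ_unique)
qed

section \<open>The Plancherel transform on all of L2\<close>

definition truncate_ball :: "real => ('a::euclidean_space => complex) => 'a => complex" where
 "truncate_ball R u x = indicator (cball 0 R) x*u x"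

lemma truncate_ball_L2:
 fixes u :: "'a::euclidean_space => complex"
 assumes u: "u : L2"
 shows "truncate_ball R u : L2" "integrable lborel (truncate_ball R u)"
proof -
 have [measurable]: "u : BM" using u by simp
 have m: "truncate_ball R u : BM" unfolding truncate_ball_def
  by (intro borel_measurable_times borel_measurable_indicator) auto
 show "truncate_ball R u : L2"
  by (rule L2_bound[OF m L2_integrable[OF u]]) (auto simp: truncate_ball_def split: split_indicator)
 have i: "integrable lborel (%x::'a. indicator (cball 0 R) x :: real)"
  by (intro integrable_real_indicator emeasure_lborel_cball_finite) auto
 show "integrable lborel (truncate_ball R u)"
 proof (rule bochner_integrable_bound)
  show "integrable lborel (%x. (cmod (u x))^2 + indicator (cball 0 R) x)"
   using u i by simp
  have "t <= t^2 + 1" for t :: real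
   using sum_squares_ge_zero[of "t - 1/2" 0] by (simp add: power2_eq_square algebra_simps)
  then show "AE x in lborel. norm (truncate_ball R u x) <= norm ((cmod (u x))^2 + indicator (cball 0 R) x)"
   by (auto simp: truncate_ball_def split: split_indicator)
 qed (use m in simp)
qed

lemma truncate_ball_tendsto:
 fixes u :: "'a::euclidean_space => complex"
 assumes u: "u : L2"
 shows "((%R. L2_norm (%x. truncate_ball R u x - u x)) ---> 0) at_top"
proof (rule tendsto_at_topI_sequentially)
 fix X :: "nat => real" assume X: "filterlim X at_top sequentially"
 have [measurable]: "u : BM" using u by simp
 show "(%n. L2_norm (%x. truncate_ball (X n) u x - u x)) ----> 0"
 proof (rule L2_norm_tendsto_0[OF _ L2_integrable[OF u]])
  show "AE x in lborel. (%n. truncate_ball (X n) u x - u x) ----> 0"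
  proof (rule AE_I2)
   fix x :: 'a
   have "\<forall>\<^sub>F n in sequentially. norm x <= X n" using X by (rule filterlim_at_top[THEN iffD1, rule_format])
   then have "\<forall>\<^sub>F n in sequentially. truncate_ball (X n) u x - u x = 0"
    by eventually_elim (simp add: truncate_ball_def)
   then show "(%n. truncate_ball (X n) u x - u x) ----> 0" by (rule tendsto_eventually)
  qed
 qed (use truncate_ball_L2[OF u] in \<open>measurable, auto simp: truncate_ball_def split: split_indicator\<close>)
qed

lemma fourier_truncate_L2:
 assumes "u : L2" shows "fourier_integral (truncate_ball R u) : L2"
 by (rule plancherel_L1_L2(1)) (use truncate_ball_L2[OF assms] in auto)

lemma plancherel_transform_iff:
 "plancherel_transform u v \<longleftrightarrow> u : L2 & v : L2 &
  ((%R. L2_norm (%p. fourier_integral (truncate_ball R u) p - v p)) ---> 0) at_top"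
proof -
 have "((%R. \<integral>\<^sup>+p. ennreal ((cmod (v p - fourier_integral (%x. indicator (cball 0 R) x*u x) p))^2) \<partial>lborel) ---> 0) at_top
  \<longleftrightarrow> ((%R. L2_norm (%p. fourier_integral (truncate_ball R u) p - v p)) ---> 0) at_top" (is "?l \<longleftrightarrow> ?r")
  if u: "u : L2" and v: "v : L2"
 proof -
  have "(\<integral>\<^sup>+p. ennreal ((cmod (v p - fourier_integral (%x. indicator (cball 0 R) x*u x) p))^2) \<partial>lborel)
   = ennreal ((L2_norm (%p. fourier_integral (truncate_ball R u) p - v p))^2)" for R
   using fourier_truncate_L2[OF u, of R] v
   by (subst L2_norm_minus_commute, subst nn_integral_L2_norm[symmetric]) (auto simp: truncate_ball_def[abs_def])
  then have "?l \<longleftrightarrow> ((%R. ennreal ((L2_norm (%p. fourier_integral (truncate_ball R u) p - v p))^2)) ---> ennreal 0) at_top"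
   by simp
  also have "... \<longleftrightarrow> ((%R. (L2_norm (%p. fourier_integral (truncate_ball R u) p - v p))^2) ---> 0) at_top"
   by (rule tendsto_ennreal_iff) auto
  also have "... \<longleftrightarrow> ?r"
  proof
   assume "((%R. (L2_norm (%p. fourier_integral (truncate_ball R u) p - v p))^2) ---> 0) at_top"
   then show ?r using tendsto_real_sqrt by fastforce
  next
   assume ?r then show "((%R. (L2_norm (%p. fourier_integral (truncate_ball R u) p - v p))^2) ---> 0) at_top"
    using tendsto_power by fastforce
  qed
  finally show ?thesis .
 qed
 then show ?thesis unfolding plancherel_transform_def by blast
qed

lemma plancherel_transform_norm:
 assumes uv: "plancherel_transform u (v :: 'a::euclidean_space => complex)"
 shows "(L2_norm v)^2 = (2*pi)^DIM('a)*(L2_norm u)^2"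
proof -
 have u: "u : L2" and v: "v : L2" and
  l: "((%R. L2_norm (%p. fourier_integral (truncate_ball R u) p - v p)) ---> 0) at_top"
  using uv by (auto simp: plancherel_transform_iff)
 have "((%R. L2_norm (fourier_integral (truncate_ball R u))) ---> L2_norm v) at_top"
  by (rule L2_norm_tendsto[OF fourier_truncate_L2[OF u] v l])
 then have "((%R. (L2_norm (fourier_integral (truncate_ball R u)))^2) ---> (L2_norm v)\<^sup>2) at_top"
  by (rule tendsto_power)
 moreover have "((%R. L2_norm (truncate_ball R u)) ---> L2_norm u) at_top"
  by (rule L2_norm_tendsto[OF truncate_ball_L2(1)[OF u] u truncate_ball_tendsto[OF u]])
 then have "((%R. (2*pi)^DIM('a)*(L2_norm (truncate_ball R u))^2) ---> (2*pi)^DIM('a)*(L2_norm u)^2) at_top"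
  by (intro tendsto_mult_left tendsto_power)
 ultimately show ?thesis
  unfolding plancherel_L1_L2(2)[OF truncate_ball_L2[OF u]]
  by (rule tendsto_unique[OF trivial_limit_at_top_linorder])
qed

lemma plancherel_transform_lincomb:
 assumes "plancherel_transform u u'" "plancherel_transform v v'"
 shows "plancherel_transform (%x. u x + c * v x) (%x. u' x + c * v' x)"
proof -
 have L: "u : L2" "u' : L2" "v : L2" "v' : L2" and
  l: "((%R. L2_norm (%p. fourier_integral (truncate_ball R u) p - u' p)) ---> 0) at_top"
  "((%R. L2_norm (%p. fourier_integral (truncate_ball R v) p - v' p)) ---> 0) at_top"
  using assms by (auto simp: plancherel_transform_iff)
 have eq: "fourier_integral (truncate_ball R (%x. u x + c * v x)) p
  = fourier_integral (truncate_ball R u) p + c*fourier_integral (truncate_ball R v) p" for R p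
 proof -
  have "truncate_ball R (%x. u x + c * v x) = (%x. truncate_ball R u x + c*truncate_ball R v x)"
   by (auto simp: truncate_ball_def algebra_simps)
  then show ?thesis
   using fourier_integral_add[OF truncate_ball_L2(2)[OF L(1)] integrable_mult_right[OF truncate_ball_L2(2)[OF L(3)]], of R c R p]
   by (simp add: fourier_integral_cmult)
 qed
 have "((%R. L2_norm (%p. fourier_integral (truncate_ball R (%x. u x + c * v x)) p - (u' p + c * v' p))) ---> 0) at_top"
 proof (rule tendsto_sandwich[OF _ _ tendsto_const])
  show "\<forall>\<^sub>F R in at_top. L2_norm (%p. fourier_integral (truncate_ball R (%x. u x + c * v x)) p - (u' p + c * v' p))
   <= L2_norm (%p. fourier_integral (truncate_ball R u) p - u' p) + cmod c*L2_norm (%p. fourier_integral (truncate_ball R v) p - v' p)"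
  proof (rule always_eventually, rule allI)
   fix R
   have "L2_norm (%p. (fourier_integral (truncate_ball R u) p - u' p) + c*(fourier_integral (truncate_ball R v) p - v' p))
    <= L2_norm (%p. fourier_integral (truncate_ball R u) p - u' p) + L2_norm (%p. c*(fourier_integral (truncate_ball R v) p - v' p))"
    by (rule L2_norm_triangle) (intro L2_diff L2_cmult fourier_truncate_L2 L)+
   then show "L2_norm (%p. fourier_integral (truncate_ball R (%x. u x + c * v x)) p - (u' p + c * v' p))
   <= L2_norm (%p. fourier_integral (truncate_ball R u) p - u' p) + cmod c*L2_norm (%p. fourier_integral (truncate_ball R v) p - v' p)"
    unfolding L2_norm_cmult by (simp add: eq add_diff_add right_diff_distrib)
  qed
  show "((%R. L2_norm (%p. fourier_integral (truncate_ball R u) p - u' p) + cmod c*L2_norm (%p. fourier_integral (truncate_ball R v) p - v' p)) ---> 0) at_top"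
   using tendsto_add[OF l(1) tendsto_mult_left[OF l(2), of "cmod c"]] by simp
 qed auto
 then show ?thesis using L by (simp add: plancherel_transform_iff)
qed

text \<open>Polarization: the norm identity for \<open>u + c v\<close> yields the real part of
  \<open>c\<close> times the inner product, and \<open>c = 1\<close>, \<open>c = \<i>\<close>
  recover both parts.\<close>

theorem plancherel_transform_inner:
 assumes u: "plancherel_transform u (u' :: 'a::euclidean_space => complex)" and v: "plancherel_transform v v'"
 shows "L2_inner u' v' = cor ((2*pi)^DIM('a))*L2_inner u v"
proof -
 let ?c = "(2*pi)^DIM('a)"
 have L: "u : L2" "u' : L2" "v : L2" "v' : L2"
  using u v by (auto simp: plancherel_transform_iff)
 have R: "Re (c*L2_inner u' v') = ?c*Re (c*L2_inner u v)" for c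
 proof -
  have "(L2_norm (%x. u' x + c * v' x))^2 = ?c*(L2_norm (%x. u x + c * v x))^2"
   by (rule plancherel_transform_norm[OF plancherel_transform_lincomb[OF u v]])
  then show ?thesis
   using plancherel_transform_norm[OF u] plancherel_transform_norm[OF v]
    L L2_norm_add_sq[of u' "%x. c * v' x"] L2_norm_add_sq[of u "%x. c * v x"]
   by (simp add: L2_inner_cmult_right L2_norm_cmult power_mult_distrib algebra_simps)
 qed
 show ?thesis
 proof (rule complex_eqI)
  show "Re (L2_inner u' v') = Re (cor ?c*L2_inner u v)" using R[of 1] by simp
  show "Im (L2_inner u' v') = Im (cor ?c*L2_inner u v)" using R[of "\<i>"] by simp
 qed
qed

lemma plancherel_transform_cong:
 assumes "plancherel_transform u v" "v' : BM" "AE x in lborel. v x = v' x"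
 shows "plancherel_transform u v'"
proof -
 have v: "u : L2" "v : L2" using assms by (auto simp: plancherel_transform_iff)
 have "L2_norm (%p. fourier_integral (truncate_ball R u) p - v' p) = L2_norm (%p. fourier_integral (truncate_ball R u) p - v p)" for R
 proof (rule L2_norm_cong_AE)
  have [measurable]: "fourier_integral (truncate_ball R u) : BM" "v : BM"
   using fourier_truncate_L2[OF v(1)] v by auto
  show "(%p. fourier_integral (truncate_ball R u) p - v' p) : BM"
   "(%p. fourier_integral (truncate_ball R u) p - v p) : BM"
   using assms(2) by measurable
  show "AE p in lborel. fourier_integral (truncate_ball R u) p - v' p = fourier_integral (truncate_ball R u) p - v p"
   using assms(3) by eventually_elim simp
 qed
 then show ?thesis
  using assms(1) L2_cong_AE[OF v(2) assms(2,3)] by (simp add: plancherel_transform_iff)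
qed

lemma plancherel_transform_compact:
 assumes u: "u : L2" and supp: "!!x. norm x > R0 ==> u x = 0"
 shows "plancherel_transform u (fourier_integral u)"
proof -
 have eq: "truncate_ball R u = u" if "R >= R0" for R
 proof
  fix x show "truncate_ball R u x = u x"
   using supp[of x] that by (cases "norm x <= R") (auto simp: truncate_ball_def indicator_def)
 qed
 have "\<forall>\<^sub>F R in at_top. L2_norm (%p. fourier_integral (truncate_ball R u) p - fourier_integral u p) = 0"
  using eventually_ge_at_top[of R0] by eventually_elim (simp add: eq L2_norm_def)
 then show ?thesis
  using fourier_truncate_L2[OF u, of R0] u by (simp add: plancherel_transform_iff eq tendsto_eventually)
qed

text \<open>Surjectivity is used for integrable \<open>v\<close>, where the inverse Fourier integral
  \<open>w\<close> can be written down. For each truncation of \<open>w\<close> the squared error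
  equals \<open>|v|^2 - (2 pi)^d |truncated w|^2\<close> exactly, by Fubini and the L1 identity; it
  tends to 0 because \<open>w\<close> has the matching norm.\<close>

theorem plancherel_transform_inverse:
 fixes v :: "'a::euclidean_space => complex"
 assumes v: "v : L2" and v1: "integrable lborel v"
 shows "EX w. plancherel_transform w v"
proof -
 let ?c = "(2*pi)^DIM('a)"
 define w where "w = (%x. cor (1/?c)*fourier_integral v (0 + (- 1) *\<^sub>R x))"
 have F: "fourier_integral v : L2" "(L2_norm (fourier_integral v))^2 = ?c*(L2_norm v)^2"
  using plancherel_L1_L2[OF v v1] by auto
 have w: "w : L2" unfolding w_def by (rule L2_cmult, rule L2_affine(1)[OF F(1)]) simp
 have [measurable]: "w : BM" "v : BM" using w v by auto
 have "(L2_norm w)^2 = (1/?c)^2*(L2_norm (fourier_integral v))^2"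
  using L2_affine(2)[OF F(1), of "-1" 0] unfolding w_def L2_norm_cmult norm_of_real by (simp add: power_mult_distrib power_divide)
 then have nw: "?c*(L2_norm w)^2 = (L2_norm v)^2"
  unfolding F(2) by (simp add: power2_eq_square)
 have key: "(L2_norm (%p. fourier_integral (truncate_ball R w) p - v p))^2 = (L2_norm v)^2 - ?c*(L2_norm (truncate_ball R w))^2" for R
 proof -
  let ?w = "truncate_ball R w"
  have wi: "?w : L2" "integrable lborel ?w" using truncate_ball_L2[OF w] by auto
  have vi: "integrable lborel (%p. cnj (v p))" using v1 by simp
  have wx: "(LBINT p. cnj (v p)*cis (- (p \<bullet> x))) = cor ?c*cnj (w x)" for x
  proof -
   have "cor ?c*cnj (w x) = cnj (LBINT p. cis (x \<bullet> p) * v p)"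
    by (simp add: w_def fourier_integral_def)
   also have "... = (LBINT p. cnj (v p)*cis (- (p \<bullet> x)))"
    unfolding bochner_integral_cnj[symmetric] by (simp add: cis_cnj mult.commute inner_commute)
   finally show ?thesis by simp
  qed
  have "L2_inner v (fourier_integral ?w) = (LBINT p. cnj (v p)*(LBINT x. ?w x*cis (- (p \<bullet> x))))"
   unfolding L2_inner_def fourier_integral_def by (simp add: mult.commute)
  also have "... = (LBINT x. ?w x*(LBINT p. cnj (v p)*cis (- (p \<bullet> x))))"
   using fubini_prod_bounded[OF vi wi(2), of "%z. cis (- (fst z \<bullet> snd z))" 1] by simp
  also have "... = (LBINT x. cor ?c*(cnj (?w x)*?w x))"
   unfolding wx by (intro bochner_integral_cong refl) (auto simp: truncate_ball_def split: split_indicator)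
  also have "... = cor ?c*L2_inner ?w ?w"
   by (simp add: L2_inner_def)
  finally have "L2_inner v (fourier_integral ?w) = cor (?c*(L2_norm ?w)^2)"
   by (simp add: L2_inner_self)
  moreover have "(L2_norm (fourier_integral ?w))^2 = ?c*(L2_norm ?w)^2"
   by (rule plancherel_L1_L2(2)[OF wi])
  ultimately show ?thesis
   using L2_norm_diff_sq[OF v plancherel_L1_L2(1)[OF wi]]
   by (subst L2_norm_minus_commute) (simp del: of_real_mult of_real_power)
 qed
 have "((%R. L2_norm (truncate_ball R w)) ---> L2_norm w) at_top"
  by (rule L2_norm_tendsto[OF truncate_ball_L2(1)[OF w] w truncate_ball_tendsto[OF w]])
 then have "((%R. sqrt ((L2_norm v)^2 - ?c*(L2_norm (truncate_ball R w))^2)) ---> sqrt ((L2_norm v)^2 - ?c*(L2_norm w)^2)) at_top"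
  by (intro tendsto_intros)
 then have "((%R. L2_norm (%p. fourier_integral (truncate_ball R w) p - v p)) ---> 0) at_top"
  unfolding key[symmetric] nw by simp
 then show ?thesis using w v by (auto simp: plancherel_transform_iff)
qed

section \<open>The Bose kernel\<close>

definition bose_density :: "real => 'a::euclidean_space => real" where
 "bose_density \<beta> p = 1/(exp (\<beta>*(norm p)^2) - 1)"

text \<open>The convolution kernel of
  \<open>e^{\<beta>\<Delta>} (1 - e^{\<beta>\<Delta>})^{-1}\<close>, expanded in a geometric series
  of heat semigroups; on the Fourier side it is \<open>bose_density\<close>.\<close>

definition bose_kernel :: "real => 'a::euclidean_space => real" where
 "bose_kernel \<beta> x = (\<Sum>k. heat_kernel (\<beta>*real (Suc k)) x)"

text \<open>The terms decay like \<open>k^(- d/2)\<close>, and \<open>d > 2\<close> means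
  \<open>d >= 3\<close>, for which the exponent \<open>- 3/2\<close> suffices. This is the
  finiteness of the critical density.\<close>

lemma summable_heat_kernel_0:
 assumes \<beta>: "\<beta> > 0" and d: "DIM('a::euclidean_space) > 2"
 shows "summable (%k. heat_kernel (\<beta>*real (Suc k)) (0::'a))"
proof -
 have "summable (%n. real n powr (- 3/2))" by (subst summable_real_powr_iff) simp
 then have "summable (%k. real (Suc k) powr (- 3/2))" by (subst summable_Suc_iff)
 then have "summable (%k. (1/sqrt (4*pi*\<beta>))^DIM('a)*real (Suc k) powr (- 3/2))"
  by (rule summable_mult)
 then show ?thesis
 proof (rule summable_comparison_test'[where N = 0])
  fix k
  have "1/sqrt (4*pi*(\<beta>*real (Suc k))) = 1/sqrt (4*pi*\<beta>)*(1/sqrt (real (Suc k)))"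
   by (simp add: real_sqrt_mult del: of_nat_Suc)
  then have "norm (heat_kernel (\<beta>*real (Suc k)) (0::'a)) = (1/sqrt (4*pi*\<beta>))^DIM('a)*(1/sqrt (real (Suc k)))^DIM('a)"
   using \<beta> by (simp only: heat_kernel_def power_mult_distrib) (simp add: abs_mult del: of_nat_Suc)
  also have "(1/sqrt (real (Suc k)))^DIM('a) <= (1/sqrt (real (Suc k)))^3"
   using d by (intro power_decreasing) (auto simp del: of_nat_Suc)
  also have "(1/sqrt (real (Suc k)))^3 = real (Suc k) powr (- 3/2)"
   by (simp add: powr_half_sqrt[symmetric] powr_powr powr_minus_divide powr_realpow[symmetric] power_divide del: of_nat_Suc)
  finally show "norm (heat_kernel (\<beta>*real (Suc k)) (0::'a)) <= (1/sqrt (4*pi*\<beta>))^DIM('a)*real (Suc k) powr (- 3/2)"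
   using \<beta> by (simp add: mult_left_mono del: of_nat_Suc)
 qed
qed

context
 fixes \<beta> :: real
 assumes \<beta>: "\<beta> > 0" and d: "DIM('a::euclidean_space) > 2"
begin

lemma summable_heat_kernel: "summable (%k. heat_kernel (\<beta>*real (Suc k)) (x::'a))"
proof (rule summable_comparison_test'[OF summable_heat_kernel_0[OF \<beta> d], where N = 0])
 fix n
 have "\<beta>*real (Suc n) > 0" using \<beta> by simp
 then show "norm (heat_kernel (\<beta>*real (Suc n)) x) <= heat_kernel (\<beta>*real (Suc n)) (0::'a)"
  by (simp add: heat_kernel_nonneg heat_kernel_le del: of_nat_Suc)
qed

lemma bose_kernel_nonneg: "0 <= bose_kernel \<beta> (x::'a)"
 unfolding bose_kernel_def by (intro suminf_nonneg summable_heat_kernel heat_kernel_nonneg) (use \<beta> in auto)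

lemma bose_kernel_le: "bose_kernel \<beta> (x::'a) <= bose_kernel \<beta> (0::'a)"
 unfolding bose_kernel_def by (intro suminf_le summable_heat_kernel heat_kernel_le) (use \<beta> in auto)

lemma bose_density_sums:
 assumes "(p::'a) ~= 0" shows "(%k. exp (- (\<beta>*real (Suc k))*(norm p)^2)) sums bose_density \<beta> p"
proof -
 let ?q = "exp (- \<beta>*(norm p)^2)"
 have q: "norm ?q < 1" using assms \<beta> by simp
 have "(%k. ?q*?q^k) sums (?q*(1/(1 - ?q)))"
  by (intro sums_mult geometric_sums q)
 moreover have "?q*?q^k = exp (- (\<beta>*real (Suc k))*(norm p)^2)" for k
  by (simp add: exp_of_nat_mult[symmetric] exp_add[symmetric] algebra_simps)
 moreover have "?q*(1/(1 - ?q)) = bose_density \<beta> p"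
  using q by (simp add: bose_density_def exp_minus field_simps)
 ultimately show ?thesis by simp
qed

lemma bose_density_nonneg: "0 <= bose_density \<beta> (p::'a)"
 using \<beta> by (simp add: bose_density_def)

lemma heat_kernel_0_gauss: "s > 0 ==> (LBINT (p::'a). exp (- s*(norm p)^2)) = (2*pi)^DIM('a)*heat_kernel s (0::'a)"
proof -
 assume s: "s > 0"
 have "cor (LBINT (p::'a). exp (- s*(norm p)^2)) = cor ((2*pi)^DIM('a)*heat_kernel s (0::'a))"
  using fourier_gauss(2)[OF s, of "0::'a"] by simp
 then show ?thesis unfolding of_real_eq_iff .
qed

text \<open>The geometric series for \<open>bose_density\<close> is integrated term by term against
  the wave, away from the null set \<open>p = 0\<close>. The absolute values integrate to multiples
  of heat kernels at 0, which are summable.\<close>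

lemma fourier_bose_density:
 shows "integrable lborel (%p::'a. bose_density \<beta> p)"
  and "(LBINT p. cis (x \<bullet> p)*cor (bose_density \<beta> p)) = cor ((2*pi)^DIM('a)*bose_kernel \<beta> (x::'a))"
proof -
 let ?s = "%k. \<beta>*real (Suc k)"
 let ?f = "%x k p. cis (x \<bullet> p)*cor (exp (- ?s k*(norm p)^2))"
 have s: "?s k > 0" for k using \<beta> by simp
 have i: "integrable lborel (?f x k)" for k x by (rule fourier_gauss(1)[OF s])
 have AE: "AE p in lborel. p ~= (0::'a)" by (rule AE_lborel_singleton)
 have sm: "AE p in lborel. summable (%k. norm (?f x k p))" for x :: 'a
  using AE by eventually_elim (use sums_summable[OF bose_density_sums] in \<open>auto simp: norm_mult\<close>)
 have "(LBINT p. norm (?f x k p)) = (2*pi)^DIM('a)*heat_kernel (?s k) (0::'a)" for k and x :: 'a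
  using heat_kernel_0_gauss[OF s] by (simp add: norm_mult)
 then have sn: "summable (%k. (LBINT p. norm (?f x k p)))" for x :: 'a
  by (simp add: summable_mult summable_heat_kernel_0[OF \<beta> d] del: of_nat_Suc)
 have eq: "AE p in lborel. (\<Sum>k. ?f x k p) = cis (x \<bullet> p)*cor (bose_density \<beta> p)" for x :: 'a
  using AE
 proof eventually_elim
  case (elim p)
  have "(%k. cor (exp (- ?s k*(norm p)^2))) sums cor (bose_density \<beta> p)"
   by (rule sums_of_real[OF bose_density_sums[OF elim]])
  then show ?case using sums_unique[OF sums_mult] by metis
 qed
 have [measurable]: "(%p::'a. bose_density \<beta> p) : BM" unfolding bose_density_def by measurable
 have m: "(%p. \<Sum>k. ?f x k p) : borel_measurable lborel" for x :: 'a
  using integrable_suminf[OF i sm sn] by auto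
 have "integrable lborel (%p::'a. cis (x \<bullet> p)*cor (bose_density \<beta> p))" for x
  using integrable_suminf[OF i sm sn, of x] integrable_cong_AE[OF m _ eq, of x] by simp
 from this[of 0] show "integrable lborel (%p::'a. bose_density \<beta> p)"
  by (simp add: complex_of_real_integrable_eq)
 have "(LBINT p. cis (x \<bullet> p)*cor (bose_density \<beta> p)) = (LBINT p. (\<Sum>k. ?f x k p))"
  by (rule integral_cong_AE[OF _ m]) (use eq[of x] in \<open>auto elim: eventually_mono\<close>)
 also have "... = (\<Sum>k. (LBINT p. ?f x k p))"
  by (rule integral_suminf[OF i sm sn])
 also have "... = (\<Sum>k. cor ((2*pi)^DIM('a)*heat_kernel (?s k) x))"
  by (intro suminf_cong fourier_gauss(2) s)
 also have "... = cor (\<Sum>k. (2*pi)^DIM('a)*heat_kernel (?s k) x)"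
  by (rule suminf_of_real[symmetric]) (intro summable_mult summable_heat_kernel)
 also have "(\<Sum>k. (2*pi)^DIM('a)*heat_kernel (?s k) x) = (2*pi)^DIM('a)*bose_kernel \<beta> x"
  unfolding bose_kernel_def by (rule suminf_mult[OF summable_heat_kernel])
 finally show "(LBINT p. cis (x \<bullet> p)*cor (bose_density \<beta> p)) = cor ((2*pi)^DIM('a)*bose_kernel \<beta> x)" .
qed

lemma critical_density_eq: "critical_density TYPE('a) \<beta> = bose_kernel \<beta> (0::'a)"
proof -
 have "cor (LBINT p. bose_density \<beta> (p::'a)) = cor ((2*pi)^DIM('a)*bose_kernel \<beta> (0::'a))"
  using fourier_bose_density(2)[of 0] by simp
 then show ?thesis unfolding of_real_eq_iff by (simp add: critical_density_def bose_density_def[abs_def])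
qed

end

lemma bose_kernel_minus [simp]: "bose_kernel \<beta> (- x) = bose_kernel \<beta> x"
 by (simp add: bose_kernel_def)

lemma bose_kernel_measurable [measurable]: "bose_kernel \<beta> : BM"
 unfolding bose_kernel_def by measurable

lemma bose_density_measurable [measurable]: "bose_density \<beta> : BM"
 unfolding bose_density_def by measurable

section \<open>Test functions and the integral operator\<close>

lemma test_functionsE:
 fixes h :: "'a::euclidean_space => real"
 assumes "h : test_functions"
 obtains R H where "R > 0" "H > 0" "!!x. h x <= H" "!!x. norm x > R ==> h x = 0"
proof -
 have "bounded (range h)" using assms by (simp add: test_functions_def)
 then obtain H where H: "!!x. norm (h x) <= H" unfolding bounded_iff by auto
 have "bounded {x. h x ~= 0}"
  using assms unfolding test_functions_def by (auto intro: bounded_subset compact_imp_bounded closure_subset)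
 then obtain R where R: "!!x. h x ~= 0 ==> norm x <= R" unfolding bounded_iff by auto
 show thesis
 proof (rule that[of "max R 1" "max H 1"])
  show "h x <= max H 1" for x using H[of x] by simp
  show "h x = 0" if "norm x > max R 1" for x using R[of x] that by force
 qed auto
qed

lemma test_functions_measurable [measurable_dest]: "h : test_functions ==> h : BM"
 and test_functions_nonneg: "h : test_functions ==> 0 <= h x"
 by (auto simp: test_functions_def)

lemma test_functionsI:
 assumes "h : BM" "!!x. 0 <= h x" "!!x. h x <= H" "!!x. norm x > R ==> h x = 0"
 shows "h : test_functions"
proof -
 have "bounded (range h)" using assms by (auto simp: bounded_iff intro!: exI[of _ H])
 moreover have "bounded {x. h x ~= 0}" using assms(4) by (auto simp: bounded_iff intro!: exI[of _ R] simp flip: not_less)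
 ultimately show ?thesis using assms by (simp add: test_functions_def compact_closure)
qed

lemma integrable_bounded_ball:
 fixes u :: "'a::euclidean_space => 'b::{banach, second_countable_topology}"
 assumes [measurable]: "u : BM" and "!!x. norm (u x) <= C" "!!x. norm x > R ==> u x = 0"
 shows "integrable lborel u"
proof (rule bochner_integrable_bound)
 show "integrable lborel (%x::'a. indicator (cball 0 R) x*C :: real)"
  by (intro integrable_mult_left integrable_real_indicator emeasure_lborel_cball_finite) auto
 have C: "0 <= C" using assms(2) norm_ge_zero order_trans by blast
 show "AE x in lborel. norm (u x) <= norm (indicator (cball 0 R) x*C :: real)"
 proof (rule AE_I2)
  fix x :: 'a
  show "norm (u x) <= norm (indicator (cball 0 R) x*C :: real)"
   using assms(2)[of x] assms(3)[of x] C by (cases "norm x <= R") (auto simp: indicator_def)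
 qed
qed auto

lemma test_functions_integrable:
 assumes "h : test_functions" shows "integrable lborel h"
proof -
 from assms obtain R H where "R > 0" "H > 0" "!!x. h x <= H" "!!x. norm x > R ==> h x = 0"
  by (rule test_functionsE) blast
 then show ?thesis
  using assms test_functions_nonneg[OF assms] by (intro integrable_bounded_ball[of _ H R]) (auto simp: test_functions_def)
qed

lemma sqrt_test_functions_L2:
 assumes h: "h : test_functions" and v: "v : L2"
 shows "(%x. cor (sqrt (h x)) * v x) : L2"
  and "integrable lborel (%x. cor (sqrt (h x)) * v x)"
proof -
 from h obtain R H where RH: "R > 0" "H > 0" "!!x. h x <= H" "!!x. norm x > R ==> h x = 0"
  by (rule test_functionsE) blast
 have [measurable]: "h : BM" using h by (simp add: test_functions_def)
 show L: "(%x. cor (sqrt (h x)) * v x) : L2"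
  by (rule L2_bounded_mult[OF v, of _ "sqrt H"], measurable) (use RH test_functions_nonneg[OF h] in auto)
 have "truncate_ball R (%x. cor (sqrt (h x)) * v x) = (%x. cor (sqrt (h x)) * v x)"
  using RH(4) by (auto simp: truncate_ball_def fun_eq_iff split: split_indicator)
 then show "integrable lborel (%x. cor (sqrt (h x)) * v x)"
  using truncate_ball_L2(2)[OF L, of R] by simp
qed

lemma sqrt_test_function_in_L2:
 assumes h: "h : test_functions"
 shows "(%x. cor (sqrt (h x))) : L2"
proof (rule L2I)
 show "integrable lborel (%x. (cmod (cor (sqrt (h x))))^2)"
  using test_functions_integrable[OF h] test_functions_nonneg[OF h] by simp
qed (use h in \<open>auto simp: test_functions_def\<close>)

lemma one_minus_exp_test:
 assumes g: "g : test_functions" shows "(%x. 1 - exp (- g x)) : test_functions"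
proof -
 from g obtain R H where RH: "R > 0" "H > 0" "!!x. g x <= H" "!!x. norm x > R ==> g x = 0"
  by (rule test_functionsE) blast
 show ?thesis
  by (rule test_functionsI[of _ 1 R]) (use g RH in \<open>auto simp: test_functions_def\<close>)
qed

text \<open>The concrete candidate for \<open>K_f\<close> when \<open>h = 1 - e^{-f}\<close>; unlike
  \<open>K_op\<close>, its values are given pointwise and not by choice.\<close>

definition kernel_op :: "real => ('a::euclidean_space => real) => ('a => complex) => 'a => complex" where
 "kernel_op \<beta> h v y = cor (sqrt (h y)) *
  (LBINT x. (cor (sqrt (h x)) * v x)*cor (bose_kernel \<beta> (y - x)))"

lemma kernel_op_measurable [measurable]:
 assumes [measurable]: "h : BM" "v : BM"
 shows "kernel_op \<beta> h v : BM"
 unfolding kernel_op_def[abs_def] by measurable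

context
 fixes \<beta> :: real and h :: "'a::euclidean_space => real"
 assumes \<beta>: "\<beta> > 0" and d: "DIM('a) > 2" and h: "h : test_functions"
begin

lemma kernel_op_bound:
 assumes v: "v : L2"
 shows "cmod (LBINT x. (cor (sqrt (h x)) * v x)*cor (bose_kernel \<beta> (y - x)))
  <= bose_kernel \<beta> (0::'a) * sqrt (LBINT x. h x)*L2_norm v"
proof -
 have [measurable]: "h : BM" "v : BM" using h v by auto
 note i = sqrt_test_functions_L2[OF h v]
 have G: "\<bar>bose_kernel \<beta> z\<bar> <= bose_kernel \<beta> (0::'a)" for z :: 'a
  using bose_kernel_nonneg[OF \<beta> d, of z] bose_kernel_le[OF \<beta> d, of z] by simp
 have "cmod (LBINT x. (cor (sqrt (h x)) * v x)*cor (bose_kernel \<beta> (y - x)))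
  <= (LBINT x. cmod (cor (sqrt (h x)) * v x)*bose_kernel \<beta> (0::'a))"
 proof (rule order_trans[OF integral_norm_bound integral_mono])
  have bi: "integrable lborel (%x. cmod (cor (sqrt (h x)) * v x)*bose_kernel \<beta> (0::'a))"
   by (rule integrable_mult_left[OF integrable_norm[OF i(2)]])
  show "integrable lborel (%x. cmod (cor (sqrt (h x)) * v x)*bose_kernel \<beta> (0::'a))" by (rule bi)
  have le: "norm (cor (sqrt (h x)) * v x*cor (bose_kernel \<beta> (y - x)))
   <= cmod (cor (sqrt (h x)) * v x)*bose_kernel \<beta> (0::'a)" for x
   unfolding norm_mult[of "_*_"] norm_of_real by (intro mult_left_mono G) auto
  then show "norm (cor (sqrt (h x)) * v x*cor (bose_kernel \<beta> (y - x)))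
   <= cmod (cor (sqrt (h x)) * v x)*bose_kernel \<beta> (0::'a)" for x .
  show "integrable lborel (%x. norm (cor (sqrt (h x)) * v x*cor (bose_kernel \<beta> (y - x))))"
   by (rule bochner_integrable_bound[OF bi]) (measurable, use le in \<open>simp add: abs_of_nonneg bose_kernel_nonneg[OF \<beta> d]\<close>)
 qed
 also have "... = bose_kernel \<beta> (0::'a)*(LBINT x. cmod (cor (sqrt (h x)) * v x))"
  by (simp add: mult.commute)
 also have "(LBINT x. cmod (cor (sqrt (h x)) * v x)) <= sqrt (LBINT x. h x)*L2_norm v"
 proof -
  let ?v = "%x. cor (cmod (v x))"
  have vL: "?v : L2" by (rule L2I) (use v in auto)
  have "cor (LBINT x. cmod (cor (sqrt (h x)) * v x)) = L2_inner (%x. cor (sqrt (h x))) ?v"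
   unfolding L2_inner_def integral_complex_of_real[symmetric]
   using test_functions_nonneg[OF h] by (simp add: norm_mult)
  then have "\<bar>(LBINT x. cmod (cor (sqrt (h x)) * v x))\<bar> = cmod (L2_inner (%x. cor (sqrt (h x))) ?v)"
   by (metis norm_of_real)
  also have "... <= L2_norm (%x. cor (sqrt (h x)))*L2_norm ?v"
   by (rule L2_Cauchy_Schwarz[OF sqrt_test_function_in_L2[OF h] vL])
  also have "... = sqrt (LBINT x. h x)*L2_norm v"
   using test_functions_nonneg[OF h] by (simp add: L2_norm_def)
  finally show ?thesis by simp
 qed
 finally show ?thesis using bose_kernel_nonneg[OF \<beta> d, of 0] by (simp add: mult_left_mono mult.assoc)
qed

lemma kernel_op_L2:
 assumes v: "v : L2"
 shows "kernel_op \<beta> h v : L2"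
  and "L2_norm (kernel_op \<beta> h v) <= bose_kernel \<beta> (0::'a)*(LBINT x. h x)*L2_norm v"
proof -
 have [measurable]: "h : BM" "v : BM" using h v by auto
 define C where "C = bose_kernel \<beta> (0::'a) * sqrt (LBINT x. h x)*L2_norm v"
 have C: "C >= 0" using bose_kernel_nonneg[OF \<beta> d, of 0] test_functions_nonneg[OF h]
  by (simp add: C_def)
 have b: "(cmod (kernel_op \<beta> h v y))^2 <= C^2*h y" for y
 proof -
  have "(cmod (kernel_op \<beta> h v y))^2 = h y*(cmod (LBINT x. (cor (sqrt (h x)) * v x)*cor (bose_kernel \<beta> (y - x))))^2"
   using test_functions_nonneg[OF h] by (simp add: kernel_op_def norm_mult power_mult_distrib)
  also have "... <= h y*C^2"
   using kernel_op_bound[OF v, of y] test_functions_nonneg[OF h, of y]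
   by (intro mult_left_mono power_mono) (auto simp: C_def)
  finally show ?thesis by (simp add: mult.commute)
 qed
 have i: "integrable lborel (%y. C^2*h y)" using test_functions_integrable[OF h] by simp
 show L: "kernel_op \<beta> h v : L2" by (rule L2_bound[OF _ i]) (measurable, use b in auto)
 have "(L2_norm (kernel_op \<beta> h v))^2 <= (LBINT y. C^2*h y)"
  unfolding L2_norm_sq by (rule integral_mono[OF L2_integrable[OF L] i]) (use b in auto)
 also have "... = (C * sqrt (LBINT x. h x))^2"
  using test_functions_nonneg[OF h] by (simp add: power_mult_distrib)
 finally have "L2_norm (kernel_op \<beta> h v) <= C * sqrt (LBINT x. h x)"
  by (rule power2_le_imp_le) (use C test_functions_nonneg[OF h] in simp)
 also have "... = bose_kernel \<beta> (0::'a)*(LBINT x. h x)*L2_norm v"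
  using test_functions_nonneg[OF h] by (simp add: C_def mult_ac)
 finally show "L2_norm (kernel_op \<beta> h v) <= bose_kernel \<beta> (0::'a)*(LBINT x. h x)*L2_norm v" .
qed

text \<open>Two applications of Fubini bring the Fourier integrals onto \<open>bose_density\<close>,
  whose transform is the Bose kernel. The left side makes positivity visible and is the form that
  \<open>W_op\<close> produces.\<close>

lemma kernel_op_form:
 assumes u: "u : L2" and v: "v : L2"
 shows "(LBINT p. cor (bose_density \<beta> p) *
   (cnj (fourier_integral (%x. cor (sqrt (h x))*u x) p)*fourier_integral (%x. cor (sqrt (h x)) * v x) p))
  = cor ((2*pi)^DIM('a))*L2_inner u (kernel_op \<beta> h v)"
proof -
 define a where "a = (%x. cor (sqrt (h x))*u x)"
 define b where "b = (%x. cor (sqrt (h x)) * v x)"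
 let ?c = "cor ((2*pi)^DIM('a))"
 let ?g = "%p::'a. cor (bose_density \<beta> p)"
 have ai: "integrable lborel a" and bi: "integrable lborel b"
  using sqrt_test_functions_L2[OF h] u v by (auto simp: a_def b_def)
 have [measurable]: "a : BM" "b : BM" using ai bi by auto
 have aci: "integrable lborel (%y. cnj (a y))" using ai by simp
 have gi: "integrable lborel ?g" by (intro integrable_of_real fourier_bose_density(1) \<beta> d)
 have bdd: "cmod (cor (bose_kernel \<beta> z)) <= bose_kernel \<beta> (0::'a)" for z :: 'a
  using bose_kernel_nonneg[OF \<beta> d, of z] bose_kernel_le[OF \<beta> d, of z] by simp
 have gui: "integrable lborel (%p. ?g p*cnj (fourier_integral a p))"
 proof (rule bochner_integrable_bound)
  show "integrable lborel (%p. (LBINT x. cmod (a x)) *\<^sub>R ?g p)" by (intro integrable_scaleR_right gi)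
  show "AE p in lborel. norm (?g p*cnj (fourier_integral a p)) <= norm ((LBINT x. cmod (a x)) *\<^sub>R ?g p)"
   using fourier_integral_bound[OF ai] by (auto simp: norm_mult mult.commute intro!: mult_left_mono)
 qed measurable
 have "(LBINT p. ?g p*(cnj (fourier_integral a p)*fourier_integral b p))
  = (LBINT p. (?g p*cnj (fourier_integral a p))*(LBINT x. b x*cis (- (p \<bullet> x))))"
  unfolding fourier_integral_def by (simp add: mult_ac)
 also have "... = (LBINT x. b x*(LBINT p. (?g p*cnj (fourier_integral a p))*cis (- (p \<bullet> x))))"
  using fubini_prod_bounded[OF gui bi, of "%z. cis (- (fst z \<bullet> snd z))" 1] by simp
 also have "... = (LBINT x. b x*(?c*(LBINT y. cnj (a y)*cor (bose_kernel \<beta> (y - x)))))"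
 proof (rule bochner_integral_cong[OF refl])
  fix x
  have i: "integrable lborel (%p. ?g p*cis (- (p \<bullet> x)))"
   using integrable_cis_mult[OF gi, of "%p. - (p \<bullet> x)"] by (simp add: mult.commute)
  have "(LBINT p. (?g p*cnj (fourier_integral a p))*cis (- (p \<bullet> x)))
   = (LBINT p. (?g p*cis (- (p \<bullet> x)))*(LBINT y. cnj (a y)*cis (p \<bullet> y)))"
   unfolding fourier_integral_def bochner_integral_cnj[symmetric]
   by (simp add: cis_cnj mult_ac)
  also have "... = (LBINT y. cnj (a y)*(LBINT p. (?g p*cis (- (p \<bullet> x)))*cis (p \<bullet> y)))"
   using fubini_prod_bounded[OF i aci, of "%z. cis (fst z \<bullet> snd z)" 1] by simp
  also have "... = (LBINT y. ?c*(cnj (a y)*cor (bose_kernel \<beta> (y - x))))"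
  proof (rule bochner_integral_cong[OF refl])
   fix y
   have "(LBINT p. (?g p*cis (- (p \<bullet> x)))*cis (p \<bullet> y)) = (LBINT p. cis ((y - x) \<bullet> p)*?g p)"
    by (intro bochner_integral_cong refl)
     (simp add: inner_diff_right inner_commute[of _ "_ :: 'a"] mult.assoc mult.commute[of "cor _"] cis_mult)
   also have "... = cor ((2*pi)^DIM('a)*bose_kernel \<beta> (y - x))"
    by (rule fourier_bose_density(2)[OF \<beta> d])
   finally show "cnj (a y)*(LBINT p. (?g p*cis (- (p \<bullet> x)))*cis (p \<bullet> y))
    = ?c*(cnj (a y)*cor (bose_kernel \<beta> (y - x)))" by simp
  qed
  also have "... = ?c*(LBINT y. cnj (a y)*cor (bose_kernel \<beta> (y - x)))"
   by (rule integral_mult_right_zero)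
  finally show "b x*(LBINT p. (?g p*cnj (fourier_integral a p))*cis (- (p \<bullet> x)))
   = b x*(?c*(LBINT y. cnj (a y)*cor (bose_kernel \<beta> (y - x))))" by simp
 qed
 also have "... = ?c*(LBINT x. b x*(LBINT y. cnj (a y)*cor (bose_kernel \<beta> (y - x))))"
  by (subst integral_mult_right_zero[symmetric]) (simp add: mult.left_commute)
 also have "(LBINT x. b x*(LBINT y. cnj (a y)*cor (bose_kernel \<beta> (y - x))))
  = (LBINT y. cnj (a y)*(LBINT x. b x*cor (bose_kernel \<beta> (y - x))))"
  using fubini_prod_bounded[OF bi aci, of "%z. cor (bose_kernel \<beta> (snd z - fst z))" "bose_kernel \<beta> (0::'a)"] bdd by simp
 also have "... = L2_inner u (kernel_op \<beta> h v)"
  unfolding L2_inner_def kernel_op_def a_def b_def by (simp add: mult_ac)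
 finally show ?thesis unfolding a_def b_def .
qed

end

section \<open>The operator \<open>K_f\<close> as an integral operator\<close>

definition bose_multiplier :: "real => real => real" where
 "bose_multiplier \<beta> = (%s. sqrt (exp (\<beta> * s)*inverse (1 - exp (\<beta> * s))))"

lemma bose_multiplier_measurable [measurable]: "bose_multiplier \<beta> : BM"
 unfolding bose_multiplier_def by measurable

lemma bose_multiplier_sq:
 assumes "\<beta> > 0" "p ~= 0"
 shows "(bose_multiplier \<beta> (- (norm p)\<^sup>2))^2 = bose_density \<beta> p"
proof -
 let ?q = "exp (\<beta>*(- (norm p)\<^sup>2))"
 have q: "?q < 1" using assms by simp
 then have "(bose_multiplier \<beta> (- (norm p)\<^sup>2))^2 = ?q*inverse (1 - ?q)"
  by (simp add: bose_multiplier_def)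
 also have "... = bose_density \<beta> p"
  using q by (simp add: bose_density_def exp_minus field_simps)
 finally show ?thesis .
qed

lemma bose_multiplier_nonneg: "\<beta> > 0 ==> 0 <= bose_multiplier \<beta> (- (norm p)\<^sup>2)"
 by (simp add: bose_multiplier_def)

text \<open>With \<open>r = exp (- \<beta> |p|^2/2)\<close> the multiplier is
  \<open>r/sqrt (1 - r^2)\<close>, and \<open>1 - r^2 >= (1 - r)^2\<close>. The bound makes the
  multiplier integrable, as \<open>plancherel_transform_inverse\<close> requires of the transform of
  \<open>W_op\<close>.\<close>

lemma bose_multiplier_le:
 assumes "\<beta> > 0" "p ~= 0"
 shows "bose_multiplier \<beta> (- (norm p)\<^sup>2) <= bose_density (\<beta>/2) p"
proof -
 let ?r = "exp (- (\<beta>/2*(norm p)^2))"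
 have r: "0 < ?r" "?r < 1" using assms by auto
 have "?r*?r = exp (\<beta>*(- (norm p)\<^sup>2))" by (simp add: exp_add[symmetric])
 then have "bose_multiplier \<beta> (- (norm p)\<^sup>2) = sqrt (?r*?r*inverse (1 - ?r*?r))"
  by (simp add: bose_multiplier_def)
 also have "... <= sqrt ((?r/(1 - ?r))^2)"
 proof (rule real_sqrt_le_mono)
  have "(1 - ?r)*(1 - ?r) <= (1 - ?r)*(1 + ?r)" using r by (intro mult_left_mono) auto
  also have "... = 1 - ?r*?r" by (simp add: algebra_simps)
  finally have "(1 - ?r)*(1 - ?r) <= 1 - ?r*?r" .
  moreover have "0 < (1 - ?r)*(1 - ?r)" using r by (intro mult_pos_pos) auto
  ultimately have "inverse (1 - ?r*?r) <= inverse ((1 - ?r)*(1 - ?r))"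
   by (rule le_imp_inverse_le)
  then have "?r*?r*inverse (1 - ?r*?r) <= ?r*?r*inverse ((1 - ?r)*(1 - ?r))"
   by (rule mult_left_mono) (use r in simp)
  then show "?r*?r*inverse (1 - ?r*?r) <= (?r/(1 - ?r))^2"
   by (simp only: power2_eq_square divide_inverse inverse_mult_distrib mult_ac)
 qed
 also have "... = ?r/(1 - ?r)"
  by (subst real_sqrt_abs) (use r in simp)
 also have "... = bose_density (\<beta>/2) p"
  using r by (simp add: bose_density_def exp_minus field_simps)
 finally show ?thesis .
qed

lemma plancherel_transform_unique:
 assumes "plancherel_transform u (a :: 'a::euclidean_space => complex)" "plancherel_transform u b"
 shows "AE x in lborel. a x = b x"
proof -
 have L: "a : L2" "b : L2" using assms by (auto simp: plancherel_transform_iff)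
 have "(L2_norm (%x. a x + (- 1)*b x))^2 = (2*pi)^DIM('a)*(L2_norm (%x. u x + (- 1)*u x))^2"
  by (rule plancherel_transform_norm[OF plancherel_transform_lincomb[OF assms]])
 also have "... = 0" by (simp add: L2_norm_def)
 finally have "L2_norm (%x. a x - b x) = 0" by simp
 then have "AE x in lborel. a x - b x = 0" by (rule L2_norm_eq_0[rotated]) (use L in simp)
 then show ?thesis by simp
qed

context
 fixes \<beta> :: real and g :: "'a::euclidean_space => real"
 assumes \<beta>: "\<beta> > 0" and d: "DIM('a) > 2" and g: "g : test_functions"
begin

text \<open>\<open>fun_laplacian\<close> picks an arbitrary function with the required transform, so
  one has to be exhibited first: the multiplier times the bounded transform of \<open>a\<close> is
  integrable and square integrable, hence is a transform. Uniqueness up to null sets then gives the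
  formula for the chosen value.\<close>

lemma W_op_transform:
 assumes v: "v : L2"
 shows "plancherel_transform (W_op \<beta> g v)
  (%p. cor (bose_multiplier \<beta> (- (norm p)\<^sup>2))*fourier_integral (%x. sqrt_one_minus_exp g x * v x) p)"
proof -
 let ?h = "%x. 1 - exp (- g x)"
 let ?m = "%p::'a. cor (bose_multiplier \<beta> (- (norm p)\<^sup>2))"
 have h: "?h : test_functions" by (rule one_minus_exp_test[OF g])
 then obtain R H where RH: "R > 0" "H > 0" "!!x. ?h x <= H" "!!x. norm x > R ==> ?h x = 0"
  by (rule test_functionsE) blast
 define a where "a = (%x. sqrt_one_minus_exp g x * v x)"
 have a: "a : L2" "integrable lborel a"
  using sqrt_test_functions_L2[OF h v] by (auto simp: a_def sqrt_one_minus_exp_def)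
 have [measurable]: "a : BM" using a by simp
 have aF: "plancherel_transform a (fourier_integral a)"
  by (rule plancherel_transform_compact[OF a(1), of R]) (use RH(4) in \<open>auto simp: a_def sqrt_one_minus_exp_def\<close>)
 let ?C = "(LBINT x. cmod (a x))"
 have C: "cmod (fourier_integral a p) <= ?C" for p by (rule fourier_integral_bound[OF a(2)])
 have AE: "AE p in lborel. p ~= (0::'a)" by (rule AE_lborel_singleton)
 define w' where "w' = (%p. ?m p*fourier_integral a p)"
 have [measurable]: "w' : BM" unfolding w'_def by measurable
 have w'L: "w' : L2"
 proof (rule L2_bound)
  show "integrable lborel (%p::'a. ?C^2*bose_density \<beta> p)"
   by (intro integrable_mult_right fourier_bose_density(1) \<beta> d)
  show "AE p in lborel. (cmod (w' p))^2 <= ?C^2*bose_density \<beta> p"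
   using AE
  proof eventually_elim
   case (elim p)
   have "(cmod (w' p))^2 = (cmod (fourier_integral a p))^2*bose_density \<beta> p"
    using bose_multiplier_sq[OF \<beta> elim] by (simp add: w'_def norm_mult power_mult_distrib)
   then show ?case
    using bose_density_nonneg[OF \<beta> d, of p] by (simp add: mult_right_mono power_mono C)
  qed
 qed measurable
 have w'1: "integrable lborel w'"
 proof (rule integrable_cong_AE_imp)
  show "integrable lborel (%p. if p = 0 then 0 else w' p)"
  proof (rule bochner_integrable_bound)
   show "integrable lborel (%p::'a. ?C*bose_density (\<beta>/2) p)"
    by (intro integrable_mult_right fourier_bose_density(1) d) (use \<beta> in simp)
   show "AE p in lborel. norm (if p = 0 then 0 else w' p) <= norm (?C*bose_density (\<beta>/2) p)"
   proof (rule AE_I2)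
    fix p :: 'a
    show "norm (if p = 0 then 0 else w' p) <= norm (?C*bose_density (\<beta>/2) p)"
    proof (cases "p = 0")
     case False
     have "norm (w' p) = bose_multiplier \<beta> (- (norm p)\<^sup>2)*cmod (fourier_integral a p)"
      using bose_multiplier_nonneg[OF \<beta>, of p] by (simp add: w'_def norm_mult)
     also have "... <= bose_density (\<beta>/2) p*?C"
      using bose_multiplier_nonneg[OF \<beta>, of p] bose_multiplier_le[OF \<beta> False] C[of p]
       bose_density_nonneg[of "\<beta>/2" p] \<beta> d by (intro mult_mono) auto
     finally show ?thesis using False by (simp add: mult.commute)
    qed simp
   qed
  qed measurable
  show "AE p in lborel. (if p = 0 then 0 else w' p) = w' p"
   using AE by eventually_elim simp
 qed measurable
 obtain w where "plancherel_transform w w'"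
  using plancherel_transform_inverse[OF w'L w'1] by blast
 then have "EX w u' w'. plancherel_transform a u' & plancherel_transform w w' & (AE p in lborel. w' p = ?m p*u' p)"
  using aF by (intro exI[of _ w] exI[of _ "fourier_integral a"] exI[of _ w']) (simp add: w'_def)
 then have "EX u' w'. plancherel_transform a u' & plancherel_transform (W_op \<beta> g v) w' & (AE p in lborel. w' p = ?m p*u' p)"
  unfolding W_op_def fun_laplacian_def a_def bose_multiplier_def by (rule someI_ex)
 then obtain u' w2 where *: "plancherel_transform a u'" "plancherel_transform (W_op \<beta> g v) w2" "AE p in lborel. w2 p = ?m p*u' p"
  by blast
 have "AE p in lborel. u' p = fourier_integral a p"
  by (rule plancherel_transform_unique[OF *(1) aF])
 then have "AE p in lborel. w2 p = w' p" using *(3) by eventually_elim (simp add: w'_def)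
 then have "plancherel_transform (W_op \<beta> g v) w'"
  by (intro plancherel_transform_cong[OF *(2)]) auto
 then show ?thesis by (simp add: w'_def a_def)
qed

lemma W_op_inner:
 assumes u: "u : L2" and v: "v : L2"
 shows "L2_inner (W_op \<beta> g u) (W_op \<beta> g v) = L2_inner u (kernel_op \<beta> (%x. 1 - exp (- g x)) v)"
proof -
 let ?h = "%x. 1 - exp (- g x)"
 have h: "?h : test_functions" by (rule one_minus_exp_test[OF g])
 let ?m = "%p::'a. cor (bose_multiplier \<beta> (- (norm p)\<^sup>2))"
 let ?F = "%u. fourier_integral (%x. cor (sqrt (?h x))*u x)"
 have [measurable]: "g : BM" "u : BM" "v : BM"
  using g u v by (auto simp: test_functions_def)
 have AE: "AE p in lborel. p ~= (0::'a)" by (rule AE_lborel_singleton)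
 have "cor ((2*pi)^DIM('a))*L2_inner (W_op \<beta> g u) (W_op \<beta> g v)
  = L2_inner (%p. ?m p*?F u p) (%p. ?m p*?F v p)"
  using plancherel_transform_inner[OF W_op_transform[OF u] W_op_transform[OF v]]
  by (simp add: sqrt_one_minus_exp_def)
 also have "... = (LBINT p. cor (bose_density \<beta> p)*(cnj (?F u p)*?F v p))"
  unfolding L2_inner_def
 proof (rule integral_cong_AE)
  show "AE p in lborel. cnj (?m p*?F u p)*(?m p*?F v p) = cor (bose_density \<beta> p)*(cnj (?F u p)*?F v p)"
   using AE
  proof eventually_elim
   case (elim p)
   show ?case
    unfolding bose_multiplier_sq[OF \<beta> elim, symmetric] by (simp add: power2_eq_square)
  qed
 qed measurable
 also have "... = cor ((2*pi)^DIM('a))*L2_inner u (kernel_op \<beta> ?h v)"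
  by (rule kernel_op_form[OF \<beta> d h u v])
 finally show ?thesis by simp
qed

text \<open>The integral operator satisfies the condition that defines the adjoint, so the choice in
  \<open>L2_adjoint\<close> is not void; the difference of two admissible values is orthogonal to
  all of L2.\<close>

theorem K_op_eq_kernel_op:
 assumes v: "v : L2"
 shows "K_op \<beta> g v : L2" "AE x in lborel. K_op \<beta> g v x = kernel_op \<beta> (%x. 1 - exp (- g x)) v x"
proof -
 let ?h = "%x. 1 - exp (- g x)"
 have h: "?h : test_functions" by (rule one_minus_exp_test[OF g])
 have kL: "kernel_op \<beta> ?h v : L2" by (rule kernel_op_L2(1)[OF \<beta> d h v])
 have "EX w. w : L2 & (ALL u:L2. L2_inner (W_op \<beta> g u) (W_op \<beta> g v) = L2_inner u w)"
  using W_op_inner[OF _ v] kL by blast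
 then have *: "K_op \<beta> g v : L2 & (ALL u:L2. L2_inner (W_op \<beta> g u) (W_op \<beta> g v) = L2_inner u (K_op \<beta> g v))"
  unfolding K_op_def L2_adjoint_def by (rule someI_ex)
 then show KL: "K_op \<beta> g v : L2" by simp
 have "AE x in lborel. K_op \<beta> g v x - kernel_op \<beta> ?h v x = 0"
 proof (rule L2_orth_all)
  show "(%x. K_op \<beta> g v x - kernel_op \<beta> ?h v x) : L2" using KL kL by simp
  fix u :: "'a => complex" assume u: "u : L2"
  show "L2_inner u (%x. K_op \<beta> g v x - kernel_op \<beta> ?h v x) = 0"
   using * u W_op_inner[OF u v] by (simp add: L2_inner_diff_right KL kL)
 qed
 then show "AE x in lborel. K_op \<beta> g v x = kernel_op \<beta> ?h v x" by simp
qed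

end

context
 fixes \<beta> :: real and h :: "'a::euclidean_space => real"
 assumes \<beta>: "\<beta> > 0" and d: "DIM('a) > 2" and h: "h : test_functions"
begin

lemma kernel_op_form_self:
 assumes v: "v : L2"
 shows "integrable lborel (%p. bose_density \<beta> p*(cmod (fourier_integral (%x. cor (sqrt (h x)) * v x) p))^2)"
  and "cor (LBINT p. bose_density \<beta> p*(cmod (fourier_integral (%x. cor (sqrt (h x)) * v x) p))^2)
   = cor ((2*pi)^DIM('a))*L2_inner v (kernel_op \<beta> h v)"
proof -
 let ?F = "fourier_integral (%x. cor (sqrt (h x)) * v x)"
 have [measurable]: "h : BM" "v : BM"
  using h v by (auto simp: test_functions_def)
 let ?C = "(LBINT x. cmod (cor (sqrt (h x)) * v x))"
 have C: "cmod (?F p) <= ?C" for p by (rule fourier_integral_bound[OF sqrt_test_functions_L2(2)[OF h v]])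
 show "integrable lborel (%p. bose_density \<beta> p*(cmod (?F p))^2)"
 proof (rule bochner_integrable_bound)
  show "integrable lborel (%p::'a. bose_density \<beta> p*?C^2)"
   by (intro integrable_mult_left fourier_bose_density(1) \<beta> d)
  show "AE p in lborel. norm (bose_density \<beta> p*(cmod (?F p))^2) <= norm (bose_density \<beta> p*?C^2)"
   using bose_density_nonneg[OF \<beta> d] C by (intro AE_I2) (simp add: abs_mult mult_left_mono power_mono)
 qed measurable
 have *: "cor (bose_density \<beta> p*(cmod (?F p))^2) = cor (bose_density \<beta> p)*(cnj (?F p)*?F p)" for p
  using complex_norm_square[of "?F p"] by (simp add: mult.commute)
 show "cor (LBINT p. bose_density \<beta> p*(cmod (?F p))^2)
   = cor ((2*pi)^DIM('a))*L2_inner v (kernel_op \<beta> h v)"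
  unfolding kernel_op_form[OF \<beta> d h v v, symmetric] integral_complex_of_real[symmetric] by (simp only: *)
qed

lemma kernel_op_psd:
 assumes v: "v : L2"
 shows "L2_inner v (kernel_op \<beta> h v) = cor (Re (L2_inner v (kernel_op \<beta> h v)))"
  and "0 <= Re (L2_inner v (kernel_op \<beta> h v))"
proof -
 let ?I = "(LBINT p. bose_density \<beta> p*(cmod (fourier_integral (%x. cor (sqrt (h x)) * v x) p))^2)"
 have "L2_inner v (kernel_op \<beta> h v) = cor (?I/(2*pi)^DIM('a))"
  using kernel_op_form_self(2)[OF v] by simp
 moreover have "0 <= ?I" using bose_density_nonneg[OF \<beta> d] by (intro integral_nonneg_AE AE_I2) auto
 ultimately show "L2_inner v (kernel_op \<beta> h v) = cor (Re (L2_inner v (kernel_op \<beta> h v)))"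
  "0 <= Re (L2_inner v (kernel_op \<beta> h v))" by auto
qed

lemma kernel_op_hermitian:
 assumes u: "u : L2" and v: "v : L2"
 shows "L2_inner (kernel_op \<beta> h u) v = L2_inner u (kernel_op \<beta> h v)"
proof -
 let ?I = "%u v. (LBINT p. cor (bose_density \<beta> p) *
   (cnj (fourier_integral (%x. cor (sqrt (h x))*u x) p)*fourier_integral (%x. cor (sqrt (h x)) * v x) p))"
 let ?c = "(2*pi)^DIM('a)"
 have "cnj (?I v u) = ?I u v"
  unfolding bochner_integral_cnj[symmetric] by (simp add: mult.commute)
 then have "cnj (cor ?c*L2_inner v (kernel_op \<beta> h u)) = cor ?c*L2_inner u (kernel_op \<beta> h v)"
  by (simp only: kernel_op_form[OF \<beta> d h u v] kernel_op_form[OF \<beta> d h v u])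
 then have "cor ?c*cnj (L2_inner v (kernel_op \<beta> h u)) = cor ?c*L2_inner u (kernel_op \<beta> h v)"
  by (simp only: complex_cnj_mult complex_cnj_complex_of_real)
 then have "cnj (L2_inner v (kernel_op \<beta> h u)) = L2_inner u (kernel_op \<beta> h v)"
  by simp
 then show ?thesis by (simp add: L2_inner_cnj)
qed

end

lemma kernel_op_diff:
 assumes \<beta>: "\<beta> > 0" and d: "DIM('a::euclidean_space) > 2" and h: "h : test_functions"
  and u: "u : L2" and v: "v : L2"
 shows "kernel_op \<beta> h (%x. u x - c * v x) y = kernel_op \<beta> h u y - c*kernel_op \<beta> h v (y::'a)"
proof -
 let ?f = "%v x. (cor (sqrt (h x)) * v x)*cor (bose_kernel \<beta> (y - x))"
 have i: "integrable lborel (?f v)" if v: "v : L2" for v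
 proof (rule bochner_integrable_bound[OF integrable_mult_left[OF sqrt_test_functions_L2(2)[OF h v]]])
  have [measurable]: "h : BM" "v : BM"
   using h v by (auto simp: test_functions_def)
  show "?f v : borel_measurable lborel" by measurable
  show "AE x in lborel. norm (?f v x) <= norm (cor (sqrt (h x)) * v x*cor (bose_kernel \<beta> (0::'a)))"
   unfolding norm_mult[of "_*_"] norm_of_real
   using bose_kernel_nonneg[OF \<beta> d] bose_kernel_le[OF \<beta> d] by (intro AE_I2 mult_left_mono) auto
 qed
 have "(LBINT x. ?f (%x. u x - c * v x) x) = (LBINT x. ?f u x - c*?f v x)"
  by (intro bochner_integral_cong refl) (simp add: algebra_simps)
 also have "... = (LBINT x. ?f u x) - c*(LBINT x. ?f v x)"
  using i[OF u] i[OF v] by simp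
 finally show ?thesis by (simp add: kernel_op_def right_diff_distrib)
qed

section \<open>Orthonormal bases and the trace\<close>

definition orthonormal_set :: "('a::euclidean_space => complex) set => bool" where
 "orthonormal_set B \<longleftrightarrow> B \<subseteq> L2 & (ALL u:B. ALL v:B. L2_inner u v = (if u = v then 1 else 0))"

lemma orthonormal_basis_iff:
 "orthonormal_basis B \<longleftrightarrow> orthonormal_set B & (ALL v:L2. (ALL u:B. L2_inner u v = 0) --> (AE x in lborel. v x = 0))"
 by (auto simp: orthonormal_basis_def orthonormal_set_def)

lemma orthonormal_set_subset: "orthonormal_set B ==> F \<subseteq> B ==> orthonormal_set F"
 unfolding orthonormal_set_def by (meson subset_iff)

lemma L2_inner_orthonormal_sum:
 assumes B: "orthonormal_set B" "F \<subseteq> B" "finite F" and u: "u : B"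
 shows "L2_inner u (%x. \<Sum>v\<in>F. c v * v x) = (if u : F then c u else 0)"
proof -
 have "L2_inner u (%x. \<Sum>v\<in>F. c v * v x) = (\<Sum>v\<in>F. c v *L2_inner u v)"
  using B u by (subst L2_inner_sum_right) (auto simp: orthonormal_set_def L2_inner_cmult_right)
 also have "... = (\<Sum>v\<in>F. if v = u then c u else 0)"
  using B u by (intro sum.cong refl) (auto simp: orthonormal_set_def subset_iff)
 finally show ?thesis using B by simp
qed

lemma L2_norm_orthonormal_sum:
 assumes B: "orthonormal_set B" "F \<subseteq> B" "finite F"
 shows "(L2_norm (%x. \<Sum>v\<in>F. c v * v x))^2 = (\<Sum>v\<in>F. (cmod (c v))^2)"
proof -
 let ?s = "%x. \<Sum>v\<in>F. c v * v x"
 have FL: "F \<subseteq> L2" using B by (auto simp: orthonormal_set_def)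
 have sL: "?s : L2" using FL by (intro L2_sum L2_cmult) auto
 have "cor ((L2_norm ?s)^2) = (\<Sum>v\<in>F. cnj (c v)*L2_inner v ?s)"
  using FL sL by (subst L2_inner_self[symmetric], subst L2_inner_sum_left) (auto simp: L2_inner_cmult_left)
 also have "... = (\<Sum>v\<in>F. cnj (c v)*c v)"
  using B by (intro sum.cong refl) (auto simp: L2_inner_orthonormal_sum[OF B])
 also have "... = cor (\<Sum>v\<in>F. (cmod (c v))^2)"
  unfolding of_real_sum by (intro sum.cong refl) (subst complex_norm_square, simp add: mult.commute)
 finally show ?thesis unfolding of_real_eq_iff .
qed

lemma L2_norm_residual:
 assumes B: "orthonormal_set B" "F \<subseteq> B" "finite F" and v: "v : L2"
 shows "(L2_norm (%x. v x - (\<Sum>u\<in>F. L2_inner u v *u x)))^2 = (L2_norm v)^2 - (\<Sum>u\<in>F. (cmod (L2_inner u v))^2)"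
proof -
 let ?s = "%x. \<Sum>u\<in>F. L2_inner u v *u x"
 have FL: "F \<subseteq> L2" using B by (auto simp: orthonormal_set_def)
 have sL: "?s : L2" using FL by (intro L2_sum L2_cmult) auto
 have "L2_inner v ?s = (\<Sum>u\<in>F. L2_inner u v *L2_inner v u)"
  using FL v by (subst L2_inner_sum_right) (auto simp: L2_inner_cmult_right)
 also have "... = cor (\<Sum>u\<in>F. (cmod (L2_inner u v))^2)"
  unfolding of_real_sum by (intro sum.cong refl) (subst complex_norm_square, simp add: L2_inner_cnj)
 finally show ?thesis
  using L2_norm_diff_sq[OF v sL] by (simp add: L2_norm_orthonormal_sum[OF B])
qed

lemma Bessel:
 assumes "orthonormal_set B" "F \<subseteq> B" "finite F" "v : L2"
 shows "(\<Sum>u\<in>F. (cmod (L2_inner u v))^2) <= (L2_norm v)^2"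
 using L2_norm_residual[OF assms] zero_le_power2[of "L2_norm (%x. v x - (\<Sum>u\<in>F. L2_inner u v *u x))"] by linarith

lemma orthonormal_countable_support:
 assumes B: "orthonormal_set B" and v: "v : L2"
 shows "countable {u:B. L2_inner u v ~= 0}"
proof -
 have "(%u. norm ((cmod (L2_inner u v))^2)) summable_on B"
  by (rule nonneg_bdd_above_summable_on)
   (auto intro!: bdd_aboveI2[where M = "(L2_norm v)^2"] Bessel[OF B _ _ v])
 then have "countable {u:B. (cmod (L2_inner u v))^2 ~= 0}"
  by (rule abs_summable_countable)
 then show ?thesis by simp
qed

section \<open>Separability and existence of orthonormal bases\<close>

lemma fourier_integral_continuous:
 fixes u :: "'a::euclidean_space => complex"
 assumes u: "integrable lborel u"
 shows "continuous_on UNIV (fourier_integral u)"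
proof (rule continuous_on_sequentiallyI)
 fix X :: "nat => 'a" and p assume X: "X ----> p"
 have [measurable]: "u : BM" using u by auto
 show "(%n. fourier_integral u (X n)) ----> fourier_integral u p"
  unfolding fourier_integral_def
 proof (rule integral_dominated_convergence[where w = "%x. norm (u x)"])
  show "AE x in lborel. (%n. cis (- (X n \<bullet> x))*u x) ----> cis (- (p \<bullet> x))*u x"
   by (intro AE_I2 tendsto_intros X)
 qed (use u in \<open>auto simp: norm_mult\<close>)
qed

lemma gauss_L2: "(%x::'a::euclidean_space. cor (exp (- (norm x)\<^sup>2))) : L2"
proof (rule L2_bound)
 show "integrable lborel (%x::'a. exp (- 1*(norm x)^2))" by (rule integral_gauss(1)) simp
 show "AE x::'a in lborel. (cmod (cor (exp (- (norm x)\<^sup>2))))^2 <= exp (- 1*(norm x)^2)"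
  by (intro AE_I2) (simp add: power2_eq_square exp_add[symmetric])
qed measurable

lemma cis_gauss_L2: "(%x::'a::euclidean_space. cis (q \<bullet> x)*cor (exp (- (norm x)\<^sup>2))) : L2"
 by (rule L2_bounded_mult[OF gauss_L2, of _ 1]) (auto simp: measurable)

text \<open>The inner products are values of the Fourier integral of \<open>v\<close> times a
  Gaussian. This integral is continuous in the frequency, so vanishing on a dense set makes it zero,
  and Plancherel finishes.\<close>

lemma L2_total_cis_gauss:
 fixes v :: "'a::euclidean_space => complex"
 assumes v: "v : L2" and D: "!!U. open U ==> U ~= {} ==> EX q:D. q : U"
  and 0: "!!q. q : D ==> L2_inner (%x. cis (q \<bullet> x)*cor (exp (- (norm x)\<^sup>2))) v = 0"
 shows "AE x in lborel. v x = 0"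
proof -
 define w where "w = (%x. cor (exp (- (norm x)\<^sup>2)) * v x)"
 have w: "w : L2" unfolding w_def
  by (rule L2_bounded_mult[OF v, of _ 1]) auto
 have w1: "integrable lborel w"
  using L2_inner_integrable[OF gauss_L2 v] by (simp add: w_def)
 have eq: "fourier_integral w q = L2_inner (%x. cis (q \<bullet> x)*cor (exp (- (norm x)\<^sup>2))) v" for q
  by (simp add: fourier_integral_def L2_inner_def w_def cis_cnj mult.assoc)
 have "open {q. fourier_integral w q ~= 0}"
  by (intro open_Collect_neq continuous_on_const fourier_integral_continuous[OF w1])
 then have "{q. fourier_integral w q ~= 0} = {}" using D 0 eq by fastforce
 then have "(L2_norm w)^2 = 0"
  using plancherel_L1_L2(2)[OF w w1] by (simp add: L2_norm_def)
 then have "AE x in lborel. w x = 0" by (intro L2_norm_eq_0[OF w]) simp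
 then show ?thesis by eventually_elim (simp add: w_def)
qed

text \<open>Each of countably many total functions has a nonzero coefficient against only countably
  many members of \<open>B\<close>, and no member is orthogonal to all of them. Countability allows
  the basis inside \<open>fredholm_det\<close> to be exhausted by an increasing sequence of finite
  sets.\<close>

lemma orthonormal_set_countable:
 assumes B: "orthonormal_set (B :: ('a::euclidean_space => complex) set)"
 shows "countable B"
proof -
 obtain D :: "'a set" where D: "countable D" "!!U. open U ==> U ~= {} ==> EX q:D. q : U"
  by (rule countable_dense_setE) blast
 let ?e = "%q x::'a. cis (q \<bullet> x)*cor (exp (- (norm x)\<^sup>2))"
 have "B \<subseteq> (\<Union>q\<in>D. {u:B. L2_inner u (?e q) ~= 0})"
 proof
  fix u assume u: "u : B"
  then have uL: "u : L2" using B by (auto simp: orthonormal_set_def)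
  have "EX q:D. L2_inner (?e q) u ~= 0"
  proof (rule ccontr)
   assume "\<not> ?thesis"
   then have "AE x in lborel. u x = 0" by (intro L2_total_cis_gauss[OF uL D(2)]) auto
   then have "L2_inner u u = L2_inner u (%x. 0)" using uL by (intro L2_inner_cong_AE) auto
   then show False using B u by (simp add: orthonormal_set_def)
  qed
  then obtain q where q: "q : D" "L2_inner (?e q) u ~= 0" by blast
  then have "L2_inner u (?e q) ~= 0" using L2_inner_cnj[of u "?e q"] by (metis complex_cnj_zero)
  then show "u : (\<Union>q\<in>D. {u:B. L2_inner u (?e q) ~= 0})"
   using u q(1) by blast
 qed
 moreover have "countable (\<Union>q\<in>D. {u:B. L2_inner u (?e q) ~= 0})"
  by (intro countable_UN D(1) orthonormal_countable_support[OF B] cis_gauss_L2)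
 ultimately show ?thesis by (rule countable_subset)
qed

lemma orthonormal_basis_exists: "EX B :: ('a::euclidean_space => complex) set. orthonormal_basis B"
proof -
 have "EX M:Collect orthonormal_set. ALL X:Collect orthonormal_set. (M :: ('a => complex) set) \<subseteq> X --> X = M"
 proof (rule subset_Zorn')
  fix C :: "('a => complex) set set" assume C: "subset.chain (Collect orthonormal_set) C"
  show "\<Union>C \<in> Collect orthonormal_set"
   unfolding orthonormal_set_def mem_Collect_eq
  proof (intro conjI ballI)
   show "\<Union>C \<subseteq> L2" using C unfolding subset.chain_def orthonormal_set_def by blast
   fix u v assume "u : \<Union>C" "v : \<Union>C"
   then obtain X Y where XY: "X : C" "Y : C" "u : X" "v : Y" by blast
   have "X \<subseteq> Y \<or> Y \<subseteq> X" using C XY unfolding subset.chain_def by blast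
   then have "EX Z:C. u : Z & v : Z" using XY by blast
   then obtain Z where "Z : C" "u : Z" "v : Z" by blast
   moreover have "orthonormal_set Z" using C \<open>Z : C\<close> by (auto simp: subset.chain_def)
   ultimately show "L2_inner u v = (if u = v then 1 else 0)" by (simp add: orthonormal_set_def)
  qed
 qed
 then obtain M :: "('a => complex) set" where M: "orthonormal_set M"
  and max: "!!X. orthonormal_set X ==> M \<subseteq> X ==> X = M" by blast
 have "AE x in lborel. v x = 0" if v: "v : L2" and orth: "ALL u:M. L2_inner u v = 0" for v
 proof (rule ccontr)
  assume nz: "\<not> (AE x in lborel. v x = 0)"
  then have n: "L2_norm v ~= 0" using L2_norm_eq_0[OF v] by blast
  define w where "w = (%x. cor (1/L2_norm v) * v x)"
  have wL: "w : L2" unfolding w_def by (rule L2_cmult[OF v])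
  have w1: "L2_inner w w = 1"
   unfolding w_def L2_inner_cmult_left L2_inner_cmult_right L2_inner_self using n by (simp add: power2_eq_square)
  have wo: "L2_inner u w = 0" "L2_inner w u = 0" if "u : M" for u
   using orth that L2_inner_cnj[of u v] unfolding w_def L2_inner_cmult_right L2_inner_cmult_left by auto
  have "w \<notin> M" using w1 wo(1) by auto
  moreover have "orthonormal_set (insert w M)"
   using M wL w1 wo by (auto simp: orthonormal_set_def)
  ultimately show False using max[of "insert w M"] by blast
 qed
 then show ?thesis using M by (auto simp: orthonormal_basis_iff)
qed

text \<open>The partial expansions converge to some \<open>t\<close> by completeness;
  \<open>v - t\<close> is orthogonal to the whole basis, hence null.\<close>

lemma Parseval:
 assumes B: "orthonormal_basis B" and F: "!!n. finite (F n)" "incseq F" "(\<Union>n. F n) = B" and v: "v : L2"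
 shows "(%n. \<Sum>u\<in>F n. (cmod (L2_inner u v))^2) ----> (L2_norm v)\<^sup>2"
proof -
 have on: "orthonormal_set B" using B by (simp add: orthonormal_basis_iff)
 have FB: "F n \<subseteq> B" for n using F(3) by blast
 have FL: "u : F n ==> u : L2" for u n using FB[of n] on by (auto simp: orthonormal_set_def)
 define S where "S = (%n. \<Sum>u\<in>F n. (cmod (L2_inner u v))^2)"
 define s where "s = (%n x. \<Sum>u\<in>F n. L2_inner u v *u x)"
 have sL: "s n : L2" for n unfolding s_def using FL by (intro L2_sum L2_cmult) auto
 have "incseq S" unfolding S_def
  by (rule incseq_SucI) (rule sum_mono2, use F(1) incseq_SucD[OF F(2)] in auto)
 moreover have "S n <= (L2_norm v)^2" for n unfolding S_def by (rule Bessel[OF on FB F(1) v])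
 ultimately obtain l where l: "S ----> l" using incseq_convergent by blast
 have diff: "(L2_norm (%x. s m x - s n x))^2 = S m - S n" if "n <= m" for m n
 proof -
  have sub: "F n \<subseteq> F m" using F(2) that by (auto simp: incseq_def)
  have "(%x. s m x - s n x) = (%x. \<Sum>u\<in>F m - F n. L2_inner u v *u x)"
   unfolding s_def by (simp add: sum_diff[OF F(1) sub])
  moreover have "F m - F n \<subseteq> B" "finite (F m - F n)" using FB[of m] F(1) by auto
  ultimately show ?thesis
   by (simp only: L2_norm_orthonormal_sum[OF on]) (simp add: S_def sum_diff[OF F(1) sub])
 qed
 have diff': "(L2_norm (%x. s m x - s n x))^2 = \<bar>S m - S n\<bar>" for m n
  using diff[of n m] diff[of m n] zero_le_power2[of "L2_norm (%x. s m x - s n x)"] zero_le_power2[of "L2_norm (%x. s n x - s m x)"]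
  by (cases "n <= m") (auto simp: L2_norm_minus_commute[of "s m"])
 obtain t where t: "t : L2" and st: "(%n. L2_norm (%x. s n x - t x)) ----> 0"
 proof (rule L2_complete[OF sL])
  fix e :: real assume e: "e > 0"
  have "Cauchy S" using l by (rule LIMSEQ_imp_Cauchy)
  then obtain N where N: "!!m n. m >= N ==> n >= N ==> dist (S m) (S n) < e^2"
   using e unfolding Cauchy_def by (meson zero_less_power)
  have "L2_norm (%x. s m x - s n x) <= e" if "m >= N" "n >= N" for m n
  proof (rule power2_le_imp_le)
   show "(L2_norm (%x. s m x - s n x))^2 <= e^2" using N[OF that] by (simp add: diff' dist_real_def)
  qed (use e in simp)
  then show "EX N. ALL m>=N. ALL n>=N. L2_norm (%x. s m x - s n x) <= e" by blast
 qed (rule that)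
 have "L2_inner u (%x. v x - t x) = 0" if u: "u : B" for u
 proof -
  have uL: "u : L2" using u on by (auto simp: orthonormal_set_def)
  have lim: "(%n. L2_inner u (s n)) ----> L2_inner u t"
   by (rule L2_inner_tendsto[OF sL t uL st])
  obtain N where N: "u : F N" using u F(3) by blast
  have "L2_inner u (s n) = L2_inner u v" if "n >= N" for n
  proof -
   have "u : F n" using N F(2) that by (auto simp: incseq_def)
   then show ?thesis unfolding s_def using L2_inner_orthonormal_sum[OF on FB F(1) u] by simp
  qed
  then have "(%n. L2_inner u (s n)) ----> L2_inner u v"
   by (intro tendsto_eventually) (auto simp: eventually_sequentially)
  then have "L2_inner u v = L2_inner u t" using lim by (rule LIMSEQ_unique)
  then show ?thesis using uL v t by (simp add: L2_inner_diff_right)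
 qed
 then have "AE x in lborel. v x - t x = 0"
  using B L2_diff[OF v t] unfolding orthonormal_basis_iff by blast
 then have eq: "L2_norm (%x. s n x - t x) = L2_norm (%x. s n x - v x)" for n
  using sL[of n] t v by (intro L2_norm_cong_AE) (auto elim: eventually_mono)
 have "S = (%n. (L2_norm v)^2 - (L2_norm (%x. s n x - v x))\<^sup>2)"
  by (rule ext, subst L2_norm_minus_commute) (use L2_norm_residual[OF on FB F(1) v] in \<open>simp add: S_def s_def\<close>)
 moreover have "(%n. (L2_norm v)^2 - (L2_norm (%x. s n x - v x))\<^sup>2) ----> (L2_norm v)\<^sup>2 - 0\<^sup>2"
  by (intro tendsto_intros st[unfolded eq])
 ultimately show ?thesis unfolding S_def[symmetric] by simp
qed

section \<open>Trace and Hilbert-Schmidt norm of the integral operator\<close>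

lemma integral_bose_density:
 assumes \<beta>: "\<beta> > 0" and d: "DIM('a::euclidean_space) > 2"
 shows "(LBINT p. bose_density \<beta> (p::'a)) = (2*pi)^DIM('a)*bose_kernel \<beta> (0::'a)"
 using critical_density_eq[OF \<beta> d] by (simp add: critical_density_def bose_density_def[abs_def] divide_eq_eq mult.commute)

text \<open>The squared Hilbert-Schmidt norm of \<open>kernel_op \<beta> h\<close>; it will bound
  the second-order part of the logarithm of the determinant.\<close>

definition kernel_hs :: "real => ('a::euclidean_space => real) => real" where
 "kernel_hs \<beta> h = (LBINT y. h y*(LBINT x. h x*(bose_kernel \<beta> (y - x))^2))"

context
 fixes \<beta> :: real and h :: "'a::euclidean_space => real"
 assumes \<beta>: "\<beta> > 0" and d: "DIM('a) > 2" and h: "h : test_functions"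
begin

private lemma m_h: "h : BM"
 using h by (simp add: test_functions_def)

private lemma wave_L2:
 shows "(%x. cis (p \<bullet> x)*cor (sqrt (h x))) : L2"
  and "(L2_norm (%x. cis (p \<bullet> x)*cor (sqrt (h x))))^2 = (LBINT x. h x)"
  and "fourier_integral (%x. cor (sqrt (h x)) * v x) p = L2_inner (%x. cis (p \<bullet> x)*cor (sqrt (h x))) v"
proof -
 note [measurable] = m_h
 show "(%x. cis (p \<bullet> x)*cor (sqrt (h x))) : L2"
  by (rule L2_bounded_mult[OF sqrt_test_function_in_L2[OF h], of _ 1]) auto
 show "(L2_norm (%x. cis (p \<bullet> x)*cor (sqrt (h x))))^2 = (LBINT x. h x)"
  using test_functions_nonneg[OF h] by (simp add: L2_norm_sq norm_mult)
 show "fourier_integral (%x. cor (sqrt (h x)) * v x) p = L2_inner (%x. cis (p \<bullet> x)*cor (sqrt (h x))) v"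
  by (simp add: fourier_integral_def L2_inner_def cis_cnj mult.assoc)
qed

private lemma trace_formula:
 assumes F: "F \<subseteq> L2" "finite F"
 shows "(2*pi)^DIM('a)*(\<Sum>v\<in>F. Re (L2_inner v (kernel_op \<beta> h v)))
  = (LBINT p. bose_density \<beta> p*(\<Sum>v\<in>F. (cmod (L2_inner v (%x. cis (p \<bullet> x)*cor (sqrt (h x)))))^2))"
proof -
 note [measurable] = m_h
 have *: "(cmod (fourier_integral (%x. cor (sqrt (h x)) * v x) p))^2
  = (cmod (L2_inner v (%x. cis (p \<bullet> x)*cor (sqrt (h x)))))^2" for v p
  unfolding wave_L2(3) by (subst L2_inner_cnj[symmetric]) simp
 have "(2*pi)^DIM('a)*Re (L2_inner v (kernel_op \<beta> h v))
  = (LBINT p. bose_density \<beta> p*(cmod (fourier_integral (%x. cor (sqrt (h x)) * v x) p))^2)"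
  if "v : F" for v
  using arg_cong[OF kernel_op_form_self(2)[OF \<beta> d h, of v], of Re] that F by auto
 then have "(2*pi)^DIM('a)*(\<Sum>v\<in>F. Re (L2_inner v (kernel_op \<beta> h v)))
  = (\<Sum>v\<in>F. (LBINT p. bose_density \<beta> p*(cmod (fourier_integral (%x. cor (sqrt (h x)) * v x) p))^2))"
  unfolding sum_distrib_left by (intro sum.cong refl)
 also have "... = (LBINT p. (\<Sum>v\<in>F. bose_density \<beta> p*(cmod (fourier_integral (%x. cor (sqrt (h x)) * v x) p))^2))"
  by (rule bochner_integral_sum[symmetric]) (use kernel_op_form_self(1)[OF \<beta> d h] F in auto)
 finally show ?thesis by (simp add: sum_distrib_left *)
qed

lemma kernel_op_trace_le:
 assumes B: "orthonormal_set F" "finite F"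
 shows "(\<Sum>v\<in>F. Re (L2_inner v (kernel_op \<beta> h v))) <= bose_kernel \<beta> (0::'a)*(LBINT x. h x)"
proof -
 note [measurable] = m_h
 let ?e = "%p x. cis (p \<bullet> x)*cor (sqrt (h x))"
 have FL: "F \<subseteq> L2" using B by (simp add: orthonormal_set_def)
 have [measurable]: "u : BM" if "u : F" for u using that FL by auto
 have i: "integrable lborel (%p::'a. bose_density \<beta> p*(LBINT x. h x))"
  by (intro integrable_mult_left fourier_bose_density(1) \<beta> d)
 have b: "(\<Sum>v\<in>F. (cmod (L2_inner v (?e p)))^2) <= (LBINT x. h x)" for p
  using Bessel[OF B(1) order_refl B(2) wave_L2(1)] wave_L2(2) by simp
 have "(2*pi)^DIM('a)*(\<Sum>v\<in>F. Re (L2_inner v (kernel_op \<beta> h v)))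
  <= (LBINT p. bose_density \<beta> (p::'a)*(LBINT x. h x))"
  unfolding trace_formula[OF FL B(2)]
 proof (rule integral_mono[OF _ i])
  show le: "bose_density \<beta> p*(\<Sum>v\<in>F. (cmod (L2_inner v (?e p)))^2) <= bose_density \<beta> p*(LBINT x. h x)" for p :: 'a
   by (intro mult_left_mono b bose_density_nonneg[OF \<beta> d])
  show "integrable lborel (%p. bose_density \<beta> p*(\<Sum>v\<in>F. (cmod (L2_inner v (?e p)))^2))"
  proof (rule bochner_integrable_bound[OF i])
   show "AE p in lborel. norm (bose_density \<beta> p*(\<Sum>v\<in>F. (cmod (L2_inner v (?e p)))^2)) <= norm (bose_density \<beta> p*(LBINT x. h x))"
    using le by (intro AE_I2) (simp add: abs_of_nonneg bose_density_nonneg[OF \<beta> d] sum_nonneg test_functions_nonneg[OF h])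
   show "(%p. bose_density \<beta> p*(\<Sum>v\<in>F. (cmod (L2_inner v (?e p)))^2)) : borel_measurable lborel"
    unfolding L2_inner_def by measurable
  qed
 qed
 also have "... = (2*pi)^DIM('a)*(bose_kernel \<beta> (0::'a)*(LBINT x. h x))"
  by (simp add: integral_bose_density[OF \<beta> d])
 finally show ?thesis by simp
qed

text \<open>Up to \<open>(2 pi)^d\<close>, each diagonal entry is an integral over \<open>p\<close>
  of \<open>bose_density\<close> times a squared coefficient of the wave \<open>?e p\<close>.
  Parseval inside the integral replaces the sum by the squared norm of the wave, which is the
  integral of \<open>h\<close> for every \<open>p\<close>.\<close>

lemma kernel_op_trace:
 assumes B: "orthonormal_basis B" and F: "!!n. finite (F n)" "incseq F" "(\<Union>n. F n) = B"
 shows "(%n. \<Sum>v\<in>F n. Re (L2_inner v (kernel_op \<beta> h v))) ----> bose_kernel \<beta> (0::'a)*(LBINT x. h x)"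
proof -
 note [measurable] = m_h
 let ?e = "%p x. cis (p \<bullet> x)*cor (sqrt (h x))"
 let ?c = "(2*pi)^DIM('a)"
 have on: "orthonormal_set (F n)" for n using B F(3) by (auto simp: orthonormal_basis_iff intro: orthonormal_set_subset)
 have FL: "F n \<subseteq> L2" for n using on[of n] by (simp add: orthonormal_set_def)
 have [measurable]: "u : BM" if "u : F n" for u n using that FL[of n] by auto
 have i: "integrable lborel (%p::'a. bose_density \<beta> p*(LBINT x. h x))"
  by (intro integrable_mult_left fourier_bose_density(1) \<beta> d)
 have "(%n. (LBINT p. bose_density \<beta> p*(\<Sum>v\<in>F n. (cmod (L2_inner v (?e p)))^2)))
  ----> (LBINT p. bose_density \<beta> (p::'a)*(LBINT x. h x))"
 proof (rule integral_dominated_convergence[OF _ _ i])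
  show "AE p in lborel. (%n. bose_density \<beta> p*(\<Sum>v\<in>F n. (cmod (L2_inner v (?e p)))^2)) ----> bose_density \<beta> p*(LBINT x. h x)"
  proof (intro AE_I2 tendsto_mult_left)
   fix p :: 'a
   show "(%n. \<Sum>v\<in>F n. (cmod (L2_inner v (?e p)))^2) ----> (LBINT x. h x)"
    using Parseval[OF B F wave_L2(1)[of p]] unfolding wave_L2(2) .
  qed
  show "AE p in lborel. norm (bose_density \<beta> p*(\<Sum>v\<in>F n. (cmod (L2_inner v (?e p)))^2)) <= bose_density \<beta> p*(LBINT x. h x)" for n
  proof (rule AE_I2)
   fix p :: 'a
   have "(\<Sum>v\<in>F n. (cmod (L2_inner v (?e p)))^2) <= (LBINT x. h x)"
    using Bessel[OF on order_refl F(1) wave_L2(1)] wave_L2(2) by simp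
   then show "norm (bose_density \<beta> p*(\<Sum>v\<in>F n. (cmod (L2_inner v (?e p)))^2)) <= bose_density \<beta> p*(LBINT x. h x)"
    by (simp add: bose_density_nonneg[OF \<beta> d] sum_nonneg mult_left_mono)
  qed
  show "(%p. bose_density \<beta> p*(\<Sum>v\<in>F n. (cmod (L2_inner v (?e p)))^2)) : borel_measurable lborel" for n
   unfolding L2_inner_def by measurable
 qed measurable
 also have "(LBINT p. bose_density \<beta> (p::'a)*(LBINT x. h x)) = ?c*(bose_kernel \<beta> (0::'a)*(LBINT x. h x))"
  by (simp add: integral_bose_density[OF \<beta> d])
 finally have "(%n. ?c*(\<Sum>v\<in>F n. Re (L2_inner v (kernel_op \<beta> h v)))) ----> ?c*(bose_kernel \<beta> (0::'a)*(LBINT x. h x))"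
  unfolding trace_formula[OF FL F(1)] .
 from tendsto_mult_left[OF this, of "1/?c"] show ?thesis by simp
qed

text \<open>Bessel's inequality is applied twice: to the images of the basis vectors, and, for each
  fixed \<open>y\<close>, to the kernel as a function of its other variable.\<close>

lemma kernel_op_hs_le:
 assumes F: "orthonormal_set F" "finite F"
 shows "(\<Sum>u\<in>F. \<Sum>v\<in>F. (cmod (L2_inner u (kernel_op \<beta> h v)))^2) <= kernel_hs \<beta> h"
proof -
 note [measurable] = m_h
 have FL: "v : L2" if "v : F" for v using F that by (auto simp: orthonormal_set_def)
 let ?k = "%y x. cor (sqrt (h x))*cor (bose_kernel \<beta> (y - x))"
 have G: "\<bar>bose_kernel \<beta> z\<bar> <= bose_kernel \<beta> (0::'a)" for z :: 'a
  using bose_kernel_nonneg[OF \<beta> d, of z] bose_kernel_le[OF \<beta> d, of z] by simp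
 have kL: "?k y : L2" for y
 proof -
  have "(%x. cor (bose_kernel \<beta> (y - x))*cor (sqrt (h x))) : L2"
   by (rule L2_bounded_mult[OF sqrt_test_function_in_L2[OF h]]) (measurable, use G in auto)
  then show ?thesis by (simp add: mult.commute)
 qed
 have kn: "(L2_norm (?k y))^2 = (LBINT x. h x*(bose_kernel \<beta> (y - x))^2)" for y
  unfolding L2_norm_sq using test_functions_nonneg[OF h] by (simp add: norm_mult power_mult_distrib)
 have Kv: "kernel_op \<beta> h v y = cor (sqrt (h y))*L2_inner (?k y) v" for v y
  by (simp add: kernel_op_def L2_inner_def mult_ac)
 have Ki: "integrable lborel (%y. (cmod (kernel_op \<beta> h v y))^2)" if "v : F" for v
  by (rule L2_integrable[OF kernel_op_L2(1)[OF \<beta> d h FL[OF that]]])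
 have hi: "integrable lborel (%y. h y*(LBINT x. h x*(bose_kernel \<beta> (y - x))^2))"
 proof (rule bochner_integrable_bound[OF integrable_mult_left[OF test_functions_integrable[OF h]]])
  have "(LBINT x. h x*(bose_kernel \<beta> (y - x))^2) <= (LBINT x. h x*(bose_kernel \<beta> (0::'a))^2)" for y
  proof (rule integral_mono)
   show "integrable lborel (%x. h x*(bose_kernel \<beta> (0::'a))^2)" by (intro integrable_mult_left test_functions_integrable h)
   show le: "h x*(bose_kernel \<beta> (y - x))^2 <= h x*(bose_kernel \<beta> (0::'a))^2" for x
    using G[of "y - x"] test_functions_nonneg[OF h, of x] by (intro mult_left_mono) (auto simp: abs_le_square_iff[symmetric])
   show "integrable lborel (%x. h x*(bose_kernel \<beta> (y - x))^2)"
    by (rule bochner_integrable_bound[OF integrable_mult_left[OF test_functions_integrable[OF h], of "(bose_kernel \<beta> (0::'a))^2"]])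
     (measurable, use le test_functions_nonneg[OF h] in simp)
  qed
  moreover have "0 <= (LBINT x. h x*(bose_kernel \<beta> (y - x))^2)" for y
   using test_functions_nonneg[OF h] by (intro integral_nonneg_AE AE_I2) auto
  ultimately show "AE y in lborel. norm (h y*(LBINT x. h x*(bose_kernel \<beta> (y - x))^2)) <= norm (h y*(LBINT x. h x*(bose_kernel \<beta> (0::'a))^2))"
   using test_functions_nonneg[OF h] by (intro AE_I2) (simp add: abs_mult mult_left_mono del: integral_mult_left_zero integral_mult_left)
 qed measurable
 have "(\<Sum>u\<in>F. \<Sum>v\<in>F. (cmod (L2_inner u (kernel_op \<beta> h v)))^2) = (\<Sum>v\<in>F. \<Sum>u\<in>F. (cmod (L2_inner u (kernel_op \<beta> h v)))^2)"
  by (rule sum.swap)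
 also have "... <= (\<Sum>v\<in>F. (L2_norm (kernel_op \<beta> h v))^2)"
  by (intro sum_mono Bessel[OF F(1) order_refl F(2)] kernel_op_L2(1)[OF \<beta> d h] FL)
 also have "... = (LBINT y. (\<Sum>v\<in>F. (cmod (kernel_op \<beta> h v y))^2))"
  unfolding L2_norm_sq by (rule bochner_integral_sum[symmetric]) (rule Ki)
 also have "... <= (LBINT y. h y*(LBINT x. h x*(bose_kernel \<beta> (y - x))^2))"
 proof (rule integral_mono[OF _ hi])
  fix y
  have "(\<Sum>v\<in>F. (cmod (kernel_op \<beta> h v y))^2) = h y*(\<Sum>v\<in>F. (cmod (L2_inner v (?k y)))^2)"
   unfolding Kv sum_distrib_left
   by (intro sum.cong refl, subst L2_inner_cnj[symmetric]) (simp add: norm_mult power_mult_distrib test_functions_nonneg[OF h])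
  also have "... <= h y*(L2_norm (?k y))^2"
   by (intro mult_left_mono Bessel[OF F(1) order_refl F(2)] kL test_functions_nonneg[OF h])
  finally show "(\<Sum>v\<in>F. (cmod (kernel_op \<beta> h v y))^2) <= h y*(LBINT x. h x*(bose_kernel \<beta> (y - x))^2)"
   unfolding kn .
 qed (use Ki in auto)
 finally show ?thesis unfolding kernel_hs_def .
qed

end

section \<open>The Fredholm determinant\<close>


lemma mat_trace_comm:
 assumes "X : carrier_mat n n" "Y : carrier_mat n n"
 shows "(\<Sum>i<n. (X*Y) $$ (i, i)) = (\<Sum>i<n. (Y*X) $$ (i, i :: nat) :: complex)"
proof -
 have "(\<Sum>i<n. (X*Y) $$ (i, i)) = (\<Sum>i<n. \<Sum>j<n. X $$ (i, j)*Y $$ (j, i))"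
  using assms by (intro sum.cong refl) (auto simp: scalar_prod_def atLeast0LessThan)
 also have "... = (\<Sum>j<n. \<Sum>i<n. Y $$ (j, i)*X $$ (i, j))"
  by (subst sum.swap) (simp add: mult.commute)
 also have "... = (\<Sum>i<n. (Y*X) $$ (i, i))"
  using assms by (intro sum.cong refl) (auto simp: scalar_prod_def atLeast0LessThan)
 finally show ?thesis .
qed

text \<open>Schur triangularization lists the eigenvalues with multiplicity; each is a Rayleigh
  quotient, hence real and in \<open>[0, \<Lambda>]\<close>. Trace, trace of the square and
  determinant are read off the triangular form. The parameter \<open>c\<close> serves two uses:
  \<open>c = 1\<close> gives \<open>det (1 + z A)\<close>, \<open>c = 0\<close> gives
  \<open>det (z A)\<close> and thereby the sign of principal minors.\<close>

lemma psd_matrix_eigenvalues: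
 fixes A :: "nat => nat => complex"
 assumes herm: "!!i j. i < n ==> j < n ==> A j i = cnj (A i j)"
  and form: "!!x :: nat => complex. EX r. (\<Sum>i<n. \<Sum>j<n. cnj (x i)*A i j*x j) = cor r
    & 0 <= r & r <= \<Lambda>*(\<Sum>i<n. (cmod (x i))^2)"
 shows "EX l :: real list. (ALL a:set l. 0 <= a & a <= \<Lambda>)
  & sum_list l = (\<Sum>i<n. Re (A i i))
  & sum_list (map (%a. a^2) l) = (\<Sum>i<n. \<Sum>j<n. (cmod (A i j))^2)
  & (ALL c z. det_on {..<n} (%i j. (if i = j then c else 0) + z*A i j) = (\<Prod>a\<leftarrow>l. c + z*cor a))"
proof -
 define M where "M = mat n n (%(i, j). A i j)"
 have M: "M : carrier_mat n n" by (simp add: M_def)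
 have Mij: "M $$ (i, j) = A i j" if "i < n" "j < n" for i j using that by (simp add: M_def)
 obtain as where as: "char_poly M = (\<Prod>a\<leftarrow>as. [:- a, 1:])" and len: "length as = n"
  using char_poly_factorized[OF M] by blast
 obtain B P Q where BPQ: "schur_decomposition M as = (B, P, Q)" by (cases "schur_decomposition M as")
 have sim: "similar_mat_wit M B P Q" and ut: "upper_triangular B" and diag: "diag_mat B = as"
  using schur_decomposition[OF M as BPQ] by auto
 have B: "B : carrier_mat n n" and P: "P : carrier_mat n n" and Q: "Q : carrier_mat n n"
  and PQ: "P*Q = 1\<^sub>m n" and QP: "Q*P = 1\<^sub>m n" and MPBQ: "M = P*B*Q"
  using similar_mat_witD2[OF M sim] by auto
 have Bii: "B $$ (i, i) = as ! i" if "i < n" for i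
  using diag that B by (auto simp: diag_mat_def)
 have real: "EX r. a = cor r & 0 <= r & r <= \<Lambda>" if a: "a : set as" for a
 proof -
  have "poly (char_poly M) a = 0"
   unfolding as using a by (induction as) auto
  then obtain v where v: "v : carrier_vec n" "v ~= 0\<^sub>v n" "M *\<^sub>v v = a \<cdot>\<^sub>v v"
   using eigenvalue_root_char_poly[OF M] M unfolding eigenvalue_def eigenvector_def by auto
  let ?N = "\<Sum>i<n. (cmod (vec_index v i))^2"
  have "EX i<n. vec_index v i ~= 0" using v by (metis carrier_vecD eq_vecI index_zero_vec)
  then have N: "?N > 0" by (intro sum_pos2[of _ "SOME i. i < n & vec_index v i ~= 0"]) (use someI_ex[of "%i. i < n & vec_index v i ~= 0"] in auto)
  obtain r where r: "(\<Sum>i<n. \<Sum>j<n. cnj (vec_index v i)*A i j * vec_index v j) = cor r" "0 <= r" "r <= \<Lambda>*?N"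
   using form[of "%i. vec_index v i"] by blast
  have "(\<Sum>i<n. \<Sum>j<n. cnj (vec_index v i)*A i j * vec_index v j) = (\<Sum>i<n. cnj (vec_index v i) * vec_index (M *\<^sub>v v) i)"
  proof (intro sum.cong refl)
   fix i assume "i : {..<n}"
   then have i: "i < n" by simp
   have "vec_index (M *\<^sub>v v) i = (\<Sum>j<n. A i j * vec_index v j)"
    using i M v(1) by (auto simp: scalar_prod_def atLeast0LessThan M_def intro!: sum.cong)
   then show "(\<Sum>j<n. cnj (vec_index v i)*A i j * vec_index v j) = cnj (vec_index v i) * vec_index (M *\<^sub>v v) i"
    by (simp add: sum_distrib_left mult.assoc)
  qed
  also have "... = (\<Sum>i<n. a*cor ((cmod (vec_index v i))^2))"
   unfolding v(3) using v(1) by (intro sum.cong refl) (subst complex_norm_square, simp add: mult_ac)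
  also have "... = a*cor ?N" by (simp add: sum_distrib_left)
  finally have "a*cor ?N = cor r" using r(1) by simp
  then have "a = cor (r/?N)" using N by (simp add: eq_divide_eq del: of_real_sum)
  moreover have "0 <= r/?N" "r/?N <= \<Lambda>" using r N by (auto simp: divide_le_eq)
  ultimately show ?thesis by blast
 qed
 define l where "l = map Re as"
 have las: "as = map cor l"
 proof -
  have "(cor \<circ> Re) a = a" if "a : set as" for a using real[OF that] by auto
  then show ?thesis unfolding l_def map_map by (intro map_idI[symmetric])
 qed
 have sum_as: "(\<Sum>i<n. g (as ! i)) = sum_list (map g as)" for g :: "complex => complex"
  using len by (simp add: sum_list_sum_nth atLeast0LessThan)
 have trM: "(\<Sum>i<n. M $$ (i, i)) = sum_list as"
 proof -
  have "(\<Sum>i<n. M $$ (i, i)) = (\<Sum>i<n. (Q*(P*B)) $$ (i, i))"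
   unfolding MPBQ by (rule mat_trace_comm) (use P B Q in auto)
  also have "Q*(P*B) = B" using P Q B QP by (simp add: assoc_mult_mat[symmetric, of Q n n P n B n])
  also have "(\<Sum>i<n. B $$ (i, i)) = (\<Sum>i<n. as ! i)" by (intro sum.cong refl) (simp add: Bii)
  finally show ?thesis using sum_as[of id] by simp
 qed
 have trM2: "(\<Sum>i<n. (M*M) $$ (i, i)) = sum_list (map (%a. a^2) as)"
 proof -
  have "M*M = P*(B*B)*Q"
  proof -
   have "M*M = P*B*(Q*(P*(B*Q)))"
    unfolding MPBQ using P B Q by (simp add: assoc_mult_mat[of _ n n _ n _ n])
   also have "Q*(P*(B*Q)) = B*Q"
    using P B Q QP by (simp add: assoc_mult_mat[symmetric, of Q n n P n "B*Q" n])
   also have "P*B*(B*Q) = P*(B*B)*Q"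
    using P B Q by (simp add: assoc_mult_mat[of _ n n _ n _ n])
   finally show ?thesis .
  qed
  then have "(\<Sum>i<n. (M*M) $$ (i, i)) = (\<Sum>i<n. (Q*(P*(B*B))) $$ (i, i))"
   by (simp only:) (rule mat_trace_comm, use P B Q in auto)
  also have "Q*(P*(B*B)) = B*B" using P Q B QP by (simp add: assoc_mult_mat[symmetric, of Q n n P n "B*B" n])
  also have "(\<Sum>i<n. (B*B) $$ (i, i)) = (\<Sum>i<n. (as ! i)^2)"
  proof (intro sum.cong refl)
   fix i assume "i : {..<n}"
   then have i: "i < n" by simp
   have "(B*B) $$ (i, i) = (\<Sum>k<n. B $$ (i, k)*B $$ (k, i))"
    using i B by (auto simp: scalar_prod_def atLeast0LessThan)
   also have "... = (\<Sum>k<n. if k = i then (B $$ (i, i))\<^sup>2 else 0)"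
   proof (intro sum.cong refl)
    fix k assume "k : {..<n}"
    then show "B $$ (i, k)*B $$ (k, i) = (if k = i then (B $$ (i, i))\<^sup>2 else 0)"
     using upper_triangularD[OF ut, of k i] upper_triangularD[OF ut, of i k] B i
     by (cases "k = i"; cases "k < i") (auto simp: power2_eq_square)
   qed
   finally show "(B*B) $$ (i, i) = (as ! i)^2" using i by (simp add: Bii)
  qed
  finally show ?thesis using sum_as[of "%a. a^2"] by simp
 qed
 have "cor (\<Sum>i<n. Re (A i i)) = cor (sum_list l)"
 proof -
  have "cor (Re (A i i)) = M $$ (i, i)" if "i < n" for i
   using herm[OF that that] that by (auto simp: Mij complex_eq_iff)
  then have "cor (\<Sum>i<n. Re (A i i)) = sum_list as"
   unfolding trM[symmetric] of_real_sum by (intro sum.cong refl) simp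
  also have "... = cor (sum_list l)" unfolding las by (induction l) auto
  finally show ?thesis .
 qed
 then have 1: "sum_list l = (\<Sum>i<n. Re (A i i))" unfolding of_real_eq_iff by simp
 have "cor (\<Sum>i<n. \<Sum>j<n. (cmod (A i j))^2) = cor (sum_list (map (%a. a^2) l))"
 proof -
  have "cor (\<Sum>i<n. \<Sum>j<n. (cmod (A i j))^2) = (\<Sum>i<n. (M*M) $$ (i, i))"
   unfolding of_real_sum
  proof (intro sum.cong refl)
   fix i assume "i : {..<n}"
   then have i: "i < n" by simp
   have "(M*M) $$ (i, i) = (\<Sum>j<n. A i j*A j i)"
    using i M by (auto simp: scalar_prod_def atLeast0LessThan M_def intro!: sum.cong)
   also have "... = (\<Sum>j<n. cor ((cmod (A i j))^2))"
   proof (intro sum.cong refl)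
    fix j assume "j : {..<n}"
    then have "A j i = cnj (A i j)" using herm[of i j] i by simp
    then show "A i j*A j i = cor ((cmod (A i j))^2)"
     by (subst complex_norm_square) simp
   qed
   finally show "(\<Sum>j<n. cor ((cmod (A i j))^2)) = (M*M) $$ (i, i)" by simp
  qed
  also have "... = sum_list (map (%a. a^2) as)" by (rule trM2)
  also have "... = cor (sum_list (map (%a. a^2) l))" unfolding las by (induction l) auto
  finally show ?thesis .
 qed
 then have 2: "sum_list (map (%a. a^2) l) = (\<Sum>i<n. \<Sum>j<n. (cmod (A i j))^2)" unfolding of_real_eq_iff by simp
 have 3: "det_on {..<n} (%i j. (if i = j then c else 0) + z*A i j) = (\<Prod>a\<leftarrow>l. c + z*cor a)" for c z
 proof -
  have "det_on {..<n} (%i j. (if i = j then c else 0) + z*A i j) = det (c \<cdot>\<^sub>m 1\<^sub>m n + z \<cdot>\<^sub>m M)"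
   unfolding det_on_def
  proof (subst det_def'[of _ n])
   show "c \<cdot>\<^sub>m 1\<^sub>m n + z \<cdot>\<^sub>m M : carrier_mat n n" using M by simp
   show "(\<Sum>\<pi> | \<pi> permutes {..<n}. of_int (sign \<pi>)*(\<Prod>i\<in>{..<n}. (if i = \<pi> i then c else 0) + z*A i (\<pi> i)))
    = (\<Sum>p | p permutes {0..<n}. signof p*(\<Prod>i = 0..<n. (c \<cdot>\<^sub>m 1\<^sub>m n + z \<cdot>\<^sub>m M) $$ (i, p i)))"
    unfolding atLeast0LessThan
   proof (intro sum.cong refl arg_cong2[where f = "(*)"] prod.cong)
    fix p i assume "p : {p. p permutes {..<n}}" "i : {..<n}"
    then have "i < n" "p i < n" using permutes_in_image[of p "{..<n}" i] by auto
    then show "(if i = p i then c else 0) + z*A i (p i) = (c \<cdot>\<^sub>m 1\<^sub>m n + z \<cdot>\<^sub>m M) $$ (i, p i)"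
     using M by (auto simp: Mij)
   qed
  qed
  also have "c \<cdot>\<^sub>m 1\<^sub>m n + z \<cdot>\<^sub>m M = P*(c \<cdot>\<^sub>m 1\<^sub>m n + z \<cdot>\<^sub>m B)*Q"
  proof -
   have "P*(c \<cdot>\<^sub>m 1\<^sub>m n + z \<cdot>\<^sub>m B)*Q = P*(c \<cdot>\<^sub>m 1\<^sub>m n)*Q + P*(z \<cdot>\<^sub>m B)*Q"
   proof -
    have "P*(c \<cdot>\<^sub>m 1\<^sub>m n + z \<cdot>\<^sub>m B) = P*(c \<cdot>\<^sub>m 1\<^sub>m n) + P*(z \<cdot>\<^sub>m B)"
     by (rule mult_add_distrib_mat[OF P]) (use B in auto)
    moreover have "(P*(c \<cdot>\<^sub>m 1\<^sub>m n) + P*(z \<cdot>\<^sub>m B))*Q = P*(c \<cdot>\<^sub>m 1\<^sub>m n)*Q + P*(z \<cdot>\<^sub>m B)*Q"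
     by (rule add_mult_distrib_mat) (use P B Q in auto)
    ultimately show ?thesis by simp
   qed
   also have "P*(z \<cdot>\<^sub>m B) = z \<cdot>\<^sub>m (P*B)" by (rule mult_smult_distrib[OF P B])
   also have "z \<cdot>\<^sub>m (P*B)*Q = z \<cdot>\<^sub>m (P*B*Q)" by (rule mult_smult_assoc_mat) (use P B Q in auto)
   also have "P*(c \<cdot>\<^sub>m 1\<^sub>m n)*Q = c \<cdot>\<^sub>m 1\<^sub>m n"
    using mult_smult_distrib[OF P one_carrier_mat, of c] mult_smult_assoc_mat[OF P Q, of c] P PQ by simp
   finally show ?thesis using MPBQ by simp
  qed
  also have "det (P*(c \<cdot>\<^sub>m 1\<^sub>m n + z \<cdot>\<^sub>m B)*Q) = det (c \<cdot>\<^sub>m 1\<^sub>m n + z \<cdot>\<^sub>m B)"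
  proof -
   have "det P*det Q = 1" using det_mult[OF P Q] PQ by simp
   then show ?thesis using P Q B by (simp add: det_mult[of _ n])
  qed
  also have "... = prod_list (diag_mat (c \<cdot>\<^sub>m 1\<^sub>m n + z \<cdot>\<^sub>m B))"
  proof (rule det_upper_triangular)
   show "upper_triangular (c \<cdot>\<^sub>m 1\<^sub>m n + z \<cdot>\<^sub>m B)"
    using ut B by (auto intro!: upper_triangularI dest: upper_triangularD)
  qed (use B in auto)
  also have "diag_mat (c \<cdot>\<^sub>m 1\<^sub>m n + z \<cdot>\<^sub>m B) = map (%a. c + z*a) as"
   using B len by (intro nth_equalityI) (auto simp: diag_mat_def Bii)
  finally show ?thesis unfolding las by (simp add: o_def)
 qed
 have 4: "ALL a:set l. 0 <= a & a <= \<Lambda>" using real by (force simp: l_def)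
 from 1 2 3 4 show ?thesis by blast
qed

lemma det_on_reindex:
 assumes e: "bij_betw e I F" and fin: "finite I"
 shows "det_on F A = det_on I (%i j. A (e i) (e j))"
proof -
 have finF: "finite F" using e fin bij_betw_finite by blast
 have inj: "inj_on e I" and im: "e ` I = F" using e by (auto simp: bij_betw_def)
 have e': "bij_betw (inv_into I e) F I" by (rule bij_betw_inv_into[OF e])
 have inv: "x : I ==> inv_into I e (e x) = x" "y : F ==> e (inv_into I e y) = y" for x y
  using inj im by (auto simp: f_inv_into_f)
 show ?thesis
  unfolding det_on_def
 proof (rule sum.reindex_bij_witness[symmetric, where i = "map_permutation F (inv_into I e)" and j = "map_permutation I e"])
  fix p assume "p : {\<pi>. \<pi> permutes I}"
  then have p: "p permutes I" by simp
  show "map_permutation I e p : {\<pi>. \<pi> permutes F}"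
   using map_permutation_permutes[OF e p] by simp
  show "map_permutation F (inv_into I e) (map_permutation I e p) = p"
   by (rule map_permutation_compose_inv[OF e p]) (use inv in auto)
  have "(\<Prod>i\<in>F. A i (map_permutation I e p i)) = (\<Prod>i\<in>I. A (e i) (map_permutation I e p (e i)))"
   unfolding im[symmetric] by (rule prod.reindex[OF inj, unfolded o_def])
  also have "... = (\<Prod>i\<in>I. A (e i) (e (p i)))"
   by (intro prod.cong refl) (simp add: map_permutation_apply[OF inj])
  finally show "of_int (sign (map_permutation I e p))*(\<Prod>i\<in>F. A i (map_permutation I e p i)) = of_int (sign p)*(\<Prod>i\<in>I. A (e i) (e (p i)))"
   by (simp add: sign_map_permutation[OF inj p fin])
 next
  fix p assume "p : {\<pi>. \<pi> permutes F}"
  then have p: "p permutes F" by simp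
  show "map_permutation F (inv_into I e) p : {\<pi>. \<pi> permutes I}"
   using map_permutation_permutes[OF e' p] by simp
  show "map_permutation I e (map_permutation F (inv_into I e) p) = p"
   by (rule map_permutation_compose_inv[OF e' p]) (use inv in auto)
 qed
qed

text \<open>When the products of \<open>\<delta>_ij + A_ij\<close> are expanded, \<open>S\<close>
  collects the positions where the factor from \<open>A\<close> is taken; a permutation survives
  only if it fixes every point outside \<open>S\<close>.\<close>

lemma sum_principal_minors:
 assumes fin: "finite F"
 shows "(\<Sum>S\<in>Pow F. det_on S A) = det_on F (%i j. (if i = j then 1 else 0) + A i j)"
proof -
 have "det_on F (%i j. (if i = j then 1 else 0) + A i j)
  = (\<Sum>\<pi> | \<pi> permutes F. \<Sum>S\<in>Pow F. of_int (sign \<pi>)*((\<Prod>i\<in>S. A i (\<pi> i))*(\<Prod>i\<in>F - S. if i = \<pi> i then 1 else 0)))"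
  unfolding det_on_def
  by (intro sum.cong refl, subst add.commute, subst prod_add[OF fin]) (simp add: sum_distrib_left)
 also have "... = (\<Sum>S\<in>Pow F. \<Sum>\<pi> | \<pi> permutes F. of_int (sign \<pi>)*((\<Prod>i\<in>S. A i (\<pi> i))*(\<Prod>i\<in>F - S. if i = \<pi> i then 1 else 0)))"
  by (rule sum.swap)
 also have "... = (\<Sum>S\<in>Pow F. det_on S A)"
 proof (intro sum.cong refl)
  fix S assume "S : Pow F"
  then have S: "S \<subseteq> F" by simp
  have "det_on S A = (\<Sum>\<pi> | \<pi> permutes S. of_int (sign \<pi>)*((\<Prod>i\<in>S. A i (\<pi> i))*(\<Prod>i\<in>F - S. if i = \<pi> i then 1 else 0)))"
   unfolding det_on_def
  proof (intro sum.cong refl)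
   fix \<pi> assume "\<pi> : {\<pi>. \<pi> permutes S}"
   then have "\<pi> i = i" if "i : F - S" for i using that by (auto simp: permutes_not_in)
   then have "(\<Prod>i\<in>F - S. if i = \<pi> i then 1 else 0 :: complex) = 1" by (intro prod.neutral) auto
   then show "of_int (sign \<pi>)*(\<Prod>i\<in>S. A i (\<pi> i)) = of_int (sign \<pi>)*((\<Prod>i\<in>S. A i (\<pi> i))*(\<Prod>i\<in>F - S. if i = \<pi> i then 1 else 0))"
    by simp
  qed
  also have "... = (\<Sum>\<pi> | \<pi> permutes F. of_int (sign \<pi>)*((\<Prod>i\<in>S. A i (\<pi> i))*(\<Prod>i\<in>F - S. if i = \<pi> i then 1 else 0)))"
  proof (rule sum.mono_neutral_left)
   show "finite {\<pi>. \<pi> permutes F}" by (rule finite_permutations[OF fin])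
   show "{\<pi>. \<pi> permutes S} \<subseteq> {\<pi>. \<pi> permutes F}" using S by (auto intro: permutes_subset)
   show "ALL \<pi>:{\<pi>. \<pi> permutes F} - {\<pi>. \<pi> permutes S}. of_int (sign \<pi>)*((\<Prod>i\<in>S. A i (\<pi> i))*(\<Prod>i\<in>F - S. if i = \<pi> i then 1 else 0)) = 0"
   proof
    fix \<pi> assume "\<pi> : {\<pi>. \<pi> permutes F} - {\<pi>. \<pi> permutes S}"
    then have "EX i:F - S. \<pi> i ~= i" using permutes_superset[of \<pi> F S] by auto
    then obtain i where "i : F - S" "\<pi> i ~= i" by blast
    then have "(\<Prod>i\<in>F - S. if i = \<pi> i then 1 else 0 :: complex) = 0"
     using fin by (intro prod_zero bexI[of _ i]) auto
    then show "of_int (sign \<pi>)*((\<Prod>i\<in>S. A i (\<pi> i))*(\<Prod>i\<in>F - S. if i = \<pi> i then 1 else 0)) = 0" by simp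
   qed
  qed
  finally show "(\<Sum>\<pi> | \<pi> permutes F. of_int (sign \<pi>)*((\<Prod>i\<in>S. A i (\<pi> i))*(\<Prod>i\<in>F - S. if i = \<pi> i then 1 else 0))) = det_on S A"
   by simp
 qed
 finally show ?thesis by simp
qed

lemma kernel_op_scale:
 assumes "z >= 0"
 shows "kernel_op \<beta> (%x. z*h x) v = (%y. cor z*kernel_op \<beta> h v y)"
proof
 fix y
 have "kernel_op \<beta> (%x. z*h x) v y = cor (sqrt z)*cor (sqrt z)*kernel_op \<beta> h v y"
 proof -
  have eq: "(%x. (cor (sqrt (z*h x)) * v x)*cor (bose_kernel \<beta> (y - x)))
   = (%x. cor (sqrt z)*((cor (sqrt (h x)) * v x)*cor (bose_kernel \<beta> (y - x))))"
   by (simp add: real_sqrt_mult mult.assoc)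
  show ?thesis unfolding kernel_op_def eq integral_mult_right_zero by (simp add: real_sqrt_mult)
 qed
 then show "kernel_op \<beta> (%x. z*h x) v y = cor z*kernel_op \<beta> h v y"
  using assms by (simp flip: of_real_mult)
qed

lemma prod_list_le_exp:
 "(!!a. a : set l ==> 0 <= a) ==> 0 <= z ==> (\<Prod>a\<leftarrow>l. 1 + z*a) <= exp (z * sum_list l :: real)"
proof (induction l)
 case (Cons a l)
 have "(1 + z*a)*(\<Prod>a\<leftarrow>l. 1 + z*a) <= exp (z*a)*exp (z * sum_list l)"
  using Cons by (intro mult_mono exp_ge_add_one_self prod_list_nonneg) (auto intro!: add_nonneg_nonneg)
 then show ?case by (simp add: distrib_left exp_add)
qed auto

context
 fixes \<beta> :: real and h :: "'a::euclidean_space => real" and \<Lambda> :: real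
 assumes \<beta>: "\<beta> > 0" and d: "DIM('a) > 2" and h: "h : test_functions"
  and \<Lambda>: "!!v. v : L2 ==> Re (L2_inner v (kernel_op \<beta> h v)) <= \<Lambda>*(L2_norm v)^2"
begin

lemma compression_eigenvalues:
 assumes F: "orthonormal_set F" "finite F"
 shows "EX l :: real list. (ALL a:set l. 0 <= a & a <= \<Lambda>)
  & sum_list l = (\<Sum>u\<in>F. Re (L2_inner u (kernel_op \<beta> h u)))
  & sum_list (map (%a. a^2) l) = (\<Sum>u\<in>F. \<Sum>v\<in>F. (cmod (L2_inner u (kernel_op \<beta> h v)))^2)
  & (ALL c z. det_on F (%u v. (if u = v then c else 0) + z*L2_inner u (kernel_op \<beta> h v)) = (\<Prod>a\<leftarrow>l. c + z*cor a))"
proof -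
 obtain e where e: "bij_betw e {..<card F} F"
  using ex_bij_betw_nat_finite[OF F(2)] by (auto simp: atLeast0LessThan)
 let ?n = "card F"
 let ?A = "%i j. L2_inner (e i) (kernel_op \<beta> h (e j))"
 have eF: "e i : F" if "i < ?n" for i using e that by (auto simp: bij_betw_def)
 have eL: "e i : L2" if "i < ?n" for i using eF[OF that] F by (auto simp: orthonormal_set_def)
 have inj: "inj_on e {..<?n}" and im: "e ` {..<?n} = F" using e by (auto simp: bij_betw_def)
 have "EX l :: real list. (ALL a:set l. 0 <= a & a <= \<Lambda>)
  & sum_list l = (\<Sum>i<?n. Re (?A i i))
  & sum_list (map (%a. a^2) l) = (\<Sum>i<?n. \<Sum>j<?n. (cmod (?A i j))^2)
  & (ALL c z. det_on {..<?n} (%i j. (if i = j then c else 0) + z*?A i j) = (\<Prod>a\<leftarrow>l. c + z*cor a))"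
 proof (rule psd_matrix_eigenvalues)
  show "?A j i = cnj (?A i j)" if "i < ?n" "j < ?n" for i j
   by (simp add: L2_inner_cnj kernel_op_hermitian[OF \<beta> d h eL[OF that(2)] eL[OF that(1)]])
  fix x :: "nat => complex"
  define v where "v = (%y. \<Sum>i<?n. x i*e i y)"
  have vL: "v : L2" unfolding v_def using eL by (intro L2_sum L2_cmult) auto
  have KL: "kernel_op \<beta> h u : L2" if "u : L2" for u by (rule kernel_op_L2(1)[OF \<beta> d h that])
  have 1: "L2_inner v w = (\<Sum>i<?n. cnj (x i)*L2_inner (e i) w)" if w: "w : L2" for w
   unfolding v_def using w eL by (subst L2_inner_sum_left) (auto simp: L2_inner_cmult_left)
  have 2: "L2_inner w v = (\<Sum>j<?n. x j*L2_inner w (e j))" if w: "w : L2" for w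
   unfolding v_def using w eL by (subst L2_inner_sum_right) (auto simp: L2_inner_cmult_right)
  have "L2_inner v (kernel_op \<beta> h v) = (\<Sum>i<?n. cnj (x i)*L2_inner (kernel_op \<beta> h (e i)) v)"
   unfolding 1[OF KL[OF vL]] by (intro sum.cong refl) (simp add: kernel_op_hermitian[OF \<beta> d h eL vL])
  also have "... = (\<Sum>i<?n. cnj (x i)*(\<Sum>j<?n. x j*?A i j))"
   by (intro sum.cong refl arg_cong2[where f = "(*)"]) (simp add: 2 KL eL kernel_op_hermitian[OF \<beta> d h eL eL])
  also have "... = (\<Sum>i<?n. \<Sum>j<?n. cnj (x i)*?A i j*x j)"
   by (simp add: sum_distrib_left mult_ac)
  finally have eq: "(\<Sum>i<?n. \<Sum>j<?n. cnj (x i)*?A i j*x j) = L2_inner v (kernel_op \<beta> h v)" by simp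
  have "cor ((L2_norm v)^2) = (\<Sum>i<?n. cnj (x i)*L2_inner (e i) v)"
   unfolding L2_inner_self[symmetric] by (rule 1[OF vL])
  also have "... = (\<Sum>i<?n. cor ((cmod (x i))^2))"
  proof (intro sum.cong refl)
   fix i assume i: "i : {..<?n}"
   have "L2_inner (e i) v = (\<Sum>j<?n. x j*(if i = j then 1 else 0))"
    unfolding 2[OF eL[OF i[simplified]]]
   proof (intro sum.cong refl arg_cong2[where f = "(*)"])
    fix j assume j: "j : {..<?n}"
    have "e i = e j \<longleftrightarrow> i = j" using inj_on_eq_iff[OF inj i j] .
    then show "L2_inner (e i) (e j) = (if i = j then 1 else 0)"
     using F(1) eF i j by (simp add: orthonormal_set_def)
   qed
   also have "... = x i" using i by (simp add: if_distrib cong: if_cong)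
   finally show "cnj (x i)*L2_inner (e i) v = cor ((cmod (x i))^2)"
    by (subst complex_norm_square) (simp add: mult.commute)
  qed
  finally have n: "(L2_norm v)^2 = (\<Sum>i<?n. (cmod (x i))^2)" unfolding of_real_sum[symmetric] of_real_eq_iff .
  show "EX r. (\<Sum>i<?n. \<Sum>j<?n. cnj (x i)*?A i j*x j) = cor r
    & 0 <= r & r <= \<Lambda>*(\<Sum>i<?n. (cmod (x i))^2)"
   unfolding eq n[symmetric] using kernel_op_psd[OF \<beta> d h vL] \<Lambda>[OF vL] by blast
 qed
 moreover have "(\<Sum>i<?n. Re (?A i i)) = (\<Sum>u\<in>F. Re (L2_inner u (kernel_op \<beta> h u)))"
  by (rule sum.reindex_bij_betw[OF e])
 moreover have "(\<Sum>i<?n. \<Sum>j<?n. (cmod (?A i j))^2) = (\<Sum>u\<in>F. \<Sum>v\<in>F. (cmod (L2_inner u (kernel_op \<beta> h v)))^2)"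
  by (subst sum.reindex_bij_betw[OF e, of "%u. \<Sum>v\<in>F. (cmod (L2_inner u (kernel_op \<beta> h v)))^2", symmetric])
   (intro sum.cong refl sum.reindex_bij_betw[OF e])
 moreover have "det_on F (%u v. (if u = v then c else 0) + z*L2_inner u (kernel_op \<beta> h v))
  = det_on {..<?n} (%i j. (if i = j then c else 0) + z*?A i j)" for c z
  unfolding det_on_reindex[OF e finite_lessThan, of "%u v. (if u = v then c else 0) + z*L2_inner u (kernel_op \<beta> h v)"]
  unfolding det_on_def
 proof (intro sum.cong refl arg_cong2[where f = "(*)"] prod.cong)
  fix \<pi> i assume "\<pi> : {\<pi>. \<pi> permutes {..<?n}}" and i: "i : {..<?n}"
  then have "\<pi> i : {..<?n}" by (simp only: mem_Collect_eq permutes_in_image)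
  then have "e i = e (\<pi> i) \<longleftrightarrow> i = \<pi> i" using inj_on_eq_iff[OF inj i] by blast
  then show "(if e i = e (\<pi> i) then c else 0) + z*L2_inner (e i) (kernel_op \<beta> h (e (\<pi> i)))
   = (if i = \<pi> i then c else 0) + z*?A i (\<pi> i)" by simp
 qed
 ultimately show ?thesis by simp
qed

text \<open>By positivity all principal minors are nonnegative, so the infinite sum is the limit
  along an exhaustion of the basis, and the partial sums are determinants of compressions. Replacing
  \<open>h\<close> by \<open>z h\<close> multiplies the matrices by \<open>z\<close>; hence one
  sequence of eigenvalue lists serves all \<open>z >= 0\<close>.\<close>

theorem fredholm_det_limit:
 shows "EX l :: nat => real list. (ALL n. ALL a:set (l n). 0 <= a & a <= \<Lambda>)
  & (ALL n. sum_list (l n) <= bose_kernel \<beta> (0::'a)*(LBINT x. h x))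
  & (%n. sum_list (l n)) ----> bose_kernel \<beta> (0::'a)*(LBINT x. h x)
  & (ALL n. sum_list (map (%a. a^2) (l n)) <= kernel_hs \<beta> h)
  & (ALL z g. 0 <= z --> g : test_functions --> (ALL x. 1 - exp (- g x) = z*h x) -->
    (EX D. fredholm_det (K_op \<beta> g) = cor D & (%n. \<Prod>a\<leftarrow>l n. 1 + z*a) ----> D))"
proof -
 \<comment> \<open>Literally the choice made in the definition of \<open>fredholm_det\<close>, so
   that the value there can be computed.\<close>
 define B :: "('a => complex) set" where "B = (SOME B. orthonormal_basis B)"
 have B: "orthonormal_basis B" unfolding B_def by (rule someI_ex[OF orthonormal_basis_exists])
 then have on: "orthonormal_set B" by (simp add: orthonormal_basis_iff)
 obtain f :: "('a => complex) => nat" where f: "inj_on f B"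
  using orthonormal_set_countable[OF on] by (auto simp: countable_def)
 define F where "F = (%n. {u:B. f u < n})"
 have Ffin: "finite (F n)" for n
 proof (rule finite_imageD)
  show "finite (f ` F n)" by (rule finite_subset[of _ "{..<n}"]) (auto simp: F_def)
  show "inj_on f (F n)" by (rule inj_on_subset[OF f]) (auto simp: F_def)
 qed
 have Finc: "incseq F" by (auto simp: F_def incseq_def)
 have Fun: "(\<Union>n. F n) = B" by (auto simp: F_def)
 have FB: "F n \<subseteq> B" for n by (auto simp: F_def)
 have Fon: "orthonormal_set (F n)" for n by (rule orthonormal_set_subset[OF on FB])
 define P where "P = (%F (l :: real list). (ALL a:set l. 0 <= a & a <= \<Lambda>)
  & sum_list l = (\<Sum>u\<in>F. Re (L2_inner u (kernel_op \<beta> h u)))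
  & sum_list (map (%a. a^2) l) = (\<Sum>u\<in>F. \<Sum>v\<in>F. (cmod (L2_inner u (kernel_op \<beta> h v)))^2)
  & (ALL c z. det_on F (%u v. (if u = v then c else 0) + z*L2_inner u (kernel_op \<beta> h v)) = (\<Prod>a\<leftarrow>l. c + z*cor a)))"
 have ex: "EX l. P F l" if "orthonormal_set F" "finite F" for F
  unfolding P_def by (rule compression_eigenvalues[OF that])
 obtain l where l: "!!n. P (F n) (l n)" using ex[OF Fon Ffin] by metis
 have l1: "ALL a:set (l n). 0 <= a & a <= \<Lambda>"
  and l2: "sum_list (l n) = (\<Sum>u\<in>F n. Re (L2_inner u (kernel_op \<beta> h u)))"
  and l3: "sum_list (map (%a. a^2) (l n)) = (\<Sum>u\<in>F n. \<Sum>v\<in>F n. (cmod (L2_inner u (kernel_op \<beta> h v)))^2)"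
  and l4: "det_on (F n) (%u v. (if u = v then c else 0) + z*L2_inner u (kernel_op \<beta> h v)) = (\<Prod>a\<leftarrow>l n. c + z*cor a)"
  for n c z using l[of n] unfolding P_def by blast+
 have tr: "sum_list (l n) <= bose_kernel \<beta> (0::'a)*(LBINT x. h x)" for n
  unfolding l2 by (rule kernel_op_trace_le[OF \<beta> d h Fon Ffin])
 have "EX D. fredholm_det (K_op \<beta> g) = cor D & (%n. \<Prod>a\<leftarrow>l n. 1 + z*a) ----> D"
  if z: "0 <= z" and g: "g : test_functions" and gh: "ALL x. 1 - exp (- g x) = z*h x" for z g
 proof -
  let ?A = "%u v. L2_inner u (K_op \<beta> g v)"
  have A: "?A u v = cor z*L2_inner u (kernel_op \<beta> h v)" if "u : B" "v : B" for u v
  proof -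
   have uL: "u : L2" "v : L2" using that on by (auto simp: orthonormal_set_def)
   note K = K_op_eq_kernel_op[OF \<beta> d g uL(2)]
   have "?A u v = L2_inner u (kernel_op \<beta> (%x. 1 - exp (- g x)) v)"
    using K uL kernel_op_L2(1)[OF \<beta> d one_minus_exp_test[OF g] uL(2)] by (intro L2_inner_cong_AE) auto
   then show ?thesis using gh z by (simp add: kernel_op_scale L2_inner_cmult_right)
  qed
  define dS where "dS = (%S. Re (det_on S ?A))"
  define \<S> where "\<S> = {S. finite S & S \<subseteq> B}"
  have dS: "det_on S ?A = cor (dS S)" "0 <= dS S" if "S : \<S>" for S
  proof -
   have S: "orthonormal_set S" "finite S" "S \<subseteq> B" using that orthonormal_set_subset[OF on] by (auto simp: \<S>_def)
   obtain m where m: "P S m" using ex[OF S(1,2)] by blast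
   have "det_on S ?A = det_on S (%u v. (if u = v then 0 else 0) + cor z*L2_inner u (kernel_op \<beta> h v))"
    unfolding det_on_def
   proof (intro sum.cong refl arg_cong2[where f = "(*)"] prod.cong)
    fix \<pi> i assume "\<pi> : {\<pi>. \<pi> permutes S}" "i : S"
    then have "\<pi> i : S" "i : S" by (auto simp: permutes_in_image)
    then show "?A i (\<pi> i) = (if i = \<pi> i then 0 else 0) + cor z*L2_inner i (kernel_op \<beta> h (\<pi> i))"
     using A S(3) by auto
   qed
   also have "... = (\<Prod>a\<leftarrow>m. 0 + cor z*cor a)"
    using m unfolding P_def by blast
   also have "... = cor (\<Prod>a\<leftarrow>m. z*a)"
    by (induction m) auto
   finally have *: "det_on S ?A = cor (\<Prod>a\<leftarrow>m. z*a)" .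
   have "0 <= (\<Prod>a\<leftarrow>m. z*a)" using m z by (intro prod_list_nonneg) (auto simp: P_def)
   with * show "det_on S ?A = cor (dS S)" "0 <= dS S" by (auto simp: dS_def)
  qed
  have sumF: "(\<Sum>S\<in>Pow (F n). dS S) = (\<Prod>a\<leftarrow>l n. 1 + z*a)" for n
  proof -
   have sub: "Pow (F n) \<subseteq> \<S>" using FB[of n] Ffin[of n] by (auto simp: \<S>_def intro: finite_subset)
   have "cor (\<Sum>S\<in>Pow (F n). dS S) = (\<Sum>S\<in>Pow (F n). det_on S ?A)"
    unfolding of_real_sum by (intro sum.cong refl) (use dS(1) sub in auto)
   also have "... = det_on (F n) (%i j. (if i = j then 1 else 0) + ?A i j)"
    by (rule sum_principal_minors[OF Ffin])
   also have "... = det_on (F n) (%u v. (if u = v then 1 else 0) + cor z*L2_inner u (kernel_op \<beta> h v))"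
    unfolding det_on_def
   proof (intro sum.cong refl arg_cong2[where f = "(*)"] prod.cong)
    fix \<pi> i assume "\<pi> : {\<pi>. \<pi> permutes F n}" "i : F n"
    then have "\<pi> i : F n" "i : F n" by (auto simp: permutes_in_image)
    then show "(if i = \<pi> i then 1 else 0) + ?A i (\<pi> i) = (if i = \<pi> i then 1 else 0) + cor z*L2_inner i (kernel_op \<beta> h (\<pi> i))"
     using A FB[of n] by auto
   qed
   also have "... = (\<Prod>a\<leftarrow>l n. 1 + cor z*cor a)" by (rule l4)
   also have "... = cor (\<Prod>a\<leftarrow>l n. 1 + z*a)"
   proof -
    have "(\<Prod>a\<leftarrow>xs. 1 + cor z*cor a) = cor (\<Prod>a\<leftarrow>xs. 1 + z*a)" for xs
     by (induction xs) auto
    then show ?thesis .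
   qed
   finally show ?thesis unfolding of_real_eq_iff .
  qed
  have cover: "EX n. X \<subseteq> Pow (F n)" if X: "finite X" "X \<subseteq> \<S>" for X
  proof -
   have finU: "finite (\<Union>X)" using X by (auto simp: \<S>_def)
   have "\<Union>X \<subseteq> F (Suc (Max (insert 0 (f ` \<Union>X))))"
   proof
    fix u assume u: "u : \<Union>X"
    then have "f u <= Max (insert 0 (f ` \<Union>X))" using finU by (intro Max_ge) auto
    moreover have "u : B" using u X by (auto simp: \<S>_def)
    ultimately show "u : F (Suc (Max (insert 0 (f ` \<Union>X))))" by (simp add: F_def)
   qed
   then show ?thesis by blast
  qed
  have "dS summable_on \<S>"
  proof (rule nonneg_bdd_above_summable_on)
   show "bdd_above (sum dS ` {X. X \<subseteq> \<S> & finite X})"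
   proof (rule bdd_aboveI2)
    fix X assume "X : {X. X \<subseteq> \<S> & finite X}"
    then obtain n where n: "X \<subseteq> Pow (F n)" using cover[of X] by auto
    have "sum dS X <= sum dS (Pow (F n))"
     using Ffin[of n] FB[of n] by (intro sum_mono2 n dS(2)) (auto simp: \<S>_def intro: finite_subset)
    also have "... <= exp (z * sum_list (l n))"
     unfolding sumF by (rule prod_list_le_exp) (use l1 z in auto)
    also have "... <= exp (z*(bose_kernel \<beta> (0::'a)*(LBINT x. h x)))"
     using tr[of n] z by (simp add: mult_left_mono)
    finally show "sum dS X <= exp (z*(bose_kernel \<beta> (0::'a)*(LBINT x. h x)))" .
   qed
  qed (use dS in auto)
  then have hs: "(dS has_sum (infsum dS \<S>)) \<S>" by (rule has_sum_infsum)
  have "((%S. cor (dS S)) has_sum cor (infsum dS \<S>)) \<S>"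
   by (rule has_sum_of_real[OF hs])
  then have "((%S. det_on S ?A) has_sum cor (infsum dS \<S>)) \<S>"
   by (rule has_sum_cong[THEN iffD1, rotated]) (use dS(1) in auto)
  then have fd: "fredholm_det (K_op \<beta> g) = cor (infsum dS \<S>)"
   unfolding fredholm_det_def Let_def B_def[symmetric] \<S>_def[symmetric] by (rule infsumI)
  have "filterlim (%n. Pow (F n)) (finite_subsets_at_top \<S>) sequentially"
   unfolding filterlim_finite_subsets_at_top
  proof (intro allI impI)
   fix X assume "finite X & X \<subseteq> \<S>"
   then obtain N where N: "X \<subseteq> Pow (F N)" using cover[of X] by auto
   show "\<forall>\<^sub>F n in sequentially. finite (Pow (F n)) & X \<subseteq> Pow (F n) & Pow (F n) \<subseteq> \<S>"
    using eventually_ge_at_top[of N]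
   proof eventually_elim
    case (elim n)
    have "F N \<subseteq> F n" using Finc elim by (auto simp: incseq_def)
    then show ?case using N Ffin[of n] FB[of n] by (auto simp: \<S>_def intro: finite_subset)
   qed
  qed
  then have "(%n. sum dS (Pow (F n))) ----> infsum dS \<S>"
   using hs unfolding has_sum_def by (rule filterlim_compose[rotated])
  then show ?thesis using fd unfolding sumF by blast
 qed
 moreover have "(%n. sum_list (l n)) ----> bose_kernel \<beta> (0::'a)*(LBINT x. h x)"
  unfolding l2 by (rule kernel_op_trace[OF \<beta> d h B Ffin Finc Fun])
 moreover have "sum_list (map (%a. a^2) (l n)) <= kernel_hs \<beta> h" for n
  unfolding l3 by (rule kernel_op_hs_le[OF \<beta> d h Fon Ffin])
 ultimately show ?thesis using l1 tr by blast
qed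

end

section \<open>Weighted convolution operators and their resolvents\<close>

text \<open>Functions defined everywhere, without identification up to null sets: the supremum
  arguments with positive kernels use pointwise inequalities.\<close>

definition bmf :: "('a::euclidean_space => real) set" where
 "bmf = {u. u : BM & (EX C. ALL x. \<bar>u x\<bar> <= C)}"

lemma bmf_measurable [measurable_dest]: "u : bmf ==> u : BM"
 by (simp add: bmf_def)

lemma bmfI: "u : BM ==> (!!x. \<bar>u x\<bar> <= C) ==> u : bmf"
 by (auto simp: bmf_def)

lemma bmfE:
 assumes "u : bmf" obtains C where "C >= 0" "!!x. \<bar>u x\<bar> <= C"
proof -
 from assms obtain C where C: "!!x. \<bar>u x\<bar> <= C" by (auto simp: bmf_def)
 have "0 <= C" using C[of undefined] by linarith
 then show thesis using C by (rule that)
qed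

lemma bmf_const [simp]: "(%x. c) : bmf"
 by (rule bmfI[of _ "\<bar>c\<bar>"]) auto

lemma bmf_add [simp]: assumes "u : bmf" "v : bmf" shows "(%x. u x + v x) : bmf"
proof -
 from assms obtain C D where "!!x. \<bar>u x\<bar> <= C" "!!x. \<bar>v x\<bar> <= D" by (metis bmfE)
 then have "\<bar>u x + v x\<bar> <= C + D" for x by (meson abs_triangle_ineq add_mono order_trans)
 then show ?thesis using assms by (intro bmfI[of _ "C + D"]) (measurable, auto)
qed

lemma bmf_mult [simp]: assumes "u : bmf" "v : bmf" shows "(%x. u x * v x) : bmf"
proof -
 from assms obtain C D where CD: "C >= 0" "!!x. \<bar>u x\<bar> <= C" "!!x. \<bar>v x\<bar> <= D" by (metis bmfE)
 then have "\<bar>u x * v x\<bar> <= C*D" for x unfolding abs_mult by (intro mult_mono) auto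
 then show ?thesis using assms by (intro bmfI[of _ "C*D"]) (measurable, auto)
qed

lemma bmf_diff [simp]: "u : bmf ==> v : bmf ==> (%x. u x - v x) : bmf"
 using bmf_add[of u "%x. (-1) * v x"] bmf_mult[of "%x. - 1" v] by simp

lemma bmf_sum [simp]: "(!!i. i : A ==> f i : bmf) ==> (%x. \<Sum>i\<in>A. f i x) : bmf"
 by (induction A rule: infinite_finite_induct) auto

lemma integrable_mult_bmf:
 assumes k: "integrable lborel k" and u: "u : bmf"
 shows "integrable lborel (%x. k x*u x :: real)"
proof -
 obtain C where C: "!!x. \<bar>u x\<bar> <= C" "C >= 0" using u by (metis bmfE)
 have [measurable]: "k : BM" using k by auto
 show ?thesis
  by (rule bochner_integrable_bound[OF integrable_mult_right[OF k, of C]])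
   (use u C in \<open>auto simp: abs_mult mult.commute[of C] intro!: mult_left_mono\<close>)
qed

lemma test_functions_bmf: assumes "h : test_functions" shows "h : bmf"
proof -
 from assms obtain R H where "!!x. h x <= H" by (rule test_functionsE) blast
 then show ?thesis using assms test_functions_nonneg[OF assms] by (intro bmfI[of _ H]) (auto simp: test_functions_def)
qed

text \<open>Cauchy-Schwarz for forms known only to be nonnegative. For \<open>c = 0\<close> the
  expression is affine in \<open>t\<close>, and a nonzero slope would make it negative
  somewhere.\<close>

lemma quadratic_form_discriminant:
 fixes a b c :: real
 assumes q: "!!t. 0 <= a - 2*t*b + t^2*c" and c: "0 <= c"
 shows "b^2 <= a*c"
proof (cases "c = 0")
 case True
 have "b = 0"
 proof (rule ccontr)
  assume "b ~= 0"
  then show False using q[of "(a + 1)/(2*b)"] True by simp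
 qed
 then show ?thesis using True by simp
next
 case False
 then have "c > 0" using c by simp
 then show ?thesis using q[of "b/c"] by (simp add: power2_eq_square field_simps)
qed

text \<open>\<open>T\<close> is convolution with \<open>k\<close> on the measure
  \<open>h dx\<close>, and \<open>ip\<close> is the possibly degenerate inner product of that
  measure. Conjugation by \<open>sqrt h\<close> gives the symmetric kernel
  \<open>sqrt (h x) k (x - y) sqrt (h y)\<close>; in the weighted form the resolvent is applied to
  the constant 1 and all functions may be taken bounded.\<close>

locale weighted_kernel =
 fixes k h :: "'a::euclidean_space => real"
 assumes k_int: "integrable lborel k" and k_nonneg: "!!x. 0 <= k x" and k_even: "!!x. k (- x) = k x"
  and h: "h : test_functions"
begin

definition T :: "('a => real) => 'a => real" where
 "T u x = (LBINT y. k (x - y)*(h y*u y))"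

definition ip :: "('a => real) => ('a => real) => real" where
 "ip u v = (LBINT x. h x*(u x * v x))"

definition nrm :: "('a => real) => real" where "nrm u = sqrt (ip u u)"

lemma k_measurable [measurable]: "k : BM"
 using k_int by auto

lemma h_measurable [measurable]: "h : BM"
 using h by (simp add: test_functions_def)

lemma h_nonneg: "0 <= h x"
 by (rule test_functions_nonneg[OF h])

lemma h_bmf: "h : bmf"
 by (rule test_functions_bmf[OF h])

lemma k_shift_int: "integrable lborel (%y. k (x - y))"
 using integrable_lborel_affine[OF k_int, of "- 1" x] by simp

lemma k_shift_integral: "(LBINT y. k (x - y)) = (LBINT y. k y)"
 using integral_lborel_affine[of "- 1" k x] by simp

lemma T_integrable: "u : bmf ==> integrable lborel (%y. k (x - y)*(h y*u y))"
 by (rule integrable_mult_bmf[OF k_shift_int bmf_mult[OF h_bmf]])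

lemma ip_integrable: "u : bmf ==> v : bmf ==> integrable lborel (%x. h x*(u x * v x))"
 by (rule integrable_mult_bmf[OF test_functions_integrable[OF h] bmf_mult])

lemma T_bound:
 assumes "u : bmf" and "!!x. \<bar>h x*u x\<bar> <= C" shows "\<bar>T u x\<bar> <= C*(LBINT y. k y)"
proof -
 have "\<bar>T u x\<bar> <= (LBINT y. \<bar>k (x - y)*(h y*u y)\<bar>)"
  unfolding T_def by (rule integral_abs_bound)
 also have "... <= (LBINT y. C*k (x - y))"
 proof (rule integral_mono)
  fix y
  have "\<bar>k (x - y)*(h y*u y)\<bar> = k (x - y)*\<bar>h y*u y\<bar>" using k_nonneg by (simp add: abs_mult)
  also have "... <= k (x - y)*C" by (intro mult_left_mono assms k_nonneg)
  finally show "\<bar>k (x - y)*(h y*u y)\<bar> <= C*k (x - y)" by (simp only: mult.commute)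
 qed (intro integrable_abs T_integrable assms integrable_mult_right k_shift_int)+
 also have "... = C*(LBINT y. k y)" by (simp add: k_shift_integral)
 finally show ?thesis .
qed

lemma T_measurable [measurable]:
 assumes [measurable]: "u : BM" shows "T u : BM"
 unfolding T_def[abs_def] by measurable

lemma T_bmf [simp]: assumes "u : bmf" shows "T u : bmf"
proof -
 obtain C where "!!x. \<bar>h x*u x\<bar> <= C" using bmfE[OF bmf_mult[OF h_bmf assms]] by metis
 then show ?thesis using T_bound[OF assms] assms by (intro bmfI) (auto simp: bmf_def)
qed

lemma T_add: "u : bmf ==> v : bmf ==> T (%x. u x + v x) = (%x. T u x + T v x)"
 unfolding T_def by (simp add: distrib_left T_integrable)

lemma T_cmult: "T (%x. c*u x) = (%x. c*T u x)"
 unfolding T_def by (simp add: mult.left_commute)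

lemma T_diff: "u : bmf ==> v : bmf ==> T (%x. u x - v x) = (%x. T u x - T v x)"
 unfolding T_def by (simp add: right_diff_distrib T_integrable)

lemma T_mono: "u : bmf ==> v : bmf ==> (!!y. u y <= v y) ==> T u x <= T v x"
 unfolding T_def by (intro integral_mono T_integrable mult_left_mono h_nonneg k_nonneg)

lemma T_nonneg: "(!!y. 0 <= u y) ==> 0 <= T u x"
 unfolding T_def by (intro integral_nonneg_AE AE_I2 mult_nonneg_nonneg h_nonneg k_nonneg)

lemma ip_commute: "ip u v = ip v u"
 by (simp add: ip_def mult.commute[of "u _"])

lemma ip_add_right: "u : bmf ==> v : bmf ==> p : bmf ==> ip u (%x. v x + p x) = ip u v + ip u p"
 unfolding ip_def by (simp add: distrib_left ip_integrable)

lemma ip_diff_right: "u : bmf ==> v : bmf ==> p : bmf ==> ip u (%x. v x - p x) = ip u v - ip u p"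
 unfolding ip_def by (simp add: right_diff_distrib ip_integrable)

lemma ip_cmult_right: "ip u (%x. c * v x) = c*ip u v"
 unfolding ip_def by (simp add: mult.left_commute)

lemma ip_add_left: "u : bmf ==> v : bmf ==> p : bmf ==> ip (%x. v x + p x) u = ip v u + ip p u"
 by (simp add: ip_commute[of _ u] ip_add_right)

lemma ip_diff_left: "u : bmf ==> v : bmf ==> p : bmf ==> ip (%x. v x - p x) u = ip v u - ip p u"
 by (simp add: ip_commute[of _ u] ip_diff_right)

lemma ip_cmult_left: "ip (%x. c * v x) u = c*ip v u"
 by (simp add: ip_commute[of _ u] ip_cmult_right)

lemma ip_nonneg: "(!!x. 0 <= u x * v x) ==> 0 <= ip u v"
 unfolding ip_def by (intro integral_nonneg_AE AE_I2 mult_nonneg_nonneg[OF h_nonneg])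

lemma ip_self_nonneg [simp]: "0 <= ip u u"
 by (rule ip_nonneg) simp

lemma nrm_nonneg [simp]: "0 <= nrm u"
 by (simp add: nrm_def)

lemma nrm_sq: "(nrm u)^2 = ip u u"
 by (simp add: nrm_def)

lemma ip_mono: "u : bmf ==> v : bmf ==> p : bmf ==> (!!x. 0 <= u x) ==> (!!x. v x <= p x) ==> ip u v <= ip u p"
 unfolding ip_def by (intro integral_mono ip_integrable mult_left_mono h_nonneg) auto

lemma T_prod_integrable:
 assumes u: "u : bmf" and v: "v : bmf"
 shows "integrable (lborel \<Otimes>\<^sub>M lborel) (%(x, y). h x*u x*(k (x - y)*(h y * v y)))"
proof -
 obtain C where C: "!!x. \<bar>h x * v x\<bar> <= C" "C >= 0" using bmfE[OF bmf_mult[OF h_bmf v]] by metis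
 have hi: "integrable lborel (%x. h x*u x)" by (rule integrable_mult_bmf[OF test_functions_integrable[OF h] u])
 note [measurable] = bmf_measurable[OF u] bmf_measurable[OF v]
 show ?thesis
 proof (rule integrableI_bounded)
  have "(\<integral>\<^sup>+z. ennreal (norm (case z of (x, y) => h x*u x*(k (x - y)*(h y * v y)))) \<partial>(lborel \<Otimes>\<^sub>M lborel))
   = (\<integral>\<^sup>+x. \<integral>\<^sup>+y. ennreal (norm (h x*u x*(k (x - y)*(h y * v y)))) \<partial>lborel \<partial>lborel)"
   by (subst lborel.nn_integral_fst[symmetric]) auto
  also have "... <= (\<integral>\<^sup>+x. \<integral>\<^sup>+y. ennreal (C*\<bar>h x*u x\<bar>)*ennreal (k (x - y)) \<partial>lborel \<partial>lborel)"
  proof (intro nn_integral_mono)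
   fix x y
   have "norm (h x*u x*(k (x - y)*(h y * v y))) = \<bar>h x*u x\<bar>*k (x - y)*\<bar>h y * v y\<bar>"
    using k_nonneg[of "x - y"] by (simp add: abs_mult)
   also have "... <= \<bar>h x*u x\<bar>*k (x - y)*C"
    using k_nonneg[of "x - y"] by (intro mult_left_mono C) auto
   finally have "norm (h x*u x*(k (x - y)*(h y * v y))) <= C*\<bar>h x*u x\<bar>*k (x - y)" by (simp only: mult_ac)
   then show "ennreal (norm (h x*u x*(k (x - y)*(h y * v y)))) <= ennreal (C*\<bar>h x*u x\<bar>)*ennreal (k (x - y))"
    using k_nonneg[of "x - y"] by (subst ennreal_mult''[symmetric]) (auto intro!: ennreal_leI)
  qed
  also have "... = (\<integral>\<^sup>+x. ennreal (C*\<bar>h x*u x\<bar>)*ennreal (LBINT y. k y) \<partial>lborel)"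
  proof (intro nn_integral_cong)
   fix x
   have "(\<integral>\<^sup>+y. ennreal (k (x - y)) \<partial>lborel) = ennreal (LBINT y. k y)"
    by (subst nn_integral_eq_integral[OF k_shift_int]) (auto simp: k_nonneg k_shift_integral)
   then show "(\<integral>\<^sup>+y. ennreal (C*\<bar>h x*u x\<bar>)*ennreal (k (x - y)) \<partial>lborel) = ennreal (C*\<bar>h x*u x\<bar>)*ennreal (LBINT y. k y)"
    by (simp add: nn_integral_cmult)
  qed
  also have "... = ennreal (LBINT x. C*\<bar>h x*u x\<bar>)*ennreal (LBINT y. k y)"
   using hi C by (subst nn_integral_multc, measurable, subst nn_integral_eq_integral) auto
  also have "... < \<infinity>" by (simp add: ennreal_mult_less_top)
  finally show "(\<integral>\<^sup>+z. ennreal (norm (case z of (x, y) => h x*u x*(k (x - y)*(h y * v y)))) \<partial>(lborel \<Otimes>\<^sub>M lborel)) < \<infinity>" .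
 qed measurable
qed

lemma T_sym:
 assumes u: "u : bmf" and v: "v : bmf"
 shows "ip u (T v) = ip (T u) v"
proof -
 have "ip u (T v) = (LBINT x. (LBINT y. h x*u x*(k (x - y)*(h y * v y))))"
  unfolding ip_def T_def by (simp add: mult.assoc)
 also have "... = (LBINT y. (LBINT x. h x*u x*(k (x - y)*(h y * v y))))"
  by (rule lborel_pair.Fubini_integral[symmetric, OF T_prod_integrable[OF u v]])
 also have "... = (LBINT y. h y*(T u y * v y))"
 proof (rule bochner_integral_cong[OF refl])
  fix y
  have eq: "h x*u x*(k (x - y)*(h y * v y)) = (h y * v y)*(k (y - x)*(h x*u x))" for x
   using k_even[of "x - y"] by (simp add: mult_ac)
  show "(LBINT x. h x*u x*(k (x - y)*(h y * v y))) = h y*(T u y * v y)"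
   unfolding eq integral_mult_right_zero T_def by (simp only: mult_ac)
 qed
 finally show ?thesis by (simp add: ip_def)
qed

lemma Cauchy_Schwarz:
 assumes "u : bmf" "v : bmf" shows "\<bar>ip u v\<bar> <= nrm u*nrm v"
proof -
 have key: "(ip u v)^2 <= ip u u*ip v v"
 proof (rule quadratic_form_discriminant)
  fix t
  have "0 <= ip (%x. u x - t * v x) (%x. u x - t * v x)" by simp
  also have "... = ip u u - 2*t*ip u v + t^2*ip v v"
   using assms bmf_mult[OF bmf_const[of t], of v]
   by (simp add: ip_diff_left ip_diff_right ip_cmult_left ip_cmult_right ip_commute[of v u] power2_eq_square algebra_simps)
  finally show "0 <= ip u u - 2*t*ip u v + t^2*ip v v" .
 qed simp
 have "\<bar>ip u v\<bar> = sqrt ((ip u v)^2)" by simp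
 also have "... <= sqrt (ip u u*ip v v)" by (rule real_sqrt_le_mono[OF key])
 finally show ?thesis by (simp add: nrm_def real_sqrt_mult)
qed

lemma nrm_cmult: "nrm (%x. c*u x) = \<bar>c\<bar>*nrm u"
 by (simp add: nrm_def ip_cmult_left ip_cmult_right real_sqrt_mult flip: mult.assoc)

lemma nrm_triangle:
 assumes "u : bmf" "v : bmf" shows "nrm (%x. u x + v x) <= nrm u + nrm v"
proof (rule power2_le_imp_le)
 have "(nrm (%x. u x + v x))^2 = ip u u + 2*ip u v + ip v v"
  using assms by (simp add: nrm_sq ip_add_left ip_add_right ip_commute[of v u])
 also have "... <= (nrm u + nrm v)^2"
  using Cauchy_Schwarz[OF assms] by (simp add: power2_sum nrm_sq)
 finally show "(nrm (%x. u x + v x))^2 <= (nrm u + nrm v)^2" .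
qed simp

text \<open>Weighted arithmetic-geometric inequality:
  \<open>2 u(x) u(y) <= u(x)^2 v(y)/v(x) + v(x) u(y)^2/v(y)\<close>. Integrated against the
  symmetric kernel, both terms on the right become \<open>ip (u^2/v) (T v)\<close>, to which the
  hypothesis on \<open>T v\<close> applies.\<close>

lemma Schur_test:
 assumes v: "v : bmf" "!!x. 1 <= v x" "!!x. T v x <= \<Lambda> * v x" and u: "u : bmf"
 shows "ip u (T u) <= \<Lambda>*ip u u"
proof -
 define \<alpha> where "\<alpha> = (%x. (u x)^2/v x)"
 have v0: "v x > 0" for x using v(2)[of x] by linarith
 obtain C where C: "!!x. \<bar>u x\<bar> <= C" using bmfE[OF u] by metis
 note [measurable] = bmf_measurable[OF u] bmf_measurable[OF v(1)]
 have \<alpha>0: "0 <= \<alpha> x" for x using v0[of x] by (simp add: \<alpha>_def)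
 have \<alpha>: "\<alpha> : bmf"
 proof (rule bmfI[of _ "C^2"])
  fix x
  have "\<alpha> x <= (u x)^2/1" unfolding \<alpha>_def using v(2)[of x] by (intro divide_left_mono) auto
  also have "(u x)^2 <= C^2" using C[of x] by (metis abs_ge_zero power2_abs power_mono)
  finally show "\<bar>\<alpha> x\<bar> <= C^2" using \<alpha>0[of x] by simp
 qed (simp add: \<alpha>_def)
 have pt: "2*(u x*u y) <= \<alpha> x * v y + v x*\<alpha> y" for x y
 proof -
  define s where "s = u x/v x"
  define t where "t = u y/v y"
  have eq: "u x = s * v x" "u y = t * v y" using v0[of x] v0[of y] by (auto simp: s_def t_def)
  have "2*(s*t) <= s^2 + t^2" using sum_squares_bound[of s t] by (simp add: mult.assoc)
  then have "(v x * v y)*(2*(s*t)) <= (v x * v y)*(s^2 + t^2)"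
   using v0[of x] v0[of y] by (intro mult_left_mono) auto
  then show ?thesis using v0[of x] v0[of y]
   by (simp add: \<alpha>_def eq power2_eq_square algebra_simps)
 qed
 have "2*(u x*T u x) <= \<alpha> x*T v x + v x*T \<alpha> x" for x
 proof -
  have "2*(u x*T u x) = (LBINT y. (2*u x)*(k (x - y)*(h y*u y)))" by (simp add: T_def)
  also have "... <= (LBINT y. \<alpha> x*(k (x - y)*(h y * v y)) + v x*(k (x - y)*(h y*\<alpha> y)))"
  proof (rule integral_mono)
   fix y
   have "(k (x - y)*h y)*(2*(u x*u y)) <= (k (x - y)*h y)*(\<alpha> x * v y + v x*\<alpha> y)"
    by (intro mult_left_mono pt mult_nonneg_nonneg k_nonneg h_nonneg)
   then show "(2*u x)*(k (x - y)*(h y*u y)) <= \<alpha> x*(k (x - y)*(h y * v y)) + v x*(k (x - y)*(h y*\<alpha> y))"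
    by (simp add: algebra_simps)
  qed (intro bochner_integrable_add integrable_mult_right T_integrable u v \<alpha>)+
  also have "... = \<alpha> x*T v x + v x*T \<alpha> x" by (simp add: T_def T_integrable v \<alpha>)
  finally show ?thesis .
 qed
 then have "(LBINT x. h x*(2*(u x*T u x))) <= (LBINT x. h x*(\<alpha> x*T v x + v x*T \<alpha> x))"
  using ip_integrable[OF u T_bmf[OF u]] ip_integrable[OF \<alpha> T_bmf[OF v(1)]] ip_integrable[OF v(1) T_bmf[OF \<alpha>]]
  by (intro integral_mono mult_left_mono h_nonneg) (auto simp: distrib_left mult.left_commute[of _ 2])
 then have "2*ip u (T u) <= ip \<alpha> (T v) + ip v (T \<alpha>)"
  using ip_integrable[OF \<alpha> T_bmf[OF v(1)]] ip_integrable[OF v(1) T_bmf[OF \<alpha>]]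
  by (simp add: ip_def distrib_left mult.left_commute[of _ 2])
 also have "ip v (T \<alpha>) = ip \<alpha> (T v)" using T_sym[OF \<alpha> v(1)] by (simp add: ip_commute)
 finally have "ip u (T u) <= ip \<alpha> (T v)" by simp
 also have "... <= ip \<alpha> (%x. \<Lambda> * v x)"
  using \<alpha>0 v(3) by (intro ip_mono \<alpha> T_bmf v(1) bmf_mult bmf_const) auto
 also have "... = \<Lambda>*ip u u"
  unfolding ip_cmult_right using v0 by (auto simp: ip_def \<alpha>_def power2_eq_square less_imp_neq[symmetric])
 finally show ?thesis .
qed

text \<open>Bounded functions need not be complete for \<open>nrm\<close>, so
  \<open>(1 - w T)^-1 1\<close> is represented by a sequence of approximate solutions; only its
  inner product with 1 is formed, in \<open>resolvent_value\<close>.\<close>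

definition resolvent_seq :: "real => (nat => 'a => real) => bool" where
 "resolvent_seq w s \<longleftrightarrow> (ALL n. s n : bmf) & (%n. nrm (%x. 1 - (s n x - w*T (s n) x))) ----> 0"

definition resolvent_value :: "real => real => bool" where
 "resolvent_value w r \<longleftrightarrow> (EX s. resolvent_seq w s & (%n. ip (%x. 1) (s n)) ----> r)"

text \<open>\<open>c\<close> is a coercivity constant of \<open>1 - w T\<close>.\<close>

definition coercive :: "real => real => bool" where
 "coercive w c \<longleftrightarrow> c > 0 & (ALL u:bmf. c*ip u u <= ip u u - w*ip u (T u))"

lemma coercive_bound:
 assumes c: "coercive w c" and u: "u : bmf"
 shows "c*nrm u <= nrm (%x. u x - w*T u x)"
proof (cases "nrm u = 0")
 case False
 have b: "(%x. w*T u x) : bmf" by (intro bmf_mult bmf_const T_bmf u)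
 have "c*(nrm u*nrm u) <= ip u u - w*ip u (T u)"
  using c u by (simp add: coercive_def power2_eq_square[symmetric] nrm_sq)
 also have "... = ip u (%x. u x - w*T u x)" by (simp add: ip_diff_right ip_cmult_right u b)
 also have "... <= nrm u*nrm (%x. u x - w*T u x)"
  using Cauchy_Schwarz[OF u bmf_diff[OF u b]] by simp
 finally have "nrm u*(c*nrm u) <= nrm u*nrm (%x. u x - w*T u x)" by (simp add: mult_ac)
 then show ?thesis using False nrm_nonneg[of u] by (simp add: mult_le_cancel_left)
qed simp

lemma resolvent_seq_bound:
 assumes c: "coercive w c" and s: "resolvent_seq w s"
 shows "nrm (s n) <= (nrm (%x. 1) + nrm (%x. 1 - (s n x - w*T (s n) x)))/c"
proof -
 have b: "s n : bmf" "(%x. w*T (s n) x) : bmf"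
  using s by (auto simp: resolvent_seq_def intro!: bmf_mult[OF bmf_const])
 have "nrm (%x. s n x - w*T (s n) x) = nrm (%x. 1 + (- 1)*(1 - (s n x - w*T (s n) x)))" by simp
 also have "... <= nrm (%x. 1) + nrm (%x. (- 1)*(1 - (s n x - w*T (s n) x)))"
  by (intro nrm_triangle bmf_const bmf_mult bmf_diff b)
 also have "nrm (%x. (- 1)*(1 - (s n x - w*T (s n) x))) = nrm (%x. 1 - (s n x - w*T (s n) x))"
  unfolding nrm_cmult by simp
 finally have "c*nrm (s n) <= nrm (%x. 1) + nrm (%x. 1 - (s n x - w*T (s n) x))"
  using coercive_bound[OF c b(1)] by linarith
 then show ?thesis using c by (simp add: coercive_def pos_le_divide_eq mult.commute)
qed

end

context weighted_kernel
begin

lemma ip_const_1: "ip (%x. 1) (%x. 1) = (LBINT x. h x)"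
 by (simp add: ip_def)

text \<open>The second resolvent identity tested against 1: up to the two residuals, the difference
  is \<open>w\<close> times \<open>ip (s' n)\<close> of the difference of the operators at
  \<open>s n\<close>. Coercivity bounds the norms of both sequences and yields the factor
  \<open>1/(c c')\<close>.\<close>

lemma resolvent_seqs_difference:
 assumes k': "weighted_kernel k' h" and \<epsilon>: "0 <= \<epsilon>"
  and diff: "!!u v. u : bmf ==> v : bmf ==> \<bar>ip u (weighted_kernel.T k' h v) - ip u (T v)\<bar> <= \<epsilon>*(nrm u*nrm v)"
  and c: "coercive w c" and c': "weighted_kernel.coercive k' h w c'"
  and s: "resolvent_seq w s" and s': "weighted_kernel.resolvent_seq k' h w s'"
 shows "EX \<delta>. \<delta> ----> \<bar>w\<bar>*\<epsilon>*(LBINT x. h x)/(c*c') & (ALL n. \<bar>ip (%x. 1) (s n) - ip (%x. 1) (s' n)\<bar> <= \<delta> n)"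
proof -
 interpret K': weighted_kernel k' h by (rule k')
 let ?N = "nrm (%x. 1)"
 define e where "e = (%n. nrm (%x. 1 - (s n x - w*T (s n) x)))"
 define e' where "e' = (%n. nrm (%x. 1 - (s' n x - w*K'.T (s' n) x)))"
 have b: "s n : bmf" "(%x. w*T (s n) x) : bmf" for n
  using s by (auto simp: resolvent_seq_def intro!: bmf_mult[OF bmf_const])
 have b': "s' n : bmf" "(%x. w*K'.T (s' n) x) : bmf" for n
  using s' by (auto simp: K'.resolvent_seq_def intro!: bmf_mult[OF bmf_const])
 have e: "e ----> 0" and e': "e' ----> 0" using s s' by (auto simp: e_def e'_def resolvent_seq_def K'.resolvent_seq_def)
 have c0: "c > 0" "c' > 0" using c c' by (auto simp: coercive_def K'.coercive_def)
 have ns: "nrm (s n) <= (?N + e n)/c" for n unfolding e_def by (rule resolvent_seq_bound[OF c s])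
 have ns': "nrm (s' n) <= (?N + e' n)/c'" for n unfolding e'_def by (rule K'.resolvent_seq_bound[OF c' s'])
 have e0: "0 <= e n" "0 <= e' n" for n by (auto simp: e_def e'_def)
 define \<delta> where "\<delta> = (%n. \<bar>w\<bar>*\<epsilon>*(((?N + e' n)/c')*((?N + e n)/c)) + e' n*((?N + e n)/c) + e n*((?N + e' n)/c'))"
 have "\<bar>ip (%x. 1) (s n) - ip (%x. 1) (s' n)\<bar> <= \<delta> n" for n
 proof -
  have A: "ip (%x. 1 - (s' n x - w*K'.T (s' n) x)) (s n) = ip (%x. 1) (s n) - (ip (s' n) (s n) - w*ip (K'.T (s' n)) (s n))"
   by (simp only: ip_diff_left ip_cmult_left bmf_const bmf_diff b b' K'.T_bmf)
  have B: "ip (s' n) (%x. 1 - (s n x - w*T (s n) x)) = ip (s' n) (%x. 1) - (ip (s' n) (s n) - w*ip (s' n) (T (s n)))"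
   by (simp only: ip_diff_right ip_cmult_right bmf_const bmf_diff b b' T_bmf)
  have eq: "ip (%x. 1) (s n) - ip (%x. 1) (s' n) =
   (ip (%x. 1 - (s' n x - w*K'.T (s' n) x)) (s n) - ip (s' n) (%x. 1 - (s n x - w*T (s n) x)))
   + w*(ip (s' n) (T (s n)) - ip (s' n) (K'.T (s n)))"
   unfolding A B K'.T_sym[OF b'(1) b(1)] by (simp add: ip_commute[of "s' n" "%x. 1"] algebra_simps)
  have "\<bar>ip (%x. 1) (s n) - ip (%x. 1) (s' n)\<bar> <= (e' n*nrm (s n) + nrm (s' n)*e n) + \<bar>w\<bar>*(\<epsilon>*(nrm (s' n)*nrm (s n)))"
   unfolding eq
  proof (intro order_trans[OF abs_triangle_ineq] add_mono order_trans[OF abs_triangle_ineq4])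
   show "\<bar>ip (%x. 1 - (s' n x - w*K'.T (s' n) x)) (s n)\<bar> <= e' n*nrm (s n)"
    unfolding e'_def by (intro Cauchy_Schwarz bmf_diff bmf_const b b')
   show "\<bar>ip (s' n) (%x. 1 - (s n x - w*T (s n) x))\<bar> <= nrm (s' n)*e n"
    unfolding e_def by (intro Cauchy_Schwarz bmf_diff bmf_const b b')
   show "\<bar>w*(ip (s' n) (T (s n)) - ip (s' n) (K'.T (s n)))\<bar> <= \<bar>w\<bar>*(\<epsilon>*(nrm (s' n)*nrm (s n)))"
    unfolding abs_mult using diff[OF b'(1)[of n] b(1)[of n]] by (intro mult_left_mono) (auto simp: abs_minus_commute)
  qed
  also have "... <= (e' n*((?N + e n)/c) + ((?N + e' n)/c')*e n) + \<bar>w\<bar>*(\<epsilon>*(((?N + e' n)/c')*((?N + e n)/c)))"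
   using ns[of n] ns'[of n] e0[of n] \<epsilon> c0
   by (intro add_mono mult_left_mono mult_right_mono mult_mono) (auto intro!: divide_nonneg_pos add_nonneg_nonneg)
  also have "... = \<delta> n" by (simp add: \<delta>_def algebra_simps)
  finally show ?thesis .
 qed
 moreover have "\<delta> ----> \<bar>w\<bar>*\<epsilon>*(((?N + 0)/c')*((?N + 0)/c)) + 0*((?N + 0)/c) + 0*((?N + 0)/c')"
  unfolding \<delta>_def using c0 by (intro tendsto_intros e e') auto
 moreover have "\<bar>w\<bar>*\<epsilon>*(((?N + 0)/c')*((?N + 0)/c)) + 0*((?N + 0)/c) + 0*((?N + 0)/c') = \<bar>w\<bar>*\<epsilon>*(LBINT x. h x)/(c*c')"
  using nrm_sq[of "%x. 1"] by (simp add: ip_const_1 power2_eq_square mult_ac)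
 ultimately show ?thesis by metis
qed

lemma resolvent_value_perturbation:
 assumes k': "weighted_kernel k' h" and \<epsilon>: "0 <= \<epsilon>"
  and diff: "!!u v. u : bmf ==> v : bmf ==> \<bar>ip u (weighted_kernel.T k' h v) - ip u (T v)\<bar> <= \<epsilon>*(nrm u*nrm v)"
  and c: "coercive w c" and c': "weighted_kernel.coercive k' h w c'"
  and r: "resolvent_value w r" and r': "weighted_kernel.resolvent_value k' h w r'"
 shows "\<bar>r - r'\<bar> <= \<bar>w\<bar>*\<epsilon>*(LBINT x. h x)/(c*c')"
proof -
 interpret K': weighted_kernel k' h by (rule k')
 obtain s where s: "resolvent_seq w s" "(%n. ip (%x. 1) (s n)) ----> r" using r by (auto simp: resolvent_value_def)
 obtain s' where s': "K'.resolvent_seq w s'" "(%n. ip (%x. 1) (s' n)) ----> r'" using r' by (auto simp: K'.resolvent_value_def)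
 obtain \<delta> where \<delta>: "\<delta> ----> \<bar>w\<bar>*\<epsilon>*(LBINT x. h x)/(c*c')" "!!n. \<bar>ip (%x. 1) (s n) - ip (%x. 1) (s' n)\<bar> <= \<delta> n"
  using resolvent_seqs_difference[OF k' \<epsilon> diff c c' s(1) s'(1)] by auto
 have "(%n. \<bar>ip (%x. 1) (s n) - ip (%x. 1) (s' n)\<bar>) ----> \<bar>r - r'\<bar>"
  by (intro tendsto_intros s s')
 then show ?thesis using \<delta> by (intro tendsto_le[OF sequentially_bot \<delta>(1)]) auto
qed

lemma resolvent_value_limit:
 assumes c: "coercive w c" and r: "resolvent_value w r" and s: "resolvent_seq w s"
 shows "(%n. ip (%x. 1) (s n)) ----> r"
proof -
 obtain s' where s': "resolvent_seq w s'" "(%n. ip (%x. 1) (s' n)) ----> r" using r by (auto simp: resolvent_value_def)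
 have "weighted_kernel k h" by unfold_locales
 then obtain \<delta> where \<delta>: "\<delta> ----> \<bar>w\<bar>*0*(LBINT x. h x)/(c*c)" "!!n. \<bar>ip (%x. 1) (s n) - ip (%x. 1) (s' n)\<bar> <= \<delta> n"
  using resolvent_seqs_difference[of k 0, OF _ _ _ c c s s'(1)] by auto
 have "(%n. \<bar>ip (%x. 1) (s n) - ip (%x. 1) (s' n)\<bar>) ----> 0"
  by (rule tendsto_sandwich[OF _ _ tendsto_const \<delta>(1)[simplified]]) (use \<delta>(2) in auto)
 then have "(%n. ip (%x. 1) (s n) - ip (%x. 1) (s' n)) ----> 0" by (rule tendsto_rabs_zero_cancel)
 from tendsto_add[OF this s'(2)] show ?thesis by simp
qed

definition Tpow :: "nat => 'a => real" where "Tpow n = (T ^^ n) (%x. 1)"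

lemma Tpow_0 [simp]: "Tpow 0 = (%x. 1)" and Tpow_Suc: "Tpow (Suc n) = T (Tpow n)"
 by (simp_all add: Tpow_def)

lemma Tpow_bmf [simp]: "Tpow n : bmf"
 by (induction n) (simp_all add: Tpow_Suc)

lemma Tpow_nonneg: "0 <= Tpow n x"
 by (induction n arbitrary: x) (simp_all add: Tpow_Suc T_nonneg)

lemma T_sum: "(!!i. i : A ==> f i : bmf) ==> T (%x. \<Sum>i\<in>A. f i x) = (%x. \<Sum>i\<in>A. T (f i) x)"
proof (induction A rule: infinite_finite_induct)
 case (insert a A)
 then show ?case by (simp add: T_add)
qed (simp_all add: T_def[abs_def])

lemma ip_sum_right: "u : bmf ==> (!!i. i : A ==> f i : bmf) ==> ip u (%x. \<Sum>i\<in>A. f i x) = (\<Sum>i\<in>A. ip u (f i))"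
 by (induction A rule: infinite_finite_induct) (simp_all add: ip_add_right, simp_all add: ip_def)

text \<open>The partial sums of the Neumann series leave the residual \<open>w^N T^N 1\<close>, so
  they form a resolvent sequence as soon as this tends to 0 in norm.\<close>

lemma resolvent_value_series:
 assumes c: "coercive w c" and r: "resolvent_value w r" and lim: "(%n. \<bar>w\<bar>^n*nrm (Tpow n)) ----> 0"
 shows "(%N. \<Sum>n<N. w^n*ip (%x. 1) (Tpow n)) ----> r"
proof -
 define s where "s = (%N x. \<Sum>n<N. w^n*Tpow n x)"
 have b: "(%x. w^n*Tpow n x) : bmf" for n by (intro bmf_mult bmf_const Tpow_bmf)
 have sb: "s N : bmf" for N unfolding s_def by (intro bmf_sum b)
 have res: "1 - (s N x - w*T (s N) x) = w^N*Tpow N x" for N x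
 proof -
  have "w*T (s N) x = (\<Sum>n<N. w^Suc n*Tpow (Suc n) x)"
   unfolding s_def T_sum[OF b] by (simp add: T_cmult Tpow_Suc sum_distrib_left mult.assoc)
  then have "s N x - w*T (s N) x = - (\<Sum>n<N. w^Suc n*Tpow (Suc n) x - w^n*Tpow n x)"
   by (simp add: s_def sum_subtractf)
  also have "... = 1 - w^N*Tpow N x" by (subst sum_lessThan_telescope) simp
  finally show ?thesis by simp
 qed
 have "resolvent_seq w s"
  unfolding resolvent_seq_def res nrm_cmult power_abs using sb lim by simp
 then have "(%N. ip (%x. 1) (s N)) ----> r" by (rule resolvent_value_limit[OF c r])
 moreover have "ip (%x. 1) (s N) = (\<Sum>n<N. w^n*ip (%x. 1) (Tpow n))" for N
  unfolding s_def by (subst ip_sum_right) (auto simp: ip_cmult_right b)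
 ultimately show ?thesis by simp
qed

end

section \<open>Holomorphy of the scalar resolvent\<close>

locale bounded_kernel = weighted_kernel +
 fixes \<Lambda> :: real
 assumes \<Lambda>_pos: "\<Lambda> > 0" and psd: "!!u. u : bmf ==> 0 <= ip u (T u)"
  and bound: "!!u. u : bmf ==> ip u (T u) <= \<Lambda>*ip u u"
begin

lemma coercive: "w*\<Lambda> < 1 ==> coercive w (if w <= 0 then 1 else 1 - w*\<Lambda>)"
 unfolding coercive_def
proof (intro conjI ballI)
 fix u :: "'a => real" assume u: "u : bmf"
 show "(if w <= 0 then 1 else 1 - w*\<Lambda>)*ip u u <= ip u u - w*ip u (T u)"
 proof (cases "w <= 0")
  case True then show ?thesis using psd[OF u] by (simp add: mult_nonpos_nonneg)
 next
  case False
  then have "w*ip u (T u) <= w*(\<Lambda>*ip u u)" using bound[OF u] by (intro mult_left_mono) auto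
  then show ?thesis using False by (simp add: algebra_simps)
 qed
qed auto

text \<open>Cauchy-Schwarz for the nonnegative form \<open>ip u (T v)\<close>, applied to
  \<open>u\<close> and \<open>T u\<close>; the result expresses
  \<open>T^2 <= \<Lambda> T\<close>.\<close>

lemma T_nrm:
 assumes u: "u : bmf" shows "ip (T u) (T u) <= \<Lambda>*ip u (T u)"
proof -
 let ?n = "ip (T u) (T u)"
 have "(ip u (T (T u)))^2 <= ip u (T u)*ip (T u) (T (T u))"
 proof (rule quadratic_form_discriminant)
  fix t
  have b: "(%x. t*T u x) : bmf" by (intro bmf_mult bmf_const T_bmf u)
  have "0 <= ip (%x. u x - t*T u x) (T (%x. u x - t*T u x))"
   by (intro psd bmf_diff b u)
  also have "T (%x. u x - t*T u x) = (%x. T u x - t*T (T u) x)"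
   unfolding T_diff[OF u b] T_cmult ..
  also have "ip (%x. u x - t*T u x) ... = ip u (T u) - t*ip u (T (T u)) - t*(ip (T u) (T u) - t*ip (T u) (T (T u)))"
   by (simp only: ip_diff_left ip_diff_right ip_cmult_left ip_cmult_right bmf_diff b u T_bmf bmf_mult bmf_const)
  also have "ip (T u) (T u) = ip u (T (T u))" by (rule T_sym[symmetric]) (simp_all add: u)
  finally show "0 <= ip u (T u) - 2*t*ip u (T (T u)) + t^2*ip (T u) (T (T u))"
   by (simp add: power2_eq_square algebra_simps)
 qed (intro psd T_bmf u)
 also have "ip u (T (T u)) = ?n" by (rule T_sym) (simp_all add: u)
 also have "ip u (T u)*ip (T u) (T (T u)) <= ip u (T u)*(\<Lambda>*?n)"
  by (intro mult_left_mono bound psd T_bmf u)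
 finally have "?n*?n <= ?n*(\<Lambda>*ip u (T u))" by (simp add: power2_eq_square mult_ac)
 then show ?thesis
  using ip_self_nonneg[of "T u"] psd[OF u] \<Lambda>_pos by (cases "?n = 0") (auto simp: mult_le_cancel_left)
qed

definition b :: real where "b = \<Lambda>/2"

text \<open>Shifting by half the norm makes \<open>S\<close> a contraction of norm \<open>b\<close> on both sides of \<open>0\<close>, so that
 the Neumann series in \<open>S\<close> converges for every \<open>w\<close> on the left of \<open>1 / \<Lambda>\<close>.\<close>

definition S :: "('a => real) => 'a => real" where "S u x = b*u x - T u x"

lemma S_bmf [simp]: "u : bmf ==> S u : bmf"
 unfolding S_def[abs_def] by (intro bmf_diff bmf_mult bmf_const T_bmf)

text \<open>As \<open>\<Lambda> = 2 b\<close>, the square of \<open>b - T\<close> is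
  \<open>b^2 - (2 b T - T^2)\<close>, and \<open>T_nrm\<close> makes the bracket
  nonnegative.\<close>

lemma S_nrm: assumes u: "u : bmf" shows "nrm (S u) <= b*nrm u"
proof (rule power2_le_imp_le)
 have bb: "(%x. b*u x) : bmf" by (intro bmf_mult bmf_const u)
 have "(nrm (S u))^2 = b*(b*ip u u) - b*ip u (T u) - (b*ip u (T u) - ip (T u) (T u))"
  unfolding nrm_sq S_def
  by (simp only: ip_diff_left ip_diff_right ip_cmult_left ip_cmult_right bmf_diff bb u T_bmf bmf_mult bmf_const ip_commute[of "T u" u])
   (simp add: algebra_simps)
 also have "... <= (b*nrm u)^2"
 proof -
  have "(b*nrm u)^2 = b*(b*ip u u)" by (simp only: power_mult_distrib nrm_sq power2_eq_square[of b] mult.assoc)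
  moreover have "ip (T u) (T u) <= 2*b*ip u (T u)" using T_nrm[OF u] by (simp add: b_def)
  ultimately show ?thesis by simp
 qed
 finally show "(nrm (S u))^2 <= (b*nrm u)^2" .
 show "0 <= b*nrm u" using \<Lambda>_pos by (simp add: b_def)
qed

definition Spow :: "nat => 'a => real" where "Spow n = (S ^^ n) (%x. 1)"

lemma Spow_0 [simp]: "Spow 0 = (%x. 1)" and Spow_Suc: "Spow (Suc n) = S (Spow n)"
 by (simp_all add: Spow_def)

lemma Spow_bmf [simp]: "Spow n : bmf"
 by (induction n) (simp_all add: Spow_Suc)

lemma Spow_nrm: "nrm (Spow n) <= b^n*nrm (%x. 1)"
proof (induction n)
 case (Suc n)
 have "nrm (Spow (Suc n)) <= b*nrm (Spow n)" unfolding Spow_Suc by (rule S_nrm) simp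
 also have "... <= b*(b^n*nrm (%x. 1))" using Suc \<Lambda>_pos by (intro mult_left_mono) (auto simp: b_def)
 finally show ?case by (simp add: mult.assoc)
qed simp

definition q :: "nat => real" where "q n = ip (%x. 1) (Spow n)"

lemma q_bound: "\<bar>q n\<bar> <= b^n*(LBINT x. h x)"
proof -
 have "\<bar>q n\<bar> <= nrm (%x. 1)*nrm (Spow n)" unfolding q_def by (rule Cauchy_Schwarz) simp_all
 also have "... <= nrm (%x. 1)*(b^n*nrm (%x. 1))" by (intro mult_left_mono Spow_nrm) simp
 also have "... = b^n*(nrm (%x. 1))^2" by (simp add: power2_eq_square mult_ac)
 finally show ?thesis by (simp add: nrm_sq ip_const_1)
qed

text \<open>From \<open>T = b - S\<close> follows \<open>1 - w T = (1 - w b) (1 - zeta w S)\<close>,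
  and \<open>1/(1 - w b) = 1 - zeta w b\<close> is the prefactor in
  \<open>resolvent_fun\<close>.\<close>

definition zeta :: "complex => complex" where "zeta w = - w/(1 - w * of_real b)"

definition resolvent_fun :: "complex => complex" where
 "resolvent_fun w = (1 - zeta w * of_real b)*(\<Sum>n. of_real (q n)*zeta w^n)"

text \<open>This is the condition \<open>|zeta w| b < 1\<close>; since
  \<open>b = \<Lambda>/2\<close>, it describes the half-plane
  \<open>Re w < 1/\<Lambda>\<close>.\<close>

definition resolvent_dom :: "complex set" where
 "resolvent_dom = {w. cmod w*b < cmod (1 - w * of_real b)}"

lemma zeta_dom: "w : resolvent_dom ==> cmod (zeta w)*b < 1"
 by (cases "1 - w * of_real b = 0") (auto simp: resolvent_dom_def zeta_def norm_divide)

lemma q_summable: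
 assumes "cmod z*b < 1" shows "summable (%n. of_real (q n)*z^n :: complex)"
proof (rule summable_comparison_test')
 have b0: "b >= 0" using \<Lambda>_pos by (simp add: b_def)
 show "summable (%n. (LBINT x. h x)*(cmod z*b)^n)"
  using assms b0 by (intro summable_mult summable_geometric) (simp add: abs_mult)
 show "norm (of_real (q n)*z^n :: complex) <= (LBINT x. h x)*(cmod z*b)^n" for n
  using mult_right_mono[OF q_bound[of n], of "cmod z^n"]
  by (simp add: norm_mult norm_power power_mult_distrib mult_ac)
qed

lemma resolvent_fun_holomorphic: "resolvent_fun holomorphic_on resolvent_dom"
proof -
 have b0: "b > 0" using \<Lambda>_pos by (simp add: b_def)
 have "(%z. \<Sum>n. of_real (q n)*z^n) holomorphic_on ball (0::complex) (1/b)"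
 proof (rule power_series_holomorphic)
  fix z :: complex assume "z : ball 0 (1/b)"
  then have "cmod z*b < 1" using b0 by (simp add: field_simps)
  then show "(%n. of_real (q n)*(z - 0)^n) sums (\<Sum>n. of_real (q n)*z^n)"
   using q_summable by (simp add: summable_sums)
 qed
 moreover have z: "zeta holomorphic_on resolvent_dom"
 proof -
  have "1 - w * of_real b ~= 0" if "w : resolvent_dom" for w
   using that b0 by (auto simp: resolvent_dom_def mult_less_0_iff)
  then show ?thesis unfolding zeta_def[abs_def] by (intro holomorphic_intros) auto
 qed
 moreover have "zeta ` resolvent_dom \<subseteq> ball 0 (1/b)"
  using zeta_dom b0 by (auto simp: field_simps)
 ultimately have "((%z. \<Sum>n. of_real (q n)*z^n) \<circ> zeta) holomorphic_on resolvent_dom"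
  by (intro holomorphic_on_compose_gen)
 then show ?thesis unfolding resolvent_fun_def[abs_def] using z
  by (intro holomorphic_intros) (simp_all add: o_def)
qed

lemma real_in_resolvent_dom: "w*\<Lambda> < 1 ==> cor w : resolvent_dom"
proof -
 assume w: "w*\<Lambda> < 1"
 have "w*b < 1" using w by (simp add: b_def)
 have "cor 1 - cor w*cor b = cor (1 - w*b)" by simp
 then have "cmod (1 - cor w*cor b) = \<bar>1 - w*b\<bar>" by (metis norm_of_real of_real_1)
 moreover have "\<bar>w\<bar>*b < \<bar>1 - w*b\<bar>" using w \<open>w * b < 1\<close> by (auto simp: b_def abs_if mult.commute)
 ultimately show ?thesis by (simp add: resolvent_dom_def)
qed

lemma ball_subset_resolvent_dom: "ball 0 (1/\<Lambda>) \<subseteq> resolvent_dom"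
proof
 fix w :: complex assume "w : ball 0 (1/\<Lambda>)"
 then have "cmod w*\<Lambda> < 1" using \<Lambda>_pos by (simp add: field_simps)
 moreover have "1 - cmod w*b <= cmod (1 - w * of_real b)"
  using norm_triangle_ineq2[of 1 "w * of_real b"] \<Lambda>_pos by (simp add: norm_mult b_def)
 ultimately show "w : resolvent_dom" by (simp add: resolvent_dom_def b_def)
qed

text \<open>Partial sums of the series in \<open>S\<close> leave the residual
  \<open>z^M S^M 1\<close>, which decays geometrically because \<open>|z| b < 1\<close>.\<close>

theorem resolvent_fun_value:
 assumes w: "w*\<Lambda> < 1"
 shows "resolvent_fun (of_real w) = of_real (Re (resolvent_fun (of_real w)))"
  and "resolvent_value w (Re (resolvent_fun (of_real w)))"
proof -
 define z where "z = - w/(1 - w*b)"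
 have wb: "1 - w*b > 0"  using w by (simp add: b_def)
 have zz: "zeta (of_real w) = of_real z" by (simp add: zeta_def z_def)
 have zb: "\<bar>z\<bar>*b < 1" using zeta_dom[OF real_in_resolvent_dom[OF w]] by (simp add: zz)
 have sm: "summable (%n. q n*z^n)"
  using q_summable[of "of_real z"] zb by (simp add: summable_complex_of_real flip: of_real_power of_real_mult)
 have "resolvent_fun (of_real w) = of_real ((1 - z*b)*(\<Sum>n. q n*z^n))"
 proof -
  have "(\<Sum>n. cor (q n)*cor z^n) = of_real (\<Sum>n. q n*z^n)"
   unfolding suminf_of_real[OF sm] by simp
  then show ?thesis unfolding resolvent_fun_def zz by simp
 qed
 then have val: "resolvent_fun (of_real w) = of_real ((1 - z*b)*(\<Sum>n. q n*z^n))" .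
 then show "resolvent_fun (of_real w) = of_real (Re (resolvent_fun (of_real w)))" by simp
 define s where "s = (%M x. (1 - z*b)*(\<Sum>n<M. z^n*Spow n x))"
 have bb: "(%x. z^n*Spow n x) : bmf" for n by (intro bmf_mult bmf_const Spow_bmf)
 have sb: "s M : bmf" for M unfolding s_def by (intro bmf_mult bmf_const bmf_sum bb)
 have zw: "(1 - z*b)*(1 - w*b) = 1" "(1 - z*b)*w = - z"
  using wb by (simp_all add: z_def field_simps)
 have res: "1 - (s M x - w*T (s M) x) = z^M*Spow M x" for M x
 proof -
  have TS: "T (Spow n) x = b*Spow n x - Spow (Suc n) x" for n by (simp add: Spow_Suc S_def)
  have "T (s M) x = (1 - z*b)*(\<Sum>n<M. z^n*(b*Spow n x - Spow (Suc n) x))"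
   unfolding s_def T_cmult T_sum[OF bb] by (simp add: TS)
  then have "s M x - w*T (s M) x = (\<Sum>n<M. (1 - z*b)*(z^n*Spow n x) - (1 - z*b)*w*(z^n*(b*Spow n x - Spow (Suc n) x)))"
   by (simp add: s_def sum_subtractf sum_distrib_left mult_ac)
  also have "... = (\<Sum>n<M. (1 - z*b)*(1 - w*b)*(z^n*Spow n x) + (1 - z*b)*w*(z^n*Spow (Suc n) x))"
   by (intro sum.cong refl) (simp add: algebra_simps)
  also have "... = - (\<Sum>n<M. z^Suc n*Spow (Suc n) x - z^n*Spow n x)"
   unfolding zw by (simp add: sum_negf[symmetric] mult.assoc)
  also have "... = 1 - z^M*Spow M x" by (subst sum_lessThan_telescope) simp
  finally show ?thesis by simp
 qed
 have b0: "b >= 0" using \<Lambda>_pos by (simp add: b_def)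
 have "(%M. \<bar>z\<bar>^M*nrm (Spow M)) ----> 0"
 proof (rule tendsto_sandwich[OF _ _ tendsto_const])
  show "\<forall>\<^sub>F M in sequentially. \<bar>z\<bar>^M*nrm (Spow M) <= (\<bar>z\<bar>*b)^M*nrm (%x. 1)"
   using mult_left_mono[OF Spow_nrm] by (intro always_eventually) (simp add: power_mult_distrib mult.assoc)
  have "(%M. (\<bar>z\<bar>*b)^M) ----> 0" using zb b0 by (intro LIMSEQ_realpow_zero) auto
  then show "(%M. (\<bar>z\<bar>*b)^M*nrm (%x. 1)) ----> 0" by (rule tendsto_mult_left_zero)
 qed auto
 then have "resolvent_seq w s"
  unfolding resolvent_seq_def res nrm_cmult power_abs using sb by simp
 moreover have "ip (%x. 1) (s M) = (1 - z*b)*(\<Sum>n<M. q n*z^n)" for M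
  unfolding s_def ip_cmult_right by (subst ip_sum_right) (auto simp: ip_cmult_right bb q_def mult.commute)
 then have "(%M. ip (%x. 1) (s M)) ----> (1 - z*b)*(\<Sum>n. q n*z^n)"
  by (simp only:) (intro tendsto_mult_left summable_LIMSEQ sm)
 ultimately show "resolvent_value w (Re (resolvent_fun (of_real w)))"
  unfolding val resolvent_value_def by auto
qed

end

text \<open>The full Bose kernel is not integrable, each of its infinitely many heat kernels having
  mass 1. Two points of norm at most \<open>R\<close> differ by at most \<open>2 R\<close>, so the
  cutoff is invisible on the support of the weight.\<close>

definition trunc_kernel :: "real => real => 'a::euclidean_space => real" where
 "trunc_kernel \<beta> R z = indicator (cball 0 (2*R)) z*bose_kernel \<beta> z"

locale bose_weight =
 fixes \<beta> R :: real and h :: "'a::euclidean_space => real"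
 assumes \<beta>: "\<beta> > 0" and d: "DIM('a) > 2" and h_test: "h : test_functions" and R: "!!x. norm x > R ==> h x = 0"
begin

lemma trunc_kernel_weighted: "weighted_kernel (trunc_kernel \<beta> R) h"
proof
 have [measurable]: "trunc_kernel \<beta> R : BM"
  unfolding trunc_kernel_def[abs_def] by (intro borel_measurable_times borel_measurable_indicator bose_kernel_measurable) auto
 have G: "0 <= bose_kernel \<beta> x" "bose_kernel \<beta> x <= bose_kernel \<beta> (0::'a)" for x :: 'a
  by (auto intro: bose_kernel_nonneg[OF \<beta> d] bose_kernel_le[OF \<beta> d])
 show "integrable lborel (trunc_kernel \<beta> R :: 'a => real)"
  by (rule integrable_bounded_ball[of _ "bose_kernel \<beta> (0::'a)" "2*R"])
   (use G in \<open>auto simp: trunc_kernel_def split: split_indicator intro: order_trans\<close>)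
 show "0 <= trunc_kernel \<beta> R x" for x :: 'a using G by (simp add: trunc_kernel_def)
 show "trunc_kernel \<beta> R (- x) = trunc_kernel \<beta> R x" for x :: 'a by (simp add: trunc_kernel_def indicator_def)
qed (rule h_test)

sublocale weighted_kernel "trunc_kernel \<beta> R" h by (rule trunc_kernel_weighted)

lemma T_eq:
 assumes "norm y <= R"
 shows "T \<phi> y = (LBINT x. bose_kernel \<beta> (y - x)*(h x*\<phi> x))"
 unfolding T_def
proof (rule bochner_integral_cong[OF refl])
 fix x
 have "norm (y - x) <= 2*R" if "norm x <= R"
  using norm_triangle_ineq4[of y x] assms that by linarith
 then show "trunc_kernel \<beta> R (y - x)*(h x*\<phi> x) = bose_kernel \<beta> (y - x)*(h x*\<phi> x)"
  using R[of x] by (cases "norm x <= R") (auto simp: trunc_kernel_def)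
qed

text \<open>A norm-preserving map from the weighted form into L2; it intertwines \<open>T\<close>
  with \<open>kernel_op\<close> and sends 1 to \<open>sqrt h\<close>.\<close>

definition emb :: "('a => real) => 'a => complex" where "emb \<phi> x = cor (sqrt (h x))*cor (\<phi> x)"

lemma emb_L2 [simp]: assumes "\<phi> : bmf" shows "emb \<phi> : L2"
proof -
 obtain C where "!!x. \<bar>\<phi> x\<bar> <= C" using bmfE[OF assms] by metis
 then have "(%x. cor (\<phi> x)*cor (sqrt (h x))) : L2"
  using assms by (intro L2_bounded_mult[OF sqrt_test_function_in_L2[OF h_test], of _ C]) (auto simp: bmf_def)
 then show ?thesis by (simp add: emb_def[abs_def] mult.commute)
qed

lemma kernel_op_emb: "kernel_op \<beta> h (emb \<phi>) = emb (T \<phi>)"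
proof
 fix y
 have *: "cor (sqrt (h x))*emb \<phi> x*cor (bose_kernel \<beta> (y - x)) = cor (bose_kernel \<beta> (y - x)*(h x*\<phi> x))" for x
  using h_nonneg[of x] by (simp add: emb_def mult_ac flip: of_real_mult)
 show "kernel_op \<beta> h (emb \<phi>) y = emb (T \<phi>) y"
 proof (cases "norm y <= R")
  case True
  then show ?thesis unfolding kernel_op_def * integral_complex_of_real T_eq[OF True, symmetric] by (simp only: emb_def)
 next
  case False
  then show ?thesis using R[of y] by (simp add: kernel_op_def emb_def)
 qed
qed

lemma L2_inner_emb: "L2_inner (emb \<phi>) (emb \<psi>) = cor (ip \<phi> \<psi>)"
proof -
 have "cnj (emb \<phi> x)*emb \<psi> x = cor (h x*(\<phi> x*\<psi> x))" for x
  using h_nonneg[of x] by (simp add: emb_def mult_ac flip: of_real_mult)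
 then show ?thesis unfolding L2_inner_def ip_def integral_complex_of_real[symmetric] by simp
qed

lemma L2_norm_emb: "L2_norm (emb \<phi>) = nrm \<phi>"
proof -
 have "(L2_norm (emb \<phi>))^2 = ip \<phi> \<phi>"
  using L2_inner_emb[of \<phi> \<phi>] unfolding L2_inner_self of_real_eq_iff .
 then show ?thesis by (simp add: nrm_def real_sqrt_unique)
qed

lemma emb_diff: "emb (%x. \<phi> x - \<psi> x) = (%x. emb \<phi> x - emb \<psi> x)"
 by (simp add: emb_def[abs_def] right_diff_distrib)

lemma emb_cmult: "emb (%x. c*\<phi> x) = (%x. cor c*emb \<phi> x)"
 by (simp add: emb_def[abs_def] mult.left_commute)

lemma T_psd: "\<phi> : bmf ==> 0 <= ip \<phi> (T \<phi>)"
 using kernel_op_psd(2)[OF \<beta> d h_test emb_L2, of \<phi>] by (simp add: kernel_op_emb L2_inner_emb)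

text \<open>The bound is needed for all of L2, in particular for basis vectors, which need not have
  the form \<open>emb \<phi>\<close>. The argument of \<open>Schur_test\<close> is therefore
  repeated for \<open>|v|\<close>, with \<open>p = |v|^2/\<psi>\<close> and
  \<open>g = h \<psi>\<close> as the two factors.\<close>

lemma kernel_op_Schur:
 assumes \<psi>: "\<psi> : bmf" "!!x. 1 <= \<psi> x" "!!x. T \<psi> x <= \<Lambda>*\<psi> x" and v: "v : L2"
 shows "Re (L2_inner v (kernel_op \<beta> h v)) <= \<Lambda>*(L2_norm v)^2"
proof -
 have \<psi>0: "\<psi> x > 0" for x using \<psi>(2)[of x] by linarith
 note [measurable] = bmf_measurable[OF \<psi>(1)]
 have [measurable]: "v : BM" using v by simp
 let ?G = "bose_kernel \<beta> :: 'a => real"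
 have G: "0 <= ?G x" "?G x <= ?G 0" for x
  by (auto intro: bose_kernel_nonneg[OF \<beta> d] bose_kernel_le[OF \<beta> d])
 obtain C where C: "C >= 0" "!!x. \<bar>\<psi> x\<bar> <= C" using bmfE[OF \<psi>(1)] by metis
 define a where "a = (%x. sqrt (h x)*cmod (v x))"
 have a0: "0 <= a x" for x by (simp add: a_def h_nonneg)
 have a_real: "integrable lborel a"
  using integrable_norm[OF sqrt_test_functions_L2(2)[OF h_test v]] h_nonneg by (simp add: a_def[abs_def] norm_mult)
 \<comment> \<open>The value 0 where \<open>h\<close> vanishes confines the last estimate to the
   ball of radius \<open>R\<close>, on which \<open>T_eq\<close> lets the full kernel be replaced by
   the truncated one.\<close>
 define p where "p = (%x. if h x = 0 then 0 else (cmod (v x))\<^sup>2/\<psi> x)"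
 have p0: "0 <= p x" for x using \<psi>0[of x] by (simp add: p_def)
 have pv: "p x <= (cmod (v x))^2" for x
  using \<psi>(2)[of x] divide_left_mono[of 1 "\<psi> x" "(cmod (v x))^2"] by (simp add: p_def)
 have pi: "integrable lborel p"
  by (rule bochner_integrable_bound[OF L2_integrable[OF v]]) (use p0 pv in \<open>auto simp: p_def\<close>)
 define g where "g = (%x. h x*\<psi> x)"
 have gi: "integrable lborel g" unfolding g_def by (rule integrable_mult_bmf[OF test_functions_integrable[OF h_test] \<psi>(1)])
 have g0: "0 <= g x" for x using h_nonneg[of x] \<psi>0[of x] by (simp add: g_def)
 have pt: "2*(a x*a y) <= p x*g y + g x*p y" for x y
 proof (cases "h x = 0 \<or> h y = 0")
  case True
  then show ?thesis using p0 g0 by (auto simp: a_def)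
 next
  case False
  define s where "s = cmod (v x) * sqrt (h y)"
  define t where "t = cmod (v y) * sqrt (h x)"
  \<comment> \<open>The factor moves \<open>\<psi> x\<close> and \<open>\<psi> y\<close> to the
    right places in the two squares without changing the product \<open>s t\<close>.\<close>
  define c where "c = sqrt (\<psi> y/\<psi> x)"
  have c: "c > 0" "c^2 = \<psi> y/\<psi> x" using \<psi>0[of x] \<psi>0[of y] by (auto simp: c_def)
  have "2*((s*c)*(t/c)) <= (s*c)^2 + (t/c)^2" using sum_squares_bound[of "s*c" "t/c"] by (simp only: mult.assoc)
  moreover have "(s*c)*(t/c) = a x*a y" using c by (simp add: s_def t_def a_def)
  moreover have "(s*c)^2 = p x*g y" using h_nonneg[of y] False by (simp add: s_def c power_mult_distrib p_def g_def)
  moreover have "(t/c)^2 = g x*p y" using h_nonneg[of x] False by (simp add: t_def c power_mult_distrib power_divide p_def g_def)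
  ultimately show ?thesis by simp
 qed
 let ?B = "%f e. (LBINT y. f y*(LBINT x. e x*?G (y - x)))"
 have ie: "integrable lborel (%x. e x*?G (y - x))" if "integrable lborel e" for e :: "'a => real" and y
 proof (rule bochner_integrable_bound[OF integrable_mult_left[OF that, of "?G 0"]])
  have [measurable]: "e : BM" using that by auto
  show "(%x. e x*?G (y - x)) : borel_measurable lborel" by measurable
  show "AE x in lborel. norm (e x*?G (y - x)) <= norm (e x*?G 0)"
   using G by (intro AE_I2) (simp add: abs_mult mult_left_mono)
 qed
 have if_: "integrable lborel (%y. f y*(LBINT x. e x*?G (y - x)))" if f: "integrable lborel f" and e: "integrable lborel e" for f e :: "'a => real"
 proof (rule bochner_integrable_bound[OF integrable_mult_left[OF f, of "(LBINT x. \<bar>e x\<bar>*?G 0)"]])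
  have [measurable]: "e : BM" "f : BM" using e f by auto
  show "(%y. f y*(LBINT x. e x*?G (y - x))) : borel_measurable lborel" by measurable
  show "AE y in lborel. norm (f y*(LBINT x. e x*?G (y - x))) <= norm (f y*(LBINT x. \<bar>e x\<bar>*?G 0))"
  proof (rule AE_I2)
   fix y
   have "\<bar>(LBINT x. e x*?G (y - x))\<bar> <= (LBINT x. \<bar>e x*?G (y - x)\<bar>)" by (rule integral_abs_bound)
   also have "... <= (LBINT x. \<bar>e x\<bar>*?G 0)"
    by (rule integral_mono[OF integrable_abs[OF ie[OF e]] integrable_mult_left[OF integrable_abs[OF e]]])
     (use G in \<open>simp add: abs_mult mult_left_mono\<close>)
   finally show "norm (f y*(LBINT x. e x*?G (y - x))) <= norm (f y*(LBINT x. \<bar>e x\<bar>*?G 0))"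
    unfolding norm_mult by (intro mult_left_mono) (auto simp: abs_le_iff)
  qed
 qed
 have "Re (L2_inner v (kernel_op \<beta> h v)) <= cmod (L2_inner v (kernel_op \<beta> h v))" by (rule complex_Re_le_cmod)
 also have "... <= (LBINT y. cmod (cnj (v y)*kernel_op \<beta> h v y))" unfolding L2_inner_def by (rule integral_norm_bound)
 also have "... <= ?B a a"
 proof (rule integral_mono[OF integrable_norm[OF L2_inner_integrable[OF v kernel_op_L2(1)[OF \<beta> d h_test v]]] if_[OF a_real a_real]])
  fix y
  let ?I = "(LBINT x. (cor (sqrt (h x)) * v x)*cor (?G (y - x)))"
  have "cmod (cnj (v y)*kernel_op \<beta> h v y) = a y*cmod ?I"
   using h_nonneg[of y] by (simp add: kernel_op_def norm_mult a_def mult_ac)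
  also have "... <= a y*(LBINT x. cmod ((cor (sqrt (h x)) * v x)*cor (?G (y - x))))"
   by (intro mult_left_mono integral_norm_bound a0)
  also have "(LBINT x. cmod ((cor (sqrt (h x)) * v x)*cor (?G (y - x)))) = (LBINT x. a x*?G (y - x))"
   using G h_nonneg by (simp add: a_def norm_mult)
  finally show "cmod (cnj (v y)*kernel_op \<beta> h v y) <= a y*(LBINT x. a x*?G (y - x))" .
 qed
 finally have 1: "Re (L2_inner v (kernel_op \<beta> h v)) <= ?B a a" .
 have 2: "2*?B a a <= ?B p g + ?B g p"
 proof -
  have "2*?B a a = (LBINT y. 2*a y*(LBINT x. a x*?G (y - x)))" by (simp add: mult.assoc)
  also have "... <= (LBINT y. p y*(LBINT x. g x*?G (y - x)) + g y*(LBINT x. p x*?G (y - x)))"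
  proof (rule integral_mono)
   fix y
   have "2*a y*(LBINT x. a x*?G (y - x)) = (LBINT x. 2*a y*(a x*?G (y - x)))" by simp
   also have "... <= (LBINT x. p y*(g x*?G (y - x)) + g y*(p x*?G (y - x)))"
   proof (rule integral_mono)
    fix x
    have "(2*(a y*a x))*?G (y - x) <= (p y*g x + g y*p x)*?G (y - x)"
     by (intro mult_right_mono pt G)
    then show "2*a y*(a x*?G (y - x)) <= p y*(g x*?G (y - x)) + g y*(p x*?G (y - x))"
     by (simp add: algebra_simps)
   qed (intro bochner_integrable_add integrable_mult_right ie a_real pi gi)+
   also have "... = p y*(LBINT x. g x*?G (y - x)) + g y*(LBINT x. p x*?G (y - x))"
    using ie[OF pi, of y] ie[OF gi, of y] by simp
   finally show "2*a y*(LBINT x. a x*?G (y - x)) <= p y*(LBINT x. g x*?G (y - x)) + g y*(LBINT x. p x*?G (y - x))" .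
  qed (use integrable_mult_right[OF if_[OF a_real a_real], of 2] if_[OF pi gi] if_[OF gi pi] in \<open>auto simp: mult.assoc\<close>)
  also have "... = ?B p g + ?B g p" by (rule bochner_integral_add[OF if_[OF pi gi] if_[OF gi pi]])
  finally show ?thesis .
 qed
 have 3: "?B g p = ?B p g"
 proof -
  have c: "integrable lborel (%x. cor (g x))" "integrable lborel (%x. cor (p x))"
   using gi pi by (simp_all add: complex_of_real_integrable_eq)
  have "cor (?B g p) = cor (LBINT x. p x*(LBINT y. g y*?G (y - x)))"
   using fubini_prod_bounded[OF c, of "%z. cor (?G (fst z - snd z))" "?G 0"] G
   by (simp add: integral_complex_of_real flip: of_real_mult)
  also have "(%x. (LBINT y. g y*?G (y - x))) = (%x. (LBINT y. g y*?G (x - y)))"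
   by (intro ext bochner_integral_cong refl) (metis bose_kernel_minus minus_diff_eq)
  finally show ?thesis unfolding of_real_eq_iff .
 qed
 have "?B p g <= (LBINT y. \<Lambda>*(cmod (v y))^2)"
 proof (rule integral_mono[OF if_[OF pi gi] integrable_mult_right[OF L2_integrable[OF v]]])
  fix y
  show "p y*(LBINT x. g x*?G (y - x)) <= \<Lambda>*(cmod (v y))^2"
  proof (cases "h y = 0")
   case True
   have "0 <= \<Lambda>*\<psi> y"
    using \<psi>(3)[of y] T_nonneg[of \<psi> y] \<psi>0 by (meson less_imp_le order_trans)
   then have "0 <= \<Lambda>" using \<psi>0[of y] by (simp add: zero_le_mult_iff)
   then show ?thesis using True by (simp add: p_def)
  next
   case False
   then have "norm y <= R" using R[of y] by force
   then have "(LBINT x. g x*?G (y - x)) = T \<psi> y" by (simp add: T_eq g_def mult.commute)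
   then have "p y*(LBINT x. g x*?G (y - x)) <= p y*(\<Lambda>*\<psi> y)"
    using \<psi>(3)[of y] p0[of y] by (simp add: mult_left_mono)
   also have "... = \<Lambda>*(cmod (v y))^2" using False \<psi>0[of y] by (simp add: p_def)
   finally show ?thesis .
  qed
 qed
 then show ?thesis using 1 2 3 by (simp add: L2_norm_sq)
qed

text \<open>By coercivity a resolvent sequence becomes Cauchy in L2 under \<open>emb\<close>, and
  its limit solves the equation, so the choice in \<open>inverse_one_plus\<close> is not void. The
  chosen solution \<open>y\<close> is then evaluated by symmetry: \<open>(a, y)\<close> is the limit
  of \<open>(A v_n, y) = (v_n, A y)\<close>, where only the equation satisfied by \<open>y\<close>
  enters.\<close>

lemma inverse_one_plus_value:
 assumes z: "z >= 0" and g: "g : test_functions" and gh: "!!x. 1 - exp (- g x) = z*h x"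
  and r: "resolvent_value (- z) r"
 shows "L2_inner (sqrt_one_minus_exp g) (inverse_one_plus (K_op \<beta> g) (sqrt_one_minus_exp g)) = cor (z*r)"
proof -
 define a where "a = emb (%x. 1)"
 have aL: "a : L2" by (simp add: a_def)
 have sq: "sqrt_one_minus_exp g = (%x. cor (sqrt z)*a x)"
  by (simp add: sqrt_one_minus_exp_def[abs_def] gh a_def emb_def real_sqrt_mult)
 have KL: "kernel_op \<beta> h u : L2" if "u : L2" for u by (rule kernel_op_L2(1)[OF \<beta> d h_test that])
 have Kg: "AE x in lborel. K_op \<beta> g u x = cor z*kernel_op \<beta> h u x" if u: "u : L2" for u
  using K_op_eq_kernel_op(2)[OF \<beta> d g u] by (simp add: gh kernel_op_scale[OF z])
 have co: "coercive (- z) 1"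
  unfolding coercive_def using T_psd z by auto
 obtain s where s: "resolvent_seq (- z) s" and sr: "(%n. ip (%x. 1) (s n)) ----> r"
  using r by (auto simp: resolvent_value_def)
 have sb: "s n : bmf" for n using s by (simp add: resolvent_seq_def)
 define v where "v = (%n. emb (s n))"
 have vL: "v n : L2" for n by (simp add: v_def sb)
 define e where "e = (%n. nrm (%x. 1 - (s n x - (- z)*T (s n) x)))"
 have e: "e ----> 0" using s by (simp add: e_def resolvent_seq_def)
 have ev: "L2_norm (%x. (v n x + cor z*kernel_op \<beta> h (v n) x) - a x) = e n" for n
 proof -
  have "(%x. a x - (v n x + cor z*kernel_op \<beta> h (v n) x)) = emb (%x. 1 - (s n x - (- z)*T (s n) x))"
   by (simp only: emb_diff emb_cmult v_def a_def kernel_op_emb) simp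
  then show ?thesis by (subst L2_norm_minus_commute) (simp add: L2_norm_emb e_def)
 qed
 have cauchy: "L2_norm (%x. v m x - v n x) <= e m + e n" for m n
 proof -
  have dS: "(%x. s m x - s n x) : bmf" by (intro bmf_diff sb)
  have eb: "(%x. 1 - (s n x - (- z)*T (s n) x)) : bmf" for n
   by (intro bmf_diff bmf_mult bmf_const sb T_bmf)
  have "L2_norm (%x. v m x - v n x) = nrm (%x. s m x - s n x)"
   by (simp add: v_def emb_diff[symmetric] L2_norm_emb)
  also have "... <= nrm (%x. (s m x - s n x) - (- z)*T (%x. s m x - s n x) x)"
   using coercive_bound[OF co dS] by simp
  also have "(%x. (s m x - s n x) - (- z)*T (%x. s m x - s n x) x)
   = (%x. (- 1)*(1 - (s m x - (- z)*T (s m) x)) + (1 - (s n x - (- z)*T (s n) x)))"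
   by (simp add: T_diff[OF sb sb] algebra_simps)
  also have "nrm ... <= nrm (%x. (- 1)*(1 - (s m x - (- z)*T (s m) x))) + nrm (%x. 1 - (s n x - (- z)*T (s n) x))"
   by (rule nrm_triangle) (intro eb bmf_mult bmf_const)+
  also have "... = e m + e n" unfolding nrm_cmult by (simp add: e_def)
  finally show ?thesis .
 qed
 obtain u where u: "u : L2" and vu: "(%n. L2_norm (%x. v n x - u x)) ----> 0"
 proof (rule L2_complete[OF vL])
  fix \<epsilon> :: real assume "\<epsilon> > 0"
  then have "\<forall>\<^sub>F n in sequentially. e n < \<epsilon>/2" by (intro order_tendstoD(2)[OF e]) simp
  then obtain N where N: "!!n. n >= N ==> e n < \<epsilon>/2" by (auto simp: eventually_sequentially)
  show "EX N. ALL m>=N. ALL n>=N. L2_norm (%x. v m x - v n x) <= \<epsilon>"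
  proof (intro exI allI impI)
   fix m n assume "N <= m" "N <= n"
   then show "L2_norm (%x. v m x - v n x) <= \<epsilon>" using cauchy[of m n] N[of m] N[of n] by linarith
  qed
 qed (rule that)
 define A where "A = (%u x. u x + cor z*kernel_op \<beta> h u x)"
 have AL: "A u : L2" if "u : L2" for u unfolding A_def by (intro L2_add L2_cmult KL that)
 have Adiff: "L2_norm (%x. A (v n) x - A u x) <= (1 + z*(bose_kernel \<beta> (0::'a)*(LBINT x. h x)))*L2_norm (%x. v n x - u x)" for n
 proof -
  let ?w = "%x. v n x - u x"
  have wL: "?w : L2" using vL u by simp
  have kd: "kernel_op \<beta> h ?w x = kernel_op \<beta> h (v n) x - kernel_op \<beta> h u x" for x
   using kernel_op_diff[OF \<beta> d h_test vL u, of n 1] by simp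
  have "(%x. A (v n) x - A u x) = (%x. ?w x + cor z*kernel_op \<beta> h ?w x)"
   by (simp add: A_def kd algebra_simps)
  then have "L2_norm (%x. A (v n) x - A u x) <= L2_norm ?w + L2_norm (%x. cor z*kernel_op \<beta> h ?w x)"
   using L2_norm_triangle[OF wL L2_cmult[OF KL[OF wL], of "cor z"]] by simp
  also have "L2_norm (%x. cor z*kernel_op \<beta> h ?w x) = z*L2_norm (kernel_op \<beta> h ?w)"
   unfolding L2_norm_cmult using z by simp
  also have "... <= z*(bose_kernel \<beta> (0::'a)*(LBINT x. h x)*L2_norm ?w)"
   using z by (intro mult_left_mono kernel_op_L2(2)[OF \<beta> d h_test wL])
  finally show ?thesis by (simp add: algebra_simps)
 qed
 have Alim: "(%n. L2_norm (%x. A (v n) x - A u x)) ----> 0"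
  by (rule tendsto_sandwich[OF _ _ tendsto_const tendsto_mult_right_zero[OF vu, of "1 + z*(bose_kernel \<beta> (0::'a)*(LBINT x. h x))"]])
   (use Adiff in auto)
 have "L2_norm (%x. A u x - a x) <= L2_norm (%x. A (v n) x - A u x) + e n" for n
  using L2_norm_triangle_diff[OF AL[OF u] AL[OF vL] aL, of n] ev[of n] L2_norm_minus_commute[of "A u" "A (v n)"] by (simp add: A_def)
 moreover have "(%n. L2_norm (%x. A (v n) x - A u x) + e n) ----> 0"
  using tendsto_add[OF Alim e] by simp
 ultimately have "L2_norm (%x. A u x - a x) <= 0"
  by (intro tendsto_le[OF sequentially_bot _ tendsto_const]) auto
 then have Au: "AE x in lborel. A u x - a x = 0"
  by (intro L2_norm_eq_0) (use L2_norm_nonneg[of "%x. A u x - a x"] AL[OF u] aL in auto)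
 let ?u = "%x. cor (sqrt z)*u x"
 have "EX u. u : L2 & (AE x in lborel. u x + K_op \<beta> g u x = sqrt_one_minus_exp g x)"
 proof (intro exI conjI)
  show uL: "?u : L2" by (rule L2_cmult[OF u])
  have keq: "kernel_op \<beta> h ?u = (%x. cor (sqrt z)*kernel_op \<beta> h u x)"
   using kernel_op_diff[OF \<beta> d h_test L2_zero u, of "- cor (sqrt z)"]
   by (auto simp: kernel_op_def fun_eq_iff)
  show "AE x in lborel. ?u x + K_op \<beta> g ?u x = sqrt_one_minus_exp g x"
   using Kg[OF uL] Au
  proof eventually_elim
   case (elim x)
   have "a x = u x + cor z*kernel_op \<beta> h u x" using elim(2) by (simp add: A_def)
   then show ?case unfolding elim(1) keq sq by (simp add: algebra_simps)
  qed
 qed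
 then have inv: "inverse_one_plus (K_op \<beta> g) (sqrt_one_minus_exp g) : L2 &
  (AE x in lborel. inverse_one_plus (K_op \<beta> g) (sqrt_one_minus_exp g) x + K_op \<beta> g (inverse_one_plus (K_op \<beta> g) (sqrt_one_minus_exp g)) x = sqrt_one_minus_exp g x)"
  unfolding inverse_one_plus_def by (rule someI_ex)
 define y where "y = inverse_one_plus (K_op \<beta> g) (sqrt_one_minus_exp g)"
 have y: "y : L2" and yeq: "AE x in lborel. y x + K_op \<beta> g y x = sqrt_one_minus_exp g x"
  using inv[folded y_def] by blast+
 have Ay: "AE x in lborel. A y x = cor (sqrt z)*a x"
  using yeq Kg[OF y] by eventually_elim (simp add: A_def sq)
 have "L2_inner (A (v n)) y = cor (sqrt z*ip (%x. 1) (s n))" for n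
 proof -
  have "L2_inner (A (v n)) y = L2_inner (v n) y + cor z*L2_inner (kernel_op \<beta> h (v n)) y"
   unfolding A_def by (subst L2_inner_add_left) (simp_all add: y vL KL L2_inner_cmult_left)
  also have "... = L2_inner (v n) (A y)"
   unfolding A_def kernel_op_hermitian[OF \<beta> d h_test vL y]
   by (subst L2_inner_add_right) (simp_all add: y vL KL L2_inner_cmult_right)
  also have "... = L2_inner (v n) (%x. cor (sqrt z)*a x)"
   by (rule L2_inner_cong_AE) (use vL[of n] AL[OF y] aL Ay in auto)
  also have "... = cor (sqrt z*ip (%x. 1) (s n))"
   by (simp add: L2_inner_cmult_right v_def a_def L2_inner_emb ip_commute[of "s n"])
  finally show ?thesis .
 qed
 moreover have "(%n. L2_inner y (A (v n))) ----> L2_inner y a"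
  by (rule L2_inner_tendsto[OF AL[OF vL] aL y]) (use e ev in \<open>simp add: A_def\<close>)
 then have "(%n. L2_inner (A (v n)) y) ----> L2_inner a y"
  using tendsto_cnj by (fastforce simp: L2_inner_cnj)
 ultimately have "(%n. cor (sqrt z*ip (%x. 1) (s n))) ----> L2_inner a y" by simp
 moreover have "(%n. cor (sqrt z*ip (%x. 1) (s n))) ----> cor (sqrt z*r)"
  by (intro tendsto_of_real tendsto_mult_left sr)
 ultimately have "L2_inner a y = cor (sqrt z*r)" by (rule LIMSEQ_unique)
 then have "L2_inner (%x. cor (sqrt z)*a x) y = cor (sqrt z)*cor (sqrt z*r)"
  by (simp add: L2_inner_cmult_left)
 also have "... = cor (z*r)" using z by (simp flip: of_real_mult mult.assoc)
 finally show ?thesis by (simp add: sq[symmetric] y_def)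
qed

end

section \<open>Point measures\<close>

lemma openin_vague_subset: "openin vague_topology V ==> V \<subseteq> point_measures"
proof -
 assume "openin vague_topology V"
 then have "V \<subseteq> topspace vague_topology" by (rule openin_subset)
 also have "... \<subseteq> point_measures" unfolding vague_topology_def topology_generated_by_topspace by auto
 finally show ?thesis .
qed

lemma point_measure_borel_facts:
 shows space_point_measure_borel: "space point_measure_borel = point_measures"
  and sets_point_measure_borel: "sets point_measure_borel = sigma_sets point_measures {V. openin vague_topology V}"
proof -
 have "{V. openin vague_topology V} \<subseteq> Pow point_measures" using openin_vague_subset by auto
 note * = space_measure_of[OF this] sets_measure_of[OF this]
 show "space point_measure_borel = point_measures"
  "sets point_measure_borel = sigma_sets point_measures {V. openin vague_topology V}"
  unfolding point_measure_borel_def by (rule *)+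
qed

lemma point_measures_sets: "Z : point_measures ==> sets Z = sets borel"
 by (simp add: point_measures_def)

lemma point_measure_measurable:
 assumes "Z : point_measures" "f : measurable borel N" shows "f : measurable Z N"
 using assms(2) by (subst measurable_cong_sets[OF point_measures_sets[OF assms(1)] refl])

lemma point_measures_finite:
 assumes Z: "Z : point_measures" and A: "A \<subseteq> cball 0 (R::real)"
 shows "emeasure Z (A :: 'a::euclidean_space set) < \<infinity>"
proof -
 have "emeasure Z A <= emeasure Z (cball 0 R)"
  using point_measures_sets[OF Z] by (intro emeasure_mono A) auto
 also have "... < \<infinity>" using Z by (simp add: point_measures_def)
 finally show ?thesis .
qed

lemma point_measures_nat:
 assumes Z: "Z : point_measures" and A: "A : sets borel" "A \<subseteq> cball 0 (R::real)"
 shows "EX n. emeasure Z (A :: 'a::euclidean_space set) = of_nat n"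
proof -
 obtain e where "emeasure Z A = ennreal_of_enat e" using Z A by (auto simp: point_measures_def)
 then show ?thesis using point_measures_finite[OF Z A(2)] by (cases e) auto
qed

lemma vague_continuous_measurable:
 fixes \<phi> :: "'a::euclidean_space => real"
 assumes "continuous_on UNIV \<phi>" "compact (closure {x. \<phi> x ~= 0})"
 shows "(%Z. \<integral>x. \<phi> x \<partial>Z) : borel_measurable point_measure_borel"
proof (rule borel_measurableI)
 fix U :: "real set" assume "open U"
 then have "openin vague_topology {Z : point_measures. (\<integral>x. \<phi> x \<partial>Z) : U}"
  unfolding vague_topology_def using assms by (intro topology_generated_by_Basis) auto
 moreover have "(%Z. \<integral>x. \<phi> x \<partial>Z) -` U \<inter> space point_measure_borel = {Z : point_measures. (\<integral>x. \<phi> x \<partial>Z) : U}"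
  by (auto simp: space_point_measure_borel)
 ultimately show "(%Z. \<integral>x. \<phi> x \<partial>Z) -` U \<inter> space point_measure_borel : sets point_measure_borel"
  by (auto simp: sets_point_measure_borel intro: sigma_sets.Basic)
qed

text \<open>The indicator of \<open>U\<close> is the limit of
  \<open>min 1 (n dist (x, - U))\<close>; these functions are continuous and vanish off
  \<open>U\<close>, hence have compact support, and the vague topology makes their integrals
  measurable.\<close>

lemma measure_open_measurable:
 fixes U :: "'a::euclidean_space set"
 assumes U: "open U" "U \<subseteq> cball 0 R"
 shows "(%Z. measure Z U) : borel_measurable point_measure_borel"
proof (rule borel_measurable_LIMSEQ_real)
 define \<phi> where "\<phi> = (%n x. min 1 (real n*infdist x (- U)))"
 have "U ~= UNIV" using bounded_subset[OF bounded_cball U(2)] not_bounded_UNIV[where 'a='a] by metis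
 then have "- U ~= {}" by auto
 have cl: "closed (- U)" using U(1) by auto
 have c: "continuous_on UNIV (\<phi> n)" for n unfolding \<phi>_def by (intro continuous_intros)
 have 0: "\<phi> n x = 0" if "x \<notin> U" for n x using that by (simp add: \<phi>_def)
 have pos: "infdist x (- U) > 0" if "x : U" for x
  using in_closed_iff_infdist_zero[OF cl \<open>- U ~= {}\<close>, of x] that infdist_nonneg[of x "- U"] by force
 show "(%Z. \<integral>x. \<phi> n x \<partial>Z) : borel_measurable point_measure_borel" for n
 proof (rule vague_continuous_measurable[OF c])
  have "{x. \<phi> n x ~= 0} \<subseteq> cball 0 R" using 0 U(2) by auto
  then show "compact (closure {x. \<phi> n x ~= 0})"
   by (intro compact_closure[THEN iffD2] bounded_subset[OF bounded_cball])
 qed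
 fix Z :: "'a measure" assume "Z : space point_measure_borel"
 then have Z: "Z : point_measures" by (simp add: space_point_measure_borel)
 note [measurable_cong] = point_measures_sets[OF Z]
 have sp: "space Z = UNIV" using sets_eq_imp_space_eq[OF point_measures_sets[OF Z]] by simp
 have Um: "U : sets Z" using U point_measures_sets[OF Z] by simp
 have "(%n. \<integral>x. \<phi> n x \<partial>Z) ----> (\<integral>x. indicator U x \<partial>Z)"
 proof (rule integral_dominated_convergence[where w = "indicator U"])
  show "integrable Z (indicator U :: 'a => real)"
   using Um point_measures_finite[OF Z U(2)] by (rule integrable_real_indicator)
  show "\<phi> n : borel_measurable Z" for n
   by (rule point_measure_measurable[OF Z borel_measurable_continuous_onI[OF c]])
  have "\<bar>\<phi> n x\<bar> <= 1" for n x
   using mult_nonneg_nonneg[OF of_nat_0_le_iff[of n] infdist_nonneg[of x "- U"]] by (simp add: \<phi>_def)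
  then show "AE x in Z. norm (\<phi> n x) <= indicator U x" for n
   by (intro AE_I2) (use 0[of _ n] infdist_nonneg in \<open>auto simp: \<phi>_def indicator_def\<close>)
  show "AE x in Z. (%n. \<phi> n x) ----> indicator U x"
  proof (rule AE_I2)
   fix x
   show "(%n. \<phi> n x) ----> indicator U x"
   proof (cases "x : U")
    case True
    obtain N where N: "1/infdist x (- U) <= real N" using real_arch_simple by blast
    have "\<phi> n x = 1" if "n >= N" for n
    proof -
     have "1/infdist x (- U) <= real n" using N that by linarith
     then show ?thesis using pos[OF True] by (simp add: \<phi>_def divide_le_eq)
    qed
    then have "(%n. \<phi> n x) ----> 1" by (intro tendsto_eventually) (auto simp: eventually_sequentially)
    then show ?thesis using True by simp
   qed (simp add: 0)
  qed
 qed (use Um in auto)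
 also have "(\<integral>x. indicator U x \<partial>Z) = measure Z U" using Um sp by simp
 finally show "(%n. \<integral>x. \<phi> n x \<partial>Z) ----> measure Z U" .
qed

text \<open>Dynkin's lemma; intersecting with a fixed ball keeps all masses finite, as the step to
  complements requires.\<close>

lemma measure_borel_measurable:
 fixes A :: "'a::euclidean_space set"
 assumes "A : sets borel"
 shows "(%Z. measure Z (A \<inter> ball 0 R)) : borel_measurable point_measure_borel"
proof -
 have "A : sigma_sets UNIV {S. open S}" using assms by (simp add: borel_def sets_measure_of)
 then show ?thesis
 proof (induction rule: sigma_sets_induct_disjoint[rotated 2, consumes 1, case_names basic empty compl union])
  case (basic A)
  then show ?case by (intro measure_open_measurable[of _ R]) auto
 next
  case (compl A)
  have eq: "measure Z ((UNIV - A) \<inter> ball 0 R) = measure Z (ball 0 R) - measure Z (A \<inter> ball 0 R)" if "Z : space point_measure_borel" for Z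
  proof -
   have Z: "Z : point_measures" using that by (simp add: space_point_measure_borel)
   have "A : sets borel" using compl(1) by (simp add: borel_def sets_measure_of)
   then have "measure Z (ball 0 R - (A \<inter> ball 0 R)) = measure Z (ball 0 R) - measure Z (A \<inter> ball 0 R)"
    using point_measures_finite[OF Z, of "ball 0 R" R] point_measures_sets[OF Z] by (intro measure_Diff) auto
   moreover have "ball 0 R - (A \<inter> ball 0 R) = (UNIV - A) \<inter> ball 0 R" by auto
   ultimately show ?thesis by simp
  qed
  have "(%Z. measure Z (ball 0 R) - measure Z (A \<inter> ball 0 R)) : borel_measurable point_measure_borel"
   by (intro borel_measurable_diff compl measure_open_measurable[of _ R]) auto
  then show ?case using eq by (subst measurable_cong) auto
 next
  case (union A)
  have eq: "measure Z (\<Union> (range A) \<inter> ball 0 R) = (\<Sum>n. measure Z (A n \<inter> ball 0 R))" if "Z : space point_measure_borel" for Z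
  proof -
   have Z: "Z : point_measures" using that by (simp add: space_point_measure_borel)
   have "A n : sets borel" for n using union(2) by (auto simp: borel_def sets_measure_of)
   then have Ab: "A n \<inter> ball 0 R : sets Z" for n using point_measures_sets[OF Z] by simp
   have "(\<Union>n. A n \<inter> ball 0 R) \<subseteq> cball 0 R" by auto
   from point_measures_finite[OF Z this] have "emeasure Z (\<Union>n. A n \<inter> ball 0 R) ~= \<infinity>" by simp
   then have "(%n. measure Z (A n \<inter> ball 0 R)) sums measure Z (\<Union>n. A n \<inter> ball 0 R)"
   proof (rule measure_UNION[rotated 2])
    show "disjoint_family (%n. A n \<inter> ball 0 R)" using union(1) unfolding disjoint_family_on_def by blast
    show "range (%n. A n \<inter> ball 0 R) \<subseteq> sets Z" using Ab by (simp add: image_subset_iff)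
   qed
   moreover have "\<Union> (range A) \<inter> ball 0 R = (\<Union>n. A n \<inter> ball 0 R)" by blast
   ultimately show ?thesis by (metis sums_unique)
  qed
  have "(%Z. \<Sum>n. measure Z (A n \<inter> ball 0 R)) : borel_measurable point_measure_borel"
   by (intro borel_measurable_suminf union)
  then show ?case using eq by (subst measurable_cong) auto
 qed (auto simp: Int_stable_def)
qed

lemma point_measure_integrable:
 fixes f :: "'a::euclidean_space => real"
 assumes Z: "Z : point_measures" and "f : BM" "!!x. \<bar>f x\<bar> <= C" "!!x. norm x > R ==> f x = 0"
 shows "integrable Z f"
proof (rule bochner_integrable_bound)
 note [measurable_cong] = point_measures_sets[OF Z]
 have "integrable Z (indicator (cball 0 R) :: 'a => real)"
  using point_measures_finite[OF Z, of "cball 0 R" R] point_measures_sets[OF Z] by (intro integrable_real_indicator) auto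
 then show "integrable Z (%x. indicator (cball 0 R) x*C :: real)" by (rule integrable_mult_left)
 show "f : borel_measurable Z" by (rule point_measure_measurable[OF Z assms(2)])
 show "AE x in Z. norm (f x) <= norm (indicator (cball 0 R) x*C :: real)"
 proof (rule AE_I2)
  fix x
  show "norm (f x) <= norm (indicator (cball 0 R) x*C :: real)"
   using assms(3)[of x] assms(4)[of x] by (cases "norm x <= R") (auto simp: indicator_def)
 qed
qed

theorem integral_test_function_measurable:
 assumes f: "f : test_functions"
 shows "(%Z. \<integral>x. f x \<partial>Z) : borel_measurable point_measure_borel"
proof -
 from f obtain R H where RH: "R > 0" "!!x. norm x > R ==> f x = 0" "!!x. f x <= H" by (rule test_functionsE) blast
 obtain m where m: "H <= real m" using real_arch_simple by blast
 show ?thesis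
 proof (rule borel_measurable_LIMSEQ_real)
  have [measurable]: "f : BM" using f by (simp add: test_functions_def)
  have f0: "0 <= f x" for x using test_functions_nonneg[OF f] by simp
  let ?A = "%n k. {x. real k <= real (Suc n)*f x}"
  \<comment> \<open>\<open>f\<close> rounded down to a multiple of \<open>1/(n + 1)\<close>, as a
    sum of indicators of superlevel sets. Because \<open>k\<close> starts at 1, \<open>f\<close> is
    positive on each set, so the open ball of radius \<open>R + 1\<close> cuts nothing off.\<close>
  let ?g = "%n x. (\<Sum>k\<in>{1..Suc n*m}. indicator (?A n k \<inter> ball 0 (R + 1)) x)/real (Suc n)"
  have A: "?A n k : sets borel" for n k by measurable
  show "(%Z. (\<Sum>k\<in>{1..Suc n*m}. measure Z (?A n k \<inter> ball 0 (R + 1)))/real (Suc n)) : borel_measurable point_measure_borel" for n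
   by (intro borel_measurable_divide borel_measurable_sum measure_borel_measurable A) simp
  have g: "?g n x = real (nat \<lfloor>real (Suc n)*f x\<rfloor>)/real (Suc n)" for n x
  proof -
   have "nat \<lfloor>real (Suc n)*f x\<rfloor> <= Suc n*m"
   proof -
    have "real (Suc n)*f x <= real (Suc n*m)" using RH(3)[of x] m by (auto simp only: of_nat_mult intro!: mult_left_mono)
    then show ?thesis by linarith
   qed
   moreover have k: "k <= nat \<lfloor>real (Suc n)*f x\<rfloor> \<longleftrightarrow> x : ?A n k \<inter> ball 0 (R + 1)" if "1 <= k" for k
   proof -
    have "k <= nat \<lfloor>real (Suc n)*f x\<rfloor> \<longleftrightarrow> real k <= real (Suc n)*f x" using that by linarith
    moreover have "norm x < R + 1" if "real k <= real (Suc n)*f x"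
     using RH(2)[of x] that \<open>1 <= k\<close> by (cases "norm x > R") auto
    ultimately show ?thesis by auto
   qed
   ultimately have "{1..Suc n*m} \<inter> {k. x : ?A n k \<inter> ball 0 (R + 1)} = {1..nat \<lfloor>real (Suc n)*f x\<rfloor>}"
    unfolding set_eq_iff Int_iff[of _ "{1..Suc n*m}"] atLeastAtMost_iff mem_Collect_eq[of _ "%k. x : ?A n k \<inter> ball 0 (R + 1)"] by (metis le_trans)
   then show ?thesis by (simp add: indicator_def[abs_def] sum.If_cases of_bool_def)
  qed
  have bounds: "f x - 1/real (Suc n) <= ?g n x" "?g n x <= f x" "0 <= ?g n x" for n x
  proof -
   have "y - 1/N <= z/N & z/N <= y & 0 <= z/N" if "N > 0" "N*y - 1 <= z" "z <= N*y" "0 <= z" for N y z :: real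
    using that divide_right_mono[of "N*y - 1" z N] by (simp add: diff_divide_distrib pos_divide_le_eq mult.commute)
   from this[of "real (Suc n)" "f x" "real (nat \<lfloor>real (Suc n)*f x\<rfloor>)"]
   show "f x - 1/real (Suc n) <= ?g n x" "?g n x <= f x" "0 <= ?g n x"
    using mult_nonneg_nonneg[OF of_nat_0_le_iff[of "Suc n"] f0[of x]] unfolding g by linarith+
  qed
  fix Z :: "'a measure" assume "Z : space point_measure_borel"
  then have Z: "Z : point_measures" by (simp add: space_point_measure_borel)
  have Am: "?A n k \<inter> ball 0 (R + 1) : sets Z" for n k using A[of k n] point_measures_sets[OF Z] by auto
  have "integrable Z (indicator (?A n k \<inter> ball 0 (R + 1)) :: 'a => real)" for n k
   using Am by (intro integrable_real_indicator point_measures_finite[OF Z, of _ "R + 1"]) auto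
  then have "(\<Sum>k\<in>{1..Suc n*m}. measure Z (?A n k \<inter> ball 0 (R + 1)))/real (Suc n) = (\<integral>x. ?g n x \<partial>Z)" for n
   using Am[THEN sets.Int_space_eq2] by simp
  moreover have "(%n. \<integral>x. ?g n x \<partial>Z) ----> (\<integral>x. f x \<partial>Z)"
  proof (rule integral_dominated_convergence[where w = f])
   show "integrable Z f" by (rule point_measure_integrable[OF Z, of _ H R]) (use RH f0 in auto)
   show "f : borel_measurable Z" by (rule point_measure_measurable[OF Z]) simp
   show "?g n : borel_measurable Z" for n using Am by (intro borel_measurable_divide borel_measurable_sum borel_measurable_indicator) auto
   show "AE x in Z. norm (?g n x) <= f x" for n using bounds(2,3) by (intro AE_I2) (simp only: real_norm_def abs_of_nonneg)
   show "AE x in Z. (%n. ?g n x) ----> f x"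
   proof (rule AE_I2, rule tendsto_sandwich[OF _ _ _ tendsto_const])
    fix x
    show "(%n. f x - 1/real (Suc n)) ----> f x" using tendsto_diff[OF tendsto_const LIMSEQ_Suc[OF lim_1_over_n]] by simp
   qed (use bounds in auto)
  qed
  ultimately show "(%n. (\<Sum>k\<in>{1..Suc n*m}. measure Z (?A n k \<inter> ball 0 (R + 1)))/real (Suc n)) ----> (\<integral>x. f x \<partial>Z)" by simp
 qed
qed

text \<open>If every point of \<open>A\<close> had a neighbourhood meeting \<open>A\<close> in mass
  0, the Lindelof property would make \<open>A\<close> null. At a remaining point all these masses
  are positive integers, hence at least 1, and continuity from above passes this to the point
  itself.\<close>

lemma point_measure_atom:
 fixes A :: "'a::euclidean_space set"
 assumes Z: "Z : point_measures" and A: "A : sets borel" "A \<subseteq> cball 0 (R::real)" and pos: "emeasure Z A ~= 0"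
 shows "EX x:A. emeasure Z {x} ~= 0"
proof -
 have sets: "S : sets Z \<longleftrightarrow> S : sets borel" for S using point_measures_sets[OF Z] by simp
 have "EX x:A. ALL n. emeasure Z (A \<inter> ball x (1/real (Suc n))) ~= 0"
 proof (rule ccontr)
  assume "\<not> ?thesis"
  then obtain n where n: "!!x. x : A ==> emeasure Z (A \<inter> ball x (1/real (Suc (n x)))) = 0" by metis
  define \<F> where "\<F> = (%x. ball x (1/real (Suc (n x)))) ` A"
  obtain \<F>' where F: "\<F>' \<subseteq> \<F>" "countable \<F>'" "\<Union>\<F>' = \<Union>\<F>"
   using Lindelof[of \<F>] by (auto simp: \<F>_def)
  have "A \<subseteq> \<Union>\<F>" by (auto simp: \<F>_def)
  then have AU: "A = (\<Union>S\<in>\<F>'. A \<inter> S)" using F(3) by auto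
  have "A \<inter> S : null_sets Z" if "S : \<F>'" for S
   using that F(1) n A by (auto simp: \<F>_def null_sets_def sets)
  then have "(\<Union>S\<in>\<F>'. A \<inter> S) : null_sets Z" by (intro null_sets_UN' F)
  then show False using pos AU by (simp add: null_sets_def)
 qed
 then obtain x where x: "x : A" "!!n. emeasure Z (A \<inter> ball x (1/real (Suc n))) ~= 0" by blast
 let ?S = "%n. A \<inter> ball x (1/real (Suc n))"
 have ge1: "1 <= emeasure Z (?S n)" for n
 proof -
  have "?S n : sets borel" "?S n \<subseteq> cball 0 R" using A by auto
  then obtain m where "emeasure Z (?S n) = of_nat m" using point_measures_nat[OF Z] by blast
  then show ?thesis using x(2)[of n] by (cases m) auto
 qed
 have "(\<Inter>n. ?S n) = {x}"
 proof -
  have "y = x" if "!!n. dist x y < 1/real (Suc n)" for y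
  proof (rule ccontr)
   assume "y ~= x"
   then have "dist x y > 0" by simp
   then obtain n where "1/real (Suc n) < dist x y" using nat_approx_posE by blast
   then show False using that[of n] by simp
  qed
  then show ?thesis using x(1) by auto
 qed
 moreover have "(%n. emeasure Z (?S n)) ----> emeasure Z (\<Inter>n. ?S n)"
 proof (rule Lim_emeasure_decseq)
  show "range ?S \<subseteq> sets Z" using A by (auto simp: sets)
  show "decseq ?S" by (rule decseq_SucI) (force intro: less_le_trans[OF _ frac_le])
  show "emeasure Z (?S i) ~= \<infinity>" for i using point_measures_finite[OF Z, of "?S i" R] A by (auto simp: subset_iff less_top)
 qed
 ultimately have "1 <= emeasure Z {x}"
  using ge1 by (intro tendsto_lowerbound[of "%n. emeasure Z (?S n)"]) auto
 then show ?thesis using x(1) by force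
qed

lemma coeff_mult_nonneg:
 fixes p q :: "real poly"
 assumes "!!n. 0 <= coeff p n" "!!n. 0 <= coeff q n" shows "0 <= coeff (p*q) n"
 unfolding coeff_mult using assms by (intro sum_nonneg mult_nonneg_nonneg)

lemma coeff_power_nonneg:
 fixes p :: "real poly"
 assumes "!!n. 0 <= coeff p n" shows "0 <= coeff (p^m) n"
proof (induction m arbitrary: n)
 case 0 show ?case by (cases n) auto
next
 case (Suc m) then show ?case using coeff_mult_nonneg[OF assms Suc] by simp
qed

text \<open>Integer-valuedness enters here: over a single atom of mass \<open>m\<close> the exponential of the integral is
 the \<open>m\<close>-th power of an affine function of \<open>y\<close>.\<close>

lemma point_measure_generating_poly:
 fixes h :: "'a::euclidean_space => real"
 assumes Z: "Z : point_measures" and [measurable]: "h : BM"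
  and h: "!!x. 0 <= h x" "!!x. h x <= H" "!!x. norm x > R ==> h x = 0" and c: "0 <= c" "c*H < 1"
 shows "EX p. (ALL n. 0 <= coeff p n) & (ALL y>=0. exp (\<integral>x. ln (1 + (y - c)*h x) \<partial>Z) = poly p y)"
proof -
 note [measurable_cong] = point_measures_sets[OF Z]
 have sp: "space Z = UNIV" using sets_eq_imp_space_eq[OF point_measures_sets[OF Z]] by simp
 have ch: "c*h x <= c*H" for x by (intro mult_left_mono h c)
 have pos: "1 - c*H <= 1 + (y - c)*h x" if "y >= 0" for x y
  using ch[of x] mult_nonneg_nonneg[OF that h(1)[of x]] by (simp add: algebra_simps)
 let ?g = "%y x. ln (1 + (y - c)*h x)"
 have gb: "\<bar>?g y x\<bar> <= \<bar>ln (1 - c*H)\<bar> + \<bar>ln (1 + y*H)\<bar>" if y: "y >= 0" for y x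
 proof -
  have "ln (1 - c*H) <= ?g y x" using pos[OF y, of x] c by (intro ln_mono) auto
  moreover have "?g y x <= ln (1 + y*H)"
   using pos[OF y, of x] c mult_left_mono[OF h(2)[of x] y] mult_nonneg_nonneg[OF c(1) h(1)[of x]]
   by (intro ln_mono) (auto simp: algebra_simps)
  ultimately show ?thesis by linarith
 qed
 have int: "integrable Z (%x. indicator A x*?g y x)" if "y >= 0" "A : sets borel" for y A
 proof (rule point_measure_integrable[OF Z, where C = "\<bar>ln (1 - c*H)\<bar> + \<bar>ln (1 + y*H)\<bar>" and R = R])
  show "\<bar>indicator A x*?g y x\<bar> <= \<bar>ln (1 - c*H)\<bar> + \<bar>ln (1 + y*H)\<bar>" for x
   using gb[OF that(1), of x] by (auto split: split_indicator)
 qed (use that h(3) in auto)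
 have main: "EX p. (ALL n. 0 <= coeff p n) & (ALL y>=0. exp (\<integral>x. indicator A x*?g y x \<partial>Z) = poly p y)"
  if "A : sets borel" "A \<subseteq> cball 0 R" "emeasure Z A = of_nat n" for A n
  using that
 proof (induction n arbitrary: A rule: less_induct)
  case (less n A)
  show ?case
  proof (cases "n = 0")
   case True
   then have "A : null_sets Z" using less.prems point_measures_sets[OF Z] by (auto simp: null_sets_def)
   then have "AE x in Z. x \<notin> A" by (rule AE_not_in)
   then have "AE x in Z. indicator A x*?g y x = 0" for y by eventually_elim auto
   then have "(\<integral>x. indicator A x*?g y x \<partial>Z) = 0" for y by (rule integral_eq_zero_AE)
   then show ?thesis by (intro exI[of _ 1]) (auto simp: coeff_1)
  next
   case False
   then obtain x where x: "x : A" "emeasure Z {x} ~= 0"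
    using point_measure_atom[OF Z less.prems(1,2)] less.prems(3) by auto
   obtain m where m: "emeasure Z {x} = of_nat m"
    using point_measures_nat[OF Z, of "{x}" R] x less.prems by (auto simp: subset_iff)
   have Am: "A - {x} : sets borel" "A - {x} \<subseteq> cball 0 R" using less.prems by auto
   obtain k where k: "emeasure Z (A - {x}) = of_nat k" using point_measures_nat[OF Z Am] by auto
   have "emeasure Z A = emeasure Z {x} + emeasure Z (A - {x})"
    using x less.prems point_measures_sets[OF Z] by (subst plus_emeasure) (auto simp: insert_absorb)
   then have "of_nat n = (of_nat (m + k) :: ennreal)" using less.prems(3) m k by simp
   then have nmk: "n = m + k" by (simp only: of_nat_eq_iff)
   have "m ~= 0" using x m by auto
   then have "k < n" using nmk by simp
   from less.IH[OF this Am k]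
   obtain p where p: "ALL n. 0 <= coeff p n" "ALL y>=0. exp (\<integral>t. indicator (A - {x}) t*?g y t \<partial>Z) = poly p y"
    by blast
   \<comment> \<open>The constant coefficient \<open>1 - c h x\<close> is nonnegative because
     \<open>c H < 1\<close>; this ties the shift \<open>c\<close> to the bound of
     \<open>h\<close>.\<close>
   have q0: "0 <= coeff [:1 - c*h x, h x:] n" for n
    using ch[of x] c h(1)[of x] by (auto simp: coeff_pCons split: nat.split)
   have "exp (\<integral>x. indicator A x*?g y x \<partial>Z) = poly ([:1 - c*h x, h x:]^m*p) y" if y: "y >= 0" for y
   proof -
    have "(\<integral>t. indicator A t*?g y t \<partial>Z) = (\<integral>t. indicator {x} t*?g y x + indicator (A - {x}) t*?g y t \<partial>Z)"
     using x by (intro bochner_integral_cong refl) (auto split: split_indicator)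
    also have "... = (\<integral>t. indicator {x} t*?g y x \<partial>Z) + (\<integral>t. indicator (A - {x}) t*?g y t \<partial>Z)"
    proof (rule bochner_integral_add[OF _ int[OF y Am(1)]])
     show "integrable Z (%t. indicator {x} t*?g y x)"
      using m point_measures_sets[OF Z] of_nat_less_top by (intro integrable_mult_left integrable_real_indicator) auto
    qed
    also have "(\<integral>t. indicator {x} t*?g y x \<partial>Z) = real m*?g y x"
     using sp point_measures_sets[OF Z] m by (simp add: measure_def)
    finally have "exp (\<integral>t. indicator A t*?g y t \<partial>Z) = exp (?g y x)^m*poly p y"
     using p(2) y by (simp add: exp_add exp_of_nat_mult)
    also have "exp (?g y x) = poly [:1 - c*h x, h x:] y"
     using pos[OF y, of x] c by (simp add: algebra_simps)
    finally show ?thesis by simp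
   qed
   moreover have "0 <= coeff ([:1 - c*h x, h x:]^m*p) n" for n
    using p(1) by (intro coeff_mult_nonneg coeff_power_nonneg q0) auto
   ultimately show ?thesis by blast
  qed
 qed
 obtain n where "emeasure Z (cball 0 R) = of_nat n" using point_measures_nat[OF Z, of "cball 0 R" R] by auto
 moreover have "indicator (cball 0 R) x*?g y x = ?g y x" for x y
  using h(3)[of x] by (auto split: split_indicator)
 ultimately show ?thesis using main[of "cball 0 R" n] by (simp only:) auto
qed

section \<open>Continuation of the Laplace transform to positive exponents\<close>

text \<open>The integral is that of \<open>- g\<close> for \<open>g = - ln (1 + w h)\<close>, and
  \<open>1 - e^{-g} = - w h\<close>. Along this family \<open>K_g\<close> is \<open>- w\<close>
  times a fixed operator, and \<open>w <= 0\<close> is the range that the definition of the field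
  covers.\<close>

definition point_exp :: "('a::euclidean_space => real) => real => 'a measure => real" where
 "point_exp h w Z = exp (\<integral>x. ln (1 + w*h x) \<partial>Z)"

lemma ln_test_function:
 assumes h: "h : test_functions" and w: "0 <= w"
 shows "(%x. ln (1 + w*h x)) : test_functions"
proof -
 from h obtain R H where RH: "R > 0" "H > 0" "!!x. h x <= H" "!!x. norm x > R ==> h x = 0"
  by (rule test_functionsE) blast
 have [measurable]: "h : BM" using h by (rule test_functions_measurable)
 note h0 = test_functions_nonneg[OF h]
 show ?thesis
 proof (rule test_functionsI[where H = "ln (1 + w*H)" and R = R])
  fix x
  have "0 <= w*h x" "w*h x <= w*H" using w h0[of x] RH by (auto intro: mult_left_mono)
  then show "0 <= ln (1 + w*h x)" "ln (1 + w*h x) <= ln (1 + w*H)" by (auto intro: ln_mono)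
 qed (use RH in auto)
qed

lemma minus_ln_test_function:
 assumes h: "h : test_functions" "!!x. h x <= H" and z: "0 <= z" "z*H < 1"
 shows "(%x. - ln (1 - z*h x)) : test_functions"
proof -
 from h(1) obtain R H' where RH: "R > 0" "H' > 0" "!!x. h x <= H'" "!!x. norm x > R ==> h x = 0"
  by (rule test_functionsE) blast
 have [measurable]: "h : BM" using h(1) by (rule test_functions_measurable)
 note h0 = test_functions_nonneg[OF h(1)]
 show ?thesis
 proof (rule test_functionsI[where H = "- ln (1 - z*H)" and R = R])
  fix x
  have "0 <= z*h x" "z*h x <= z*H" using z h0[of x] h(2)[of x] by (auto intro: mult_left_mono)
  then show "0 <= - ln (1 - z*h x)" "- ln (1 - z*h x) <= - ln (1 - z*H)" using z by (auto intro: ln_mono)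
 qed (use RH in auto)
qed

lemma point_exp_measurable:
 assumes h: "h : test_functions" "!!x. h x <= H" and w: "- w*H < 1"
 shows "point_exp h w : borel_measurable point_measure_borel"
proof (cases "0 <= w")
 case True
 show ?thesis unfolding point_exp_def[abs_def]
  using integral_test_function_measurable[OF ln_test_function[OF h(1) True]] by measurable
next
 case False
 then have "(%Z. exp (- (\<integral>x. - ln (1 - (- w)*h x) \<partial>Z))) : borel_measurable point_measure_borel"
  using integral_test_function_measurable[OF minus_ln_test_function[OF h, of "- w"]] w False by simp
 then show ?thesis unfolding point_exp_def[abs_def] by simp
qed

text \<open>Recovers coefficients from values near 0. In this way measurability reaches
  \<open>generating_poly\<close>, which is chosen separately for each point measure.\<close>

lemma coeff_eq_limit:
 fixes p :: "real poly"
 assumes y: "y ----> 0" "!!k. y k ~= 0"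
 shows "(%k. (poly p (y k) - (\<Sum>m<n. coeff p m*y k^m))/y k^n) ----> coeff p n"
proof (induction n arbitrary: p)
 case 0
 have "(%k. poly p (y k)) ----> poly p 0" by (rule isCont_tendsto_compose[OF poly_isCont y(1)])
 then show ?case by (simp add: poly_0_coeff_0)
next
 case (Suc n)
 obtain a q where p: "p = pCons a q" by (cases p)
 have "(poly p (y k) - (\<Sum>m<Suc n. coeff p m*y k^m))/y k^Suc n
   = (poly q (y k) - (\<Sum>m<n. coeff q m*y k^m))/y k^n" for k
 proof -
  have "(\<Sum>m<Suc n. coeff p m*y k^m) = a + y k*(\<Sum>m<n. coeff q m*y k^m)"
   unfolding sum.lessThan_Suc_shift p by (simp add: sum_distrib_left mult_ac)
  then have "poly p (y k) - (\<Sum>m<Suc n. coeff p m*y k^m) = y k*(poly q (y k) - (\<Sum>m<n. coeff q m*y k^m))"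
   by (simp add: p right_diff_distrib)
  then show ?thesis using y(2)[of k] by simp
 qed
 then show ?case using Suc[of q] by (simp add: p)
qed

definition generating_poly :: "('a::euclidean_space => real) => real => 'a measure => real poly" where
 "generating_poly h c Z = (SOME p. (ALL n. 0 <= coeff p n) & (ALL y>=0. point_exp h (y - c) Z = poly p y))"

context
 fixes h :: "'a::euclidean_space => real" and H c :: real
 assumes h: "h : test_functions" "!!x. h x <= H" and c: "0 <= c" "c*H < 1"
begin

lemma generating_poly:
 assumes Z: "Z : point_measures"
 shows "0 <= coeff (generating_poly h c Z) n" "0 <= y ==> point_exp h (y - c) Z = poly (generating_poly h c Z) y"
proof -
 from h(1) obtain R H' where RH: "R > 0" "H' > 0" "!!x. h x <= H'" "!!x. norm x > R ==> h x = 0"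
  by (rule test_functionsE) blast
 have "EX p. (ALL n. 0 <= coeff p n) & (ALL y>=0. point_exp h (y - c) Z = poly p y)"
  unfolding point_exp_def
  by (rule point_measure_generating_poly[OF Z test_functions_measurable[OF h(1)] test_functions_nonneg[OF h(1)] h(2) RH(4) c])
 from someI_ex[OF this] show "0 <= coeff (generating_poly h c Z) n" "0 <= y ==> point_exp h (y - c) Z = poly (generating_poly h c Z) y"
  by (auto simp: generating_poly_def)
qed

lemma coeff_generating_poly_measurable:
 "(%Z. coeff (generating_poly h c Z) n) : borel_measurable point_measure_borel"
proof (induction n rule: less_induct)
 case (less n)
 define y where "y = (%k. 1/real (Suc k))"
 have H0: "0 <= H" using test_functions_nonneg[OF h(1)] h(2) order_trans by blast
 have ym: "point_exp h (y k - c) : borel_measurable point_measure_borel" for k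
 proof (rule point_exp_measurable[OF h])
  have "0 <= y k*H" using H0 by (simp add: y_def)
  then show "- (y k - c)*H < 1" using c by (simp add: algebra_simps)
 qed
 show ?case
 proof (rule borel_measurable_LIMSEQ_real)
  show "(%Z. (point_exp h (y k - c) Z - (\<Sum>m<n. coeff (generating_poly h c Z) m*y k^m))/y k^n) : borel_measurable point_measure_borel" for k
   using ym less by (intro borel_measurable_divide borel_measurable_diff borel_measurable_sum borel_measurable_times) auto
  fix Z :: "'a measure" assume "Z : space point_measure_borel"
  then have "Z : point_measures" by (simp add: space_point_measure_borel)
  then have "point_exp h (y k - c) Z = poly (generating_poly h c Z) (y k)" for k
   by (rule generating_poly) (simp add: y_def)
  then show "(%k. (point_exp h (y k - c) Z - (\<Sum>m<n. coeff (generating_poly h c Z) m*y k^m))/y k^n) ----> coeff (generating_poly h c Z) n"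
   using coeff_eq_limit[of y "generating_poly h c Z" n] LIMSEQ_inverse_real_of_nat by (simp add: y_def inverse_eq_divide)
 qed
qed

text \<open>Tonelli in \<open>[0, \<infinity>]\<close>: since the coefficients are nonnegative, no
  moment has to be known finite beforehand.\<close>

theorem point_exp_power_series:
 assumes \<nu>: "sets \<nu> = sets point_measure_borel" and y: "0 <= y"
 shows "(\<integral>\<^sup>+Z. ennreal (point_exp h (y - c) Z) \<partial>\<nu>) = (\<Sum>n. (\<integral>\<^sup>+Z. ennreal (coeff (generating_poly h c Z) n) \<partial>\<nu>)*ennreal (y^n))"
proof -
 note [measurable_cong] = \<nu>
 note [measurable] = coeff_generating_poly_measurable
 have sp: "space \<nu> = point_measures" using sets_eq_imp_space_eq[OF \<nu>] by (simp add: space_point_measure_borel)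
 have "(\<integral>\<^sup>+Z. ennreal (point_exp h (y - c) Z) \<partial>\<nu>) = (\<integral>\<^sup>+Z. (\<Sum>n. ennreal (coeff (generating_poly h c Z) n)*ennreal (y^n)) \<partial>\<nu>)"
 proof (rule nn_integral_cong)
  fix Z assume "Z : space \<nu>"
  then have Z: "Z : point_measures" using sp by simp
  note g = generating_poly[OF Z]
  have "poly (generating_poly h c Z) y = (\<Sum>n\<le>degree (generating_poly h c Z). coeff (generating_poly h c Z) n*y^n)"
   by (rule poly_altdef)
  then have "(%n. coeff (generating_poly h c Z) n*y^n) sums point_exp h (y - c) Z"
   unfolding g(2)[OF y] by (metis (no_types, lifting) sums_finite finite_atMost atMost_iff coeff_eq_0 mult_zero_left not_le)
  then have "(\<Sum>n. ennreal (coeff (generating_poly h c Z) n*y^n)) = ennreal (point_exp h (y - c) Z)"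
   using g(1) y by (intro suminf_ennreal_eq) auto
  then show "ennreal (point_exp h (y - c) Z) = (\<Sum>n. ennreal (coeff (generating_poly h c Z) n)*ennreal (y^n))"
   using g(1) y by (simp add: ennreal_mult)
 qed
 also have "... = (\<Sum>n. \<integral>\<^sup>+Z. ennreal (coeff (generating_poly h c Z) n)*ennreal (y^n) \<partial>\<nu>)"
  by (rule nn_integral_suminf) measurable
 also have "... = (\<Sum>n. (\<integral>\<^sup>+Z. ennreal (coeff (generating_poly h c Z) n) \<partial>\<nu>)*ennreal (y^n))"
  by (subst nn_integral_multc) measurable
 finally show ?thesis .
qed

end

section \<open>Determinants as limits of finite products\<close>

lemma minus_ln_bounds:
 fixes x :: real assumes "x < 1"
 shows "x <= - ln (1 - x)" "- ln (1 - x) <= x + x^2/(1 - max 0 x)"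
proof -
 show "x <= - ln (1 - x)" using ln_le_minus_one[of "1 - x"] assms by simp
 have "- ln (1 - x) <= 1/(1 - x) - 1" using ln_le_minus_one[of "1/(1 - x)"] assms by (simp add: ln_div)
 also have "... = x + x^2/(1 - x)" using assms by (simp add: field_simps power2_eq_square)
 also have "... <= x + x^2/(1 - max 0 x)" using assms by (intro add_left_mono divide_left_mono) auto
 finally show "- ln (1 - x) <= x + x^2/(1 - max 0 x)" .
qed

text \<open>Factor by factor, \<open>- ln (1 - x)\<close> lies between \<open>x\<close> and
  \<open>x + x^2/(1 - max 0 x)\<close>. The maximum with 0 treats both signs of \<open>w\<close> at
  once: a negative \<open>w\<close> costs nothing in the denominator.\<close>

lemma prod_list_bounds:
 fixes l :: "real list"
 assumes "!!a. a : set l ==> 0 <= a & a <= \<Lambda>" "w*\<Lambda> < 1"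
 shows prod_list_upper: "(\<Prod>a\<leftarrow>l. 1 - w*a) <= exp (- (w * sum_list l))"
  and prod_list_lower: "exp (- (w * sum_list l + w^2 * sum_list (map (%a. a^2) l)/(1 - max 0 (w*\<Lambda>)))) <= (\<Prod>a\<leftarrow>l. 1 - w*a)"
  and prod_list_pos: "0 < (\<Prod>a\<leftarrow>l. 1 - w*a)"
proof -
 have "(\<Prod>a\<leftarrow>l. 1 - w*a) <= exp (- (w * sum_list l))
  & exp (- (w * sum_list l + w^2 * sum_list (map (%a. a^2) l)/(1 - max 0 (w*\<Lambda>)))) <= (\<Prod>a\<leftarrow>l. 1 - w*a)
  & 0 < (\<Prod>a\<leftarrow>l. 1 - w*a)"
 using assms(1)
proof (induction l)
 case (Cons a l)
 let ?m = "1 - max 0 (w*\<Lambda>)"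
 have a: "0 <= a" "a <= \<Lambda>" using Cons.prems by auto
 have wa: "w*a <= max 0 (w*\<Lambda>)"
  using a mult_left_mono[of a \<Lambda> w] mult_nonpos_nonneg[of w a] by (cases "0 <= w") (auto simp: le_max_iff_disj)
 then have wa1: "w*a < 1" using assms(2) by simp
 have m: "?m > 0" using assms(2) by simp
 have e: "1 - w*a = exp (- (- ln (1 - w*a)))" using wa1 by simp
 have u: "1 - w*a <= exp (- (w*a))" by (subst e) (use minus_ln_bounds(1)[OF wa1] in simp)
 have "(w*a)^2/(1 - max 0 (w*a)) <= (w*a)^2/?m" using wa m by (intro divide_left_mono mult_pos_pos) auto
 then have l: "exp (- (w*a + (w*a)^2/?m)) <= 1 - w*a" by (subst e) (use minus_ln_bounds(2)[OF wa1] in simp)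
 have IH: "(\<Prod>a\<leftarrow>l. 1 - w*a) <= exp (- (w * sum_list l))"
  "exp (- (w * sum_list l + w^2 * sum_list (map (%a. a^2) l)/?m)) <= (\<Prod>a\<leftarrow>l. 1 - w*a)"
  "0 < (\<Prod>a\<leftarrow>l. 1 - w*a)" using Cons.IH Cons.prems by auto
 have "(1 - w*a)*(\<Prod>a\<leftarrow>l. 1 - w*a) <= exp (- (w*a))*exp (- (w * sum_list l))"
  using IH wa1 by (intro mult_mono u) auto
 then have 1: "(\<Prod>a\<leftarrow>a # l. 1 - w*a) <= exp (- (w * sum_list (a # l)))" by (simp add: exp_add[symmetric] algebra_simps)
 have "exp (- (w*a + (w*a)^2/?m))*exp (- (w * sum_list l + w^2 * sum_list (map (%a. a^2) l)/?m)) <= (1 - w*a)*(\<Prod>a\<leftarrow>l. 1 - w*a)"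
  using IH wa1 by (intro mult_mono l) auto
 moreover have "- (w*a + (w*a)^2/?m) + - (w * sum_list l + w^2 * sum_list (map (%a. a^2) l)/?m)
  = - (w * sum_list (a # l) + w^2 * sum_list (map (%a. a^2) (a # l))/?m)"
  by (simp add: distrib_left add_divide_distrib power_mult_distrib)
 ultimately have 2: "exp (- (w * sum_list (a # l) + w^2 * sum_list (map (%a. a^2) (a # l))/?m)) <= (\<Prod>a\<leftarrow>a # l. 1 - w*a)"
  by (simp only: mult_exp_exp) simp
 have "0 < (\<Prod>a\<leftarrow>a # l. 1 - w*a)" using IH wa1 by simp
 with 1 2 show ?case by blast
qed auto
 then show "(\<Prod>a\<leftarrow>l. 1 - w*a) <= exp (- (w * sum_list l))"
  "exp (- (w * sum_list l + w^2 * sum_list (map (%a. a^2) l)/(1 - max 0 (w*\<Lambda>)))) <= (\<Prod>a\<leftarrow>l. 1 - w*a)"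
  "0 < (\<Prod>a\<leftarrow>l. 1 - w*a)" by blast+
qed

lemma log_det_limit:
 fixes l :: "nat => real list"
 assumes l: "!!n a. a : set (l n) ==> 0 <= a & a <= \<Lambda>" and w: "w*\<Lambda> < 1"
  and tr: "(%n. sum_list (l n)) ----> tr" and hs: "!!n. sum_list (map (%a. a^2) (l n)) <= hs"
  and D: "(%n. \<Prod>a\<leftarrow>l n. 1 - w*a) ----> D"
 shows "0 < D" "\<bar>- ln D - w*tr\<bar> <= w^2*hs/(1 - max 0 (w*\<Lambda>))"
proof -
 let ?B = "w^2*hs/(1 - max 0 (w*\<Lambda>))"
 have "(\<Prod>a\<leftarrow>l n. 1 - w*a) <= exp (- (w * sum_list (l n)))" for n by (rule prod_list_upper[OF l w])
 then have u: "D <= exp (- (w*tr))"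
  by (intro LIMSEQ_le[OF D, of "%n. exp (- (w * sum_list (l n)))"] tendsto_intros tr) auto
 have "exp (- (w * sum_list (l n) + ?B)) <= (\<Prod>a\<leftarrow>l n. 1 - w*a)" for n
 proof -
  have "w^2 * sum_list (map (%a. a^2) (l n))/(1 - max 0 (w*\<Lambda>)) <= ?B"
   using hs[of n] w by (intro divide_right_mono mult_left_mono) auto
  then show ?thesis by (intro order_trans[OF _ prod_list_lower[of "l n" \<Lambda> w, OF l[of _ n] w]]) simp_all
 qed
 then have low: "exp (- (w*tr + ?B)) <= D"
  by (intro LIMSEQ_le[of "%n. exp (- (w * sum_list (l n) + ?B))", OF _ D] tendsto_intros tr) auto
 then show D0: "0 < D" using exp_gt_zero less_le_trans by blast
 have "- (w*tr + ?B) <= ln D" using low D0 by (simp only: ln_ge_iff)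
 moreover have "ln D <= - (w*tr)" using ln_mono[OF u D0] by simp
 moreover have "0 <= ?B" using calculation by linarith
 ultimately show "\<bar>- ln D - w*tr\<bar> <= ?B" by (simp add: abs_le_iff)
qed

text \<open>Determinants of the field give convergence only at real \<open>z <= 0\<close>; Montel's
  theorem supplies a holomorphic limit on the whole disc at the price of a subsequence. A lower
  bound on the moduli keeps the limit away from 0, so that it can stand in a denominator.\<close>

lemma det_limit_holomorphic:
 fixes l :: "nat => real list"
 assumes l: "!!n a. a : set (l n) ==> 0 <= a & a <= \<Lambda>" and \<Lambda>: "\<Lambda> > 0" and C: "!!n. sum_list (l n) <= C"
 shows "EX D s. strict_mono (s :: nat => nat) & D holomorphic_on (ball 0 (1/\<Lambda>))
  & (ALL z:ball 0 (1/\<Lambda>). D z ~= 0 & (%n. \<Prod>a\<leftarrow>l (s n). 1 - z*cor a) ----> D z)"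
proof -
 define P where "P = (%n z. \<Prod>a\<leftarrow>l n. 1 - z*cor a)"
 have hol: "(%z. \<Prod>a\<leftarrow>m. 1 - z*cor a) holomorphic_on UNIV" for m
  by (induction m) (auto intro!: holomorphic_intros)
 \<comment> \<open>Since every \<open>a\<close> is nonnegative, the modulus at \<open>z\<close> is
   enclosed by the values at the real points \<open>- |z|\<close> and \<open>|z|\<close>.\<close>
 have up_lo: "cmod (\<Prod>a\<leftarrow>m. 1 - z*cor a) <= (\<Prod>a\<leftarrow>m. 1 - (- cmod z)*a)
  & (cmod z*\<Lambda> < 1 --> (\<Prod>a\<leftarrow>m. 1 - cmod z*a) <= cmod (\<Prod>a\<leftarrow>m. 1 - z*cor a))"
  if "!!a. a : set m ==> 0 <= a & a <= \<Lambda>" for m z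
  using that
 proof (induction m)
  case (Cons a m)
  have a: "0 <= a" "a <= \<Lambda>" using Cons.prems by auto
  have n: "cmod (1 - z*cor a) <= 1 - (- cmod z)*a" "1 - cmod z*a <= cmod (1 - z*cor a)"
   using norm_triangle_ineq4[of 1 "z*cor a"] norm_triangle_ineq2[of 1 "z*cor a"] a by (auto simp: norm_mult)
  have IH: "cmod (\<Prod>a\<leftarrow>m. 1 - z*cor a) <= (\<Prod>a\<leftarrow>m. 1 - (- cmod z)*a)"
   "cmod z*\<Lambda> < 1 ==> (\<Prod>a\<leftarrow>m. 1 - cmod z*a) <= cmod (\<Prod>a\<leftarrow>m. 1 - z*cor a)"
   using Cons by auto
  have "(1 - cmod z*a)*(\<Prod>a\<leftarrow>m. 1 - cmod z*a) <= cmod (1 - z*cor a)*cmod (\<Prod>a\<leftarrow>m. 1 - z*cor a)"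
   if z: "cmod z*\<Lambda> < 1"
   using prod_list_pos[of m \<Lambda> "cmod z"] Cons.prems z by (intro mult_mono n IH z) (auto simp: less_imp_le)
  moreover have "cmod (1 - z*cor a)*cmod (\<Prod>a\<leftarrow>m. 1 - z*cor a) <= (1 - (- cmod z)*a)*(\<Prod>a\<leftarrow>m. 1 - (- cmod z)*a)"
   using a by (intro mult_mono n IH) auto
  ultimately show ?case by (simp add: norm_mult)
 qed auto
 note up = up_lo[THEN conjunct1] and lo = up_lo[THEN conjunct2, rule_format]
 have "EX D s. D holomorphic_on ball 0 (1/\<Lambda>) & strict_mono (s :: nat => nat) & (ALL z:ball 0 (1/\<Lambda>). (%n. P (s n) z) ----> D z)"
 proof (rule Montel[of "ball 0 (1/\<Lambda>)" "range P" P])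
  show "f holomorphic_on ball 0 (1/\<Lambda>)" if "f : range P" for f
   using that holomorphic_on_subset[OF hol] by (auto simp: P_def)
  show "EX B. ALL f:range P. ALL z:K. cmod (f z) <= B" if K: "compact K" "K \<subseteq> ball 0 (1/\<Lambda>)" for K
  proof (intro exI ballI)
   fix f z assume "f : range P" "z : K"
   then obtain n where f: "f = P n" by auto
   have z: "cmod z <= 1/\<Lambda>" using K \<open>z : K\<close> by auto
   have "cmod (f z) <= (\<Prod>a\<leftarrow>l n. 1 - (- cmod z)*a)" unfolding f P_def by (rule up[OF l])
   also have "... <= exp (- (- cmod z * sum_list (l n)))"
    using \<Lambda> by (intro prod_list_upper[OF l]) (auto intro: less_le_trans[of "-1" 0])
   also have "... <= exp (1/\<Lambda>*\<bar>C\<bar>)"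
    using mult_mono[OF z, of "sum_list (l n)" "\<bar>C\<bar>"] C[of n] \<Lambda> sum_list_nonneg[of "l n"] l by (auto intro: order_trans)
   finally show "cmod (f z) <= exp (1/\<Lambda>*\<bar>C\<bar>)" .
  qed
  fix D and s :: "nat => nat"
  assume "D holomorphic_on ball 0 (1/\<Lambda>)" "strict_mono s" "!!z. z : ball 0 (1/\<Lambda>) ==> (%n. P (s n) z) ----> D z"
  then show "EX D s. D holomorphic_on ball 0 (1/\<Lambda>) & strict_mono (s :: nat => nat) & (ALL z:ball 0 (1/\<Lambda>). (%n. P (s n) z) ----> D z)" by blast
 qed auto
 then obtain D and s :: "nat => nat" where D: "D holomorphic_on ball 0 (1/\<Lambda>)" "strict_mono s"
  "!!z. z : ball 0 (1/\<Lambda>) ==> (%n. P (s n) z) ----> D z" by blast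
 have "D z ~= 0" if z: "z : ball 0 (1/\<Lambda>)" for z
 proof -
  let ?q = "cmod z" let ?m = "1 - max 0 (?q*\<Lambda>)"
  have q: "?q*\<Lambda> < 1" using z \<Lambda> by (simp add: field_simps)
  have sq: "sum_list (map (%a. a^2) m) <= \<Lambda> * sum_list m" if "!!a. a : set m ==> 0 <= a & a <= \<Lambda>" for m
   using that by (induction m) (auto simp: distrib_left power2_eq_square intro!: add_mono mult_right_mono)
  have "exp (- (?q*C + ?q^2*(\<Lambda>*C)/?m)) <= cmod (P (s n) z)" for n
  proof -
   have "sum_list (map (%a. a^2) (l (s n))) <= \<Lambda> * sum_list (l (s n))" by (rule sq) (rule l)
   then have "sum_list (map (%a. a^2) (l (s n))) <= \<Lambda>*C"
    using mult_left_mono[OF C[of "s n"], of \<Lambda>] \<Lambda> by linarith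
   then have "?q * sum_list (l (s n)) + ?q^2 * sum_list (map (%a. a^2) (l (s n)))/?m <= ?q*C + ?q^2*(\<Lambda>*C)/?m"
    using q C[of "s n"] by (intro add_mono divide_right_mono mult_left_mono) auto
   then have "exp (- (?q*C + ?q^2*(\<Lambda>*C)/?m)) <= exp (- (?q * sum_list (l (s n)) + ?q^2 * sum_list (map (%a. a^2) (l (s n)))/?m))" by simp
   also have "... <= (\<Prod>a\<leftarrow>l (s n). 1 - ?q*a)" by (rule prod_list_lower[OF l q])
   also have "... <= cmod (P (s n) z)" unfolding P_def by (rule lo[OF l q])
   finally show ?thesis .
  qed
  then have "exp (- (?q*C + ?q^2*(\<Lambda>*C)/?m)) <= cmod (D z)"
   by (intro LIMSEQ_le_const[OF tendsto_norm[OF D(3)[OF z]]]) auto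
  from less_le_trans[OF exp_gt_zero this] show ?thesis by auto
 qed
 with D show ?thesis unfolding P_def by blast
qed

text \<open>The difference series vanishes on a real interval, whereas a power series with a nonzero
  coefficient has at most an isolated zero at its centre.\<close>

lemma powser_eq_on_interval:
 fixes a b :: "nat => complex"
 assumes c: "c > 0" and ab: "!!y::real. 0 <= y ==> y < c ==> EX s. (%n. a n * of_real y^n) sums s & (%n. b n * of_real y^n) sums s"
 shows "a n = b n"
proof (rule ccontr)
 assume ne: "a n ~= b n"
 define f where "f = (%z. \<Sum>n. (a n - b n)*z^n)"
 have y0: "EX s. (%n. (a n - b n) * of_real y^n) sums 0" if "0 <= y" "y < c" for y :: real
  using ab[OF that] sums_diff by (fastforce simp: left_diff_distrib)
 have "(%n. (a n - b n)*z^n) sums f z" if "norm z < c/2" for z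
 proof -
  have "summable (%n. (a n - b n) * of_real (c/2)^n)" using y0[of "c/2"] c by (auto intro: sums_summable)
  then have "summable (%n. (a n - b n)*z^n)" by (rule powser_inside) (use that c in auto)
  then show ?thesis unfolding f_def by (rule summable_sums)
 qed
 moreover have f0: "f (of_real y) = 0" if "0 <= y" "y < c" for y :: real
  using y0[OF that] by (auto simp: f_def sums_iff)
 moreover have "n > 0"
 proof (rule ccontr)
  assume "\<not> n > 0"
  then have "n = 0" by simp
  moreover have "f 0 = a 0 - b 0" unfolding f_def by (rule powser_zero)
  ultimately show False using f0[of 0] c ne by simp
 qed
 ultimately obtain s where s: "s > 0" "!!z. z : cball 0 s - {0} ==> f z ~= 0"
  using powser_0_nonzero[of "c/2" 0 "%n. a n - b n" f n] ne c f0[of 0] by auto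
 define y where "y = min s (c/2)"
 have "y > 0" "y <= s" "y < c" using s c by (auto simp: y_def)
 then show False using s(2)[of "of_real y"] f0[of y] by auto
qed

text \<open>Pringsheim-type continuation: nonnegativity of the coefficients lets an identity near the centre
 propagate to the whole disc of holomorphy.\<close>

lemma nonneg_power_series_continuation:
 fixes e :: "nat => ennreal"
 assumes c: "c > 0" and R: "F holomorphic_on ball z r"
  and eq: "!!y. 0 <= y ==> y <= c ==> (\<Sum>n. e n*ennreal (y^n)) = ennreal (g y)"
  and Fg: "!!y. 0 <= y ==> y < r ==> F (z + of_real y) = of_real (g y)" and g: "!!y. 0 <= y ==> y < r ==> 0 <= g y"
  and y: "0 <= y" "y < r"
 shows "(\<Sum>n. e n*ennreal (y^n)) = ennreal (g y)"
proof -
 have fin: "e n < \<infinity>" for n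
 proof -
  have "(\<Sum>n. e n*ennreal (c^n)) < \<infinity>" using eq[of c] c by simp
  then have "e n*ennreal (c^n) < \<infinity>" using sum_le_suminf[of "%n. e n*ennreal (c^n)" "{n}"] by (simp add: le_less_trans)
  then show ?thesis using c by (auto simp: ennreal_mult_less_top)
 qed
 define a where "a n = enn2real (e n)" for n
 have ea: "e n = ennreal (a n)" "0 <= a n" for n using fin[of n] by (auto simp: a_def)
 define b where "b n = (deriv ^^ n) F z/fact n" for n
 have bF: "(%n. b n * of_real y^n) sums of_real (g y)" if "0 <= y" "y < r" for y
  using holomorphic_power_series[OF R, of "z + of_real y"] that Fg[OF that] by (simp add: b_def dist_norm)
 have ab: "of_real (a n) = b n" for n
 proof (rule powser_eq_on_interval)
  show "0 < min c r" using c y by auto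
  fix y assume y: "0 <= y" "y < min c r"
  have "(\<Sum>n. ennreal (a n*y^n)) = ennreal (g y)"
   using eq[of y] y ea by (simp add: ennreal_mult)
  then have "(%n. a n*y^n) sums g y"
  proof -
   have nn: "0 <= a n*y^n" for n using ea y by simp
   have "summable (%n. a n*y^n)"
    by (rule summable_suminf_not_top) (use nn \<open>(\<Sum>n. ennreal (a n * y ^ n)) = ennreal (g y)\<close> in auto)
   moreover have "(\<Sum>n. a n*y^n) = g y"
    using suminf_ennreal2[OF nn calculation] \<open>(\<Sum>n. ennreal (a n * y ^ n)) = ennreal (g y)\<close> g[of y] y suminf_nonneg[OF calculation nn] by simp
   ultimately show ?thesis by (simp add: sums_iff)
  qed
  then have "(%n. cor (a n*y^n)) sums of_real (g y)" by (rule sums_of_real)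
  then show "EX s. (%n. of_real (a n) * of_real y^n) sums s & (%n. b n * of_real y^n) sums s"
   using bF[of y] y by auto
 qed
 have "(%n. cor (a n*y^n)) sums of_real (g y)" using bF[OF y] by (simp flip: ab)
 then have "(%n. a n*y^n) sums g y" by (simp only: sums_of_real_iff)
 then have "(\<Sum>n. ennreal (a n*y^n)) = ennreal (g y)" using ea y by (intro suminf_ennreal_eq) auto
 then show ?thesis using ea y by (simp add: ennreal_mult)
qed

lemma (in bounded_kernel) resolvent_value_unique:
 assumes "w*\<Lambda> < 1" "resolvent_value w r" "resolvent_value w r'" shows "r = r'"
proof -
 have wk: "weighted_kernel k h" by unfold_locales
 have "\<bar>r - r'\<bar> <= \<bar>w\<bar>*0*(LBINT x. h x)/((if w <= 0 then 1 else 1 - w*\<Lambda>)*(if w <= 0 then 1 else 1 - w*\<Lambda>))"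
  by (rule resolvent_value_perturbation[OF wk _ _ coercive coercive assms(2,3)]) (use assms(1) in auto)
 then show ?thesis by simp
qed

context bose_weight
begin

text \<open>For \<open>w <= 0\<close> the formula comes from the definition of the field. For
  \<open>w > 0\<close> both sides are expanded around \<open>- c\<close>: the expectation as a
  series with nonnegative coefficients, the right side as the function \<open>F\<close>, holomorphic
  on the disc of radius \<open>1/\<Lambda>\<close> about 0. \<open>log_det_limit\<close> then
  replaces the determinant by its trace.\<close>

theorem point_exp_expectation:
 fixes \<nu> :: "'a measure measure"
 assumes \<nu>: "boson_point_field \<beta> \<rho> \<nu>" and H: "!!x. h x <= H"
  and \<psi>: "\<psi> : bmf" "!!x. 1 <= \<psi> x" "!!x. T \<psi> x <= \<Lambda>*\<psi> x" and \<Lambda>: "\<Lambda> > 0"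
  and w: "w*\<Lambda> < 1" "- w*H < 1" and r: "resolvent_value w r"
 shows "EX L. (\<integral>\<^sup>+Z. ennreal (point_exp h w Z) \<partial>\<nu>) = ennreal (exp L)
  & \<bar>L - ((\<rho> - critical_density TYPE('a) \<beta>)*w*r + w*(bose_kernel \<beta> (0::'a)*(LBINT x. h x)))\<bar>
   <= w^2*kernel_hs \<beta> h/(1 - max 0 (w*\<Lambda>))"
proof -
 note Schur = kernel_op_Schur[OF \<psi>]
 interpret bounded_kernel "trunc_kernel \<beta> R" h \<Lambda>
 proof
  show "\<Lambda> > 0" by fact
  show "0 <= ip \<phi> (T \<phi>)" if "\<phi> : bmf" for \<phi> by (rule T_psd[OF that])
  show "ip \<phi> (T \<phi>) <= \<Lambda>*ip \<phi> \<phi>" if "\<phi> : bmf" for \<phi>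
   using Schur[OF emb_L2[OF that]] by (simp add: kernel_op_emb L2_inner_emb L2_norm_emb nrm_sq)
 qed
 define a where "a = \<rho> - critical_density TYPE('a) \<beta>"
 define tr where "tr = bose_kernel \<beta> (0::'a)*(LBINT x. h x)"
 define rv where "rv = (%w. Re (resolvent_fun (cor w)))"
 have H0: "0 <= H" using h_nonneg H order_trans by blast
 have \<nu>s: "sets \<nu> = sets point_measure_borel" using \<nu> by (simp add: boson_point_field_def)
 note [measurable_cong] = \<nu>s
 obtain l :: "nat => real list" where l: "!!n a. a : set (l n) ==> 0 <= a & a <= \<Lambda>" "!!n. sum_list (l n) <= tr"
  "(%n. sum_list (l n)) ----> tr" "!!n. sum_list (map (%a. a^2) (l n)) <= kernel_hs \<beta> h"
  and ld: "!!z g. 0 <= z ==> g : test_functions ==> (!!x. 1 - exp (- g x) = z*h x) ==>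
    EX D. fredholm_det (K_op \<beta> g) = cor D & (%n. \<Prod>a\<leftarrow>l n. 1 + z*a) ----> D"
  using fredholm_det_limit[OF \<beta> d h_test Schur] unfolding tr_def by blast
 have neg: "EX D>0. (%n. \<Prod>a\<leftarrow>l n. 1 - w*a) ----> D & (\<integral>\<^sup>+Z. ennreal (point_exp h w Z) \<partial>\<nu>) = ennreal (exp (a*w*rv w)/D)"
  if w: "w <= 0" "- w*H < 1" for w
 proof -
  let ?g = "%x. - ln (1 - (- w)*h x)"
  have w\<Lambda>: "w*\<Lambda> < 1" using w \<Lambda> mult_nonpos_nonneg[of w \<Lambda>] by linarith
  have g: "?g : test_functions" by (rule minus_ln_test_function[OF h_test H]) (use w in auto)
  have gh: "1 - exp (- ?g x) = - w*h x" for x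
   using mult_left_mono[OF H[of x], of "- w"] w by simp
  obtain D where D: "fredholm_det (K_op \<beta> ?g) = cor D" "(%n. \<Prod>a\<leftarrow>l n. 1 - w*a) ----> D"
   using ld[OF _ g gh] w by auto
  have D0: "D > 0" by (rule log_det_limit(1)[OF l(1) w\<Lambda> l(3,4) D(2)])
  have "cor (\<integral>Z. exp (- (\<integral>x. ?g x \<partial>Z)) \<partial>\<nu>) = exp (- (cor a*cor (- w*rv w)))/cor D"
  proof -
   have "resolvent_value (- (- w)) (rv w)" using resolvent_fun_value(2)[OF w\<Lambda>] by (simp add: rv_def)
   from inverse_one_plus_value[OF _ g gh this] w
   have v: "L2_inner (sqrt_one_minus_exp ?g) (inverse_one_plus (K_op \<beta> ?g) (sqrt_one_minus_exp ?g)) = cor (- w*rv w)" by simp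
   have "cor (\<integral>Z. exp (- (\<integral>x. ?g x \<partial>Z)) \<partial>\<nu>) = exp (- (cor a*L2_inner (sqrt_one_minus_exp ?g) (inverse_one_plus (K_op \<beta> ?g) (sqrt_one_minus_exp ?g))))/fredholm_det (K_op \<beta> ?g)"
    using \<nu> g unfolding boson_point_field_def a_def by blast
   then show ?thesis unfolding v D(1) .
  qed
  also have "... = cor (exp (a*w*rv w)/D)" by (simp add: exp_of_real[symmetric] mult.assoc)
  finally have e: "(\<integral>Z. point_exp h w Z \<partial>\<nu>) = exp (a*w*rv w)/D"
   unfolding of_real_eq_iff by (simp add: point_exp_def)
  \<comment> \<open>A function that is not integrable has integral 0 by convention, while the value
    here is positive.\<close>
  then have "integrable \<nu> (point_exp h w)" using D0 not_integrable_integral_eq[of \<nu> "point_exp h w"] by force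
  then have "(\<integral>\<^sup>+Z. ennreal (point_exp h w Z) \<partial>\<nu>) = ennreal (exp (a*w*rv w)/D)"
   using nn_integral_eq_integral[of \<nu> "point_exp h w"] e by (simp add: point_exp_def)
  with D D0 show ?thesis by blast
 qed
 have main: "EX D s. (%n. \<Prod>a\<leftarrow>l (s n). 1 - w*a) ----> D & strict_mono (s :: nat => nat) & (\<integral>\<^sup>+Z. ennreal (point_exp h w Z) \<partial>\<nu>) = ennreal (exp (a*w*rv w)/D)"
 proof (cases "w <= 0")
  case True
  obtain D where "(%n. \<Prod>a\<leftarrow>l n. 1 - w*a) ----> D" "(\<integral>\<^sup>+Z. ennreal (point_exp h w Z) \<partial>\<nu>) = ennreal (exp (a*w*rv w)/D)"
   using neg[OF True w(2)] by blast
  then show ?thesis by (intro exI[of _ D] exI[of _ "%n. n"]) (auto simp: strict_mono_def)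
 next
  case False
  have "EX D s. strict_mono (s :: nat => nat) & D holomorphic_on (ball 0 (1/\<Lambda>))
   & (ALL z:ball 0 (1/\<Lambda>). D z ~= 0 & (%n. \<Prod>a\<leftarrow>l (s n). 1 - z*cor a) ----> D z)"
  proof (rule det_limit_holomorphic)
   show "0 <= a & a <= \<Lambda>" if "a : set (l n)" for n a by (rule l(1)[OF that])
  qed (use l(2) \<Lambda> in auto)
  then obtain D and s :: "nat => nat" where s: "strict_mono s" and D: "D holomorphic_on ball 0 (1/\<Lambda>)"
   "!!z. z : ball 0 (1/\<Lambda>) ==> D z ~= 0"
   "!!z. z : ball 0 (1/\<Lambda>) ==> (%n. \<Prod>a\<leftarrow>l (s n). 1 - z*cor a) ----> D z"
   by blast
  define Dr where "Dr = (%y. Re (D (cor y)))"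
  have prod_real: "(\<Prod>a\<leftarrow>m. 1 - cor y*cor a) = cor (\<Prod>a\<leftarrow>m. 1 - y*a)" for m y
   by (induction m) auto
  have Dr: "(%n. \<Prod>a\<leftarrow>l (s n). 1 - y*a) ----> Dr y" "D (of_real y) = of_real (Dr y)" "Dr y > 0" if "\<bar>y\<bar> < 1/\<Lambda>" for y
  proof -
   have yb: "cor y : ball 0 (1/\<Lambda>)" using that by simp
   have "y*\<Lambda> < 1" using that \<Lambda> abs_le_D1[OF order_refl, of y] pos_less_divide_eq[OF \<Lambda>, of y 1] by linarith
   note lim = D(3)[OF yb, unfolded prod_real]
   show 1: "(%n. \<Prod>a\<leftarrow>l (s n). 1 - y*a) ----> Dr y" using tendsto_Re[OF lim] by (simp add: Dr_def)
   show "D (of_real y) = of_real (Dr y)" by (rule LIMSEQ_unique[OF lim tendsto_of_real[OF 1]])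
   show "Dr y > 0"
    by (rule log_det_limit(1)[OF l(1) \<open>y * \<Lambda> < 1\<close> LIMSEQ_subseq_LIMSEQ[OF l(3) s, unfolded comp_def] l(4) 1])
  qed
  define F where "F = (%z. exp (cor a*z*resolvent_fun z)/D z)"
  have Fhol: "F holomorphic_on ball 0 (1/\<Lambda>)" unfolding F_def
   using D holomorphic_on_subset[OF resolvent_fun_holomorphic ball_subset_resolvent_dom] by (intro holomorphic_intros) auto
  define g where "g = (%y. exp (a*y*rv y)/Dr y)"
  have Fg: "F (of_real y) = of_real (g y)" if "\<bar>y\<bar> < 1/\<Lambda>" for y
  proof -
   have "y*\<Lambda> < 1" using that \<Lambda> abs_le_D1[OF order_refl, of y] pos_less_divide_eq[OF \<Lambda>, of y 1] by linarith
   then have "resolvent_fun (of_real y) = of_real (rv y)" unfolding rv_def by (rule resolvent_fun_value(1))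
   then show ?thesis using Dr(2)[OF that] by (simp add: F_def g_def flip: exp_of_real)
  qed
  have w1: "w < 1/\<Lambda>" using w \<Lambda> by (simp add: field_simps)
  \<comment> \<open>The first bound gives \<open>c H < 1\<close>, as the generating polynomial
    requires. The second gives \<open>w + c < 1/\<Lambda> - c\<close>, so \<open>w\<close> lies in
    the disc about \<open>- c\<close> that fits into the domain of \<open>F\<close>. With
    \<open>H + 1\<close> the denominator is nonzero even for \<open>H = 0\<close>.\<close>
  define c where "c = min (1/(2*(H + 1))) ((1/\<Lambda> - w)/4)"
  have c: "c > 0" "c <= (1/\<Lambda> - w)/4"
   using H0 w1 unfolding c_def by (simp, intro min.cobounded2)
  have "c*H <= 1/(2*(H + 1))*H" using H0 by (intro mult_right_mono) (auto simp: c_def)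
  also have "... < 1" using H0 by (simp add: field_simps)
  finally have cH: "c*H < 1" .
  have in_dom: "\<bar>- c + y\<bar> < 1/\<Lambda>" if "0 <= y" "y < 1/\<Lambda> - c" for y
   using that c False w1 by (simp add: abs_if)
  have "(\<Sum>n. (\<integral>\<^sup>+Z. ennreal (coeff (generating_poly h c Z) n) \<partial>\<nu>)*ennreal ((w + c)^n)) = ennreal (g (- c + (w + c)))"
  proof (rule nonneg_power_series_continuation[where g = "%y. g (- c + y)", OF c(1)])
   show "F holomorphic_on ball (- cor c) (1/\<Lambda> - c)"
   proof (rule holomorphic_on_subset[OF Fhol])
    show "ball (- cor c) (1/\<Lambda> - c) \<subseteq> ball 0 (1/\<Lambda>)"
    proof
     fix z assume "z : ball (- cor c) (1/\<Lambda> - c)"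
     then show "z : ball 0 (1/\<Lambda>)" using norm_triangle_ineq2[of z "- cor c"] c by (simp add: dist_norm norm_minus_commute)
    qed
   qed
   fix y :: real assume y: "0 <= y"
   show "(\<Sum>n. (\<integral>\<^sup>+Z. ennreal (coeff (generating_poly h c Z) n) \<partial>\<nu>)*ennreal (y^n)) = ennreal (g (- c + y))" if yc: "y <= c"
   proof -
    have "- (y - c)*H <= c*H" using y H0 by (intro mult_right_mono) auto
    then obtain D' where D': "(%n. \<Prod>a\<leftarrow>l n. 1 - (y - c)*a) ----> D'"
     "(\<integral>\<^sup>+Z. ennreal (point_exp h (y - c) Z) \<partial>\<nu>) = ennreal (exp (a*(y - c)*rv (y - c))/D')"
     using neg[of "y - c"] yc cH by auto
    have "D' = Dr (y - c)"
     using LIMSEQ_unique[OF LIMSEQ_subseq_LIMSEQ[OF D'(1) s, unfolded comp_def] Dr(1)] in_dom[of y] y yc c False by simp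
    then show ?thesis
     using point_exp_power_series[OF h_test H less_imp_le[OF c(1)] cH \<nu>s y] D'(2) by (simp add: g_def)
   qed
   assume yr: "y < 1/\<Lambda> - c"
   show "F (- cor c + of_real y) = of_real (g (- c + y))"
    using Fg[OF in_dom[OF y yr]] by simp
   show "0 <= g (- c + y)" using Dr(3)[OF in_dom[OF y yr]] by (simp add: g_def)
  qed (use c False in auto)
  also have "- c + (w + c) = w" by simp
  finally have "(\<integral>\<^sup>+Z. ennreal (point_exp h w Z) \<partial>\<nu>) = ennreal (g w)"
   using point_exp_power_series[OF h_test H less_imp_le[OF c(1)] cH \<nu>s, of "w + c"] False c by simp
  moreover have "(%n. \<Prod>a\<leftarrow>l (s n). 1 - w*a) ----> Dr w" using Dr(1)[of w] w1 False by simp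
  ultimately show ?thesis using s by (auto simp: g_def)
 qed
 then obtain D and s :: "nat => nat" where D: "(%n. \<Prod>a\<leftarrow>l (s n). 1 - w*a) ----> D" and s: "strict_mono s"
  and eq: "(\<integral>\<^sup>+Z. ennreal (point_exp h w Z) \<partial>\<nu>) = ennreal (exp (a*w*rv w)/D)" by blast
 note est = log_det_limit[OF l(1) w(1) LIMSEQ_subseq_LIMSEQ[OF l(3) s, unfolded comp_def] l(4) D]
 have "r = rv w" by (rule resolvent_value_unique[OF w(1) r]) (simp add: rv_def resolvent_fun_value(2)[OF w(1)])
 moreover have "exp (a*w*rv w)/D = exp (a*w*rv w - ln D)" using est(1) by (simp add: exp_diff)
 ultimately show ?thesis using est(2) eq by (intro exI[of _ "a*w*rv w - ln D"]) (simp add: a_def tr_def)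
qed

end

section \<open>Perturbation of the kernel and divergence of the resolvent\<close>

lemma contraction_tendsto_0:
 fixes u v :: "nat => real"
 assumes u: "!!n. 0 <= u n" "!!n. u (Suc n) <= u n/2 + v n" and v: "v ----> 0"
 shows "u ----> 0"
proof (rule LIMSEQ_I)
 fix \<epsilon> :: real assume \<epsilon>: "0 < \<epsilon>"
 obtain N where N: "!!n. n >= N ==> \<bar>v n\<bar> < \<epsilon>/4" using LIMSEQ_D[OF v, of "\<epsilon>/4"] \<epsilon> by auto
 have b: "u (N + j) <= u N*(1/2)^j + \<epsilon>/2" for j
 proof (induction j)
  case (Suc j)
  have "u (N + Suc j) <= u (N + j)/2 + \<epsilon>/4" using u(2)[of "N + j"] N[of "N + j"] by simp
  then show ?case using Suc by simp
 qed (use \<epsilon> in simp)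
 have "(%j. u N*(1/2)^j) ----> u N*0" by (intro tendsto_intros LIMSEQ_realpow_zero) auto
 then obtain J where J: "!!j. j >= J ==> \<bar>u N*(1/2)^j\<bar> < \<epsilon>/2" using LIMSEQ_D[of "%j. u N*(1/2)^j" 0 "\<epsilon>/2"] \<epsilon> by auto
 have "norm (u n - 0) < \<epsilon>" if "n >= N + J" for n
 proof -
  have "N + (n - N) = n" "J <= n - N" using that by auto
  then show ?thesis using b[of "n - N"] J[of "n - N"] u(1)[of n] by simp
 qed
 then show "EX n0. ALL n>=n0. norm (u n - 0) < \<epsilon>" by blast
qed

context weighted_kernel
begin

lemma T_const_le:
 assumes H: "!!x. h x <= H" and g: "g : bmf" "!!x. g x <= C" and C: "0 <= C"
 shows "T g x <= C*(H*(LBINT x. k x))"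
proof -
 have "T g x <= T (%x. C*1) x" using g by (intro T_mono) auto
 also have "... = C*T (%x. 1) x" by (simp only: T_cmult)
 also have "T (%x. 1) x <= H*(LBINT x. k x)"
  using T_bound[of "%x. 1" H x] H h_nonneg by simp
 finally show ?thesis using C by (simp add: mult_left_mono)
qed

lemma excess_tendsto: "(%n. (LBINT x. max 0 (k x - real n))) ----> 0"
proof -
 have [measurable]: "k : BM" by simp
 have "(%n. (LBINT x. max 0 (k x - real n))) ----> (LBINT (x::'a). 0)"
 proof (rule integral_dominated_convergence[where w = k])
  show "AE x in lborel. (%n. max 0 (k x - real n)) ----> 0"
  proof (rule AE_I2)
   fix x
   obtain N where "k x <= real N" using real_arch_simple by blast
   then have "max 0 (k x - real n) = 0" if "n >= N" for n using that by (simp add: max_def)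
   then show "(%n. max 0 (k x - real n)) ----> 0" by (intro tendsto_eventually) (auto simp: eventually_sequentially)
  qed
  show "AE x in lborel. norm (max 0 (k x - real n)) <= k x" for n using k_nonneg by (auto simp: max_def)
 qed (use k_int in auto)
 then show ?thesis by simp
qed

lemma kernel_T_diff:
 assumes k': "weighted_kernel k' h" and H: "!!x. h x <= H" and g: "g : bmf" "!!x. \<bar>g x\<bar> <= C"
 shows "\<bar>weighted_kernel.T k' h g x - T g x\<bar> <= weighted_kernel.T (%x. \<bar>k' x - k x\<bar>) h (%x. \<bar>g x\<bar>) x"
  and "weighted_kernel.T (%x. \<bar>k' x - k x\<bar>) h (%x. \<bar>g x\<bar>) x <= C*(H*(LBINT x. \<bar>k' x - k x\<bar>))"
  and "weighted_kernel (%x. \<bar>k' x - k x\<bar>) h"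
proof -
 interpret K': weighted_kernel k' h by (rule k')
 show D: "weighted_kernel (%x. \<bar>k' x - k x\<bar>) h"
  by unfold_locales (use k_int K'.k_int h in \<open>auto simp: k_even K'.k_even\<close>)
 interpret D: weighted_kernel "%x. \<bar>k' x - k x\<bar>" h by (rule D)
 have "K'.T g x - T g x = (LBINT y. (k' (x - y) - k (x - y))*(h y*g y))"
  unfolding T_def K'.T_def using T_integrable[OF g(1), of x] K'.T_integrable[OF g(1), of x]
  by (subst bochner_integral_diff[symmetric]) (auto simp: left_diff_distrib)
 also have "\<bar>...\<bar> <= (LBINT y. \<bar>(k' (x - y) - k (x - y))*(h y*g y)\<bar>)" by (rule integral_abs_bound)
 also have "... = D.T (%x. \<bar>g x\<bar>) x" unfolding D.T_def by (simp add: abs_mult h_nonneg)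
 finally show "\<bar>K'.T g x - T g x\<bar> <= D.T (%x. \<bar>g x\<bar>) x" .
 have C: "0 <= C" using order_trans[OF abs_ge_zero g(2)] .
 have "(%x. \<bar>g x\<bar>) : bmf" by (rule bmfI[of _ C]) (use g in \<open>auto simp: bmf_def\<close>)
 then show "D.T (%x. \<bar>g x\<bar>) x <= C*(H*(LBINT x. \<bar>k' x - k x\<bar>))" by (rule D.T_const_le[OF H _ g(2) C])
qed

text \<open>For equal arguments the bound is the Schur test for the kernel \<open>|k' - k|\<close>
  with the constant function 1. Polarization and the parallelogram law, combined through the
  discriminant, extend it to two functions without loss of a factor.\<close>

lemma kernel_ip_diff:
 assumes k': "weighted_kernel k' h" and H: "!!x. h x <= H" and g: "g : bmf" and z: "z : bmf"
 shows "\<bar>ip g (weighted_kernel.T k' h z) - ip g (T z)\<bar> <= H*(LBINT x. \<bar>k' x - k x\<bar>)*(nrm g*nrm z)"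
proof -
 interpret K': weighted_kernel k' h by (rule k')
 interpret D: weighted_kernel "%x. \<bar>k' x - k x\<bar>" h by (rule kernel_T_diff(3)[OF k' H bmf_const order_refl])
 let ?e = "H*(LBINT x. \<bar>k' x - k x\<bar>)"
 have e0: "0 <= ?e" using order_trans[OF h_nonneg H] by simp
 have quad: "\<bar>ip \<eta> (K'.T \<eta>) - ip \<eta> (T \<eta>)\<bar> <= ?e*ip \<eta> \<eta>" if \<eta>: "\<eta> : bmf" for \<eta>
 proof -
  obtain C where C: "!!x. \<bar>\<eta> x\<bar> <= C" using bmfE[OF \<eta>] by metis
  have a: "(%x. \<bar>\<eta> x\<bar>) : bmf" by (rule bmfI[of _ C]) (use \<eta> C in \<open>auto simp: bmf_def\<close>)
  have db: "(%x. K'.T \<eta> x - T \<eta> x) : bmf" using \<eta> by simp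
  have "ip \<eta> (K'.T \<eta>) - ip \<eta> (T \<eta>) = ip \<eta> (%x. K'.T \<eta> x - T \<eta> x)" using \<eta> by (simp add: ip_diff_right)
  also have "\<bar>...\<bar> <= (LBINT x. \<bar>h x*(\<eta> x*(K'.T \<eta> x - T \<eta> x))\<bar>)" unfolding ip_def by (rule integral_abs_bound)
  also have "... <= ip (%x. \<bar>\<eta> x\<bar>) (D.T (%x. \<bar>\<eta> x\<bar>))" unfolding ip_def
  proof (intro integral_mono integrable_abs ip_integrable \<eta> db a D.T_bmf)
   fix x
   show "\<bar>h x*(\<eta> x*(K'.T \<eta> x - T \<eta> x))\<bar> <= h x*(\<bar>\<eta> x\<bar>*D.T (%x. \<bar>\<eta> x\<bar>) x)"
    using kernel_T_diff(1)[OF k' H \<eta> C, of x] h_nonneg by (auto simp: abs_mult intro!: mult_left_mono)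
  qed
  also have "... <= ?e*ip (%x. \<bar>\<eta> x\<bar>) (%x. \<bar>\<eta> x\<bar>)"
  proof (rule D.Schur_test[OF bmf_const _ _ a])
   show "D.T (%x. 1) x <= ?e*1" for x using D.T_const_le[OF H bmf_const order_refl, of 1 x] by simp
  qed simp
  also have "ip (%x. \<bar>\<eta> x\<bar>) (%x. \<bar>\<eta> x\<bar>) = ip \<eta> \<eta>" by (simp add: ip_def)
  finally show ?thesis .
 qed
 define b where "b = ip g (K'.T z) - ip g (T z)"
 have "b^2 <= (?e*ip g g)*(?e*ip z z)"
 proof (rule quadratic_form_discriminant)
  fix t :: real
  have tz: "(%x. t*z x) : bmf" by (intro bmf_mult bmf_const z)
  note s = T_sym[OF z g] K'.T_sym[OF z g]
  have "4*(t*b) = (ip (%x. g x + t*z x) (K'.T (%x. g x + t*z x)) - ip (%x. g x + t*z x) (T (%x. g x + t*z x)))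
   - (ip (%x. g x - t*z x) (K'.T (%x. g x - t*z x)) - ip (%x. g x - t*z x) (T (%x. g x - t*z x)))"
   using g z tz s by (simp add: b_def T_add T_diff K'.T_add K'.T_diff T_cmult K'.T_cmult ip_add_left ip_add_right ip_diff_left ip_diff_right
    ip_cmult_left ip_cmult_right ip_commute[of g] algebra_simps)
  moreover have "?e*ip (%x. g x + t*z x) (%x. g x + t*z x) + ?e*ip (%x. g x - t*z x) (%x. g x - t*z x)
   = 2*(?e*ip g g) + 2*(t^2*(?e*ip z z))"
   using g z tz by (simp add: ip_add_left ip_add_right ip_diff_left ip_diff_right ip_cmult_left ip_cmult_right power2_eq_square algebra_simps)
  ultimately show "0 <= ?e*ip g g - 2*t*b + t^2*(?e*ip z z)"
   using quad[OF bmf_add[OF g tz]] quad[OF bmf_diff[OF g tz]] by linarith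
 qed (use e0 in simp)
 also have "(?e*ip g g)*(?e*ip z z) = (?e*(nrm g*nrm z))^2"
  unfolding nrm_sq[symmetric] by (simp add: power2_eq_square mult_ac)
 finally have "b^2 <= (?e*(nrm g*nrm z))^2" .
 then have "\<bar>b\<bar> <= ?e*(nrm g*nrm z)" using e0 by (simp add: abs_le_square_iff[symmetric])
 then show ?thesis by (simp add: b_def)
qed

text \<open>Since \<open>T\<close> preserves positivity, the supremum of \<open>T^n 1\<close> is the
  norm of \<open>T^n\<close> on bounded functions.\<close>

definition pow_bounded :: "real => bool" where
 "pow_bounded w \<longleftrightarrow> 0 < w & (EX C. ALL n x. w^n*Tpow n x <= C)"

text \<open>An open half-line or the whole line, ending at the inverse of the spectral radius of
  \<open>T\<close> on bounded functions. The strict inequality makes it open and leaves a geometric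
  factor for the Neumann series.\<close>

definition dom :: "real set" where "dom = {w. EX w'>w. pow_bounded w'}"

lemma zero_in_dom: "0 : dom"
proof -
 obtain R H where H: "H > 0" "!!x. h x <= H" using h by (rule test_functionsE) blast
 define b where "b = H*(LBINT x. k x)"
 have b: "b >= 0" using H k_nonneg by (simp add: b_def)
 have le: "Tpow n x <= b^n" for n x
 proof (induction n arbitrary: x)
  case (Suc n)
  then show ?case using T_const_le[OF H(2) Tpow_bmf, of n "b^n" x] b by (simp add: Tpow_Suc b_def mult.commute)
 qed simp
 have "(1/(b + 1))^n*Tpow n x <= 1" for n x
 proof -
  have "(1/(b + 1))^n*Tpow n x <= (1/(b + 1))^n*(b + 1)^n"
   using le[of n x] power_mono[of b "b + 1" n] b by (intro mult_left_mono) auto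
  then show ?thesis using b by (simp add: power_one_over)
 qed
 then have "pow_bounded (1/(b + 1))" using b by (auto simp: pow_bounded_def)
 then show ?thesis using b by (auto simp: dom_def intro!: exI[of _ "1/(b + 1)"])
qed

lemma dom_down: "w : dom ==> w' <= w ==> w' : dom"
 unfolding dom_def by (blast intro: le_less_trans)

lemma dom_open: "open dom"
proof -
 have "dom = (\<Union>w'\<in>{w'. pow_bounded w'}. {..<w'})" by (auto simp: dom_def)
 then show ?thesis by auto
qed

text \<open>\<open>z = \<Sum> w'\<^sup>n T\<^sup>n 1\<close> with \<open>w < w'\<close> inside the domain; the \<open>- 1\<close> leaves room for perturbing \<open>T\<close>.\<close>

lemma dom_Schur:
 assumes w: "w : dom"
 shows "EX \<Lambda> z. 0 < \<Lambda> & w*\<Lambda> < 1 & z : bmf & (ALL x. 1 <= z x) & (ALL x. T z x <= \<Lambda>*(z x - 1))"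
proof -
 obtain w' where w': "w < w'" "pow_bounded w'" using w by (auto simp: dom_def)
 obtain C where C: "!!n x. w'^n*Tpow n x <= C" and w'0: "0 < w'" using w'(2) by (auto simp: pow_bounded_def)
 obtain R H where H: "H > 0" "!!x. h x <= H" using h by (rule test_functionsE) blast
 have C0: "0 <= C" using C[of 0] by simp
 \<comment> \<open>Three gaps are used: \<open>u > w\<close> gives \<open>w/u < 1\<close>,
   \<open>u > 0\<close> allows division, and \<open>u < w'\<close> gives the geometric ratio
   \<open>q < 1\<close>.\<close>
 define u where "u = (max w 0 + w')/2"
 have u: "w < u" "0 < u" "u < w'" using w'(1) w'0 by (auto simp: u_def)
 define q where "q = u/w'"
 have q: "0 < q" "q < 1" using u by (auto simp: q_def)
 have t: "u^n*Tpow n x <= C*q^n" "0 <= u^n*Tpow n x" for n x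
 proof -
  have "u^n*Tpow n x = q^n*(w'^n*Tpow n x)" using w'0 by (simp add: q_def power_divide)
  also have "... <= q^n*C" using q by (intro mult_left_mono C) simp
  finally show "u^n*Tpow n x <= C*q^n" by (simp only: mult.commute)
  show "0 <= u^n*Tpow n x" using u Tpow_nonneg by simp
 qed
 have gs: "summable (%n. C*q^n)" using q by (intro summable_mult summable_geometric) auto
 have sm: "summable (%n. u^n*Tpow n x)" for x
  by (rule summable_comparison_test'[OF gs, of 0]) (use t in auto)
 define z where "z = (%x. \<Sum>n. u^n*Tpow n x)"
 define s where "s = (%N x. \<Sum>n<N. u^n*Tpow n x)"
 \<comment> \<open>A bound for the tail that is uniform in \<open>x\<close>. \<open>T\<close> is
   monotone and finitely additive, so the series passes through \<open>T\<close> by way of its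
   partial sums, with an error proportional to \<open>e N\<close>.\<close>
 define e where "e = (%N. \<Sum>n. C*q^(n + N))"
 have sb: "s N : bmf" for N unfolding s_def by (intro bmf_sum bmf_mult bmf_const Tpow_bmf)
 have zs: "s N x <= z x" "z x <= s N x + e N" for N x
 proof -
  show "s N x <= z x" unfolding s_def z_def by (rule sum_le_suminf[OF sm]) (use t in auto)
  have "z x = s N x + (\<Sum>n. u^(n + N)*Tpow (n + N) x)"
   unfolding z_def s_def using suminf_split_initial_segment[OF sm, of x N] by simp
  also have "(\<Sum>n. u^(n + N)*Tpow (n + N) x) <= e N"
   unfolding e_def by (intro suminf_le t summable_ignore_initial_segment sm gs)
  finally show "z x <= s N x + e N" by simp
 qed
 have e0: "e ----> 0" unfolding e_def using suminf_exist_split2[OF gs] by simp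
 have eN: "0 <= e N" for N unfolding e_def using C0 q by (intro suminf_nonneg summable_ignore_initial_segment gs) auto
 have one: "1 <= z x" for x using zs(1)[of 1 x] by (simp add: s_def)
 have zb: "z : bmf"
 proof (rule bmfI)
  show "z : BM" unfolding z_def using bmf_measurable[OF Tpow_bmf] by (intro borel_measurable_suminf) auto
  show "\<bar>z x\<bar> <= e 0" for x using zs(2)[of x 0] one[of x] by (simp add: s_def)
 qed
 have "T z x <= 1/u*(z x - 1)" for x
 proof -
  have "T z x <= 1/u*(z x - 1) + e N*(H*(LBINT x. k x))" for N
  proof -
   have "T z x <= T (%x. s N x + e N) x" using zs(2) by (intro T_mono zb bmf_add sb bmf_const)
   also have "... = T (s N) x + T (%x. e N) x" by (simp add: T_add sb)
   also have "T (s N) x = 1/u*(s (Suc N) x - 1)"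
   proof -
    have "T (s N) x = (\<Sum>n<N. u^n*Tpow (Suc n) x)"
     unfolding s_def by (subst T_sum) (simp_all add: T_cmult Tpow_Suc)
    moreover have "s (Suc N) x = 1 + u*(\<Sum>n<N. u^n*Tpow (Suc n) x)"
     unfolding s_def by (subst sum.lessThan_Suc_shift) (simp add: sum_distrib_left mult.assoc)
    ultimately show ?thesis using u by simp
   qed
   also have "... <= 1/u*(z x - 1)" using zs(1)[of "Suc N" x] u by (simp add: divide_right_mono)
   also have "T (%x. e N) x <= e N*(H*(LBINT x. k x))" by (rule T_const_le[OF H(2)]) (use eN in auto)
   finally show ?thesis by simp
  qed
  then show ?thesis
   by (intro LIMSEQ_le_const[OF tendsto_eq_rhs[OF tendsto_add[OF tendsto_const tendsto_mult_left_zero[OF e0]]]]) auto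
 qed
 then show ?thesis using one zb u by (intro exI[of _ "1/u"] exI[of _ z]) (auto simp: field_simps)
qed

end

section \<open>The scalar resolvent on its domain\<close>

locale psd_kernel = weighted_kernel +
 assumes psd: "!!g. g : bmf ==> 0 <= ip g (T g)"
begin

lemma bounded_kernel_Schur:
 assumes "0 < \<Lambda>" "z : bmf" "!!x. 1 <= z x" "!!x. T z x <= \<Lambda>*z x"
 shows "bounded_kernel k h \<Lambda>"
 by unfold_locales (use assms(1) psd Schur_test[OF assms(2-4)] in auto)

lemma dom_bounded_kernel: "w : dom ==> EX \<Lambda>. w*\<Lambda> < 1 & bounded_kernel k h \<Lambda>"
proof -
 assume "w : dom"
 then obtain \<Lambda> z where *: "0 < \<Lambda>" "w*\<Lambda> < 1" "z : bmf" "!!x. 1 <= z x" "!!x. T z x <= \<Lambda>*(z x - 1)"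
  using dom_Schur by blast
 have "T z x <= \<Lambda>*z x" for x using *(5)[of x] *(1) by (simp add: right_diff_distrib)
 then show ?thesis using bounded_kernel_Schur[OF *(1,3,4)] *(2) by blast
qed

definition rv :: "real => real" where "rv w = (THE r. resolvent_value w r)"

lemma rv_eq:
 assumes "bounded_kernel k h \<Lambda>" "w*\<Lambda> < 1"
 shows "rv w = Re (bounded_kernel.resolvent_fun k h \<Lambda> (of_real w))" "resolvent_value w (rv w)"
proof -
 interpret B: bounded_kernel k h \<Lambda> by fact
 show "rv w = Re (B.resolvent_fun (of_real w))" unfolding rv_def
  by (rule the_equality) (use B.resolvent_fun_value(2)[OF assms(2)] B.resolvent_value_unique[OF assms(2)] in blast)+
 then show "resolvent_value w (rv w)" using B.resolvent_fun_value(2)[OF assms(2)] by simp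
qed

lemma rv_value: "w : dom ==> resolvent_value w (rv w)"
 using dom_bounded_kernel rv_eq(2) by blast

text \<open>A bound \<open>\<Lambda>\<close> with \<open>w \<Lambda> < 1\<close> remains valid for
  nearby \<open>w\<close>, so \<open>rv\<close> is locally the restriction of a holomorphic function
  to the real line.\<close>

lemma rv_differentiable: assumes "w : dom" shows "rv differentiable (at w)"
proof -
 obtain \<Lambda> where \<Lambda>: "w*\<Lambda> < 1" "bounded_kernel k h \<Lambda>" using dom_bounded_kernel[OF assms] by blast
 interpret B: bounded_kernel k h \<Lambda> by fact
 have "open B.resolvent_dom" unfolding B.resolvent_dom_def by (intro open_Collect_less continuous_intros)
 then have "B.resolvent_fun field_differentiable at (of_real w)"
  using B.resolvent_fun_holomorphic B.real_in_resolvent_dom[OF \<Lambda>(1)] by (blast intro: holomorphic_on_imp_differentiable_at)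
 then obtain D where "(B.resolvent_fun has_field_derivative D) (at (cor w))" by (auto simp: field_differentiable_def)
 then have "((%x. B.resolvent_fun (cor x)) has_vector_derivative D) (at w)"
  using field_vector_diff_chain_at[of cor 1 w B.resolvent_fun D] has_vector_derivative_of_real[OF DERIV_ident[of "at w"]]
  by (simp add: comp_def)
 then have "((%x. Re (B.resolvent_fun (cor x))) has_real_derivative Re D) (at w)"
  unfolding has_real_derivative_iff_has_vector_derivative by (rule bounded_linear.has_vector_derivative[OF bounded_linear_Re])
 moreover have "\<forall>\<^sub>F x in nhds w. Re (B.resolvent_fun (cor x)) = rv x"
 proof -
  have "open {x. x*\<Lambda> < 1}" by (intro open_Collect_less continuous_intros)
  then show ?thesis unfolding eventually_nhds using \<Lambda>(1) rv_eq(1)[OF \<Lambda>(2)] by (intro exI[of _ "{x. x*\<Lambda> < 1}"]) auto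
 qed
 ultimately have "(rv has_real_derivative Re D) (at w)"
  by (subst DERIV_cong_ev[OF refl _ refl, of _ rv, symmetric]) (auto elim: eventually_mono)
 then show ?thesis by (auto simp: real_differentiable_def)
qed

text \<open>For \<open>w > 0\<close> the terms of the Neumann series are nonnegative, and the ratio
  \<open>w/w'\<close> gained from a larger admissible \<open>w'\<close> makes the residual vanish,
  so the series increases to \<open>rv w\<close>.\<close>

lemma rv_partial_sum_le:
 assumes w: "w : dom" "0 < w" shows "(\<Sum>n<N. w^n*ip (%x. 1) (Tpow n)) <= rv w"
proof -
 obtain \<Lambda> where \<Lambda>: "w*\<Lambda> < 1" "bounded_kernel k h \<Lambda>" using dom_bounded_kernel[OF w(1)] by blast
 interpret B: bounded_kernel k h \<Lambda> by fact
 obtain w' C where C: "w < w'" "!!n x. w'^n*Tpow n x <= C" using w(1) by (auto simp: dom_def pow_bounded_def)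
 have q: "\<bar>w/w'\<bar> < 1" using C w by simp
 have C0: "0 <= C" using C(2)[of 0] by simp
 have "(%n. \<bar>w\<bar>^n*nrm (Tpow n)) ----> 0"
 proof (rule tendsto_sandwich[of "%n. 0" _ _ "%n. (w/w')^n*(C*nrm (%x. 1))"])
  have "\<bar>w\<bar>^n*nrm (Tpow n) <= (w/w')^n*(C*nrm (%x. 1))" for n
  proof -
   have "w'^n*nrm (Tpow n) = nrm (%x. w'^n*Tpow n x)" using nrm_cmult[of "w'^n" "Tpow n"] C(1) w by simp
   also have "... <= nrm (%x. C*1)"
    unfolding nrm_def
   proof (rule real_sqrt_le_mono)
    let ?f = "%x. w'^n*Tpow n x"
    have b: "?f : bmf" by (intro bmf_mult bmf_const Tpow_bmf)
    have nn: "0 <= ?f x" for x using C(1) w Tpow_nonneg by simp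
    have "ip ?f ?f <= ip ?f (%x. C*1)" by (rule ip_mono) (use b nn C(2) in auto)
    also have "... = ip (%x. C*1) ?f" by (rule ip_commute)
    also have "... <= ip (%x. C*1) (%x. C*1)" by (rule ip_mono) (use b C0 C(2) in auto)
    finally show "ip ?f ?f <= ip (%x. C*1) (%x. C*1)" .
   qed
   also have "... = C*nrm (%x. 1)" using nrm_cmult[of C "%x. 1"] C0 by simp
   finally have "w'^n*nrm (Tpow n) <= C*nrm (%x. 1)" .
   from mult_left_mono[OF this, of "(w/w')^n"] show ?thesis using C(1) w by (simp add: power_divide)
  qed
  then show "\<forall>\<^sub>F n in sequentially. \<bar>w\<bar>^n*nrm (Tpow n) <= (w/w')^n*(C*nrm (%x. 1))" by simp
  show "(%n. (w/w')^n*(C*nrm (%x. 1))) ----> 0" using q by (intro tendsto_mult_left_zero LIMSEQ_power_zero) simp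
 qed auto
 from resolvent_value_series[OF B.coercive[OF \<Lambda>(1)] rv_eq(2)[OF \<Lambda>(2,1)] this]
 have "(%N. \<Sum>n<N. w^n*ip (%x. 1) (Tpow n)) ----> rv w" .
 moreover have "incseq (%N. \<Sum>n<N. w^n*ip (%x. 1) (Tpow n))"
  using w Tpow_nonneg by (intro incseq_SucI) (auto intro!: mult_nonneg_nonneg ip_nonneg)
 ultimately show ?thesis by (rule incseq_le[rotated])
qed

text \<open>Steepness in contrapositive form. For \<open>l > 0\<close>, boundedness makes
  \<open>l^n m n\<close> summable. The kernel is split at a height \<open>N\<close> into a bounded
  part, controlled by the moments \<open>m n\<close>, and an excess of small mass, which contracts
  the supremum norm. Hence \<open>l^n T^n 1\<close> tends to 0 uniformly, and a slightly larger
  parameter is still power bounded.\<close>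

lemma rv_blow_up:
 assumes t: "!!n. t n : dom" "t ----> l" and B: "!!n. rv (t n) <= B"
 shows "l : dom"
proof (cases "l <= 0")
 case True then show ?thesis using zero_in_dom dom_down by blast
next
 case False
 define m where "m n = ip (%x. 1) (Tpow n)" for n
 have m0: "0 <= m n" for n unfolding m_def by (rule ip_nonneg) (simp add: Tpow_nonneg)
 have "\<forall>\<^sub>F n in sequentially. 0 < t n" using order_tendstoD(1)[OF t(2), of 0] False by simp
 then have ev: "\<forall>\<^sub>F j in sequentially. (\<Sum>n<N. t j^n*m n) <= B" for N
  by eventually_elim (rule order_trans[OF rv_partial_sum_le[OF t(1), folded m_def] B])
 have "(%j. \<Sum>n<N. t j^n*m n) ----> (\<Sum>n<N. l^n*m n)" for N
  by (intro tendsto_sum tendsto_mult tendsto_power tendsto_const t(2))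
 from tendsto_upperbound[OF this ev] have "(\<Sum>n<N. l^n*m n) <= B" for N by simp
 then have "summable (%n. l^n*m n)" using False m0 by (intro bounded_imp_summable[of _ B]) (auto simp: lessThan_Suc_atMost[symmetric] simp del: sum.lessThan_Suc)
 then have lm: "(%n. l^n*m n) ----> 0" by (rule summable_LIMSEQ_zero)
 obtain R H where H: "H > 0" "!!x. h x <= H" using h by (rule test_functionsE) blast
 have "(%n. (LBINT x. max 0 (k x - real n))) ----> 0" by (rule excess_tendsto)
 then have "\<forall>\<^sub>F n in sequentially. (LBINT x. max 0 (k x - real n)) < 1/(2*(l*H))"
  by (rule order_tendstoD(2)) (use False H in simp)
 then obtain N where N: "(LBINT x. max 0 (k x - real N)) < 1/(2*(l*H))" by (auto simp: eventually_sequentially)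
 define \<epsilon> where "\<epsilon> = (LBINT x. max 0 (k x - real N))"
 define k' where "k' x = max 0 (k x - real N)" for x
 have k'i: "integrable lborel k'" unfolding k'_def
  by (rule bochner_integrable_bound[OF k_int]) (use k_nonneg in \<open>auto simp: max_def\<close>)
 have \<epsilon>0: "0 <= \<epsilon>" unfolding \<epsilon>_def by simp
 interpret K': weighted_kernel k' h by unfold_locales (use k'i h k_even in \<open>auto simp: k'_def\<close>)
 have step: "T g x <= c*(H*\<epsilon>) + real N*ip (%x. 1) g" if g: "g : bmf" "!!x. 0 <= g x" "!!x. g x <= c" for g c x
 proof -
  have hi: "integrable lborel (%y. h y*g y)" by (rule integrable_mult_bmf[OF test_functions_integrable[OF h] g(1)])
  have "T g x <= (LBINT y. k' (x - y)*(h y*g y) + real N*(h y*g y))"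
   unfolding T_def
  proof (intro integral_mono T_integrable g bochner_integrable_add K'.T_integrable integrable_mult_right hi)
   fix y
   show "k (x - y)*(h y*g y) <= k' (x - y)*(h y*g y) + real N*(h y*g y)"
    unfolding distrib_right[symmetric] using h_nonneg g(2) by (intro mult_right_mono) (auto simp: k'_def)
  qed
  also have "... = K'.T g x + real N*ip (%x. 1) g"
   unfolding K'.T_def ip_def using hi by (subst bochner_integral_add) (auto intro: K'.T_integrable g)
  also have "K'.T g x <= c*(H*\<epsilon>)"
   using K'.T_const_le[OF H(2) g(1,3), of x] order_trans[OF g(2,3)] by (simp add: \<epsilon>_def k'_def)
  finally show ?thesis by simp
 qed
 \<comment> \<open>\<open>M n\<close> bounds \<open>T^n 1\<close> from above. After multiplication
   by \<open>l^n\<close> the recursion contracts by \<open>l H \<epsilon> <= 1/2\<close>, up to a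
   term that tends to 0.\<close>
 define M where "M = rec_nat 1 (%n c. c*(H*\<epsilon>) + real N*m n)"
 have M: "M 0 = 1" "M (Suc n) = M n*(H*\<epsilon>) + real N*m n" for n by (simp_all add: M_def)
 have TM: "Tpow n x <= M n" for n x
 proof (induction n arbitrary: x)
  case (Suc n)
  show ?case unfolding Tpow_Suc M m_def by (rule step[OF Tpow_bmf Tpow_nonneg Suc])
 qed (simp add: M)
 have "(%n. l^n*M n) ----> 0"
 proof (rule contraction_tendsto_0)
  have M0: "0 <= M n" for n using order_trans[OF Tpow_nonneg TM] .
  then show "0 <= l^n*M n" for n using False by simp
  have half: "l*(H*\<epsilon>) <= 1/2" using N False H by (simp add: \<epsilon>_def field_simps)
  show "l^Suc n*M (Suc n) <= l^n*M n/2 + l*real N*(l^n*m n)" for n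
  proof -
   have "l^n*M n*(l*(H*\<epsilon>)) <= l^n*M n*(1/2)" using M0 False half by (intro mult_left_mono) auto
   then show ?thesis by (simp add: M algebra_simps)
  qed
  show "(%n. l*real N*(l^n*m n)) ----> 0" by (rule tendsto_mult_right_zero[OF lm])
 qed
 then have "\<forall>\<^sub>F n in sequentially. l^n*M n < 1/2" by (rule order_tendstoD) simp
 from eventually_happens[OF eventually_conj[OF eventually_gt_at_top[of 0] this]]
 obtain p where p: "p > 0" "l^p*M p < 1/2" by auto
 \<comment> \<open>From \<open>l^p T^p 1 <= 1/2\<close> there is room to enlarge \<open>l\<close> by
   the factor \<open>2^(1/p)\<close> and keep \<open>w^p T^p 1 <= 1\<close>; the first
   \<open>p\<close> powers then control all others.\<close>
 define w where "w = root p 2*l"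
 have w: "l < w" "w^p = 2*l^p" "0 < w"
  using False p real_root_gt_1_iff[of p 2] by (auto simp: w_def power_mult_distrib real_root_pow_pos2)
 have wM: "w^p*Tpow p x <= 1" for x
 proof -
  have "l^p*Tpow p x <= l^p*M p" using False by (intro mult_left_mono TM) simp
  then show ?thesis using p(2) by (simp only: w(2) mult.assoc)
 qed
 have shift: "w^(n + p)*Tpow (n + p) x <= w^n*Tpow n x" for n x
 proof -
  have "w^p*Tpow (n + p) x <= Tpow n x"
  proof (induction n arbitrary: x)
   case (Suc n)
   have "w^p*Tpow (Suc n + p) x = T (%x. w^p*Tpow (n + p) x) x" by (simp add: T_cmult Tpow_Suc)
   also have "... <= T (Tpow n) x" by (intro T_mono Suc bmf_mult bmf_const Tpow_bmf)
   finally show ?case by (simp add: Tpow_Suc)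
  qed (simp add: wM)
  from mult_left_mono[OF this, of "w^n"] show ?thesis using w(3) by (simp add: power_add mult.assoc)
 qed
 obtain C where C: "!!n x. n < p ==> w^n*Tpow n x <= C"
 proof
  fix n x assume "n < p"
  then have "w^n*M n <= (\<Sum>n<p. w^n*M n)"
   using w(3) order_trans[OF Tpow_nonneg TM] by (intro member_le_sum) auto
  moreover have "w^n*Tpow n x <= w^n*M n" using w(3) by (intro mult_left_mono TM) simp
  ultimately show "w^n*Tpow n x <= (\<Sum>n<p. w^n*M n)" by linarith
 qed
 have "w^n*Tpow n x <= C" for n x
 proof (induction n rule: less_induct)
  case (less n)
  show ?case
  proof (cases "n < p")
   case False
   then show ?thesis using shift[of "n - p" x] less[of "n - p"] p(1) by simp
  qed (rule C)
 qed
 then have "pow_bounded w" using w(3) by (auto simp: pow_bounded_def)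
 then show ?thesis using w(1) by (auto simp: dom_def)
qed

end

section \<open>Scaling limit\<close>

lemma heat_kernel_scale:
 assumes "s > 0" "q > 0"
 shows "heat_kernel s (q *\<^sub>R (z::'a::euclidean_space)) = heat_kernel (s/q^2) z/q^DIM('a)"
proof -
 have "sqrt (4*pi * s) = q * sqrt (4*pi*(s/q^2))"
  using assms by (simp add: real_sqrt_mult real_sqrt_divide)
 then show ?thesis using assms unfolding heat_kernel_def
  by (simp add: power_mult_distrib power_divide field_simps)
qed

text \<open>On the cell \<open>(n \<delta>, (n + 1) \<delta>]\<close> the index
  \<open>nat \<lceil>s/\<delta>\<rceil> - 1\<close> equals \<open>n\<close>. A Riemann sum becomes
  the integral of a step function, which opens the way to dominated convergence in
  \<open>s\<close>.\<close>

lemma step_function_integral: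
 fixes \<phi> :: "nat => real"
 assumes \<delta>: "\<delta> > 0" and \<phi>: "!!n. 0 <= \<phi> n" "summable \<phi>"
 shows "integrable lborel (%s. indicator {0<..} s*\<phi> (nat \<lceil>s/\<delta>\<rceil> - 1))"
  and "(LBINT s. indicator {0<..} s*\<phi> (nat \<lceil>s/\<delta>\<rceil> - 1)) = \<delta> * suminf \<phi>"
proof -
 define f where "f = (%n s. indicator {real n*\<delta><..real (Suc n)*\<delta>} s*\<phi> n)"
 have sums: "(%n. f n s) sums (indicator {0<..} s*\<phi> (nat \<lceil>s/\<delta>\<rceil> - 1))" for s
 proof (cases "s > 0")
  case True
  define N where "N = nat \<lceil>s/\<delta>\<rceil> - 1"
  have c: "\<lceil>s/\<delta>\<rceil> >= 1" using True \<delta> by (simp add: one_le_ceiling)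
  then have N: "\<lceil>s/\<delta>\<rceil> = int N + 1" unfolding N_def by linarith
  have "indicator {real n*\<delta><..real (Suc n)*\<delta>} s = (if n = N then 1 else (0::real))" for n
  proof -
   have "s : {real n*\<delta><..real (Suc n)*\<delta>} \<longleftrightarrow> \<lceil>s/\<delta>\<rceil> = int n + 1"
    using \<delta> by (simp add: ceiling_eq_iff pos_less_divide_eq pos_divide_le_eq add.commute)
   also have "... \<longleftrightarrow> n = N" unfolding N by auto
   finally show ?thesis by (simp add: indicator_def)
  qed
  then have "(%n. f n s) = (%n. if n = N then \<phi> n else 0)" by (auto simp: f_def)
  then show ?thesis using sums_single[of N \<phi>] True by (simp add: N_def)
 next
  case False
  have "s \<notin> {real n*\<delta><..real (Suc n)*\<delta>}" for n
  proof -
   have "0 <= real n*\<delta>" using \<delta> by simp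
   then have "s <= real n*\<delta>" using False by linarith
   then show ?thesis by simp
  qed
  then have "f n s = 0" for n by (simp add: f_def)
  then show ?thesis using False by simp
 qed
 have int: "integrable lborel (f n)" for n unfolding f_def
  using \<delta> by (intro integrable_mult_left integrable_real_indicator) (auto simp: emeasure_lborel_Ioc mult_right_mono)
 have "(LBINT s. norm (f n s)) = \<delta>*\<phi> n" and nf: "(LBINT s. f n s) = \<delta>*\<phi> n" for n
  using \<phi>(1)[of n] \<delta> by (simp_all add: f_def abs_mult distrib_right)
 then have sn: "summable (%n. (LBINT s. norm (f n s)))" using \<phi>(2) by (simp add: summable_mult)
 have sa: "AE s in lborel. summable (%n. norm (f n s))"
  using sums_summable[OF sums] \<phi>(1) by (auto simp: f_def abs_mult)
 have eq: "(\<Sum>n. f n s) = indicator {0<..} s*\<phi> (nat \<lceil>s/\<delta>\<rceil> - 1)" for s by (rule sums_unique[OF sums, symmetric])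
 show "integrable lborel (%s. indicator {0<..} s*\<phi> (nat \<lceil>s/\<delta>\<rceil> - 1))"
  using integrable_suminf[OF int sa sn] unfolding eq .
 show "(LBINT s. indicator {0<..} s*\<phi> (nat \<lceil>s/\<delta>\<rceil> - 1)) = \<delta> * suminf \<phi>"
  using integral_suminf[OF int sa sn] unfolding eq nf by (simp add: suminf_mult[OF \<phi>(2)])
qed

text \<open>The right end of the cell of width \<open>1/q^2\<close> that contains \<open>s\<close>.
  This matches the times \<open>\<beta> (k + 1)\<close> in \<open>bose_kernel\<close> and keeps the
  time at least \<open>s\<close>, so that heat kernels are dominated by their peak at time
  \<open>\<beta> s\<close>.\<close>

definition riemann_point :: "real => real => real" where "riemann_point q s = real (nat \<lceil>s/(1/q^2)\<rceil>)/q^2"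

lemma riemann_point:
 assumes "q > 0" "s > 0" shows "s <= riemann_point q s" "riemann_point q s <= s + 1/q^2"
proof -
 let ?c = "\<lceil>s/(1/q^2)\<rceil>"
 have k: "q^2 > 0" using assms by simp
 have n: "real (nat ?c) = of_int ?c" using assms by simp
 have "s*q^2 <= of_int ?c" "of_int ?c <= s*q^2 + 1" using of_int_ceiling_le_add_one[of "s*q^2"] by simp_all
 then show "s <= riemann_point q s" "riemann_point q s <= s + 1/q^2"
  using k unfolding riemann_point_def n by (simp_all add: field_simps)
qed

lemma riemann_point_ge: "q > 0 ==> ALL s>0. s <= riemann_point q s"
 using riemann_point(1) by blast

text \<open>By the scaling of heat kernels, \<open>q^(d - 2) G (q z)\<close> is the Riemann sum of
  mesh \<open>1/q^2\<close> for the integral in \<open>limit_kernel\<close>.\<close>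

definition scaled_kernel :: "real => real => real => 'a::euclidean_space => real" where
 "scaled_kernel \<beta> R q z = indicator (cball 0 (2*R)) z*(q^(DIM('a) - 2)*bose_kernel \<beta> (q *\<^sub>R z))"

text \<open>For \<open>\<beta> > 0\<close> and \<open>d > 2\<close> a multiple of the Newtonian
  potential \<open>|z|^(2 - d)\<close>, cut off at \<open>2 R\<close>. The singular point is a null
  set, so the default value of the integral there is harmless.\<close>

definition limit_kernel :: "real => real => 'a::euclidean_space => real" where
 "limit_kernel \<beta> R z = (LBINT s. indicator {0<..} s*(indicator (cball 0 (2*R)) z*heat_kernel (\<beta> * s) z))"

context
 fixes \<beta> R :: real and d :: "'a::euclidean_space itself"
 assumes \<beta>: "\<beta> > 0" and d: "DIM('a) > 2"
begin

private definition B :: "'a set" where "B = cball 0 (2*R)"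

private definition f :: "(real => real) => real => 'a => real" where
 "f \<tau> s z = indicator {0<..} s*(indicator B z*heat_kernel (\<beta>*\<tau> s) z)"

text \<open>A majorant for the mass of a slice, uniform over all time changes with
  \<open>\<tau> s >= s\<close>: for \<open>0 < s <= 1\<close> the total mass 1 of a heat kernel, for
  \<open>n < s <= n + 1\<close> with \<open>n >= 1\<close> the volume of \<open>B\<close> times the
  peak at time \<open>\<beta> n\<close>. It is integrable because \<open>d > 2\<close>.\<close>

private definition w :: "real => real" where
 "w s = indicator {0<..} s*(%n. if n = 0 then 1 else measure lborel B*heat_kernel (\<beta>*real n) (0::'a)) (nat \<lceil>s/1\<rceil> - 1)"

private lemma w_int: "integrable lborel w"
 unfolding w_def
proof (rule step_function_integral(1))
 have "summable (%n. if Suc n = 0 then 1 else measure lborel B*heat_kernel (\<beta>*real (Suc n)) (0::'a))"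
  using summable_mult[OF summable_heat_kernel_0[OF \<beta> d]] by simp
 then show "summable (%n. if n = 0 then 1 else measure lborel B*heat_kernel (\<beta>*real n) (0::'a))"
  by (simp only: summable_Suc_iff[of "%n. if n = 0 then 1 else measure lborel B*heat_kernel (\<beta>*real n) (0::'a)"])
qed (use \<beta> in \<open>auto intro!: mult_nonneg_nonneg heat_kernel_nonneg\<close>)

private lemma heat_mono: "0 < s ==> s <= t ==> heat_kernel t (x::'a) <= heat_kernel s (0::'a)"
proof -
 assume st: "0 < s" "s <= t"
 have "heat_kernel t x <= heat_kernel t (0::'a)" using st by (intro heat_kernel_le) simp
 also have "... <= heat_kernel s (0::'a)" using st by (auto simp: heat_kernel_def intro!: power_mono frac_le)
 finally show ?thesis .
qed

private lemma f_measurable: assumes [measurable]: "\<tau> : BM"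
 shows "case_prod (f \<tau>) : borel_measurable (lborel \<Otimes>\<^sub>M lborel)"
proof -
 have [measurable]: "B : sets borel" by (simp add: B_def)
 show ?thesis unfolding f_def heat_kernel_def case_prod_beta' by measurable
qed

context
 fixes \<tau> :: "real => real"
 assumes \<tau>: "\<tau> : BM" "ALL s>0. s <= \<tau> s"
begin

lemma slice_nonneg: "0 <= f \<tau> s z"
 using \<tau>(2)[rule_format, of s] \<beta> by (auto simp: f_def indicator_def intro!: heat_kernel_nonneg mult_pos_pos intro: less_le_trans)

lemma slice_bound: "f \<tau> s z <= indicator {0<..} s*(indicator B z*heat_kernel (\<beta> * s) (0::'a))"
 using \<tau>(2)[rule_format, of s] \<beta> by (auto simp: f_def indicator_def intro!: heat_mono)

lemma slice_integrable: "integrable lborel (f \<tau> s)"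
proof (rule bochner_integrable_bound)
 have "emeasure lborel B < \<infinity>" unfolding B_def by (rule emeasure_lborel_cball_finite)
 then show "integrable lborel (%z. indicator {0<..} s*(indicator B z*heat_kernel (\<beta> * s) (0::'a)))"
  by (intro integrable_mult_right integrable_mult_left integrable_real_indicator) (auto simp: B_def)
 show "f \<tau> s : borel_measurable lborel" unfolding f_def by (intro borel_measurable_times borel_measurable_indicator) (auto simp: B_def)
 show "AE z in lborel. norm (f \<tau> s z) <= norm (indicator {0<..} s*(indicator B z*heat_kernel (\<beta> * s) (0::'a)))"
  using slice_nonneg slice_bound by (intro AE_I2) (simp add: abs_of_nonneg order_trans[OF _ abs_ge_self])
qed

lemma slice_integral_le: "(LBINT z. f \<tau> s z) <= w s"
proof (cases "s > 0")
 case True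
 define n where "n = nat \<lceil>s\<rceil> - 1"
 have ns: "real n < s" using True by (simp add: n_def) linarith
 show ?thesis
 proof (cases "n = 0")
  case n0: True
  have t: "\<beta>*\<tau> s > 0" using \<tau>(2)[rule_format, OF True] True \<beta> by simp
  have "(LBINT z. f \<tau> s z) <= (LBINT (z::'a). heat_kernel (\<beta>*\<tau> s) z)"
   using heat_kernel_nonneg[OF t] True by (intro integral_mono slice_integrable integral_heat_kernel(1) t) (auto simp: f_def indicator_def)
  also have "... = 1" by (rule integral_heat_kernel(2)[OF t])
  finally show ?thesis using True n0 by (simp add: w_def n_def)
 next
  case False
  have b: "emeasure lborel B < \<infinity>" unfolding B_def by (rule emeasure_lborel_cball_finite)
  have "(LBINT z. f \<tau> s z) <= (LBINT z. indicator B z*heat_kernel (\<beta>*real n) (0::'a))"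
  proof (intro integral_mono slice_integrable integrable_mult_left integrable_real_indicator b)
   fix z :: 'a
   have "heat_kernel (\<beta>*\<tau> s) z <= heat_kernel (\<beta>*real n) (0::'a)"
    using ns \<tau>(2)[rule_format, OF True] False \<beta> by (intro heat_mono) auto
   then show "f \<tau> s z <= indicator B z*heat_kernel (\<beta>*real n) (0::'a)" using True by (auto simp: f_def indicator_def)
  qed (auto simp: B_def)
  also have "... = measure lborel B*heat_kernel (\<beta>*real n) (0::'a)" by simp
  finally show ?thesis using True False by (simp add: w_def n_def)
 qed
next
 case False then show ?thesis by (simp add: f_def w_def)
qed

lemma slice_product_integrable: "integrable (lborel \<Otimes>\<^sub>M lborel) (case_prod (f \<tau>))"
proof (rule lborel_pair.Fubini_integrable)
 note [measurable] = f_measurable[OF \<tau>(1)]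
 show "case_prod (f \<tau>) : borel_measurable (lborel \<Otimes>\<^sub>M lborel)" by measurable
 show "integrable lborel (%s. (LBINT z. norm (case_prod (f \<tau>) (s, z))))"
 proof (rule bochner_integrable_bound[OF w_int])
  have "(%s. (LBINT z. norm (case_prod (f \<tau>) (s, z)))) : borel_measurable lborel" by measurable
  then show "(%s. (LBINT z. norm (case_prod (f \<tau>) (s, z)))) : borel_measurable lborel" .
  show "AE s in lborel. norm (LBINT z. norm (case_prod (f \<tau>) (s, z))) <= norm (w s)"
   using slice_integral_le slice_nonneg by (intro AE_I2) (simp add: abs_of_nonneg order_trans[OF _ abs_ge_self])
 qed
 show "AE s in lborel. integrable lborel (%z. case_prod (f \<tau>) (s, z))" using slice_integrable by simp
qed

end

private lemma limit_eq: "limit_kernel \<beta> R = (%z. (LBINT s. f (%s. s) s z))"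
 by (simp add: limit_kernel_def f_def B_def fun_eq_iff)

lemma limit_kernel_integrable: "integrable lborel (limit_kernel \<beta> R :: 'a => real)"
 and limit_kernel_nonneg: "0 <= limit_kernel \<beta> R (z::'a)"
 and limit_kernel_even: "limit_kernel \<beta> R (- z) = limit_kernel \<beta> R (z::'a)"
proof -
 show "integrable lborel (limit_kernel \<beta> R :: 'a => real)"
  unfolding limit_eq by (rule lborel_pair.integrable_snd[OF slice_product_integrable]) auto
 show "0 <= limit_kernel \<beta> R (z::'a)" unfolding limit_eq by (intro integral_nonneg_AE AE_I2 slice_nonneg) auto
 show "limit_kernel \<beta> R (- z) = limit_kernel \<beta> R (z::'a)" by (simp add: limit_kernel_def indicator_def)
qed

private lemma scaled_eq: "q > 0 ==> scaled_kernel \<beta> R q (z::'a) = (LBINT s. f (riemann_point q) s z)"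
proof -
 assume q: "q > 0"
 let ?\<phi> = "%n. heat_kernel (\<beta>*(real (Suc n)/q^2)) z"
 have \<phi>: "?\<phi> n = q^DIM('a)*heat_kernel (\<beta>*real (Suc n)) (q *\<^sub>R z)" for n
  using heat_kernel_scale[of "\<beta>*real (Suc n)" q z] q \<beta> by simp
 have sm: "summable ?\<phi>" unfolding \<phi> by (intro summable_mult summable_heat_kernel \<beta> d)
 have p0: "!!n. 0 <= ?\<phi> n" using q \<beta> by (intro heat_kernel_nonneg) simp
 have "(LBINT s. f (riemann_point q) s z) = (LBINT s. indicator B z*(indicator {0<..} s*?\<phi> (nat \<lceil>s/(1/q^2)\<rceil> - 1)))"
 proof (intro bochner_integral_cong refl)
  fix s :: real
  have "Suc (nat \<lceil>s/(1/q^2)\<rceil> - 1) = nat \<lceil>s/(1/q^2)\<rceil>" if "s > 0"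
  proof -
   have "s/(1/q^2) > 0" using that q by simp
   then have "\<lceil>s/(1/q^2)\<rceil> > 0" by (simp only: zero_less_ceiling)
   then show ?thesis by simp
  qed
  then show "f (riemann_point q) s z = indicator B z*(indicator {0<..} s*?\<phi> (nat \<lceil>s/(1/q^2)\<rceil> - 1))"
   unfolding f_def riemann_point_def by (auto simp: indicator_def simp del: of_nat_Suc)
 qed
 also have "... = indicator B z*(1/q^2 * suminf ?\<phi>)"
  using step_function_integral(2)[of "1/q^2" ?\<phi>] q p0 sm by (simp del: of_nat_Suc)
 also have "suminf ?\<phi> = q^DIM('a)*bose_kernel \<beta> (q *\<^sub>R z)"
  unfolding \<phi> bose_kernel_def by (rule suminf_mult[OF summable_heat_kernel[OF \<beta> d]])
 also have "1/q^2*(q^DIM('a)*bose_kernel \<beta> (q *\<^sub>R z)) = q^(DIM('a) - 2)*bose_kernel \<beta> (q *\<^sub>R z)"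
  using d q by (simp add: power_diff)
 finally show ?thesis by (simp add: scaled_kernel_def B_def)
qed

private lemma riemann_measurable: "riemann_point q : BM"
 unfolding riemann_point_def by measurable

lemma scaled_kernel_integrable: "q > 0 ==> integrable lborel (scaled_kernel \<beta> R q :: 'a => real)"
 and scaled_kernel_nonneg: "q > 0 ==> 0 <= scaled_kernel \<beta> R q (z::'a)"
 and scaled_kernel_even: "scaled_kernel \<beta> R q (- z) = scaled_kernel \<beta> R q (z::'a)"
proof -
 show "scaled_kernel \<beta> R q (- z) = scaled_kernel \<beta> R q (z::'a)"
  by (simp add: scaled_kernel_def indicator_def)
 assume q: "q > 0"
 show "integrable lborel (scaled_kernel \<beta> R q :: 'a => real)"
  unfolding scaled_eq[OF q, abs_def] by (rule lborel_pair.integrable_snd[OF slice_product_integrable[OF riemann_measurable riemann_point_ge[OF q]]])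
 show "0 <= scaled_kernel \<beta> R q (z::'a)" using bose_kernel_nonneg[OF \<beta> d, of "q *\<^sub>R z"] q by (simp add: scaled_kernel_def)
qed

text \<open>Fubini bounds the L1 distance by an iterated integral, which is treated by dominated
  convergence twice: over \<open>z\<close> for fixed \<open>s\<close>, where the Riemann time tends
  to \<open>s\<close>, and then over \<open>s\<close> with majorant \<open>2 w\<close>.\<close>

theorem scaled_kernel_tendsto:
 "((%q. (LBINT (z::'a). \<bar>scaled_kernel \<beta> R q z - limit_kernel \<beta> R z\<bar>)) ---> 0) at_top"
proof -
 let ?g = "%q s z. \<bar>f (riemann_point q) s z - f (%s. s) s z\<bar>"
 define D where "D q s = (LBINT z. ?g q s z)" for q s
 note fi = slice_integrable[of "%s. s", simplified] and fb = slice_bound[of "%s. s", simplified] and fn = slice_nonneg[of "%s. s", simplified]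
  and fI = slice_integral_le[of "%s. s", simplified] and fp = slice_product_integrable[of "%s. s", simplified]
 have meas: "case_prod (?g q) : borel_measurable (lborel \<Otimes>\<^sub>M lborel)" for q
  using f_measurable[OF riemann_measurable[of q]] f_measurable[of "%s. s"]
  by (auto simp: case_prod_beta' intro!: borel_measurable_abs borel_measurable_diff)
 have gp: "integrable (lborel \<Otimes>\<^sub>M lborel) (case_prod (?g q))" if q: "q > 0" for q
  using integrable_abs[OF bochner_integrable_diff[OF slice_product_integrable[OF riemann_measurable riemann_point_ge[OF q]] fp]]
  by (simp add: case_prod_beta')
 have le: "(LBINT (z::'a). \<bar>scaled_kernel \<beta> R q z - limit_kernel \<beta> R z\<bar>) <= (LBINT s. D q s)" if q: "q > 0" for q
 proof -
  note P = slice_product_integrable[OF riemann_measurable riemann_point_ge[OF q]]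
  have "(LBINT (z::'a). \<bar>scaled_kernel \<beta> R q z - limit_kernel \<beta> R z\<bar>) <= (LBINT z. (LBINT s. ?g q s z))"
  proof (rule integral_mono_AE)
   show "integrable lborel (%z::'a. \<bar>scaled_kernel \<beta> R q z - limit_kernel \<beta> R z\<bar>)"
    by (intro integrable_abs bochner_integrable_diff scaled_kernel_integrable limit_kernel_integrable q)
   show "integrable lborel (%z. (LBINT s. ?g q s z))" by (rule lborel_pair.integrable_snd[OF gp[OF q]])
   show "AE z in lborel. \<bar>scaled_kernel \<beta> R q z - limit_kernel \<beta> R z\<bar> <= (LBINT s. ?g q s z)"
    using lborel_pair.AE_integrable_snd[OF P] lborel_pair.AE_integrable_snd[OF fp]
   proof eventually_elim
    case (elim z)
    show ?case unfolding scaled_eq[OF q] limit_eq bochner_integral_diff[OF elim, symmetric] by (rule integral_abs_bound)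
   qed
  qed
  also have "... = (LBINT s. D q s)" unfolding D_def by (rule lborel_pair.Fubini_integral[OF gp[OF q]])
  finally show ?thesis .
 qed
 have "((%q. (LBINT s. D q s)) ---> (LBINT (s::real). 0)) at_top"
 proof (rule integral_dominated_convergence_at_top[where w = "%s. 2*w s"])
  show "D q : borel_measurable lborel" for q unfolding D_def using meas[of q] by measurable
  show "\<forall>\<^sub>F q in at_top. AE s in lborel. norm (D q s) <= 2*w s"
   using eventually_gt_at_top[of 0]
  proof eventually_elim
   case (elim q)
   note R = riemann_measurable[of q] riemann_point_ge[OF elim]
   have "D q s <= 2*w s" for s
   proof -
    have "D q s <= (LBINT z. f (riemann_point q) s z + f (%s. s) s z)"
     unfolding D_def using slice_nonneg[OF R] fn
     by (intro integral_mono integrable_abs bochner_integrable_diff bochner_integrable_add slice_integrable[OF R] fi) (smt (verit))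
    also have "... <= 2*w s" using slice_integral_le[OF R, of s] fI[of s] by (subst bochner_integral_add[OF slice_integrable[OF R] fi]) simp
    finally show ?thesis .
   qed
   moreover have "0 <= D q s" for s by (simp add: D_def)
   ultimately show ?case by simp
  qed
  show "AE s in lborel. ((%q. D q s) ---> 0) at_top"
  proof (rule AE_I2)
   fix s :: real
   show "((%q. D q s) ---> 0) at_top"
   proof (cases "s > 0")
    case True
    have rp: "((%q. riemann_point q s) ---> s) at_top"
    proof (rule tendsto_sandwich)
     have ev: "\<forall>\<^sub>F q in at_top. s <= riemann_point q s & riemann_point q s <= s + 1/q^2"
      using eventually_gt_at_top[of 0] by eventually_elim (use riemann_point True in auto)
     show "\<forall>\<^sub>F q in at_top. s <= riemann_point q s" "\<forall>\<^sub>F q in at_top. riemann_point q s <= s + 1/q^2"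
      using ev by (auto elim: eventually_mono)
     have "((%q::real. 1/q^2) ---> 0) at_top" by real_asymp
     from tendsto_add[OF tendsto_const this, of s] show "((%q::real. s + 1/q^2) ---> s) at_top" by simp
    qed (rule tendsto_const)
    have "((%q. (LBINT z. ?g q s z)) ---> (LBINT (z::'a). 0)) at_top"
    proof (rule integral_dominated_convergence_at_top[where w = "%z. 2*(indicator B z*heat_kernel (\<beta> * s) (0::'a))"])
     show "?g q s : borel_measurable lborel" for q
      unfolding f_def by (intro borel_measurable_abs borel_measurable_diff borel_measurable_times borel_measurable_indicator) (auto simp: B_def)
     have "emeasure lborel B < \<infinity>" unfolding B_def by (rule emeasure_lborel_cball_finite)
     then show "integrable lborel (%z. 2*(indicator B z*heat_kernel (\<beta> * s) (0::'a)))"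
      by (intro integrable_mult_right integrable_mult_left integrable_real_indicator) (auto simp: B_def)
     show "\<forall>\<^sub>F q in at_top. AE z in lborel. norm (?g q s z) <= 2*(indicator B z*heat_kernel (\<beta> * s) (0::'a))"
      using eventually_gt_at_top[of 0]
     proof eventually_elim
      case (elim q)
      note R = riemann_measurable[of q] riemann_point_ge[OF elim]
      show ?case
      proof (rule AE_I2)
       fix z
       show "norm (?g q s z) <= 2*(indicator B z*heat_kernel (\<beta> * s) (0::'a))"
        using slice_nonneg[OF R, of s z] fn[of s z] slice_bound[OF R, of s z] fb[of s z] True by simp
      qed
     qed
     show "AE z in lborel. ((%q. ?g q s z) ---> 0) at_top"
     proof (rule AE_I2)
      fix z :: 'a
      have "((%q. f (riemann_point q) s z) ---> f (%s. s) s z) at_top"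
       unfolding f_def heat_kernel_def using True \<beta> by (intro tendsto_intros rp) auto
      from tendsto_rabs[OF tendsto_diff[OF this tendsto_const[of "f (%s. s) s z"]]] show "((%q. ?g q s z) ---> 0) at_top" by simp
     qed
    qed auto
    then show ?thesis by (simp add: D_def)
   qed (simp add: D_def f_def)
  qed
 qed (use w_int in auto)
 then have "((%q. (LBINT s. D q s)) ---> 0) at_top" by simp
 moreover have le': "\<forall>\<^sub>F q in at_top. (LBINT (z::'a). \<bar>scaled_kernel \<beta> R q z - limit_kernel \<beta> R z\<bar>) <= (LBINT s. D q s)"
  using eventually_gt_at_top[of 0] by eventually_elim (rule le)
 ultimately show ?thesis
  using tendsto_sandwich[OF _ le' tendsto_const[of "0::real"]] by simp
qed

end

section \<open>Dilated test functions and their operators\<close>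

locale dilated_weight =
 fixes \<beta> R :: real and f :: "'a::euclidean_space => real"
 assumes \<beta>: "\<beta> > 0" and d: "DIM('a) > 2" and f_test: "f : test_functions" and R: "!!x. norm x > R ==> f x = 0"
begin

text \<open>The factor \<open>1/q^2\<close> is the speed \<open>q^(d - 2)\<close> divided by the
  volume factor \<open>q^d\<close>, so \<open>t\<close> times the speed times the rescaled
  observable is \<open>t\<close> times the integral of \<open>dilated q\<close>.\<close>

definition dilated :: "real => 'a => real" where "dilated q x = f (x /\<^sub>R q)/q^2"

lemma f_measurable [measurable]: "f : BM"
 by (rule test_functions_measurable[OF f_test])

lemma dilated_test:
 assumes q: "q > 0" shows "dilated q : test_functions" "norm x > q*R ==> dilated q x = 0"
proof -
 obtain R' H where H: "H > 0" "!!x. f x <= H" using f_test by (rule test_functionsE) blast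
 show z: "dilated q x = 0" if "norm x > q*R" for x
  using R[of "x /\<^sub>R q"] that q by (simp add: dilated_def field_simps)
 show "dilated q : test_functions"
 proof (rule test_functionsI)
  show "dilated q : BM" unfolding dilated_def by measurable
  show "dilated q x <= H/q^2" for x using H q by (simp add: dilated_def divide_right_mono)
  show "0 <= dilated q x" for x using test_functions_nonneg[OF f_test] by (simp add: dilated_def)
  show "norm x > q*R ==> dilated q x = 0" for x by (rule z)
 qed
qed

lemma limit_weighted: "weighted_kernel (limit_kernel \<beta> R) f"
 by unfold_locales (auto intro: limit_kernel_integrable limit_kernel_nonneg limit_kernel_even \<beta> d f_test)

context
 fixes q :: real assumes q: "q > 0"
begin

lemma scaled_weighted: "weighted_kernel (scaled_kernel \<beta> R q) f"
 by unfold_locales (auto intro: scaled_kernel_integrable scaled_kernel_nonneg scaled_kernel_even \<beta> d f_test q)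

lemma dilated_bose_weight: "bose_weight \<beta> (q*R) (dilated q)"
 by unfold_locales (auto intro: \<beta> d dilated_test[OF q])

interpretation K: weighted_kernel "scaled_kernel \<beta> R q" f by (rule scaled_weighted)
interpretation B: bose_weight \<beta> "q*R" "dilated q" by (rule dilated_bose_weight)

lemma dilation_integral: "g : BM ==> (LBINT x. g x) = q^DIM('a)*((LBINT (x::'a). g (q *\<^sub>R x)) :: real)"
 using integral_lborel_affine[of q g 0] q by simp

lemma power_dim: "q^DIM('a) = q^(DIM('a) - 2)*q^2"
proof -
 have "DIM('a) = (DIM('a) - 2) + 2" using d by simp
 then show ?thesis by (metis power_add)
qed

lemma bmf_dilate [simp]: "\<phi> : bmf ==> (%x. \<phi> (x /\<^sub>R q)) : bmf"
 by (auto simp: bmf_def)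

text \<open>The change of variables contributes \<open>q^d\<close>; the weight absorbs
  \<open>q^2\<close> of it and \<open>scaled_kernel\<close> contains the remaining
  \<open>q^(d - 2)\<close>. All dilations thereby act with the same weight \<open>f\<close>.\<close>

lemma T_dilate: assumes \<phi>: "\<phi> : bmf" shows "B.T (%x. \<phi> (x /\<^sub>R q)) = (%x. K.T \<phi> (x /\<^sub>R q))"
proof
 fix x
 note [measurable] = bmf_measurable[OF \<phi>]
 have [measurable]: "dilated q : BM" using dilated_test(1)[OF q] by (rule test_functions_measurable)
 have "B.T (%x. \<phi> (x /\<^sub>R q)) x = q^DIM('a)*(LBINT y. trunc_kernel \<beta> (q*R) (x - q *\<^sub>R y)*(dilated q (q *\<^sub>R y)*\<phi> y))"
  unfolding B.T_def by (subst dilation_integral) (measurable, use q in simp)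
 also have "... = (LBINT y. q^DIM('a)*(trunc_kernel \<beta> (q*R) (x - q *\<^sub>R y)*(dilated q (q *\<^sub>R y)*\<phi> y)))" by simp
 also have "... = K.T \<phi> (x /\<^sub>R q)" unfolding K.T_def
 proof (intro bochner_integral_cong refl)
  fix y
  have e: "q *\<^sub>R (x /\<^sub>R q - y) = x - q *\<^sub>R y" using q by (simp add: scaleR_right_diff_distrib)
  have "norm (x - q *\<^sub>R y) <= 2*(q*R) \<longleftrightarrow> norm (x /\<^sub>R q - y) <= 2*R"
   using q unfolding e[symmetric] norm_scaleR by (simp add: mult.left_commute[of 2])
  then show "q^DIM('a)*(trunc_kernel \<beta> (q*R) (x - q *\<^sub>R y)*(dilated q (q *\<^sub>R y)*\<phi> y)) = scaled_kernel \<beta> R q (x /\<^sub>R q - y)*(f y*\<phi> y)"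
   using q by (simp add: trunc_kernel_def scaled_kernel_def dilated_def e power_dim indicator_def)
 qed
 finally show "B.T (%x. \<phi> (x /\<^sub>R q)) x = K.T \<phi> (x /\<^sub>R q)" .
qed

lemma ip_dilate: assumes \<phi>: "\<phi> : bmf" "\<psi> : bmf" shows "B.ip (%x. \<phi> (x /\<^sub>R q)) (%x. \<psi> (x /\<^sub>R q)) = q^(DIM('a) - 2)*K.ip \<phi> \<psi>"
proof -
 note [measurable] = bmf_measurable[OF \<phi>(1)] bmf_measurable[OF \<phi>(2)]
 have [measurable]: "dilated q : BM" using dilated_test(1)[OF q] by (rule test_functions_measurable)
 have "B.ip (%x. \<phi> (x /\<^sub>R q)) (%x. \<psi> (x /\<^sub>R q)) = q^DIM('a)*(LBINT x. dilated q (q *\<^sub>R x)*(\<phi> x*\<psi> x))"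
  unfolding B.ip_def by (subst dilation_integral) (measurable, use q in simp)
 also have "... = q^(DIM('a) - 2)*(LBINT x. q^2*(dilated q (q *\<^sub>R x)*(\<phi> x*\<psi> x)))" by (simp add: power_dim)
 also have "(LBINT x. q^2*(dilated q (q *\<^sub>R x)*(\<phi> x*\<psi> x))) = K.ip \<phi> \<psi>"
  unfolding K.ip_def using q by (intro bochner_integral_cong refl) (simp add: dilated_def)
 finally show ?thesis .
qed

lemma dilated_integral: "(LBINT x. dilated q x) = q^(DIM('a) - 2)*(LBINT x. f x)"
 using ip_dilate[of "%x. 1" "%x. 1"] by (simp add: B.ip_def K.ip_def)

lemma scaled_psd: "psd_kernel (scaled_kernel \<beta> R q) f"
proof
 fix \<phi> :: "'a => real" assume \<phi>: "\<phi> : bmf"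
 have "0 <= B.ip (%x. \<phi> (x /\<^sub>R q)) (B.T (%x. \<phi> (x /\<^sub>R q)))" by (rule B.T_psd) (simp add: \<phi>)
 then have "q^(DIM('a) - 2)*0 <= q^(DIM('a) - 2)*K.ip \<phi> (K.T \<phi>)" by (simp add: T_dilate ip_dilate \<phi>)
 then show "0 <= K.ip \<phi> (K.T \<phi>)" using q by (subst (asm) mult_le_cancel_left_pos) auto
qed

lemma resolvent_value_dilate:
 assumes "K.resolvent_value w r" shows "B.resolvent_value w (q^(DIM('a) - 2)*r)"
proof -
 obtain s where s: "K.resolvent_seq w s" "(%n. K.ip (%x. 1) (s n)) ----> r" using assms by (auto simp: K.resolvent_value_def)
 have b: "s n : bmf" for n using s(1) by (simp add: K.resolvent_seq_def)
 have rb: "(%x. 1 - (s n x - w*K.T (s n) x)) : bmf" for n by (intro bmf_diff bmf_mult bmf_const K.T_bmf b)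
 let ?S = "%n x. s n (x /\<^sub>R q)"
 have "B.nrm (%x. 1 - (?S n x - w*B.T (?S n) x)) = sqrt (q^(DIM('a) - 2))*K.nrm (%x. 1 - (s n x - w*K.T (s n) x))" for n
  using ip_dilate[OF rb rb, of n n] by (simp add: T_dilate[OF b] B.nrm_def K.nrm_def real_sqrt_mult)
 moreover have "(%n. sqrt (q^(DIM('a) - 2))*K.nrm (%x. 1 - (s n x - w*K.T (s n) x))) ----> 0"
  using s(1) by (intro tendsto_mult_right_zero) (simp add: K.resolvent_seq_def)
 ultimately have "B.resolvent_seq w ?S" using b by (simp add: B.resolvent_seq_def)
 moreover have "(%n. B.ip (%x. 1) (?S n)) ----> q^(DIM('a) - 2)*r"
  using ip_dilate[OF bmf_const b, of 1] tendsto_mult_left[OF s(2)] by simp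
 ultimately show ?thesis by (auto simp: B.resolvent_value_def)
qed

end

sublocale lim: weighted_kernel "limit_kernel \<beta> R" f by (rule limit_weighted)

definition L1_error :: "real => real" where "L1_error q = (LBINT (z::'a). \<bar>scaled_kernel \<beta> R q z - limit_kernel \<beta> R z\<bar>)"

lemma L1_error_tendsto: "(L1_error ---> 0) at_top" and L1_error_nonneg: "0 <= L1_error q"
 unfolding L1_error_def using scaled_kernel_tendsto[OF \<beta> d] by auto

lemma limit_psd: "psd_kernel (limit_kernel \<beta> R) f"
proof
 fix \<phi> :: "'a => real" assume \<phi>: "\<phi> : bmf"
 obtain R' H where H: "H > 0" "!!x. f x <= H" using f_test by (rule test_functionsE) blast
 have "((%q. - (H*L1_error q*(lim.nrm \<phi>*lim.nrm \<phi>))) ---> - (H*0*(lim.nrm \<phi>*lim.nrm \<phi>))) at_top"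
  by (intro tendsto_intros L1_error_tendsto)
 moreover have "\<forall>\<^sub>F q in at_top. - (H*L1_error q*(lim.nrm \<phi>*lim.nrm \<phi>)) <= lim.ip \<phi> (lim.T \<phi>)"
  using eventually_gt_at_top[of 0]
 proof eventually_elim
  case (elim q)
  show ?case using lim.kernel_ip_diff[OF scaled_weighted[OF elim] H(2) \<phi> \<phi>] psd_kernel.psd[OF scaled_psd[OF elim] \<phi>]
   by (simp add: L1_error_def abs_le_iff)
 qed
 ultimately show "0 <= lim.ip \<phi> (lim.T \<phi>)" by (intro tendsto_upperbound[of _ 0 at_top]) auto
qed

sublocale lim: psd_kernel "limit_kernel \<beta> R" f by (rule limit_psd)

text \<open>The Bose kernel is split into \<open>N\<close> heat kernels and a tail below
  \<open>\<epsilon>\<close>, which gives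
  \<open>G^2 <= G(0) (sum of N heat kernels) + \<epsilon> G\<close>. The heat kernels have mass 1
  and meet a weight of size \<open>H/q^2\<close>; the other term is \<open>\<epsilon>\<close> times
  \<open>T 1\<close>, which stays bounded for large \<open>q\<close>. The outer integral supplies
  \<open>q^(d - 2)\<close>.\<close>

lemma kernel_hs_dilated_tendsto: "((%q. kernel_hs \<beta> (dilated q)/q^(DIM('a) - 2)) ---> 0) at_top"
proof (rule tendstoI)
 fix e :: real assume e: "e > 0"
 obtain R' H where H: "H > 0" "!!x. f x <= H" using f_test by (rule test_functionsE) blast
 let ?G = "bose_kernel \<beta> :: 'a => real" and ?F = "(LBINT x. f x)" and ?k = "(LBINT (x::'a). limit_kernel \<beta> R x)"
 let ?t = "%n x. heat_kernel (\<beta>*real (Suc n)) (x::'a)"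
 define A where "A = ?F*(H*(?k + 1))"
 have F: "0 <= ?F" using test_functions_nonneg[OF f_test] by simp
 have A: "0 <= A" using F H lim.k_nonneg by (simp add: A_def)
 have t0: "0 <= ?t n x" for n x using \<beta> by (intro heat_kernel_nonneg) simp
 have ti: "integrable lborel (?t n)" "(LBINT x. ?t n x) = 1" for n using \<beta> by (simp_all add: integral_heat_kernel)
 have G: "0 <= ?G x" "?G x <= ?G 0" for x by (auto intro: bose_kernel_nonneg[OF \<beta> d] bose_kernel_le[OF \<beta> d])
 define \<epsilon> where "\<epsilon> = e/(2*(A + 1))"
 have \<epsilon>: "\<epsilon> > 0" "A*\<epsilon> < e" using e mult_nonneg_nonneg[OF A less_imp_le[OF e]] A by (auto simp: \<epsilon>_def field_simps intro: add_nonneg_pos)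
 have "(%N. \<Sum>n. ?t (n + N) 0) ----> 0" by (rule suminf_exist_split2[OF summable_heat_kernel_0[OF \<beta> d]])
 from eventually_happens[OF order_tendstoD(2)[OF this \<epsilon>(1)]] obtain N where N: "(\<Sum>n. ?t (n + N) 0) < \<epsilon>" by auto
 have G2: "(?G x)^2 <= ?G 0*(\<Sum>n<N. ?t n x) + \<epsilon>*?G x" for x
 proof -
  note sm = summable_heat_kernel[OF \<beta> d, of x]
  have "?G x = (\<Sum>n. ?t (n + N) x) + (\<Sum>n<N. ?t n x)" unfolding bose_kernel_def by (rule suminf_split_initial_segment[OF sm])
  moreover have "(\<Sum>n. ?t (n + N) x) <= (\<Sum>n. ?t (n + N) 0)"
   using \<beta> by (intro suminf_le heat_kernel_le summable_ignore_initial_segment sm summable_heat_kernel_0[OF \<beta> d]) simp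
  ultimately have "?G x <= \<epsilon> + (\<Sum>n<N. ?t n x)" using N by linarith
  then have "?G x*?G x <= ?G x*(\<epsilon> + (\<Sum>n<N. ?t n x))" by (intro mult_left_mono G)
  also have "... <= \<epsilon>*?G x + ?G 0*(\<Sum>n<N. ?t n x)"
   using G t0 by (simp add: distrib_left mult.commute[of \<epsilon>] mult_right_mono sum_nonneg)
  finally show ?thesis by (simp add: power2_eq_square)
 qed
 have "((%q. ?F*(?G 0*(H/q^2*real N) + \<epsilon>*(H*(?k + L1_error q)))) ---> ?F*(?G 0*(0*real N) + \<epsilon>*(H*(?k + 0)))) at_top"
  by (intro tendsto_intros L1_error_tendsto tendsto_divide_0[OF tendsto_const] filterlim_mono[OF filterlim_pow_at_top at_top_le_at_infinity order_refl] filterlim_ident) simp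
 moreover have "?F*(?G 0*(0*real N) + \<epsilon>*(H*(?k + 0))) <= A*\<epsilon>" using F H \<epsilon> by (simp add: A_def mult_left_mono algebra_simps)
 ultimately have "\<forall>\<^sub>F q in at_top. ?F*(?G 0*(H/q^2*real N) + \<epsilon>*(H*(?k + L1_error q))) < e"
  by (rule order_tendstoD(2)[OF _ le_less_trans[OF _ \<epsilon>(2)]])
 then show "\<forall>\<^sub>F q in at_top. dist (kernel_hs \<beta> (dilated q)/q^(DIM('a) - 2)) 0 < e"
  using eventually_gt_at_top[of 0]
 proof eventually_elim
  case (elim q)
  note q = elim(2)
  let ?p = "q^(DIM('a) - 2)"
  interpret K: weighted_kernel "scaled_kernel \<beta> R q" f by (rule scaled_weighted[OF q])
  interpret B: bose_weight \<beta> "q*R" "dilated q" by (rule dilated_bose_weight[OF q])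
  define c where "c = ?G 0*(H/q^2*real N) + \<epsilon>*(H*(?k + L1_error q))"
  have c: "0 <= c" using G(1)[of 0] H \<epsilon> lim.k_nonneg L1_error_nonneg by (simp add: c_def)
  have hH: "dilated q x <= H/q^2" for x using H(2) by (simp add: dilated_def divide_right_mono)
  have kk: "(LBINT z. scaled_kernel \<beta> R q (z::'a)) <= ?k + L1_error q"
  proof -
   have di: "integrable lborel (%z::'a. \<bar>scaled_kernel \<beta> R q z - limit_kernel \<beta> R z\<bar>)" using K.k_int lim.k_int by auto
   have "(LBINT z. scaled_kernel \<beta> R q (z::'a)) <= (LBINT (z::'a). limit_kernel \<beta> R z + \<bar>scaled_kernel \<beta> R q z - limit_kernel \<beta> R z\<bar>)"
    by (intro integral_mono K.k_int bochner_integrable_add di lim.k_int) simp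
   also have "... = ?k + L1_error q" unfolding L1_error_def by (rule bochner_integral_add[OF lim.k_int di])
   finally show ?thesis .
  qed
  have T1: "B.T (%x. 1) y <= H*(?k + L1_error q)" for y
  proof -
   have "H*(LBINT z. scaled_kernel \<beta> R q (z::'a)) <= H*(?k + L1_error q)" using H by (intro mult_left_mono kk) simp
   then show ?thesis using K.T_const_le[OF H(2) bmf_const order_refl, of 1 "y /\<^sub>R q"] T_dilate[OF q bmf_const[of 1]] by simp
  qed
  have inner: "(LBINT x. dilated q x*(?G (y - x))^2) <= c" if y: "norm y <= q*R" for y
  proof -
   have ts: "integrable lborel (%x. ?t n (y - x))" "(LBINT x. ?t n (y - x)) = 1" for n
    using integrable_lborel_affine[OF ti(1)[of n], of "-1" y] integral_lborel_affine[of "-1" "?t n" y] ti(2)[of n] by auto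
   have Gi: "integrable lborel (%x. ?G (y - x)*dilated q x)"
    unfolding mult.commute[of "?G _"]
    by (intro integrable_mult_bmf test_functions_integrable dilated_test(1)[OF q] bmfI[of _ "?G 0"] measurable_compose[OF _ bose_kernel_measurable])
     (use G in auto)
   have "(LBINT x. dilated q x*(?G (y - x))^2) <= (LBINT x. ?G 0*(H/q^2*(\<Sum>n<N. ?t n (y - x))) + \<epsilon>*(?G (y - x)*dilated q x))"
   proof (rule integral_mono')
    show "integrable lborel (%x. ?G 0*(H/q^2*(\<Sum>n<N. ?t n (y - x))) + \<epsilon>*(?G (y - x)*dilated q x))"
     by (intro bochner_integrable_add integrable_mult_right bochner_integrable_sum ts Gi)
    fix x
    have "dilated q x*(?G (y - x))^2 <= dilated q x*(?G 0*(\<Sum>n<N. ?t n (y - x)) + \<epsilon>*?G (y - x))"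
     by (intro mult_left_mono G2 B.h_nonneg)
    moreover have "dilated q x*(?G 0*(\<Sum>n<N. ?t n (y - x))) <= H/q^2*(?G 0*(\<Sum>n<N. ?t n (y - x)))"
     using G t0 by (intro mult_right_mono hH mult_nonneg_nonneg sum_nonneg) auto
    ultimately show "dilated q x*(?G (y - x))^2 <= ?G 0*(H/q^2*(\<Sum>n<N. ?t n (y - x))) + \<epsilon>*(?G (y - x)*dilated q x)"
     by (simp add: algebra_simps)
    show "0 <= ?G 0*(H/q^2*(\<Sum>n<N. ?t n (y - x))) + \<epsilon>*(?G (y - x)*dilated q x)"
     using G t0 H \<epsilon> B.h_nonneg by (intro add_nonneg_nonneg mult_nonneg_nonneg sum_nonneg) auto
   qed
   also have "... = ?G 0*(H/q^2*real N) + \<epsilon>*B.T (%x. 1) y"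
    unfolding B.T_eq[OF y] using ts Gi by (simp add: bochner_integral_sum)
   also have "... <= c" unfolding c_def using T1 \<epsilon> by (intro add_left_mono mult_left_mono) auto
   finally show ?thesis .
  qed
  have "kernel_hs \<beta> (dilated q) <= (LBINT y. dilated q y*c)"
   unfolding kernel_hs_def
  proof (rule integral_mono')
   show "integrable lborel (%y. dilated q y*c)" by (intro integrable_mult_left test_functions_integrable dilated_test(1)[OF q])
   fix y
   show "0 <= dilated q y*c" using c B.h_nonneg by simp
   show "dilated q y*(LBINT x. dilated q x*(?G (y - x))^2) <= dilated q y*c"
    using inner[of y] dilated_test(2)[OF q, of y] B.h_nonneg[of y] by (cases "norm y <= q*R") (auto intro: mult_left_mono)
  qed
  also have "... = ?p*(?F*c)" using dilated_integral[OF q] by simp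
  finally have "kernel_hs \<beta> (dilated q)/?p <= ?F*c" using q by (simp add: pos_divide_le_eq mult.commute)
  moreover have "0 <= kernel_hs \<beta> (dilated q)" unfolding kernel_hs_def using B.h_nonneg by simp
  ultimately show ?case using elim(1) q by (simp add: c_def)
 qed
qed

text \<open>One \<open>\<psi>\<close> and one \<open>\<Lambda>\<close>, taken from the limit kernel,
  serve all large \<open>q\<close>: on \<open>\<psi>\<close> the operators differ by at most
  \<open>C H L1_error q\<close>, and the \<open>- 1\<close> in the subinvariance of
  \<open>\<psi>\<close> absorbs this. \<open>E\<close> adds the perturbation of the resolvent to the
  Hilbert-Schmidt error; both tend to 0.\<close>

theorem point_exp_limit:
 fixes \<nu> :: "'a measure measure"
 assumes \<nu>: "boson_point_field \<beta> \<rho> \<nu>" and w: "w : lim.dom"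
 shows "EX L. (L ---> (\<rho> - critical_density TYPE('a) \<beta>)*w*lim.rv w + w*(bose_kernel \<beta> (0::'a)*(LBINT x. f x))) at_top
  & (\<forall>\<^sub>F q in at_top. (\<integral>\<^sup>+\<xi>. ennreal (point_exp (dilated q) w \<xi>) \<partial>\<nu>) = ennreal (exp (q^(DIM('a) - 2)*L q)))"
proof -
 obtain R' H where H: "H > 0" "!!x. f x <= H" using f_test by (rule test_functionsE) blast
 obtain \<Lambda> \<psi> where \<Lambda>: "0 < \<Lambda>" "w*\<Lambda> < 1" and \<psi>: "\<psi> : bmf" "!!x. 1 <= \<psi> x" "!!x. lim.T \<psi> x <= \<Lambda>*(\<psi> x - 1)"
  using lim.dom_Schur[OF w] by blast
 obtain C where C: "!!x. \<bar>\<psi> x\<bar> <= C" using bmfE[OF \<psi>(1)] by metis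
 define a where "a = \<rho> - critical_density TYPE('a) \<beta>"
 let ?F = "(LBINT x. f x)"
 define tr where "tr = bose_kernel \<beta> (0::'a)*?F"
 define l where "l = a*w*lim.rv w + w*tr"
 define c where "c = (if w <= 0 then 1 else 1 - w*\<Lambda>)"
 define E where "E q = \<bar>a*w\<bar>*(\<bar>w\<bar>*(H*L1_error q)*?F/(c*c)) + w^2*(kernel_hs \<beta> (dilated q)/q^(DIM('a) - 2))/(1 - max 0 (w*\<Lambda>))" for q
 have Tlim: "lim.T \<psi> x <= \<Lambda>*\<psi> x" for x using \<psi>(3)[of x] \<Lambda> by (simp add: right_diff_distrib)
 have bl: "bounded_kernel (limit_kernel \<beta> R) f \<Lambda>" by (rule lim.bounded_kernel_Schur[OF \<Lambda>(1) \<psi>(1,2) Tlim])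
 have "((%q. C*(H*L1_error q)) ---> C*(H*0)) at_top" by (intro tendsto_intros L1_error_tendsto)
 then have ev1: "\<forall>\<^sub>F q in at_top. C*(H*L1_error q) < \<Lambda>" using \<Lambda> by (intro order_tendstoD(2)) auto
 have "((%q. - w*(H/q^2)) ---> - w*0) at_top"
  by (intro tendsto_intros tendsto_divide_0[OF tendsto_const] filterlim_mono[OF filterlim_pow_at_top at_top_le_at_infinity order_refl] filterlim_ident) simp
 then have ev2: "\<forall>\<^sub>F q in at_top. - w*(H/q^2) < 1" by (intro order_tendstoD(2)) auto
 have main: "\<forall>\<^sub>F q in at_top. EX x. (\<integral>\<^sup>+\<xi>. ennreal (point_exp (dilated q) w \<xi>) \<partial>\<nu>) = ennreal (exp (q^(DIM('a) - 2)*x)) & \<bar>x - l\<bar> <= E q"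
  using ev1 ev2 eventually_gt_at_top[of 0]
 proof eventually_elim
  case (elim q)
  note q = elim(3)
  let ?p = "q^(DIM('a) - 2)"
  have p: "?p > 0" using q by simp
  interpret K: psd_kernel "scaled_kernel \<beta> R q" f by (rule scaled_psd[OF q])
  interpret B: bose_weight \<beta> "q*R" "dilated q" by (rule dilated_bose_weight[OF q])
  have wk: "weighted_kernel (scaled_kernel \<beta> R q) f" by (rule scaled_weighted[OF q])
  have TK: "K.T \<psi> x <= \<Lambda>*\<psi> x" for x
   using lim.kernel_T_diff(1,2)[OF wk H(2) \<psi>(1) C, of x] \<psi>(3)[of x] elim(1) by (simp add: L1_error_def right_diff_distrib)
  have bk: "bounded_kernel (scaled_kernel \<beta> R q) f \<Lambda>" by (rule K.bounded_kernel_Schur[OF \<Lambda>(1) \<psi>(1,2) TK])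
  note rK = K.rv_eq(2)[OF bk \<Lambda>(2)]
  have "\<bar>lim.rv w - K.rv w\<bar> <= \<bar>w\<bar>*(H*L1_error q)*?F/(c*c)"
   unfolding c_def
   by (rule lim.resolvent_value_perturbation[OF wk _ _ bounded_kernel.coercive[OF bl \<Lambda>(2)] bounded_kernel.coercive[OF bk \<Lambda>(2)] lim.rv_value[OF w] rK])
    (use H L1_error_nonneg lim.kernel_ip_diff[OF wk H(2)] in \<open>auto simp: L1_error_def\<close>)
  then have rd: "\<bar>a*w*(K.rv w - lim.rv w)\<bar> <= \<bar>a*w\<bar>*(\<bar>w\<bar>*(H*L1_error q)*?F/(c*c))"
   unfolding abs_mult by (intro mult_left_mono) (auto simp: abs_minus_commute)
  have "EX L. (\<integral>\<^sup>+\<xi>. ennreal (point_exp (dilated q) w \<xi>) \<partial>\<nu>) = ennreal (exp L)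
   & \<bar>L - (a*w*(?p*K.rv w) + w*(bose_kernel \<beta> (0::'a)*(LBINT x. dilated q x)))\<bar> <= w^2*kernel_hs \<beta> (dilated q)/(1 - max 0 (w*\<Lambda>))"
   unfolding a_def
  proof (rule B.point_exp_expectation[OF \<nu> _ _ _ _ \<Lambda> elim(2) resolvent_value_dilate[OF q rK]])
   show "dilated q x <= H/q^2" for x using H(2) by (simp add: dilated_def divide_right_mono)
   show "(%x. \<psi> (x /\<^sub>R q)) : bmf" using bmf_dilate[OF q \<psi>(1)] .
   show "1 <= \<psi> (x /\<^sub>R q)" for x by (rule \<psi>(2))
   show "B.T (%x. \<psi> (x /\<^sub>R q)) x <= \<Lambda>*\<psi> (x /\<^sub>R q)" for x unfolding T_dilate[OF q \<psi>(1)] by (rule TK)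
  qed
  then obtain L where L: "(\<integral>\<^sup>+\<xi>. ennreal (point_exp (dilated q) w \<xi>) \<partial>\<nu>) = ennreal (exp L)"
   "\<bar>L - (a*w*(?p*K.rv w) + w*(bose_kernel \<beta> (0::'a)*(LBINT x. dilated q x)))\<bar> <= w^2*kernel_hs \<beta> (dilated q)/(1 - max 0 (w*\<Lambda>))" by blast
  have "L - (a*w*(?p*K.rv w) + w*(bose_kernel \<beta> (0::'a)*(LBINT x. dilated q x))) = ?p*(L/?p - (a*w*K.rv w + w*tr))"
   using p q by (simp add: dilated_integral tr_def right_diff_distrib distrib_left mult_ac)
  then have "?p*\<bar>L/?p - (a*w*K.rv w + w*tr)\<bar> <= ?p*(w^2*(kernel_hs \<beta> (dilated q)/?p)/(1 - max 0 (w*\<Lambda>)))"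
   using L(2) p q by (simp add: abs_mult)
  then have "\<bar>L/?p - (a*w*K.rv w + w*tr)\<bar> <= w^2*(kernel_hs \<beta> (dilated q)/?p)/(1 - max 0 (w*\<Lambda>))"
   using p by (simp only: mult_le_cancel_left_pos)
  moreover have "L/?p - l = (L/?p - (a*w*K.rv w + w*tr)) + a*w*(K.rv w - lim.rv w)" by (simp add: l_def algebra_simps)
  ultimately have "\<bar>L/?p - l\<bar> <= E q" using rd unfolding E_def by linarith
  then show ?case using L(1) q by (intro exI[of _ "L/?p"]) simp
 qed
 have E0: "(E ---> \<bar>a*w\<bar>*(\<bar>w\<bar>*(H*0)*?F/(c*c)) + w^2*0/(1 - max 0 (w*\<Lambda>))) at_top"
  unfolding E_def[abs_def] using \<Lambda>(2) by (intro tendsto_intros L1_error_tendsto kernel_hs_dilated_tendsto) (auto simp: c_def)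
 define L where "L = (%q. SOME x. (\<integral>\<^sup>+\<xi>. ennreal (point_exp (dilated q) w \<xi>) \<partial>\<nu>) = ennreal (exp (q^(DIM('a) - 2)*x)) & \<bar>x - l\<bar> <= E q)"
 have evL: "\<forall>\<^sub>F q in at_top. (\<integral>\<^sup>+\<xi>. ennreal (point_exp (dilated q) w \<xi>) \<partial>\<nu>) = ennreal (exp (q^(DIM('a) - 2)*L q)) & \<bar>L q - l\<bar> <= E q"
  using main unfolding L_def by eventually_elim (rule someI_ex)
 have "((%q. L q - l) ---> 0) at_top"
  by (rule Lim_null_comparison[OF _ tendsto_eq_rhs[OF E0]]) (use evL in \<open>auto elim: eventually_mono\<close>)
 then have "(L ---> l) at_top" by (simp add: LIM_zero_iff)
 then show ?thesis using evL by (intro exI[of _ L]) (auto simp: l_def a_def tr_def elim: eventually_mono)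
qed

end

section \<open>The Gaertner--Ellis theorem on the line\<close>

text \<open>Closed sublevel sets encode steepness: as \<open>U\<close> is open,
  \<open>\<Lambda>\<close> cannot stay bounded above along a sequence that tends to a finite
  endpoint of \<open>U\<close>, while \<open>U\<close> may also be the whole line. The moment
  formula is required only eventually in \<open>q\<close>, separately for each
  \<open>t\<close>.\<close>

locale large_deviation_mgf = prob_space +
 fixes Y :: "real => 'a => real" and v \<Lambda> :: "real => real" and U :: "real set"
 assumes Y: "!!q. 0 < q ==> Y q : borel_measurable M"
  and v: "filterlim v at_top at_top"
  and U: "open U" "0 : U" "!!t u. t : U ==> u <= t ==> u : U"
  and mgf: "!!t. t : U ==> EX L. (L ---> \<Lambda> t) at_top &
   (\<forall>\<^sub>F q in at_top. (\<integral>\<^sup>+x. ennreal (exp (v q*(t*Y q x))) \<partial>M) = ennreal (exp (v q*L q)))"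
  and diff: "!!t. t : U ==> \<Lambda> differentiable (at t)"
  and steep: "!!B. closed {t:U. \<Lambda> t <= B}"
begin

definition rate :: "real => ereal" where "rate s = (SUP t\<in>U. ereal (t * s - \<Lambda> t))"

lemma v_pos: "\<forall>\<^sub>F q in at_top. 0 < v q" and v_inv: "((%q. c/v q) ---> 0) at_top"
 using v by (auto simp: filterlim_at_top_dense intro!: tendsto_divide_0[OF tendsto_const] filterlim_mono[OF v at_top_le_at_infinity])

lemma \<Lambda>_0: "\<Lambda> 0 = 0"
proof -
 obtain L where L: "(L ---> \<Lambda> 0) at_top" "\<forall>\<^sub>F q in at_top. (\<integral>\<^sup>+x. ennreal (exp (v q*(0*Y q x))) \<partial>M) = ennreal (exp (v q*L q))"
  using mgf[OF U(2)] by blast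
 have "\<forall>\<^sub>F q in at_top. L q = 0" using L(2) v_pos
 proof eventually_elim
  case (elim q)
  then have "ennreal (exp (v q*L q)) = 1" by (simp add: emeasure_space_1)
  then show ?case using elim(2) by simp
 qed
 then have "(L ---> 0) at_top" by (rule tendsto_eventually)
 then show ?thesis using tendsto_unique[OF _ L(1)] by simp
qed

text \<open>Exponential Chebyshev inequality on top of a tilt by \<open>t\<close>; the sign of
  \<open>u\<close> selects the side, and \<open>t = 0\<close> is the Chernoff bound.\<close>

lemma tail:
 assumes tu: "t + u : U" and c: "c < u*x - \<Lambda> (t + u)"
 shows "\<forall>\<^sub>F q in at_top. (\<integral>\<^sup>+w. ennreal (exp (v q*(t*Y q w)))*indicator {w. u*x <= u*Y q w} w \<partial>M) <= ennreal (exp (- (v q*c)))"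
proof -
 obtain L where L: "(L ---> \<Lambda> (t + u)) at_top" "\<forall>\<^sub>F q in at_top. (\<integral>\<^sup>+x. ennreal (exp (v q*((t + u)*Y q x))) \<partial>M) = ennreal (exp (v q*L q))"
  using mgf[OF tu] by blast
 have "\<forall>\<^sub>F q in at_top. L q < u*x - c" using L(1) c by (intro order_tendstoD(2)) auto
 then show ?thesis using L(2) v_pos eventually_gt_at_top[of 0]
 proof eventually_elim
  case (elim q)
  note [measurable] = Y[OF elim(4)]
  have "(\<integral>\<^sup>+w. ennreal (exp (v q*(t*Y q w)))*indicator {w. u*x <= u*Y q w} w \<partial>M)
    <= (\<integral>\<^sup>+w. ennreal (exp (- (v q*(u*x))))*ennreal (exp (v q*((t + u)*Y q w))) \<partial>M)"
  proof (rule nn_integral_mono)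
   fix w
   show "ennreal (exp (v q*(t*Y q w)))*indicator {w. u*x <= u*Y q w} w <= ennreal (exp (- (v q*(u*x))))*ennreal (exp (v q*((t + u)*Y q w)))"
   proof (cases "u*x <= u*Y q w")
    case True
    then have "v q*(u*x) <= v q*(u*Y q w)" by (rule mult_left_mono) (use elim in simp)
    then show ?thesis using True by (simp add: ennreal_mult[symmetric] exp_add[symmetric] algebra_simps)
   qed simp
  qed
  also have "... = ennreal (exp (- (v q*(u*x))))*ennreal (exp (v q*L q))"
   by (subst nn_integral_cmult) (use elim in auto)
  also have "... = ennreal (exp (- (v q*(u*x - L q))))"
   by (simp add: ennreal_mult[symmetric] exp_add[symmetric] algebra_simps)
  also have "... <= ennreal (exp (- (v q*c)))" using elim by (intro ennreal_leI) (simp add: mult_left_mono)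
  finally show ?case .
 qed
qed

lemma Chernoff:
 assumes "u : U" "c < u*x - \<Lambda> u"
 shows "\<forall>\<^sub>F q in at_top. measure M {w:space M. u*x <= u*Y q w} <= exp (- (v q*c))"
proof -
 have "\<forall>\<^sub>F q in at_top. (\<integral>\<^sup>+w. indicator {w. u*x <= u*Y q w} w \<partial>M) <= ennreal (exp (- (v q*c)))"
  using tail[of 0 u c x] assms by simp
 then show ?thesis using eventually_gt_at_top[of 0]
 proof eventually_elim
 case (elim q)
 note [measurable] = Y[OF elim(2)]
 have "emeasure M {w:space M. u*x <= u*Y q w} = (\<integral>\<^sup>+w. indicator {w. u*x <= u*Y q w} w \<partial>M)"
 proof -
  have "(\<integral>\<^sup>+w. indicator {w. u*x <= u*Y q w} w \<partial>M) = (\<integral>\<^sup>+w. indicator {w:space M. u*x <= u*Y q w} w \<partial>M)"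
   by (intro nn_integral_cong) (auto simp: indicator_def)
  then show ?thesis by (simp add: nn_integral_indicator)
 qed
 then have "ennreal (measure M {w:space M. u*x <= u*Y q w}) <= ennreal (exp (- (v q*c)))"
  using elim by (simp add: emeasure_eq_measure)
 then show ?case by simp
 qed
qed

text \<open>Convexity along rays from 0 suffices later. It follows from the convexity of
  \<open>exp\<close> between 0 and the exponent normalized by the logarithmic moment
  \<open>?l\<close>.\<close>

lemma mgf_convex_0:
 assumes t: "t : U" and \<theta>: "0 < \<theta>" "\<theta> < 1" "\<theta>*t : U"
 shows "\<Lambda> (\<theta>*t) <= \<theta>*\<Lambda> t"
proof -
 obtain L where L: "(L ---> \<Lambda> t) at_top" "\<forall>\<^sub>F q in at_top. (\<integral>\<^sup>+x. ennreal (exp (v q*(t*Y q x))) \<partial>M) = ennreal (exp (v q*L q))"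
  using mgf[OF t] by blast
 obtain L' where L': "(L' ---> \<Lambda> (\<theta>*t)) at_top" "\<forall>\<^sub>F q in at_top. (\<integral>\<^sup>+x. ennreal (exp (v q*(\<theta>*t*Y q x))) \<partial>M) = ennreal (exp (v q*L' q))"
  using mgf[OF \<theta>(3)] by blast
 have "\<forall>\<^sub>F q in at_top. L' q <= \<theta>*L q"
  using L(2) L'(2) v_pos eventually_gt_at_top[of 0]
 proof eventually_elim
  case (elim q)
  note [measurable] = Y[OF elim(4)]
  let ?l = "v q*L q"
  have "ennreal (exp (v q*L' q)) = (\<integral>\<^sup>+x. ennreal (exp (\<theta>*?l))*ennreal (exp (\<theta>*(v q*(t*Y q x) - ?l))) \<partial>M)"
   unfolding elim(2)[symmetric] by (intro nn_integral_cong) (simp add: ennreal_mult[symmetric] exp_add[symmetric] algebra_simps)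
  also have "... <= (\<integral>\<^sup>+x. ennreal (exp (\<theta>*?l))*(ennreal (1 - \<theta>) + ennreal (\<theta>*exp (- ?l))*ennreal (exp (v q*(t*Y q x)))) \<partial>M)"
  proof (intro nn_integral_mono mult_left_mono)
   fix x
   let ?a = "v q*(t*Y q x) - ?l"
   have "exp ((1 - \<theta>)*0 + \<theta>*?a) <= (1 - \<theta>)*exp 0 + \<theta>*exp ?a"
    using convex_onD[OF exp_convex, of \<theta> 0 ?a] \<theta> by simp
   then have "exp (\<theta>*?a) <= (1 - \<theta>) + \<theta>*exp (- ?l)*exp (v q*(t*Y q x))" by (simp add: exp_diff exp_minus field_simps)
   then show "ennreal (exp (\<theta>*?a)) <= ennreal (1 - \<theta>) + ennreal (\<theta>*exp (- ?l))*ennreal (exp (v q*(t*Y q x)))"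
    using \<theta> by (simp add: ennreal_mult[symmetric] ennreal_plus[symmetric] ennreal_leI del: ennreal_plus)
  qed simp
  also have "... = ennreal (exp (\<theta>*?l))*(ennreal (1 - \<theta>) + ennreal (\<theta>*exp (- ?l))*ennreal (exp ?l))"
   by (simp add: nn_integral_cmult nn_integral_add emeasure_space_1 elim(1))
  also have "... = ennreal (exp (\<theta>*?l))"
   using \<theta> by (simp add: ennreal_mult[symmetric] ennreal_plus[symmetric] exp_minus del: ennreal_plus)
  finally have "v q*L' q <= v q*(\<theta>*L q)" by (simp add: mult_ac)
  then show ?case using elim(3) by simp
 qed
 then show ?thesis by (intro tendsto_le[OF _ tendsto_mult_left[OF L(1)] L'(1)]) auto
qed

text \<open>Convexity along rays puts \<open>\<Lambda>\<close> above its tangent at 0. For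
  \<open>s\<close> above the mean \<open>D\<close>, only positive \<open>t\<close> can then make
  \<open>t s - \<Lambda> t\<close> positive, and conversely below \<open>D\<close>; this makes the
  Chernoff bounds one-sided.\<close>

lemma tangent_0:
 assumes t: "t : U" and D: "DERIV \<Lambda> 0 :> D" shows "D*t <= \<Lambda> t"
proof -
 have "((%\<theta>. \<Lambda> (\<theta>*t)) has_real_derivative D*t) (at 0)"
  by (rule DERIV_chain2[where f = \<Lambda>]) (use D in \<open>auto intro!: derivative_eq_intros\<close>)
 then have "((%\<theta>. \<Lambda> (\<theta>*t)/\<theta>) ---> D*t) (at 0)"
  by (simp add: has_field_derivative_iff \<Lambda>_0)
 then have lim: "((%\<theta>. \<Lambda> (\<theta>*t)/\<theta>) ---> D*t) (at_right 0)" by (rule filterlim_mono) (auto simp: at_within_le_at)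
 have "\<forall>\<^sub>F \<theta> in at_right 0. \<theta>*t : U"
 proof -
  have "((%\<theta>::real. \<theta>*t) ---> 0*t) (at_right 0)" by (intro tendsto_intros)
  then show ?thesis using topological_tendstoD[OF _ U(1)] U(2) by fastforce
 qed
 moreover have "\<forall>\<^sub>F \<theta>::real in at_right 0. \<theta> < 1 & 0 < \<theta>"
  by (intro eventually_conj eventually_at_right_less eventually_at_rightI[of 0 1]) auto
 ultimately have "\<forall>\<^sub>F \<theta> in at_right 0. \<Lambda> (\<theta>*t)/\<theta> <= \<Lambda> t"
  by eventually_elim (use mgf_convex_0[OF t] in \<open>simp add: divide_le_eq mult.commute\<close>)
 then show ?thesis by (intro tendsto_upperbound[OF lim]) auto
qed

lemma log_upper:
 assumes "\<forall>\<^sub>F q in at_top. p q <= 2*exp (- (v q*\<alpha>))" "!!q. 0 <= p q"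
 shows "Limsup at_top (%q. ereal (1/v q)*ereal_log (p q)) <= ereal (- \<alpha>)"
proof -
 have "\<forall>\<^sub>F q in at_top. ereal (1/v q)*ereal_log (p q) <= ereal (- \<alpha> + ln 2/v q)"
  using assms(1) v_pos
 proof eventually_elim
  case (elim q)
  show ?case
  proof (cases "p q = 0")
   case False
   then have "ln (p q) <= ln 2 - v q*\<alpha>"
    using ln_mono[OF elim(1)] assms(2)[of q] by (simp add: ln_mult)
   then have "ln (p q)/v q <= (ln 2 - v q*\<alpha>)/v q" using elim by (intro divide_right_mono) auto
   then show ?thesis using False elim by (simp add: ereal_log_def diff_divide_distrib)
  qed (use elim in \<open>simp add: ereal_log_def\<close>)
 qed
 then have "Limsup at_top (%q. ereal (1/v q)*ereal_log (p q)) <= Limsup at_top (%q. ereal (- \<alpha> + ln 2/v q))"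
  by (rule Limsup_mono)
 also have "... = ereal (- \<alpha>)"
  by (rule lim_imp_Limsup) (use tendsto_add[OF tendsto_const v_inv[of "ln 2"], of "- \<alpha>"] in auto)
 finally show ?thesis .
qed

lemma log_lower:
 assumes "\<forall>\<^sub>F q in at_top. exp (v q*\<alpha>)/2 <= p q"
 shows "ereal \<alpha> <= Liminf at_top (%q. ereal (1/v q)*ereal_log (p q))"
proof -
 have "ereal \<alpha> = Liminf at_top (%q. ereal (\<alpha> - ln 2/v q))"
  by (rule lim_imp_Liminf[symmetric]) (use tendsto_diff[OF tendsto_const v_inv[of "ln 2"], of \<alpha>] in auto)
 also have "... <= Liminf at_top (%q. ereal (1/v q)*ereal_log (p q))"
 proof (rule Liminf_mono)
  show "\<forall>\<^sub>F q in at_top. ereal (\<alpha> - ln 2/v q) <= ereal (1/v q)*ereal_log (p q)"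
   using assms v_pos
  proof eventually_elim
   case (elim q)
   have p: "0 < p q" using elim(1) exp_gt_zero[of "v q*\<alpha>"] by linarith
   have "v q*\<alpha> - ln 2 <= ln (p q)" using ln_mono[OF elim(1)] by (simp add: ln_div)
   then have "(v q*\<alpha> - ln 2)/v q <= ln (p q)/v q" using elim by (intro divide_right_mono) auto
   then show ?case using p elim by (simp add: ereal_log_def diff_divide_distrib)
  qed
 qed
 finally show ?thesis .
qed

text \<open>\<open>F\<close> is cut at the mean \<open>D\<close>. Each nonempty half has a point
  nearest to \<open>D\<close>, and a good slope at that point has the sign that places the whole
  half in one Chernoff event, so unbounded sets are covered as well.\<close>

theorem upper_bound:
 assumes F: "closed F"
 shows "Limsup at_top (%q. ereal (1/v q)*ereal_log (measure M {w:space M. Y q w : F})) <= - (INF s\<in>F. rate s)"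
proof (rule dense_ge)
 fix z assume "- (INF s\<in>F. rate s) < z"
 \<comment> \<open>A real level is inserted because the infimum of the rate may be infinite.\<close>
 then obtain r where r: "- (INF s\<in>F. rate s) < ereal r" "ereal r < z" using ereal_dense2 by blast
 define \<alpha> where "\<alpha> = - r"
 have "ereal \<alpha> < (INF s\<in>F. rate s)" using r(1) by (simp add: \<alpha>_def ereal_uminus_less_reorder flip: uminus_ereal.simps)
 then have \<alpha>: "ereal \<alpha> < rate s" if "s : F" for s using that by (meson INF_lower less_le_trans)
 have "\<forall>\<^sub>F q in at_top. measure M {w:space M. Y q w : F} <= 2*exp (- (v q*\<alpha>))"
 proof (cases "\<alpha> < 0")
  case True
  show ?thesis using v_pos
  proof eventually_elim
   case (elim q)
   then have "1 <= exp (- (v q*\<alpha>))" using True by (simp add: mult_nonneg_nonpos)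
   then show ?case using prob_le_1[of "{w:space M. Y q w : F}"] by linarith
  qed
 next
  case False
  obtain D where D: "DERIV \<Lambda> 0 :> D" using diff[OF U(2)] by (auto simp: real_differentiable_def)
  have ex: "EX t:U. \<alpha> < t * s - \<Lambda> t & (D <= s --> 0 <= t) & (s <= D --> t <= 0)" if sF: "s : F" for s
  proof -
   obtain t where t: "t : U" "\<alpha> < t * s - \<Lambda> t" using \<alpha>[OF sF] by (auto simp: rate_def less_SUP_iff)
   have "0 < t*(s - D)" using tangent_0[OF t(1) D] t(2) False by (simp add: algebra_simps)
   then show ?thesis using t by (intro bexI[of _ t]) (auto simp: zero_less_mult_iff)
  qed
  have half: "\<forall>\<^sub>F q in at_top. measure M {w:space M. Y q w : F & \<sigma>*D <= \<sigma>*Y q w} <= exp (- (v q*\<alpha>))" if \<sigma>: "\<sigma> = 1 \<or> \<sigma> = -1" for \<sigma> :: real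
  proof (cases "EX s:F. \<sigma>*D <= \<sigma> * s")
   case True
   \<comment> \<open>Multiplication by \<open>\<sigma>\<close> reflects the line, so that both
     halves are treated as the part above \<open>\<sigma> D\<close>.\<close>
   let ?A = "(%s. \<sigma> * s) ` F \<inter> {\<sigma>*D..}"
   have "closed ?A" using F \<sigma> by (intro closed_Int) (auto simp: closed_negations)
   then have "Inf ?A : ?A" using True by (intro closed_contains_Inf) auto
   then obtain x where x: "x : F" "\<sigma>*D <= \<sigma>*x" "!!s. s : F ==> \<sigma>*D <= \<sigma> * s ==> \<sigma>*x <= \<sigma> * s"
    using cInf_lower[OF _ bdd_belowI[of ?A "\<sigma>*D"]] by fastforce
   obtain t where t: "t : U" "\<alpha> < t*x - \<Lambda> t" "0 <= \<sigma>*t" using ex[OF x(1)] x(2) \<sigma> by auto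
   have "\<forall>\<^sub>F q in at_top. measure M {w:space M. t*x <= t*Y q w} <= exp (- (v q*\<alpha>))" by (rule Chernoff[OF t(1,2)])
   then show ?thesis using eventually_gt_at_top[of 0]
   proof eventually_elim
    case (elim q)
    note [measurable] = Y[OF elim(2)]
    have "measure M {w:space M. Y q w : F & \<sigma>*D <= \<sigma>*Y q w} <= measure M {w:space M. t*x <= t*Y q w}"
     using x(3) t(3) \<sigma> by (intro finite_measure_mono) (auto intro: mult_left_mono mult_left_mono_neg)
    then show ?case using elim by linarith
   qed
  next
   case False
   then have emp: "{w:space M. Y q w : F & \<sigma>*D <= \<sigma>*Y q w} = {}" for q by auto
   show ?thesis unfolding emp by simp
  qed
  show ?thesis using half[of 1, simplified] half[of "-1", simplified] eventually_gt_at_top[of 0]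
  proof eventually_elim
   case (elim q)
   note [measurable] = Y[OF elim(3)] borel_closed[OF F]
   have "measure M {w:space M. Y q w : F} <= measure M ({w:space M. Y q w : F & D <= Y q w} \<union> {w:space M. Y q w : F & Y q w <= D})"
    by (intro finite_measure_mono) auto
   also have "... <= measure M {w:space M. Y q w : F & D <= Y q w} + measure M {w:space M. Y q w : F & Y q w <= D}"
    by (intro measure_Un_le) auto
   finally show ?case using elim by linarith
  qed
 qed
 then have "Limsup at_top (%q. ereal (1/v q)*ereal_log (measure M {w:space M. Y q w : F})) <= ereal (- \<alpha>)"
  by (rule log_upper) simp
 also have "... <= z" using r(2) by (simp add: \<alpha>_def)
 finally show "Limsup at_top (%q. ereal (1/v q)*ereal_log (measure M {w:space M. Y q w : F})) <= z" .
qed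

text \<open>Under the measure tilted by \<open>t\<close> the variable concentrates at \<open>\<Lambda>'(t)\<close>.\<close>

lemma tilted_lower_bound:
 assumes t: "t : U" and D: "DERIV \<Lambda> t :> D" and h: "0 < h" and c: "c < \<Lambda> t - t*D - \<bar>t\<bar>*h"
 shows "\<forall>\<^sub>F q in at_top. exp (v q*c)/2 <= measure M {w:space M. \<bar>Y q w - D\<bar> < h}"
proof -
 \<comment> \<open>For small \<open>u\<close> of sign \<open>\<sigma>\<close>,
   \<open>\<Lambda> (t + u) - \<Lambda> t\<close> is within \<open>|u| h\<close> of
   \<open>u D\<close>, hence strictly below \<open>u (D + \<sigma> h)\<close>. The mass beyond
   distance \<open>h\<close> on that side is therefore exponentially smaller than the total tilted
   mass.\<close>
 have side: "EX u. u ~= 0 & 0 <= \<sigma>*u & t + u : U & - \<Lambda> t < u*(D + \<sigma>*h) - \<Lambda> (t + u)" if \<sigma>: "\<sigma> = 1 \<or> \<sigma> = -1" for \<sigma> :: real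
 proof -
  have "((%u. (\<Lambda> (t + u) - \<Lambda> t)/u) ---> D) (at 0)" using D by (simp add: DERIV_def)
  then have "\<forall>\<^sub>F u in at 0. \<bar>(\<Lambda> (t + u) - \<Lambda> t)/u - D\<bar> < h" using tendstoD[OF _ h] by (fastforce simp: dist_real_def)
  then obtain e where e: "e > 0" "!!u. u ~= 0 ==> \<bar>u\<bar> < e ==> \<bar>(\<Lambda> (t + u) - \<Lambda> t)/u - D\<bar> < h"
   unfolding eventually_at by (auto simp: dist_real_def)
  obtain e' where e': "e' > 0" "ball t e' \<subseteq> U" using U(1) t open_contains_ball by blast
  define u where "u = \<sigma>*(min e e'/2)"
  have u: "u ~= 0" "\<bar>u\<bar> < e" "\<bar>u\<bar> < e'" "0 <= \<sigma>*u" "u*\<sigma> = \<bar>u\<bar>" using e e' \<sigma> by (auto simp: u_def)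
  have "\<bar>u\<bar>*\<bar>(\<Lambda> (t + u) - \<Lambda> t)/u - D\<bar> < \<bar>u\<bar>*h" using u e(2) by (intro mult_strict_left_mono) auto
  moreover have "u*((\<Lambda> (t + u) - \<Lambda> t)/u - D) = \<Lambda> (t + u) - \<Lambda> t - u*D"
  proof -
   have "u*((\<Lambda> (t + u) - \<Lambda> t)/u) = \<Lambda> (t + u) - \<Lambda> t" using u(1) by simp
   then show ?thesis by (simp only: right_diff_distrib[of u _ D])
  qed
  ultimately have "\<bar>\<Lambda> (t + u) - \<Lambda> t - u*D\<bar> < \<bar>u\<bar>*h" by (metis abs_mult)
  moreover have "u*(D + \<sigma>*h) = u*D + \<bar>u\<bar>*h" unfolding distrib_left mult.assoc[symmetric] u(5) ..
  moreover have "t + u : U" using e'(2) u(3) by (auto simp: dist_real_def subset_iff)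
  ultimately show ?thesis using u by (intro exI[of _ u]) auto
 qed
 obtain L where L: "(L ---> \<Lambda> t) at_top" "\<forall>\<^sub>F q in at_top. (\<integral>\<^sup>+x. ennreal (exp (v q*(t*Y q x))) \<partial>M) = ennreal (exp (v q*L q))"
  using mgf[OF t] by blast
 have small: "\<forall>\<^sub>F q in at_top. (\<integral>\<^sup>+w. ennreal (exp (v q*(t*Y q w)))*indicator {w. \<sigma>*D + h <= \<sigma>*Y q w} w \<partial>M) <= ennreal (exp (v q*L q)/4)"
  if \<sigma>: "\<sigma> = 1 \<or> \<sigma> = -1" for \<sigma> :: real
 proof -
  obtain u where u: "u ~= 0" "0 <= \<sigma>*u" "t + u : U" "- \<Lambda> t < u*(D + \<sigma>*h) - \<Lambda> (t + u)" using side[OF \<sigma>] by blast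
  obtain b where b: "- \<Lambda> t < b" "b < u*(D + \<sigma>*h) - \<Lambda> (t + u)" using dense[OF u(4)] by blast
  \<comment> \<open>This threshold together with the bound \<open>3\<close> gives
    \<open>v q (L q + b) >= ln 4\<close>: each tail carries at most a quarter of the tilted mass, so
    half of it stays within distance \<open>h\<close> of \<open>D\<close>.\<close>
  have 2: "\<forall>\<^sub>F q in at_top. 2*ln 4/(\<Lambda> t + b) < v q" using v by (simp add: filterlim_at_top_dense)
  have "(\<Lambda> t - b)/2 < \<Lambda> t" using b(1) by (simp add: field_simps)
  then have 3: "\<forall>\<^sub>F q in at_top. (\<Lambda> t - b)/2 < L q" by (rule order_tendstoD(1)[OF L(1)])
  show ?thesis using tail[OF u(3) b(2)] 2 3 v_pos
  proof eventually_elim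
   case (elim q)
   have "u*(D + \<sigma>*h) <= u*Y q w \<longleftrightarrow> \<sigma>*D + h <= \<sigma>*Y q w" for w
    using u(1,2) \<sigma> by auto
   then have "(\<integral>\<^sup>+w. ennreal (exp (v q*(t*Y q w)))*indicator {w. \<sigma>*D + h <= \<sigma>*Y q w} w \<partial>M) <= ennreal (exp (- (v q*b)))"
    using elim(1) by simp
   also have "... <= ennreal (exp (v q*L q)/4)"
   proof (intro ennreal_leI)
    have "ln 4 <= v q*((\<Lambda> t + b)/2)" using elim(2) b(1) by (simp add: divide_less_eq)
    moreover have "v q*((\<Lambda> t - b)/2) <= v q*L q" using elim by (intro mult_left_mono) auto
    ultimately have "- (v q*b) <= v q*L q - ln 4" by (simp add: field_simps)
    then have "exp (- (v q*b)) <= exp (v q*L q - ln 4)" by simp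
    then show "exp (- (v q*b)) <= exp (v q*L q)/4" by (simp add: exp_diff)
   qed
   finally show ?case .
  qed
 qed
 have 4: "\<forall>\<^sub>F q in at_top. c + (t*D + \<bar>t\<bar>*h) < L q" using c by (intro order_tendstoD(1)[OF L(1)]) linarith
 show ?thesis using small[of 1, simplified] small[of "-1", simplified] L(2) 4 v_pos eventually_gt_at_top[of 0]
 proof eventually_elim
  case (elim q)
  note [measurable] = Y[OF elim(6)]
  let ?e = "%w. ennreal (exp (v q*(t*Y q w)))"
  let ?l = "exp (v q*L q)" let ?m = "exp (v q*(t*D + \<bar>t\<bar>*h))"
  let ?B = "{w:space M. \<bar>Y q w - D\<bar> < h}"
  have "ennreal ?l = (\<integral>\<^sup>+w. ?e w \<partial>M)" using elim(3) by simp
  also have "... <= (\<integral>\<^sup>+w. ennreal ?m*indicator ?B w + (?e w*indicator {w. D + h <= Y q w} w + ?e w*indicator {w. h - D <= - Y q w} w) \<partial>M)"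
  proof (rule nn_integral_mono)
   fix w assume w: "w : space M"
   show "?e w <= ennreal ?m*indicator ?B w + (?e w*indicator {w. D + h <= Y q w} w + ?e w*indicator {w. h - D <= - Y q w} w)"
   proof (cases "\<bar>Y q w - D\<bar> < h")
    case True
    have "t*(Y q w - D) <= \<bar>t\<bar>*h" using True abs_ge_self[of "t*(Y q w - D)"] mult_left_mono[of "\<bar>Y q w - D\<bar>" h "\<bar>t\<bar>"] by (simp add: abs_mult)
    then have "v q*(t*Y q w) <= v q*(t*D + \<bar>t\<bar>*h)" using elim(5) by (intro mult_left_mono) (auto simp: algebra_simps)
    then have "?e w <= ennreal ?m" by (intro ennreal_leI) simp
    then show ?thesis using True w by (auto simp: add_increasing2)
   next
    case False
    then have "D + h <= Y q w \<or> h - D <= - Y q w" by linarith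
    then have "?e w <= ?e w*indicator {w. D + h <= Y q w} w + ?e w*indicator {w. h - D <= - Y q w} w"
     by (auto simp: indicator_def)
    then show ?thesis by (rule add_increasing[OF zero_le])
   qed
  qed
  also have "... = ennreal ?m*emeasure M ?B + ((\<integral>\<^sup>+w. ?e w*indicator {w. D + h <= Y q w} w \<partial>M) + (\<integral>\<^sup>+w. ?e w*indicator {w. h - D <= - Y q w} w \<partial>M))"
   by (subst nn_integral_add; (subst nn_integral_add)?; simp add: nn_integral_cmult)
  also have "... <= ennreal ?m*emeasure M ?B + (ennreal (?l/4) + ennreal (?l/4))"
   using elim(1,2) by (intro add_left_mono add_mono) (simp_all add: add.commute)
  also have "... = ennreal (?m*measure M ?B + ?l/2)"
   by (simp add: emeasure_eq_measure ennreal_mult[symmetric] ennreal_plus[symmetric] del: ennreal_plus)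
  finally have "?l <= ?m*measure M ?B + ?l/2" by (subst (asm) ennreal_le_iff) auto
  then have "?l/2 <= ?m*measure M ?B" by linarith
  moreover have "?m*exp (v q*c) <= ?l"
   using elim(4,5) mult_left_mono[of "c + (t*D + \<bar>t\<bar>*h)" "L q" "v q"] by (simp add: exp_add[symmetric] algebra_simps)
  ultimately have "?m*(exp (v q*c)/2) <= ?m*measure M ?B" by linarith
  then show ?case by simp
 qed
qed

text \<open>Maximising \<open>ts - \<Lambda>(t) - ht\<^sup>2/2\<close> gives exposed points \<open>\<Lambda>'(t)\<close> near \<open>s\<close> with no larger rate.\<close>

lemma exposed_point:
 assumes I: "rate s = ereal r" and e: "0 < e"
 shows "EX t:U. EX D. DERIV \<Lambda> t :> D & \<bar>D - s\<bar> < e & t*D - \<Lambda> t <= r"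
proof -
 have r: "t * s - \<Lambda> t <= r" if "t : U" for t
  using SUP_upper[of t U "%t. ereal (t * s - \<Lambda> t)"] that I by (simp add: rate_def)
 have r0: "0 <= r" using r[OF U(2)] by (simp add: \<Lambda>_0)
 \<comment> \<open>A maximizer \<open>t\<close> will satisfy \<open>D = s - h t\<close> and
   \<open>h t^2 <= 2 r\<close>, so that \<open>|D - s|^2 <= 2 r h\<close>, which this choice keeps
   below \<open>(e/2)^2\<close>.\<close>
 define h where "h = (e/2)^2/(2*(r + 1))"
 have h: "h > 0" using e r0 by (simp add: h_def)
 define \<phi> where "\<phi> = (%t. t * s - \<Lambda> t - h/2*t^2)"
 \<comment> \<open>Contains 0 and every \<open>u\<close> in \<open>U\<close> with
   \<open>\<phi> u > 0\<close>: for these \<open>h/2 u^2 <= r\<close>, and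
   \<open>\<Lambda> u\<close> is at most \<open>u s - h/2 u^2\<close>, whose maximum over
   \<open>u\<close> is \<open>s^2/(2 h)\<close>. Although \<open>U\<close> is open,
   \<open>steep\<close> makes this set closed.\<close>
 define K where "K = {t:U. \<Lambda> t <= s^2/(2*h)} \<inter> {t. h/2*t^2 <= r}"
 have "bounded {t. h/2*t^2 <= r}"
 proof -
  have "\<bar>t\<bar> <= sqrt (2*r/h)" if "h/2*t^2 <= r" for t
   using that h real_sqrt_le_mono[of "t^2" "2*r/h"] by (simp add: field_simps)
  then show ?thesis by (auto simp: bounded_iff)
 qed
 moreover have "closed K" unfolding K_def by (intro closed_Int steep closed_Collect_le continuous_intros)
 moreover have "K \<subseteq> {t. h/2*t^2 <= r}" by (simp add: K_def)
 ultimately have "compact K" using bounded_subset by (simp add: compact_eq_bounded_closed)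
 moreover have "0 : K" using U(2) r0 h by (simp add: K_def \<Lambda>_0)
 moreover have "continuous_on K \<phi>" unfolding \<phi>_def
 proof (intro continuous_intros continuous_at_imp_continuous_on ballI)
  show "isCont \<Lambda> t" if "t : K" for t
   using diff[of t] that by (auto simp: K_def real_differentiable_def intro: DERIV_isCont)
 qed
 ultimately obtain t where t: "t : K" "!!u. u : K ==> \<phi> u <= \<phi> t" using continuous_attains_sup[of K \<phi>] by blast
 have tU: "t : U" using t(1) by (simp add: K_def)
 have p0: "0 <= \<phi> t" using t(2)[OF \<open>0 : K\<close>] by (simp add: \<phi>_def \<Lambda>_0)
 have max: "\<phi> u <= \<phi> t" if "u : U" for u
 proof (cases "u : K")
  case False
  have "\<phi> u <= 0"
  proof (rule ccontr)
   assume "\<not> \<phi> u <= 0"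
   then have "h/2*u^2 <= r" "\<Lambda> u <= u * s - h/2*u^2" using r[OF that] by (auto simp: \<phi>_def)
   moreover have "u * s - h/2*u^2 = s^2/(2*h) - h/2*(u - s/h)^2"
    using h by (simp add: power2_eq_square field_simps)
   moreover have "0 <= h/2*(u - s/h)^2" using h by simp
   ultimately show False using False that by (simp add: K_def)
  qed
  then show ?thesis using p0 by linarith
 qed (rule t(2))
 obtain D where D: "DERIV \<Lambda> t :> D" using diff[OF tU] by (auto simp: real_differentiable_def)
 obtain d where d: "d > 0" "ball t d \<subseteq> U" using U(1) tU open_contains_ball by blast
 have "DERIV \<phi> t :> s - D - h*t" unfolding \<phi>_def by (auto intro!: derivative_eq_intros D)
 then have "s - D - h*t = 0"
  by (rule DERIV_local_max[OF _ d(1)]) (use max d(2) in \<open>auto simp: dist_real_def subset_iff\<close>)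
 then have Ds: "D = s - h*t" by simp
 have "h/2*t^2 <= r" using t(1) by (simp add: K_def)
 then have "h*(h*t^2) <= h*(2*(r + 1))" using h by (intro mult_left_mono) auto
 then have "(h*t)^2 <= h*(2*(r + 1))" by (simp add: power2_eq_square mult.assoc mult.left_commute[of t])
 also have "... = (e/2)^2" using r0 by (simp add: h_def)
 finally have "\<bar>h*t\<bar> <= e/2" using e by (simp add: abs_le_square_iff[symmetric])
 then have "\<bar>D - s\<bar> < e" using e Ds by simp
 moreover have "t*D - \<Lambda> t <= r"
  using r[OF tU] h unfolding Ds by (simp add: right_diff_distrib mult.left_commute[of t] power2_eq_square) (smt (verit) mult_nonneg_nonneg zero_le_square)
 ultimately show ?thesis using tU D by blast
qed

text \<open>Every point of finite rate is approximated by values \<open>D\<close> of the derivative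
  with no larger rate, to which the tilted bound applies; undoing the tilt costs at most
  \<open>|t| h\<close>, which is made smaller than \<open>\<epsilon>\<close>.\<close>

theorem lower_bound:
 assumes G: "open G"
 shows "- (INF s\<in>G. rate s) <= Liminf at_top (%q. ereal (1/v q)*ereal_log (measure M {w:space M. Y q w : G}))" (is "_ <= ?L")
proof -
 have "- ?L <= rate s" if s: "s : G" for s
 proof (cases "rate s")
  case (real r)
  obtain e where e: "e > 0" "ball s e \<subseteq> G" using G s open_contains_ball by blast
  obtain t D where t: "t : U" "DERIV \<Lambda> t :> D" "\<bar>D - s\<bar> < e" "t*D - \<Lambda> t <= r" using exposed_point[OF real e(1)] by blast
  have "ereal (- r - \<epsilon>) <= ?L" if \<epsilon>: "\<epsilon> > 0" for \<epsilon>
  proof (rule log_lower)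
   define h where "h = min (e - \<bar>D - s\<bar>) (\<epsilon>/(2*(\<bar>t\<bar> + 1)))"
   have h: "h > 0" using t(3) \<epsilon> by (simp add: h_def)
   have "\<bar>t\<bar>*h <= \<bar>t\<bar>*(\<epsilon>/(2*(\<bar>t\<bar> + 1)))" by (intro mult_left_mono) (auto simp: h_def)
   also have "... < \<epsilon>" using \<epsilon> by (simp add: field_simps) (smt (verit) mult_nonneg_nonneg abs_ge_zero)
   finally have "- r - \<epsilon> < \<Lambda> t - t*D - \<bar>t\<bar>*h" using t(4) by linarith
   from tilted_lower_bound[OF t(1,2) h this] eventually_gt_at_top[of 0]
   show "\<forall>\<^sub>F q in at_top. exp (v q*(- r - \<epsilon>))/2 <= measure M {w:space M. Y q w : G}"
   proof eventually_elim
    case (elim q)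
    note [measurable] = Y[OF elim(2)] borel_open[OF G]
    have "y : G" if "\<bar>y - D\<bar> < h" for y
     using e(2) that by (auto simp: dist_real_def subset_iff h_def)
    then have "measure M {w:space M. \<bar>Y q w - D\<bar> < h} <= measure M {w:space M. Y q w : G}"
     by (intro finite_measure_mono) auto
    then show ?case using elim by linarith
   qed
  qed
  note low = this
  have "ereal (- r) <= ?L"
  proof (rule ereal_le_epsilon2)
   fix \<epsilon> :: real assume "0 < \<epsilon>"
   from add_right_mono[OF low[OF this], of "ereal \<epsilon>"] show "ereal (- r) <= ?L + ereal \<epsilon>" by simp
  qed
  then have "- ?L <= - ereal (- r)" by (simp only: ereal_minus_le_minus)
  then show ?thesis unfolding real by simp
 next
  case PInf then show ?thesis by simp
 next
  case MInf
  then show ?thesis using SUP_upper[OF U(2), of "%t. ereal (t * s - \<Lambda> t)"] by (simp add: rate_def)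
 qed
 then have "- ?L <= (INF s\<in>G. rate s)" by (rule INF_greatest)
 then have "- (INF s\<in>G. rate s) <= - (- ?L)" by (simp only: ereal_minus_le_minus)
 then show ?thesis by (simp only: ereal_uminus_uminus)
qed

lemma convex_rate: "convex_ereal rate"
 unfolding convex_ereal_def
proof (intro allI ballI)
 fix x y t :: real assume t: "t : {0..1}"
 show "rate ((1 - t)*x + t*y) <= ereal (1 - t)*rate x + ereal t*rate y"
  unfolding rate_def[of "(1 - t)*x + t*y"]
 proof (rule SUP_least)
  fix u assume u: "u : U"
  have "ereal (u*((1 - t)*x + t*y) - \<Lambda> u) = ereal (1 - t)*ereal (u*x - \<Lambda> u) + ereal t*ereal (u*y - \<Lambda> u)"
   by (simp add: algebra_simps)
  also have "... <= ereal (1 - t)*rate x + ereal t*rate y"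
   using t u by (intro add_mono ereal_mult_left_mono) (auto simp: rate_def intro: SUP_upper)
  finally show "ereal (u*((1 - t)*x + t*y) - \<Lambda> u) <= ereal (1 - t)*rate x + ereal t*rate y" .
 qed
qed

text \<open>Sublevel sets are bounded because \<open>U\<close>, a neighbourhood of 0, contains
  slopes of both signs; they are closed as intersections of closed half-lines or the whole
  line.\<close>

lemma good_rate: "good_rate_function rate"
 unfolding good_rate_function_def
proof (intro conjI allI impI)
 show "0 <= rate s" for s
  using SUP_upper[OF U(2), of "%t. ereal (t * s - \<Lambda> t)"] by (simp add: rate_def \<Lambda>_0 zero_ereal_def)
 fix a :: real
 have eq: "{s. rate s <= ereal a} = (\<Inter>t\<in>U. {s. t * s - \<Lambda> t <= a})" by (auto simp: rate_def SUP_le_iff)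
 obtain d where d: "d > 0" "ball 0 d \<subseteq> U" using U(1,2) open_contains_ball by blast
 then have dU: "d/2 : U" "- (d/2) : U" by auto
 have "\<bar>s\<bar> <= (\<bar>a\<bar> + \<bar>\<Lambda> (d/2)\<bar> + \<bar>\<Lambda> (- (d/2))\<bar>)/(d/2)" if "s : {s. rate s <= ereal a}" for s
 proof -
  have "d/2 * s - \<Lambda> (d/2) <= a" "- (d/2) * s - \<Lambda> (- (d/2)) <= a" using that dU unfolding eq by auto
  then have "d/2*\<bar>s\<bar> <= \<bar>a\<bar> + \<bar>\<Lambda> (d/2)\<bar> + \<bar>\<Lambda> (- (d/2))\<bar>" by (cases "s >= 0") auto
  then show ?thesis using d by (simp add: field_simps)
 qed
 then have "bounded {s. rate s <= ereal a}" by (auto simp: bounded_iff)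
 moreover have "closed {s. rate s <= ereal a}" unfolding eq by (intro closed_INT ballI closed_Collect_le continuous_intros)
 ultimately show "compact {s. rate s <= ereal a}" by (simp add: compact_eq_bounded_closed)
qed

end

section \<open>Large deviations of the boson field\<close>

lemma exp_sandwich:
 fixes x :: real assumes "\<bar>x\<bar> <= \<delta>" "\<delta> <= 1"
 shows "1 + x <= exp x" "exp x <= 1 + (x + \<delta>*\<bar>x\<bar>)"
proof -
 show "1 + x <= exp x" by (rule exp_ge_add_one_self)
 have "x^2 <= \<delta>*\<bar>x\<bar>" using mult_right_mono[OF assms(1) abs_ge_zero[of x]] by (simp add: power2_eq_square)
 moreover have "exp x <= 1 + x + x^2"
 proof (cases "0 <= x")
  case True then show ?thesis using exp_bound[of x] assms by simp
 next
  case False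
  have "x*x^2 <= 0" using False by (intro mult_nonpos_nonneg) auto
  then have "1 <= (1 + x + x^2)*(1 - x)" by (simp add: power2_eq_square algebra_simps)
  also have "... <= (1 + x + x^2)*exp (- x)"
   using exp_ge_add_one_self[of "- x"] zero_le_power2[of "x + 1/2"]
   by (intro mult_left_mono) (simp_all add: power2_eq_square algebra_simps)
  finally show ?thesis by (simp add: exp_minus field_simps)
 qed
 ultimately show "exp x <= 1 + (x + \<delta>*\<bar>x\<bar>)" by linarith
qed

context dilated_weight
begin

text \<open>The first summand is the condensate, the second the trace of the determinant. As
  \<open>lim.rv 0\<close> is the integral of \<open>f\<close>, the slope at 0 is
  \<open>\<rho>\<close> times that integral, the mean expected at density
  \<open>\<rho>\<close>.\<close>

definition Lam :: "real => real => real" where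
 "Lam \<rho> w = (\<rho> - critical_density TYPE('a) \<beta>)*w*lim.rv w + w*(bose_kernel \<beta> (0::'a)*(LBINT x. f x))"

lemma Lam_differentiable: "w : lim.dom ==> Lam \<rho> differentiable (at w)"
 unfolding Lam_def[abs_def] using lim.rv_differentiable by (intro derivative_intros) auto

text \<open>For \<open>w > 0\<close> the trace term is nonnegative, so a bound on \<open>Lam\<close>
  bounds \<open>lim.rv\<close> near a positive limit point, and \<open>rv_blow_up\<close> applies.
  Dividing by the condensate factor is where \<open>\<rho>\<close> above the critical density
  enters.\<close>

lemma Lam_steep:
 assumes \<rho>: "\<rho> > critical_density TYPE('a) \<beta>" shows "closed {w:lim.dom. Lam \<rho> w <= B}"
 unfolding closed_sequential_limits
proof (intro allI impI, elim conjE)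
 fix t l assume t: "ALL n. t n : {w:lim.dom. Lam \<rho> w <= B}" "t ----> l"
 let ?a = "\<rho> - critical_density TYPE('a) \<beta>" and ?c = "bose_kernel \<beta> (0::'a)*(LBINT x. f x)"
 have c: "0 <= ?c" using bose_kernel_nonneg[OF \<beta> d, of 0] test_functions_nonneg[OF f_test] by simp
 have "l : lim.dom"
 proof (cases "l <= 0")
  case True then show ?thesis using lim.zero_in_dom lim.dom_down by blast
 next
  case False
  then have "\<forall>\<^sub>F n in sequentially. l/2 < t n" using order_tendstoD(1)[OF t(2), of "l/2"] by simp
  then obtain N where N: "!!n. n >= N ==> l/2 < t n" by (auto simp: eventually_sequentially)
  have "lim.rv (t (n + N)) <= \<bar>B\<bar>/(?a*(l/2))" for n
  proof (cases "lim.rv (t (n + N)) <= 0")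
   case True
   then show ?thesis using False \<rho> by (elim order_trans) simp
  next
   case rv: False
   have tn: "l/2 < t (n + N)" by (rule N) simp
   have "?a*(l/2)*lim.rv (t (n + N)) <= ?a*t (n + N)*lim.rv (t (n + N))"
    using tn \<rho> rv by (intro mult_right_mono mult_left_mono) auto
   also have "... <= Lam \<rho> (t (n + N))" using c tn False by (simp add: Lam_def)
   also have "Lam \<rho> (t (n + N)) <= B" using t(1) by blast
   also have "B <= \<bar>B\<bar>" by (rule abs_ge_self)
   finally show ?thesis using False \<rho> by (simp add: pos_le_divide_eq mult.commute)
  qed
  from lim.rv_blow_up[OF _ LIMSEQ_ignore_initial_segment[OF t(2)] this] show ?thesis using t(1) by simp
 qed
 moreover have "Lam \<rho> l <= B"
 proof (rule LIMSEQ_le_const2)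
  have "isCont (Lam \<rho>) l" using Lam_differentiable[OF calculation] by (auto simp: real_differentiable_def intro: DERIV_isCont)
  then show "(%n. Lam \<rho> (t n)) ----> Lam \<rho> l" by (rule isCont_tendsto_compose[OF _ t(2)])
 qed (use t(1) in auto)
 ultimately show "l : {w:lim.dom. Lam \<rho> w <= B}" by simp
qed

text \<open>For large \<open>q\<close> the function \<open>t h\<close> with
  \<open>h = dilated q\<close> is at most \<open>\<delta>\<close> in absolute value, and then
  \<open>ln (1 + t h) <= t h <= ln (1 + (t + \<delta> |t|) h)\<close>. The exponential moment lies
  between two expectations of \<open>point_exp\<close>, and continuity of \<open>Lam\<close> closes
  the gap as \<open>\<delta>\<close> tends to 0.\<close>

lemma linear_mgf:
 fixes \<nu> :: "'a measure measure"
 assumes \<nu>: "boson_point_field \<beta> \<rho> \<nu>" and t: "t : lim.dom"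
 shows "EX L. (L ---> Lam \<rho> t) at_top &
  (\<forall>\<^sub>F q in at_top. (\<integral>\<^sup>+\<xi>. ennreal (exp (t*(\<integral>x. dilated q x \<partial>\<xi>))) \<partial>\<nu>) = ennreal (exp (q^(DIM('a) - 2)*L q)))"
proof -
 obtain R' H where H: "H > 0" "!!x. f x <= H" using f_test by (rule test_functionsE) blast
 have \<nu>s: "sets \<nu> = sets point_measure_borel" using \<nu> by (simp add: boson_point_field_def)
 have sp: "space \<nu> = point_measures" using sets_eq_imp_space_eq[OF \<nu>s] by (simp add: space_point_measure_borel)
 define E where "E q = (\<integral>\<^sup>+\<xi>. ennreal (exp (t*(\<integral>x. dilated q x \<partial>\<xi>))) \<partial>\<nu>)" for q
 define L where "L q = ln (enn2real (E q))/q^(DIM('a) - 2)" for q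
 have sandwich: "\<forall>\<^sub>F q in at_top. (\<integral>\<^sup>+\<xi>. ennreal (point_exp (dilated q) t \<xi>) \<partial>\<nu>) <= E q
  & E q <= (\<integral>\<^sup>+\<xi>. ennreal (point_exp (dilated q) (t + \<delta>*\<bar>t\<bar>) \<xi>) \<partial>\<nu>)" if \<delta>: "0 < \<delta>" "\<delta> < 1" for \<delta>
 proof -
  have "((%q. \<bar>t\<bar>*(H/q^2)) ---> \<bar>t\<bar>*0) at_top"
   by (intro tendsto_intros tendsto_divide_0[OF tendsto_const] filterlim_mono[OF filterlim_pow_at_top at_top_le_at_infinity order_refl] filterlim_ident) simp
  then have "\<forall>\<^sub>F q in at_top. \<bar>t\<bar>*(H/q^2) < \<delta>" using \<delta> by (intro order_tendstoD(2)) auto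
  then show ?thesis using eventually_gt_at_top[of 0]
  proof eventually_elim
   case (elim q)
   note h = dilated_test(1)[OF elim(2)]
   have h0: "0 <= dilated q x" for x by (rule test_functions_nonneg[OF h])
   have small: "\<bar>t*dilated q x\<bar> <= \<delta>" for x
   proof -
    have "\<bar>t\<bar>*dilated q x <= \<bar>t\<bar>*(H/q^2)" using H(2) by (intro mult_left_mono) (auto simp: dilated_def divide_right_mono)
    then show ?thesis using elim(1) h0[of x] by (simp add: abs_mult)
   qed
   have lo: "0 < 1 + t*dilated q x" for x using small[of x] \<delta> by (simp add: abs_le_iff)
   have ln_le: "ln (1 + t*dilated q x) <= t*dilated q x" for x using ln_add_one_self_le_self2[of "t*dilated q x"] lo[of x] by simp
   have le_ln: "t*dilated q x <= ln (1 + (t + \<delta>*\<bar>t\<bar>)*dilated q x)" for x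
    using ln_mono[OF exp_sandwich(2)[OF small[of x]] exp_gt_zero] \<delta> h0[of x] by (simp add: abs_mult distrib_right mult.assoc)
   obtain R'' H'' where h_bd: "!!x. dilated q x <= H''" "!!x. norm x > R'' ==> dilated q x = 0" using h by (rule test_functionsE) blast
   have int: "integrable \<xi> (%x. g (dilated q x))" if "\<xi> : point_measures" "g : BM" "g 0 = 0" "!!x. \<bar>g (dilated q x)\<bar> <= C" for \<xi> and g :: "real => real" and C
    by (rule point_measure_integrable[OF that(1) _ that(4), where R = R'']) (use that h_bd(2) test_functions_measurable[OF h] in auto)
   have int1: "integrable \<xi> (%x. t*dilated q x)" if "\<xi> : point_measures" for \<xi>
    by (rule int[OF that, of "%y. t*y" \<delta>]) (use small in auto)
   have int2: "integrable \<xi> (%x. ln (1 + t*dilated q x))" if "\<xi> : point_measures" for \<xi>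
   proof (rule int[OF that, of "%y. ln (1 + t*y)" "max \<delta> (- ln (1 - \<delta>))"])
    fix x
    have "ln (1 - \<delta>) <= ln (1 + t*dilated q x)" using small[of x] \<delta> by (intro ln_mono) (auto simp: abs_le_iff)
    then show "\<bar>ln (1 + t*dilated q x)\<bar> <= max \<delta> (- ln (1 - \<delta>))" using ln_le[of x] small[of x] by (auto simp: abs_le_iff le_max_iff_disj)
   qed auto
   have int3: "integrable \<xi> (%x. ln (1 + (t + \<delta>*\<bar>t\<bar>)*dilated q x))" if "\<xi> : point_measures" for \<xi>
   proof (rule int[OF that, of "%y. ln (1 + (t + \<delta>*\<bar>t\<bar>)*y)" 2])
    fix x
    have "t*dilated q x <= \<delta>" "- \<delta> <= t*dilated q x"
     using abs_le_D1[OF small[of x]] abs_le_D2[OF small[of x]] by linarith+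
    moreover have "\<delta>*\<bar>t\<bar>*dilated q x <= \<delta>"
     using small[of x] \<delta> h0[of x] mult_left_mono[of "\<bar>t\<bar>*dilated q x" \<delta> \<delta>] mult_left_le[of \<delta> \<delta>] by (auto simp: abs_mult mult.assoc abs_le_iff)
    moreover have "ln (1 + (t + \<delta>*\<bar>t\<bar>)*dilated q x) <= (t + \<delta>*\<bar>t\<bar>)*dilated q x"
    proof (rule ln_add_one_self_le_self2)
     have "0 <= \<delta>*\<bar>t\<bar>*dilated q x" using \<delta> h0[of x] by simp
     then show "- 1 < (t + \<delta>*\<bar>t\<bar>)*dilated q x" using lo[of x] unfolding distrib_right by linarith
    qed
    ultimately show "\<bar>ln (1 + (t + \<delta>*\<bar>t\<bar>)*dilated q x)\<bar> <= 2"
     using le_ln[of x] \<delta> unfolding abs_le_iff distrib_right by linarith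
   qed auto
   show ?case unfolding E_def point_exp_def
   proof (intro conjI nn_integral_mono ennreal_leI)
    fix \<xi> assume "\<xi> : space \<nu>"
    then have \<xi>: "\<xi> : point_measures" using sp by simp
    have "(\<integral>x. ln (1 + t*dilated q x) \<partial>\<xi>) <= (\<integral>x. t*dilated q x \<partial>\<xi>)" by (intro integral_mono int1 int2 \<xi> ln_le)
    then show "exp (\<integral>x. ln (1 + t*dilated q x) \<partial>\<xi>) <= exp (t*(\<integral>x. dilated q x \<partial>\<xi>))" by simp
    have "(\<integral>x. t*dilated q x \<partial>\<xi>) <= (\<integral>x. ln (1 + (t + \<delta>*\<bar>t\<bar>)*dilated q x) \<partial>\<xi>)" by (intro integral_mono int1 int3 \<xi> le_ln)
    then show "exp (t*(\<integral>x. dilated q x \<partial>\<xi>)) <= exp (\<integral>x. ln (1 + (t + \<delta>*\<bar>t\<bar>)*dilated q x) \<partial>\<xi>)" by simp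
   qed
  qed
 qed
 obtain L1 where L1: "(L1 ---> Lam \<rho> t) at_top"
  "\<forall>\<^sub>F q in at_top. (\<integral>\<^sup>+\<xi>. ennreal (point_exp (dilated q) t \<xi>) \<partial>\<nu>) = ennreal (exp (q^(DIM('a) - 2)*L1 q))"
  using point_exp_limit[OF \<nu> t] unfolding Lam_def by blast
 have cont: "((%\<delta>. Lam \<rho> (t + \<delta>*\<bar>t\<bar>)) ---> Lam \<rho> t) (at_right 0)"
 proof (rule isCont_tendsto_compose[of t "Lam \<rho>"])
  show "isCont (Lam \<rho>) t" using Lam_differentiable[OF t] by (auto simp: real_differentiable_def intro: DERIV_isCont)
  have "((%\<delta>. t + \<delta>*\<bar>t\<bar>) ---> t + 0*\<bar>t\<bar>) (at_right 0)" by (intro tendsto_intros)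
  then show "((%\<delta>. t + \<delta>*\<bar>t\<bar>) ---> t) (at_right 0)" by simp
 qed
 have dom: "\<forall>\<^sub>F \<delta> in at_right 0. t + \<delta>*\<bar>t\<bar> : lim.dom"
 proof -
  have "((%\<delta>. t + \<delta>*\<bar>t\<bar>) ---> t + 0*\<bar>t\<bar>) (at_right 0)" by (intro tendsto_intros)
  then show ?thesis using topological_tendstoD[OF _ lim.dom_open] t by fastforce
 qed
 have main: "\<forall>\<^sub>F q in at_top. E q = ennreal (exp (q^(DIM('a) - 2)*L q)) & L1 q <= L q & L q < Lam \<rho> t + e" if e: "e > 0" for e
 proof -
  have "\<forall>\<^sub>F \<delta> in at_right 0. Lam \<rho> (t + \<delta>*\<bar>t\<bar>) < Lam \<rho> t + e & t + \<delta>*\<bar>t\<bar> : lim.dom & \<delta> < 1 & 0 < \<delta>"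
   using e by (intro eventually_conj order_tendstoD(2)[OF cont] dom eventually_at_right_less eventually_at_rightI[of 0 1]) auto
  from eventually_happens[OF this] obtain \<delta> where \<delta>: "Lam \<rho> (t + \<delta>*\<bar>t\<bar>) < Lam \<rho> t + e" "t + \<delta>*\<bar>t\<bar> : lim.dom" "0 < \<delta>" "\<delta> < 1" by auto
  obtain L2 where L2: "(L2 ---> Lam \<rho> (t + \<delta>*\<bar>t\<bar>)) at_top"
   "\<forall>\<^sub>F q in at_top. (\<integral>\<^sup>+\<xi>. ennreal (point_exp (dilated q) (t + \<delta>*\<bar>t\<bar>) \<xi>) \<partial>\<nu>) = ennreal (exp (q^(DIM('a) - 2)*L2 q))"
   using point_exp_limit[OF \<nu> \<delta>(2)] unfolding Lam_def by blast
  show ?thesis using sandwich[OF \<delta>(3,4)] L1(2) L2(2) order_tendstoD(2)[OF L2(1) \<delta>(1)] eventually_gt_at_top[of 0]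
  proof eventually_elim
   case (elim q)
   let ?p = "q^(DIM('a) - 2)"
   have p: "?p > 0" using elim(5) by simp
   have 1: "ennreal (exp (?p*L1 q)) <= E q" "E q <= ennreal (exp (?p*L2 q))" using elim by auto
   then obtain x where x: "E q = ennreal x" "0 <= x" by (cases "E q") (auto simp: top_unique)
   have 2: "exp (?p*L1 q) <= x" "x <= exp (?p*L2 q)" using 1 x by auto
   have x0: "0 < x" using 2(1) exp_gt_zero[of "?p*L1 q"] by linarith
   have 3: "?p*L q = ln x" using x elim(5) by (simp add: L_def)
   have "?p*L1 q <= ?p*L q" "?p*L q <= ?p*L2 q"
    unfolding 3 using 2 x0 ln_mono[OF 2(2) x0] by (auto simp: ln_ge_iff)
   then have "L1 q <= L q" "L q <= L2 q" using p by auto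
   moreover have "E q = ennreal (exp (?p*L q))" unfolding 3 x(1) using x0 by simp
   ultimately show ?case using elim(4) by linarith
  qed
 qed
 have main1: "\<forall>\<^sub>F q in at_top. E q = ennreal (exp (q^(DIM('a) - 2)*L q)) & L1 q <= L q"
  by (rule eventually_mono[OF main[of 1]]) auto
 have "(L ---> Lam \<rho> t) at_top"
 proof (rule order_tendstoI)
  fix a assume "a < Lam \<rho> t"
  then have "\<forall>\<^sub>F q in at_top. a < L1 q" by (rule order_tendstoD(1)[OF L1(1)])
  then show "\<forall>\<^sub>F q in at_top. a < L q" using main1 by eventually_elim linarith
 next
  fix a assume "Lam \<rho> t < a"
  then have "0 < a - Lam \<rho> t" by simp
  from main[OF this] show "\<forall>\<^sub>F q in at_top. L q < a" by eventually_elim linarith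
 qed
 moreover have "\<forall>\<^sub>F q in at_top. E q = ennreal (exp (q^(DIM('a) - 2)*L q))" using main1 by eventually_elim blast
 ultimately show ?thesis unfolding E_def by blast
qed

theorem large_deviations:
 fixes \<nu> :: "'a measure measure"
 assumes \<nu>: "boson_point_field \<beta> \<rho> \<nu>" and \<rho>: "\<rho> > critical_density TYPE('a) \<beta>"
 shows "large_deviation_mgf \<nu> (%q \<xi>. 1/q^DIM('a)*(\<integral>x. f (x /\<^sub>R q) \<partial>\<xi>)) (%q. q^(DIM('a) - 2)) (Lam \<rho>) lim.dom"
proof (intro large_deviation_mgf.intro large_deviation_mgf_axioms.intro)
 have \<nu>s: "sets \<nu> = sets point_measure_borel" using \<nu> by (simp add: boson_point_field_def)
 show "prob_space \<nu>" using \<nu> by (simp add: boson_point_field_def)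
 have scale: "q^(DIM('a) - 2)*(t*(1/q^DIM('a)*(\<integral>x. f (x /\<^sub>R q) \<partial>\<xi>))) = t*(\<integral>x. dilated q x \<partial>\<xi>)" if "q > 0" for q t \<xi>
  using that by (simp add: dilated_def[abs_def] power_dim)
 show "(%\<xi>. 1/q^DIM('a)*(\<integral>x. f (x /\<^sub>R q) \<partial>\<xi>)) : borel_measurable \<nu>" if q: "0 < q" for q
 proof -
  have "(%\<xi>. 1*(\<integral>x. dilated q x \<partial>\<xi>)) : borel_measurable point_measure_borel"
   using integral_test_function_measurable[OF dilated_test(1)[OF q]] by simp
  then have "(%\<xi>. (\<integral>x. dilated q x \<partial>\<xi>)/q^(DIM('a) - 2)) : borel_measurable point_measure_borel" by simp
  then have "(%\<xi>. 1/q^DIM('a)*(\<integral>x. f (x /\<^sub>R q) \<partial>\<xi>)) : borel_measurable point_measure_borel"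
   using q by (simp add: dilated_def[abs_def] power_dim[OF q] mult_ac)
  then show ?thesis by (subst measurable_cong_sets[OF \<nu>s refl])
 qed
 show "filterlim (%q. q^(DIM('a) - 2) :: real) at_top at_top" using d by (intro filterlim_pow_at_top filterlim_ident) simp
 show "EX L. (L ---> Lam \<rho> t) at_top & (\<forall>\<^sub>F q in at_top. (\<integral>\<^sup>+\<xi>. ennreal (exp (q^(DIM('a) - 2)*(t*(1/q^DIM('a)*(\<integral>x. f (x /\<^sub>R q) \<partial>\<xi>))))) \<partial>\<nu>) = ennreal (exp (q^(DIM('a) - 2)*L q)))"
  if t: "t : lim.dom" for t
 proof -
  obtain L where L: "(L ---> Lam \<rho> t) at_top"
   "\<forall>\<^sub>F q in at_top. (\<integral>\<^sup>+\<xi>. ennreal (exp (t*(\<integral>x. dilated q x \<partial>\<xi>))) \<partial>\<nu>) = ennreal (exp (q^(DIM('a) - 2)*L q))"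
   using linear_mgf[OF \<nu> t] by blast
  have "\<forall>\<^sub>F q in at_top. (\<integral>\<^sup>+\<xi>. ennreal (exp (q^(DIM('a) - 2)*(t*(1/q^DIM('a)*(\<integral>x. f (x /\<^sub>R q) \<partial>\<xi>))))) \<partial>\<nu>) = ennreal (exp (q^(DIM('a) - 2)*L q))"
   using L(2) eventually_gt_at_top[of 0] by eventually_elim (simp only: scale)
  then show ?thesis using L(1) by blast
 qed
qed (auto intro: lim.dom_open lim.zero_in_dom lim.dom_down Lam_differentiable Lam_steep[OF \<rho>])

end

theorem theorem1p3:
 fixes \<beta> \<rho> :: real
  and \<nu> :: "(real ^ 'd) measure measure"
  and f :: "real ^ 'd \<Rightarrow> real"
 assumes "CARD('d) > 2"
  and "\<beta> > 0"
  and "\<rho> > critical_density TYPE(real ^ 'd) \<beta>"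
  and "boson_point_field \<beta> \<rho> \<nu>"
  and "f \<in> test_functions"
 shows "\<exists>I :: real \<Rightarrow> ereal. convex_ereal I \<and> good_rate_function I \<and>
  (\<forall>F. closed F \<longrightarrow>
   Limsup at_top (\<lambda>\<kappa>::real. ereal (1 / \<kappa> ^ (CARD('d) - 2)) *
    ereal_log (measure \<nu> {\<xi> \<in> space \<nu>. 1 / \<kappa> ^ CARD('d) * (\<integral>x. f (x /\<^sub>R \<kappa>) \<partial>\<xi>) \<in> F}))
   \<le> - (INF s\<in>F. I s)) \<and>
  (\<forall>G. open G \<longrightarrow>
   Liminf at_top (\<lambda>\<kappa>::real. ereal (1 / \<kappa> ^ (CARD('d) - 2)) *
    ereal_log (measure \<nu> {\<xi> \<in> space \<nu>. 1 / \<kappa> ^ CARD('d) * (\<integral>x. f (x /\<^sub>R \<kappa>) \<partial>\<xi>) \<in> G}))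
   \<ge> - (INF s\<in>G. I s))"
proof -
 obtain R H where R: "\<And>x. norm x > R \<Longrightarrow> f x = 0" using assms(5) by (rule test_functionsE) blast
 have dim: "DIM(real ^ 'd) = CARD('d)" by simp
 interpret W: dilated_weight \<beta> R f by unfold_locales (use assms R in auto)
 interpret P: large_deviation_mgf \<nu> "\<lambda>\<kappa> \<xi>. 1 / \<kappa> ^ CARD('d) * (\<integral>x. f (x /\<^sub>R \<kappa>) \<partial>\<xi>)" "\<lambda>\<kappa>. \<kappa> ^ (CARD('d) - 2)" "W.Lam \<rho>" W.lim.dom
  using W.large_deviations[OF assms(4,3)] unfolding dim .
 show ?thesis
  using P.convex_rate P.good_rate P.upper_bound P.lower_bound by blast
qed

end
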